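(* Let $K$ be a field, let $S$ be a normal (positively) graded $K$-algebra that is finitely generated by its elements of degree one, and let $Y=\operatorname{Proj} S$ be the corresponding normal projective variety over $K$. Then the complement of every non-empty hypersurface of $Y$ is affine if and only if the complement of every hypersurface in the affine cone $X=\operatorname{Spec} S$ is affine.
   Context: $S=\bigoplus_{d\geq 0}S_d$ is an integral domain with $S_0=K$, integrally closed in its field of fractions, generated as a $K$-algebra by finitely many elements of $S_1$. A hypersurface in a scheme is a closed subset all of whose irreducible components have codimension one (hypersurfaces of $X$ are not assumed to be homogeneous). *)

theory Defs
  imports
    "HOL-Analysis.Abstract_Topology"
    "HOL-Algebra.QuotRing"
    "HOL-Algebra.Generated_Rings"
    "HOL-Library.Extended_Nat"
    "HOL-Library.FuncSet"
begin

section \<open>Irreducible components, codimension, hypersurfaces\<close>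

definition irreducible_in :: "'p topology \<Rightarrow> 'p set \<Rightarrow> bool" where
  "irreducible_in X C \<longleftrightarrow> C \<subseteq> topspace X \<and> C \<noteq> {} \<and>
     (\<forall>A B. closedin X A \<and> closedin X B \<and> C \<subseteq> A \<union> B \<longrightarrow> C \<subseteq> A \<or> C \<subseteq> B)"

definition irreducible_component :: "'p topology \<Rightarrow> 'p set \<Rightarrow> 'p set \<Rightarrow> bool" where
  "irreducible_component X Z C \<longleftrightarrow> C \<subseteq> Z \<and> irreducible_in X C \<and>
     (\<forall>D. D \<subseteq> Z \<and> irreducible_in X D \<and> C \<subseteq> D \<longrightarrow> D = C)"

definition codimension :: "'p topology \<Rightarrow> 'p set \<Rightarrow> enat" where
  "codimension X Z = Sup {enat n | n. \<exists>C :: nat \<Rightarrow> 'p set. C 0 = Z \<and>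
     (\<forall>i\<le>n. closedin X (C i) \<and> irreducible_in X (C i)) \<and> (\<forall>i<n. C i \<subset> C (Suc i))}"

text \<open>The empty set has no irreducible components, hence counts as a hypersurface.\<close>

definition hypersurface :: "'p topology \<Rightarrow> 'p set \<Rightarrow> bool" where
  "hypersurface X Z \<longleftrightarrow> closedin X Z \<and>
     (\<forall>C. irreducible_component X Z C \<longrightarrow> codimension X C = 1)"

section \<open>Localization of a commutative ring\<close>

text \<open>The fraction \<open>a/s\<close> is represented by the set of all pairs \<open>(b, t)\<close> equivalent to \<open>(a, s)\<close>.\<close>

definition fraction :: "('a, 'm) ring_scheme \<Rightarrow> 'a set \<Rightarrow> 'a \<Rightarrow> 'a \<Rightarrow> ('a \<times> 'a) set" where
  "fraction R T a s = {(b, t). b \<in> carrier R \<and> t \<in> T \<and>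
     (\<exists>u\<in>T. u \<otimes>\<^bsub>R\<^esub> (t \<otimes>\<^bsub>R\<^esub> a \<ominus>\<^bsub>R\<^esub> s \<otimes>\<^bsub>R\<^esub> b) = \<zero>\<^bsub>R\<^esub>)}"

definition localization :: "('a, 'm) ring_scheme \<Rightarrow> 'a set \<Rightarrow> ('a \<times> 'a) set ring" where
  "localization R T = \<lparr>
     carrier = {fraction R T a s | a s. a \<in> carrier R \<and> s \<in> T},
     mult = (\<lambda>x y. \<Union>(a, s)\<in>x. \<Union>(b, t)\<in>y. fraction R T (a \<otimes>\<^bsub>R\<^esub> b) (s \<otimes>\<^bsub>R\<^esub> t)),
     one = fraction R T \<one>\<^bsub>R\<^esub> \<one>\<^bsub>R\<^esub>,
     zero = fraction R T \<zero>\<^bsub>R\<^esub> \<one>\<^bsub>R\<^esub>,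
     add = (\<lambda>x y. \<Union>(a, s)\<in>x. \<Union>(b, t)\<in>y.
              fraction R T (t \<otimes>\<^bsub>R\<^esub> a \<oplus>\<^bsub>R\<^esub> s \<otimes>\<^bsub>R\<^esub> b) (s \<otimes>\<^bsub>R\<^esub> t)) \<rparr>"

definition fraction_field :: "('a, 'm) ring_scheme \<Rightarrow> ('a \<times> 'a) set ring" where
  "fraction_field R = localization R (carrier R - {\<zero>\<^bsub>R\<^esub>})"

definition to_fraction_field :: "('a, 'm) ring_scheme \<Rightarrow> 'a \<Rightarrow> ('a \<times> 'a) set" where
  "to_fraction_field R a = fraction R (carrier R - {\<zero>\<^bsub>R\<^esub>}) a \<one>\<^bsub>R\<^esub>"

text \<open>\<open>x\<close> is a root of the monic polynomial
  \<open>T ^ n + c (n - 1) T ^ (n - 1) + \<dots> + c 0\<close> with coefficients in \<open>R\<close>.\<close>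

definition integral_over_base :: "('a, 'm) ring_scheme \<Rightarrow> ('a \<times> 'a) set \<Rightarrow> bool" where
  "integral_over_base R x \<longleftrightarrow> (\<exists>n. \<exists>c \<in> {..<n} \<rightarrow> carrier R.
     x [^]\<^bsub>fraction_field R\<^esub> (n::nat) \<oplus>\<^bsub>fraction_field R\<^esub>
     finsum (fraction_field R)
       (\<lambda>i. to_fraction_field R (c i) \<otimes>\<^bsub>fraction_field R\<^esub> x [^]\<^bsub>fraction_field R\<^esub> i) {..<n}
     = \<zero>\<^bsub>fraction_field R\<^esub>)"

definition integrally_closed_domain :: "('a, 'm) ring_scheme \<Rightarrow> bool" where
  "integrally_closed_domain R \<longleftrightarrow> domain R \<and>
     (\<forall>x\<in>carrier (fraction_field R).
        integral_over_base R x \<longrightarrow> x \<in> to_fraction_field R ` carrier R)"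

section \<open>Spaces with a sheaf of rings\<close>

record ('p, 's) ringed_space =
  points :: "'p topology"
  sections :: "'p set \<Rightarrow> 's ring"
  restr :: "'p set \<Rightarrow> 'p set \<Rightarrow> 's \<Rightarrow> 's"

definition open_subspace :: "('p, 's) ringed_space \<Rightarrow> 'p set \<Rightarrow> ('p, 's) ringed_space" where
  "open_subspace X U = X\<lparr>points := subtopology (points X) U\<rparr>"

definition open_complement :: "('p, 's) ringed_space \<Rightarrow> 'p set \<Rightarrow> ('p, 's) ringed_space" where
  "open_complement X Z = open_subspace X (topspace (points X) - Z)"

text \<open>An isomorphism of ringed spaces: a homeomorphism \<open>f\<close> together with isomorphisms
  \<open>\<phi> V\<close> from the sections of \<open>Y\<close> over \<open>V\<close> to those of \<open>X\<close> over the preimage of \<open>V\<close>,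
  compatible with restriction. The induced maps on stalks are isomorphisms, so for locally
  ringed spaces this is the same as an isomorphism of locally ringed spaces.\<close>

definition ringed_space_iso ::
  "('p, 's) ringed_space \<Rightarrow> ('q, 't) ringed_space \<Rightarrow> ('p \<Rightarrow> 'q) \<Rightarrow> ('q set \<Rightarrow> 't \<Rightarrow> 's) \<Rightarrow> bool"
where
  "ringed_space_iso X Y f \<phi> \<longleftrightarrow>
     (let pre = (\<lambda>V. {x \<in> topspace (points X). f x \<in> V}) in
       homeomorphic_map (points X) (points Y) f \<and>
       (\<forall>V. openin (points Y) V \<longrightarrow> \<phi> V \<in> ring_iso (sections Y V) (sections X (pre V))) \<and>
       (\<forall>V W. openin (points Y) V \<and> openin (points Y) W \<and> W \<subseteq> V \<longrightarrow>
          (\<forall>s\<in>carrier (sections Y V).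
             \<phi> W (restr Y V W s) = restr X (pre V) (pre W) (\<phi> V s))))"

section \<open>Spec and Proj\<close>

text \<open>The topology on a set \<open>P\<close> of prime ideals whose closed sets are the sets
  \<open>V(E) = {p \<in> P. E \<subseteq> p}\<close> for \<open>E \<subseteq> H\<close>.\<close>

definition zariski_topology :: "'a set set \<Rightarrow> 'a set \<Rightarrow> 'a set topology" where
  "zariski_topology P H = topology (\<lambda>U. \<exists>E\<subseteq>H. U = P - {p \<in> P. E \<subseteq> p})"

text \<open>The sheaf on \<open>X\<close> whose sections over \<open>U\<close> are the functions \<open>s\<close> sending \<open>p \<in> U\<close> to an
  element of \<open>localization R (T p)\<close> and locally of the form \<open>q \<mapsto> a/f\<close> with a fixed pair
  \<open>(a, f) \<in> F\<close> of an admissible numerator and denominator.\<close>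

definition fraction_sections ::
  "('a, 'm) ring_scheme \<Rightarrow> 'p topology \<Rightarrow> ('p \<Rightarrow> 'a set) \<Rightarrow> ('a \<times> 'a) set \<Rightarrow> 'p set \<Rightarrow>
   ('p \<Rightarrow> ('a \<times> 'a) set) ring"
where
  "fraction_sections R X T F U = \<lparr>
     carrier = {s \<in> (\<Pi>\<^sub>E p\<in>U. carrier (localization R (T p))).
       \<forall>p\<in>U. \<exists>V. openin X V \<and> p \<in> V \<and> V \<subseteq> U \<and>
         (\<exists>(a, f)\<in>F. \<forall>q\<in>V. f \<in> T q \<and> s q = fraction R (T q) a f)},
     mult = (\<lambda>s t. \<lambda>p\<in>U. s p \<otimes>\<^bsub>localization R (T p)\<^esub> t p),
     one = (\<lambda>p\<in>U. \<one>\<^bsub>localization R (T p)\<^esub>),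
     zero = (\<lambda>p\<in>U. \<zero>\<^bsub>localization R (T p)\<^esub>),
     add = (\<lambda>s t. \<lambda>p\<in>U. s p \<oplus>\<^bsub>localization R (T p)\<^esub> t p) \<rparr>"

definition fraction_space ::
  "('a, 'm) ring_scheme \<Rightarrow> 'p topology \<Rightarrow> ('p \<Rightarrow> 'a set) \<Rightarrow> ('a \<times> 'a) set \<Rightarrow>
   ('p, 'p \<Rightarrow> ('a \<times> 'a) set) ringed_space"
where
  "fraction_space R X T F = \<lparr>
     points = X,
     sections = fraction_sections R X T F,
     restr = (\<lambda>V W s. restrict s W) \<rparr>"

definition Spec ::
  "('a, 'm) ring_scheme \<Rightarrow> ('a set, 'a set \<Rightarrow> ('a \<times> 'a) set) ringed_space" where
  "Spec R = fraction_space R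
     (zariski_topology {p. primeideal p R} (carrier R))
     (\<lambda>p. carrier R - p)
     (carrier R \<times> carrier R)"

locale graded_ring = cring R for R (structure) +
  fixes G :: "nat \<Rightarrow> 'a set"
  assumes component_subgroup: "additive_subgroup (G d) R"
    and component_mult: "\<lbrakk>x \<in> G d; y \<in> G e\<rbrakk> \<Longrightarrow> x \<otimes> y \<in> G (d + e)"
    and direct_sum: "x \<in> carrier R \<Longrightarrow>
      \<exists>!c. (\<forall>d. c d \<in> G d) \<and> finite {d. c d \<noteq> \<zero>} \<and> x = finsum R c {d. c d \<noteq> \<zero>}"

text \<open>Homogeneous ideals are the ideals generated by homogeneous elements.\<close>

definition homogeneous_ideal :: "('a, 'm) ring_scheme \<Rightarrow> (nat \<Rightarrow> 'a set) \<Rightarrow> 'a set \<Rightarrow> bool" where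
  "homogeneous_ideal R G I \<longleftrightarrow> ideal I R \<and> genideal R (I \<inter> (\<Union>d. G d)) = I"

definition irrelevant_ideal :: "('a, 'm) ring_scheme \<Rightarrow> (nat \<Rightarrow> 'a set) \<Rightarrow> 'a set" where
  "irrelevant_ideal R G = genideal R (\<Union>d\<in>{1..}. G d)"

text \<open>The admissible pairs are those of homogeneous elements of the same degree, so the value of
  a section at \<open>p\<close> lies in the degree-zero part of the homogeneous localization at \<open>p\<close>.\<close>

definition Proj ::
  "('a, 'm) ring_scheme \<Rightarrow> (nat \<Rightarrow> 'a set) \<Rightarrow> ('a set, 'a set \<Rightarrow> ('a \<times> 'a) set) ringed_space"
where
  "Proj R G = fraction_space R
     (zariski_topology
        {p. primeideal p R \<and> homogeneous_ideal R G p \<and> \<not> irrelevant_ideal R G \<subseteq> p} (\<Union>d. G d))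
     (\<lambda>p. (\<Union>d. G d) - p)
     (\<Union>d. G d \<times> G d)"

text \<open>A ringed space is affine if it is isomorphic to the spectrum of a commutative ring. Such a
  ring is isomorphic to the ring of global sections, so it can be taken to have elements in the
  type \<open>'s\<close> of sections.\<close>

definition is_affine :: "('p, 's) ringed_space \<Rightarrow> bool" where
  "is_affine X \<longleftrightarrow> (\<exists>R :: 's ring. cring R \<and> (\<exists>f \<phi>. ringed_space_iso X (Spec R) f \<phi>))"

section \<open>The constructions are well defined\<close>

lemma istopology_zariski:
  assumes "\<And>p. p \<in> P \<Longrightarrow> primeideal p R" "H \<subseteq> carrier R"
    and mult: "\<And>x y. \<lbrakk>x \<in> H; y \<in> H\<rbrakk> \<Longrightarrow> x \<otimes>\<^bsub>R\<^esub> y \<in> H"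
  shows "istopology (\<lambda>U. \<exists>E\<subseteq>H. U = P - {p \<in> P. E \<subseteq> p})"
  unfolding istopology_def
proof (intro conjI allI impI)
  fix U W
  assume "\<exists>E\<subseteq>H. U = P - {p \<in> P. E \<subseteq> p}" "\<exists>E\<subseteq>H. W = P - {p \<in> P. E \<subseteq> p}"
  then obtain E F where E: "E \<subseteq> H" "U = P - {p \<in> P. E \<subseteq> p}"
    and F: "F \<subseteq> H" "W = P - {p \<in> P. F \<subseteq> p}" by auto
  let ?M = "{x \<otimes>\<^bsub>R\<^esub> y | x y. x \<in> E \<and> y \<in> F}"
  have "?M \<subseteq> p \<longleftrightarrow> E \<subseteq> p \<or> F \<subseteq> p" if p: "p \<in> P" for p
  proof -
    interpret primeideal p R by (rule assms(1)[OF p])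
    show ?thesis
    proof
      assume M: "?M \<subseteq> p"
      show "E \<subseteq> p \<or> F \<subseteq> p"
      proof (rule ccontr)
        assume "\<not> (E \<subseteq> p \<or> F \<subseteq> p)"
        then obtain x y where "x \<in> E" "x \<notin> p" "y \<in> F" "y \<notin> p" by auto
        moreover from this have "x \<otimes>\<^bsub>R\<^esub> y \<in> p" "x \<in> carrier R" "y \<in> carrier R"
          using M E(1) F(1) assms(2) by auto
        ultimately show False using I_prime by blast
      qed
    next
      assume "E \<subseteq> p \<or> F \<subseteq> p"
      moreover have "E \<subseteq> carrier R" "F \<subseteq> carrier R" using E F assms(2) by auto
      ultimately show "?M \<subseteq> p" using I_l_closed I_r_closed by blast
    qed
  qed
  moreover have "?M \<subseteq> H" using E F mult by auto
  ultimately have "U \<inter> W = P - {p \<in> P. ?M \<subseteq> p}" "?M \<subseteq> H"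
    unfolding E F by (simp_all add: set_eq_iff) blast
  then show "\<exists>E\<subseteq>H. U \<inter> W = P - {p \<in> P. E \<subseteq> p}"
    by blast
next
  fix \<U> assume "\<forall>U\<in>\<U>. \<exists>E\<subseteq>H. U = P - {p \<in> P. E \<subseteq> p}"
  then obtain e where e: "\<And>U. U \<in> \<U> \<Longrightarrow> e U \<subseteq> H \<and> U = P - {p \<in> P. e U \<subseteq> p}" by metis
  have "x \<in> \<Union>\<U> \<longleftrightarrow> x \<in> P - {p \<in> P. \<Union>(e ` \<U>) \<subseteq> p}" for x
    using e by blast
  then show "\<exists>E\<subseteq>H. \<Union>\<U> = P - {p \<in> P. E \<subseteq> p}"
    using e by (intro exI[of _ "\<Union>(e ` \<U>)"]) blast
qed

end

(* For an ideal I of a noetherian domain, the open set D(I) is affine iff I generates the unit ideal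
   of the ring of sections over D(I); clearing denominators, this says that some c ~= 0 lies in the
   ideal generated by the products x * y with x in I and y in the transform of c, that is
   z^n * y in cS for every z in I and some n = n(z). For homogeneous I the same condition
   characterizes affineness of the complement of V(I) in Proj S. Hence the complement of a
   hypersurface of Proj S is affine iff the complement of the cone over it is.

   It remains to treat the irreducible hypersurfaces of Spec S that are not cones, given by a prime P
   of height one without nonzero homogeneous elements. Choose f in P, f ~= 0, whose components lie in
   the smallest possible range of degrees. Since S is normal, Gauss's lemma holds for homogeneous
   divisors, and it shows that f divides x * f_j for all x in P and all components f_j of f. Hence the
   condition for P follows from the condition for the homogeneous ideals (f_i S : f_0, f_1, ...), all
   of whose minimal primes have height one. *)
theory Submission
  imports Defs
begin

section \<open>Ideals and primes\<close>

text \<open>Affineness is tested by global sections, not by cohomology: inside the fraction field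
  the sections over D(I) are the fractions y / c with y in the transform of c, so the test is
  arithmetic in the ring and can be carried from one ideal to another. Spec and Proj share one
  argument, Spec being the homogeneous spectrum of the ring graded in degree zero. The obstacle on
  the Proj side is that only fractions of degree zero are sections: an element a of I of degree e
  has to be paired with a twisted section g of degree -e. Such g come from the components of an
  identity h^n = sum of z w, after the denominator c has been turned into a power of one homogeneous
  h in I. Normality enters as complete integral closedness; it makes each minimal prime of (a : b)
  locally principal, which yields both height one and the orders of vanishing in Gauss's lemma. One
  case is invisible to the hypothesis on Proj: a homogeneous ideal whose only minimal prime is the
  irrelevant ideal has empty zero set there. It is settled directly by a principal ideal with the
  same radical.\<close>

definition minimal_prime :: "('a, 'm) ring_scheme \<Rightarrow> 'a set \<Rightarrow> 'a set \<Rightarrow> bool" where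
  "minimal_prime R J P \<longleftrightarrow> primeideal P R \<and> J \<subseteq> P \<and>
     (\<forall>Q. primeideal Q R \<and> J \<subseteq> Q \<and> Q \<subseteq> P \<longrightarrow> Q = P)"

text \<open>In a domain with \<open>c\<close> nonzero, \<open>y / c\<close> is regular on D(I)
  exactly when multiplication by a power of \<open>z\<close> brings it into \<open>R\<close>, for
  each \<open>z\<close> in \<open>I\<close>. So these are the numerators over \<open>c\<close> of
  the sections on D(I).\<close>

definition transform :: "('a, 'm) ring_scheme \<Rightarrow> 'a set \<Rightarrow> 'a \<Rightarrow> 'a set" where
  "transform R I c = {y \<in> carrier R. \<forall>z\<in>I. \<exists>n::nat. z [^]\<^bsub>R\<^esub> n \<otimes>\<^bsub>R\<^esub> y \<in> PIdl\<^bsub>R\<^esub> c}"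

definition affine_ideal :: "('a, 'm) ring_scheme \<Rightarrow> 'a set \<Rightarrow> bool" where
  "affine_ideal R I \<longleftrightarrow> (\<exists>c\<in>carrier R - {\<zero>\<^bsub>R\<^esub>}.
     c \<in> genideal R {x \<otimes>\<^bsub>R\<^esub> y | x y. x \<in> I \<and> y \<in> transform R I c})"

context cring
begin

lemma directed_Union_ideal:
  assumes "C \<noteq> {}" "\<And>I. I \<in> C \<Longrightarrow> ideal I R" "\<And>I J. I \<in> C \<Longrightarrow> J \<in> C \<Longrightarrow> I \<subseteq> J \<or> J \<subseteq> I"
  shows "ideal (\<Union>C) R"
proof (rule idealI[OF ring_axioms])
  have ab: "I \<in> C \<Longrightarrow> additive_subgroup I R" for I using assms(2) ideal.axioms(1) by metis
  show "subgroup (\<Union>C) (add_monoid R)"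
  proof (rule subgroup.intro)
    show "\<Union>C \<subseteq> carrier (add_monoid R)" using additive_subgroup.a_Hcarr[OF ab] by auto
    obtain I where "I \<in> C" using assms(1) by auto
    then show "\<one>\<^bsub>add_monoid R\<^esub> \<in> \<Union>C" using additive_subgroup.zero_closed[OF ab] by auto
    show "x \<otimes>\<^bsub>add_monoid R\<^esub> y \<in> \<Union>C" if "x \<in> \<Union>C" "y \<in> \<Union>C" for x y
    proof -
      have "\<exists>I\<in>C. x \<in> I \<and> y \<in> I" using that assms(3) by (metis UnionE subsetD)
      then show ?thesis using additive_subgroup.a_closed[OF ab] by auto
    qed
    show "inv\<^bsub>add_monoid R\<^esub> x \<in> \<Union>C" if "x \<in> \<Union>C" for x
      using that additive_subgroup.a_inv_closed[OF ab] by (auto simp flip: a_inv_def)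
  qed
  fix x y assume "x \<in> \<Union>C" and y: "y \<in> carrier R"
  then obtain I where I: "I \<in> C" "x \<in> I" by auto
  show "y \<otimes> x \<in> \<Union>C" using ideal.I_l_closed[OF assms(2)[OF I(1)] I(2) y] I(1) by auto
  show "x \<otimes> y \<in> \<Union>C" using ideal.I_r_closed[OF assms(2)[OF I(1)] I(2) y] I(1) by auto
qed

section \<open>Principal ideals, colon ideals and products of generated ideals\<close>

lemma PIdl_iff: "b \<in> PIdl a \<longleftrightarrow> (\<exists>x\<in>carrier R. b = x \<otimes> a)"
  by (auto simp: cgenideal_def)

lemma PIdl_mult_left: "a \<in> carrier R \<Longrightarrow> x \<in> carrier R \<Longrightarrow> x \<otimes> a \<in> PIdl a"
  by (auto simp: PIdl_iff)

lemma PIdl_carrier: "a \<in> carrier R \<Longrightarrow> b \<in> PIdl a \<Longrightarrow> b \<in> carrier R"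
  by (auto simp: PIdl_iff)

lemma PIdl_add: "a \<in> carrier R \<Longrightarrow> x \<in> PIdl a \<Longrightarrow> y \<in> PIdl a \<Longrightarrow> x \<oplus> y \<in> PIdl a"
  by (rule additive_subgroup.a_closed[OF ideal.axioms(1)[OF cgenideal_ideal]])

lemma PIdl_mult: "a \<in> carrier R \<Longrightarrow> x \<in> PIdl a \<Longrightarrow> y \<in> carrier R \<Longrightarrow> y \<otimes> x \<in> PIdl a"
  by (rule ideal.I_l_closed[OF cgenideal_ideal])

lemma PIdl_mult_mult:
  assumes "a \<in> carrier R" "b \<in> carrier R" "x \<in> PIdl a" "y \<in> PIdl b"
  shows "x \<otimes> y \<in> PIdl (a \<otimes> b)"
proof -
  obtain u v where "u \<in> carrier R" "v \<in> carrier R" "x = u \<otimes> a" "y = v \<otimes> b"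
    using assms by (auto simp: PIdl_iff)
  then have "x \<otimes> y = (u \<otimes> v) \<otimes> (a \<otimes> b)" "u \<otimes> v \<in> carrier R"
    using assms by (auto simp: m_ac)
  then show ?thesis by (auto simp: PIdl_iff)
qed

lemma PIdl_zero: "PIdl \<zero> = {\<zero>}"
  using zero_closed by (auto simp: PIdl_iff simp del: zero_closed)

lemma ideal_mono_PIdl:
  assumes "ideal J R" "a \<in> J" "b \<in> PIdl a" shows "b \<in> J"
  using cgenideal_minimal[OF assms(1,2)] assms(3) by blast

lemma colon_ideal:
  assumes "ideal K R" "x \<in> carrier R"
  shows "ideal {a \<in> carrier R. a \<otimes> x \<in> K} R"
proof -
  interpret ideal K R by fact
  show ?thesis
  proof (rule idealI)
    show "subgroup {a \<in> carrier R. a \<otimes> x \<in> K} (add_monoid R)"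
    proof (rule subgroup.intro)
      fix a assume "a \<in> {a \<in> carrier R. a \<otimes> x \<in> K}"
      then have "a \<in> carrier R" "a \<otimes> x \<in> K" by auto
      then show "inv\<^bsub>add_monoid R\<^esub> a \<in> {a \<in> carrier R. a \<otimes> x \<in> K}"
        using assms(2) l_minus a_inv_closed by (fold a_inv_def) auto
    qed (use assms(2) in \<open>auto simp: l_distr a_closed\<close>)
  next
    fix a y assume "a \<in> {a \<in> carrier R. a \<otimes> x \<in> K}" "y \<in> carrier R"
    then have *: "a \<in> carrier R" "y \<in> carrier R" "y \<otimes> (a \<otimes> x) \<in> K" by (auto intro: I_l_closed)
    then show "y \<otimes> a \<in> {a \<in> carrier R. a \<otimes> x \<in> K}" "a \<otimes> y \<in> {a \<in> carrier R. a \<otimes> x \<in> K}"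
      using assms(2) by (auto simp: m_ac)
  qed (rule ring_axioms)
qed

lemma Inter_colon_ideal:
  assumes "\<And>x. x \<in> X \<Longrightarrow> ideal (K x) R" "\<And>x. x \<in> X \<Longrightarrow> f x \<in> carrier R"
  shows "ideal {a \<in> carrier R. \<forall>x\<in>X. a \<otimes> f x \<in> K x} R"
proof -
  have "ideal (\<Inter> (insert (carrier R) ((\<lambda>x. {a \<in> carrier R. a \<otimes> f x \<in> K x}) ` X))) R"
    using colon_ideal assms oneideal by (intro i_Intersect) auto
  also have "\<Inter> (insert (carrier R) ((\<lambda>x. {a \<in> carrier R. a \<otimes> f x \<in> K x}) ` X)) =
    {a \<in> carrier R. \<forall>x\<in>X. a \<otimes> f x \<in> K x}" by auto
  finally show ?thesis .
qed

text \<open>Two colon ideals of \<open>K\<close>, first by a generator \<open>x\<close> and then by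
  \<open>b\<close>, reduce products in the generated ideals to products of generators.\<close>

lemma genideal_mult:
  assumes "ideal K R" "X \<subseteq> carrier R" "Y \<subseteq> carrier R"
    and "\<And>x y. x \<in> X \<Longrightarrow> y \<in> Y \<Longrightarrow> x \<otimes> y \<in> K"
    and "a \<in> Idl X" "b \<in> Idl Y"
  shows "a \<otimes> b \<in> K"
proof -
  have b: "b \<in> carrier R" if "b \<in> Idl Y" for b
    using ideal.Icarr[OF genideal_ideal[OF assms(3)] that] .
  have "X \<subseteq> {a \<in> carrier R. a \<otimes> b \<in> K}"
  proof
    fix x assume x: "x \<in> X"
    have "Y \<subseteq> {b \<in> carrier R. b \<otimes> x \<in> K}"
    proof
      fix y assume y: "y \<in> Y"
      then have "y \<otimes> x = x \<otimes> y" using assms(2,3) x m_comm[of y x] by blast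
      then show "y \<in> {b \<in> carrier R. b \<otimes> x \<in> K}" using assms(3) assms(4)[OF x y] y by auto
    qed
    moreover have "ideal {b \<in> carrier R. b \<otimes> x \<in> K} R"
      using colon_ideal assms x by auto
    ultimately have "Idl Y \<subseteq> {b \<in> carrier R. b \<otimes> x \<in> K}" by (rule genideal_minimal[rotated])
    then have "b \<in> {b \<in> carrier R. b \<otimes> x \<in> K}" using assms(6) by (rule subsetD)
    moreover have "x \<in> carrier R" using x assms(2) by (rule subsetD[rotated])
    ultimately show "x \<in> {a \<in> carrier R. a \<otimes> b \<in> K}" by (simp add: m_comm)
  qed
  then have "Idl X \<subseteq> {a \<in> carrier R. a \<otimes> b \<in> K}"
    using colon_ideal[OF assms(1) b[OF assms(6)]] by (rule genideal_minimal[rotated])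
  then show ?thesis using assms(5) by auto
qed

section \<open>Existence of primes, and elements with a power in a given ideal\<close>

lemma add_PIdl_iff:
  assumes "a \<in> carrier R"
  shows "z \<in> M <+>\<^bsub>R\<^esub> PIdl a \<longleftrightarrow> (\<exists>m\<in>M. \<exists>x\<in>carrier R. z = m \<oplus> x \<otimes> a)"
  by (simp add: set_add_def' cgenideal_def) blast

lemma add_PIdl:
  assumes "ideal M R" "a \<in> carrier R"
  shows "ideal (M <+>\<^bsub>R\<^esub> PIdl a) R" "M \<subseteq> M <+>\<^bsub>R\<^esub> PIdl a" "a \<in> M <+>\<^bsub>R\<^esub> PIdl a"
proof -
  interpret ideal M R by fact
  show "ideal (M <+>\<^bsub>R\<^esub> PIdl a) R" using assms add_ideals cgenideal_ideal by auto
  have "m \<in> M <+>\<^bsub>R\<^esub> PIdl a" if "m \<in> M" for m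
    unfolding add_PIdl_iff[OF assms(2)]
    using assms that by (intro bexI[of _ m] bexI[of _ \<zero>]) (auto simp: Icarr)
  then show "M \<subseteq> M <+>\<^bsub>R\<^esub> PIdl a" by auto
  show "a \<in> M <+>\<^bsub>R\<^esub> PIdl a"
    unfolding add_PIdl_iff[OF assms(2)]
    using assms by (intro bexI[of _ \<zero>] bexI[of _ \<one>]) auto
qed

lemma add_PIdl_mult:
  assumes "ideal M R" "a \<in> carrier R" "b \<in> carrier R" "a \<otimes> b \<in> M"
    and "s \<in> M <+>\<^bsub>R\<^esub> PIdl a" "t \<in> M <+>\<^bsub>R\<^esub> PIdl b"
  shows "s \<otimes> t \<in> M"
proof -
  interpret ideal M R by fact
  obtain m x n y where *: "m \<in> M" "x \<in> carrier R" "s = m \<oplus> x \<otimes> a"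
     "n \<in> M" "y \<in> carrier R" "t = n \<oplus> y \<otimes> b"
    using assms by (auto simp: add_PIdl_iff)
  have mn: "m \<in> carrier R" "n \<in> carrier R" using * Icarr by auto
  have "x \<otimes> a \<otimes> (y \<otimes> b) = (x \<otimes> y) \<otimes> (a \<otimes> b)"
    using * assms by (simp add: m_ac)
  moreover have "\<dots> \<in> M" using * assms by (simp add: I_l_closed)
  ultimately have 1: "x \<otimes> a \<otimes> (y \<otimes> b) \<in> M" by simp
  have "s \<otimes> t = m \<otimes> t \<oplus> (x \<otimes> a \<otimes> n \<oplus> x \<otimes> a \<otimes> (y \<otimes> b))"
    unfolding * using * assms mn by (simp add: l_distr r_distr a_ac)
  moreover have "m \<otimes> t \<in> M" "x \<otimes> a \<otimes> n \<in> M"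
    using * assms mn I_r_closed[of m t] I_l_closed[of n "x \<otimes> a"] by auto
  ultimately show ?thesis using 1 by auto
qed

text \<open>Zorn's lemma: an ideal \<open>M\<close> maximal among those disjoint from
  \<open>T\<close> is prime. If \<open>a\<close> and \<open>b\<close> are outside \<open>M\<close>,
  both enlargements \<open>M + (a)\<close> and \<open>M + (b)\<close> meet \<open>T\<close>, and
  when \<open>a b\<close> is in \<open>M\<close> the product of the two meeting elements would lie
  in \<open>M\<close> and in \<open>T\<close>.\<close>

lemma prime_avoiding:
  assumes "ideal I R" "T \<subseteq> carrier R" "\<one> \<in> T" "\<And>s t. s \<in> T \<Longrightarrow> t \<in> T \<Longrightarrow> s \<otimes> t \<in> T" "I \<inter> T = {}"
  shows "\<exists>P. primeideal P R \<and> I \<subseteq> P \<and> P \<inter> T = {}"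
proof -
  let ?F = "{J. ideal J R \<and> I \<subseteq> J \<and> J \<inter> T = {}}"
  have "\<exists>M\<in>?F. \<forall>J\<in>?F. M \<subseteq> J \<longrightarrow> J = M"
  proof (rule subset_Zorn)
    fix C assume C: "subset.chain ?F C"
    show "\<exists>U\<in>?F. \<forall>J\<in>C. J \<subseteq> U"
    proof (cases "C = {}")
      case True then show ?thesis using assms by auto
    next
      case False
      have "ideal (\<Union>C) R"
      proof (rule directed_Union_ideal[OF False])
        show "ideal J R" if "J \<in> C" for J using C that by (auto simp: subset_chain_def)
        show "J \<subseteq> J' \<or> J' \<subseteq> J" if "J \<in> C" "J' \<in> C" for J J'
          using C that by (simp add: subset_chain_def)
      qed
      moreover have "C \<subseteq> ?F" using C by (simp add: pred_on.chain_def)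
      then have "I \<subseteq> \<Union>C" "\<Union>C \<inter> T = {}" using False by blast+
      ultimately show ?thesis by (intro bexI[of _ "\<Union>C"]) auto
    qed
  qed
  then obtain M where M: "ideal M R" "I \<subseteq> M" "M \<inter> T = {}"
    and max: "\<And>J. ideal J R \<Longrightarrow> I \<subseteq> J \<Longrightarrow> J \<inter> T = {} \<Longrightarrow> M \<subseteq> J \<Longrightarrow> J = M" by auto
  have meets: "(M <+>\<^bsub>R\<^esub> PIdl a) \<inter> T \<noteq> {}" if "a \<in> carrier R" "a \<notin> M" for a
    using max[of "M <+>\<^bsub>R\<^esub> PIdl a"] add_PIdl[OF M(1) that(1)] M that by blast
  have "primeideal M R"
  proof (rule primeidealI[OF M(1) is_cring])
    show "carrier R \<noteq> M" using M assms by auto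
    fix a b assume ab: "a \<in> carrier R" "b \<in> carrier R" "a \<otimes> b \<in> M"
    show "a \<in> M \<or> b \<in> M"
    proof (rule ccontr)
      assume "\<not> (a \<in> M \<or> b \<in> M)"
      then obtain s t where "s \<in> M <+>\<^bsub>R\<^esub> PIdl a" "s \<in> T" "t \<in> M <+>\<^bsub>R\<^esub> PIdl b" "t \<in> T"
        using meets ab by blast
      then have "s \<otimes> t \<in> M" "s \<otimes> t \<in> T" using add_PIdl_mult[OF M(1) ab] assms by auto
      then show False using M by auto
    qed
  qed
  then show ?thesis using M by auto
qed

lemma proper_ideal_prime:
  assumes "ideal I R" "\<one> \<notin> I"
  shows "\<exists>P. primeideal P R \<and> I \<subseteq> P"
  using prime_avoiding[OF assms(1), of "{\<one>}"] assms by auto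

text \<open>If no power of \<open>h\<close> is in \<open>B\<close>, some prime over \<open>B\<close>
  avoids all powers of \<open>h\<close>. Many exponents below are obtained in this way from a
  statement about primes.\<close>

lemma radical_prime:
  assumes "ideal B R" "h \<in> carrier R" "\<And>P. primeideal P R \<Longrightarrow> B \<subseteq> P \<Longrightarrow> h \<in> P"
  shows "\<exists>n::nat. h [^] n \<in> B"
proof (rule ccontr)
  assume neg: "\<nexists>n::nat. h [^] n \<in> B"
  have "\<exists>P. primeideal P R \<and> B \<subseteq> P \<and> P \<inter> range (\<lambda>n::nat. h [^] n) = {}"
  proof (rule prime_avoiding[OF assms(1)])
    show "\<one> \<in> range (\<lambda>n::nat. h [^] n)" using nat_pow_0 by (metis rangeI)
    show "s \<otimes> t \<in> range (\<lambda>n::nat. h [^] n)"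
      if "s \<in> range (\<lambda>n::nat. h [^] n)" "t \<in> range (\<lambda>n::nat. h [^] n)" for s t
      using that nat_pow_mult[OF assms(2)] by auto
  qed (use assms neg in auto)
  moreover have "h \<in> range (\<lambda>n::nat. h [^] n)"
    using nat_pow_Suc[of h 0] assms by (metis l_one nat_pow_0 rangeI)
  ultimately show False using assms by blast
qed

lemma prime_pow_mem:
  assumes "primeideal P R" "h \<in> carrier R" "h [^] (n::nat) \<in> P"
  shows "h \<in> P"
proof -
  interpret primeideal P R by fact
  show ?thesis using assms(3)
  proof (induction n)
    case 0
    then have "\<one> \<in> P" by simp
    then show ?case using one_imp_carrier I_notcarr by blast
  next
    case (Suc n) then show ?case using I_prime[of "h [^] n" h] assms by auto
  qed
qed

lemma pow_mem_mono:
  assumes "ideal B R" "h \<in> carrier R" "h [^] (n::nat) \<in> B" "n \<le> m"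
  shows "h [^] m \<in> B"
proof -
  have "h [^] m = h [^] (m - n) \<otimes> h [^] n" using assms by (simp add: nat_pow_mult)
  then show ?thesis using assms ideal.I_l_closed[OF assms(1)] by auto
qed

lemma pow_split:
  assumes "x \<in> carrier R" "y \<in> carrier R" "ideal B R"
    and "x [^] (m::nat) \<in> B" "y [^] (n::nat) \<in> B"
  shows "(x \<oplus> y) [^] (m + n) \<in> B"
proof -
  interpret ideal B R by fact
  \<comment> \<open>Instead of the binomial formula, one factor is expanded at a time by induction
    on \<open>k\<close>; when none is left, \<open>i + j = m + n\<close> forces
    \<open>m \<le> i\<close> or \<open>n \<le> j\<close>.\<close>
  have "x [^] i \<otimes> y [^] j \<otimes> (x \<oplus> y) [^] k \<in> B" if "i + j + k = m + n" for i j k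
    using that
  proof (induction k arbitrary: i j)
    case 0
    show ?case
    proof (cases "m \<le> i")
      case True then show ?thesis using pow_mem_mono[OF assms(3,1,4)] assms
        by (simp add: I_r_closed)
    next
      case False
      then have "n \<le> j" using 0 by auto
      then show ?thesis using pow_mem_mono[OF assms(3,2,5)] assms by (simp add: I_l_closed)
    qed
  next
    case (Suc k)
    let ?c = "(x \<oplus> y) [^] k"
    have "x [^] i \<otimes> y [^] j \<otimes> (x \<oplus> y) [^] Suc k
      = x [^] Suc i \<otimes> y [^] j \<otimes> ?c \<oplus> x [^] i \<otimes> y [^] Suc j \<otimes> ?c"
      using assms by (simp add: r_distr l_distr m_ac)
    moreover have "x [^] Suc i \<otimes> y [^] j \<otimes> ?c \<in> B" "x [^] i \<otimes> y [^] Suc j \<otimes> ?c \<in> B"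
      using Suc.IH[of "Suc i" j] Suc.IH[of i "Suc j"] Suc.prems by auto
    ultimately show ?case by simp
  qed
  from this[of 0 0 "m + n"] show ?thesis using assms by simp
qed

text \<open>Adding a generator adds its exponent, by \<open>pow_split\<close>. So one exponent
  serves all elements of the ideal, not only the generators.\<close>

lemma finite_genideal_pow:
  assumes "finite A" "A \<subseteq> carrier R" "ideal B R" "\<And>z. z \<in> A \<Longrightarrow> \<exists>n::nat. z [^] n \<in> B"
  shows "\<exists>n::nat. \<forall>z\<in>Idl A. z [^] n \<in> B"
  using assms
proof (induction A)
  case empty
  have "Idl {} \<subseteq> {\<zero>}" by (intro genideal_minimal zeroideal) auto
  moreover have "\<zero> [^] (1::nat) \<in> B" using empty additive_subgroup.zero_closed ideal.axioms(1) by fastforce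
  ultimately show ?case by blast
next
  case (insert a A)
  interpret B: ideal B R by fact
  obtain n :: nat where n: "\<forall>z\<in>Idl A. z [^] n \<in> B" using insert by auto
  obtain k :: nat where k: "a [^] k \<in> B" using insert.prems(3)[of a] by blast
  have idA: "ideal (Idl A) R" using insert genideal_ideal by auto
  interpret A: ideal "Idl A" R by fact
  have a: "a \<in> carrier R" using insert by auto
  have "Idl (insert a A) \<subseteq> Idl A <+>\<^bsub>R\<^esub> PIdl a"
    using add_PIdl[OF idA a] genideal_self[of A] insert by (intro genideal_minimal) auto
  moreover have "z [^] (n + k) \<in> B" if zA: "z \<in> Idl A <+>\<^bsub>R\<^esub> PIdl a" for z
  proof -
    obtain m x where "m \<in> Idl A" "x \<in> carrier R" "z = m \<oplus> x \<otimes> a"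
      using zA by (auto simp: add_PIdl_iff[OF a])
    moreover from this have "(x \<otimes> a) [^] k \<in> B"
      using a k nat_pow_distrib by (simp add: B.I_l_closed)
    ultimately show ?thesis using pow_split[of m "x \<otimes> a" B n k] n a insert A.Icarr by auto
  qed
  ultimately show ?case by blast
qed

section \<open>The transform as an ideal, and first instances of the criterion\<close>

lemma transformD: "y \<in> transform R I c \<Longrightarrow> z \<in> I \<Longrightarrow> \<exists>n::nat. z [^] n \<otimes> y \<in> PIdl c"
  by (simp add: transform_def)

lemma transform_ideal:
  assumes "I \<subseteq> carrier R" "c \<in> carrier R"
  shows "ideal (transform R I c) R"
proof -
  interpret c: ideal "PIdl c" R using assms cgenideal_ideal by auto
  have neg: "\<ominus> a \<in> transform R I c" if "a \<in> transform R I c" for a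
    using that assms r_minus unfolding transform_def
    by (smt (verit) a_inv_closed c.a_inv_closed in_mono mem_Collect_eq nat_pow_closed)
  show ?thesis
  proof (rule idealI[OF ring_axioms])
    show "subgroup (transform R I c) (add_monoid R)"
    proof (rule subgroup.intro)
      fix x y assume "x \<in> transform R I c" "y \<in> transform R I c"
      then have x: "x \<in> carrier R" "\<And>z. z \<in> I \<Longrightarrow> \<exists>n::nat. z [^] n \<otimes> x \<in> PIdl c"
        and y: "y \<in> carrier R" "\<And>z. z \<in> I \<Longrightarrow> \<exists>n::nat. z [^] n \<otimes> y \<in> PIdl c"
        by (auto simp: transform_def)
      have "\<exists>n::nat. z [^] n \<otimes> (x \<oplus> y) \<in> PIdl c" if "z \<in> I" for z
      proof -
        have z: "z \<in> carrier R" using assms that by auto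
        obtain m n :: nat where mn: "z [^] m \<otimes> x \<in> PIdl c" "z [^] n \<otimes> y \<in> PIdl c"
          using x y \<open>z \<in> I\<close> by blast
        have "z [^] (m + n) \<otimes> (x \<oplus> y)
          = z [^] n \<otimes> (z [^] m \<otimes> x) \<oplus> z [^] m \<otimes> (z [^] n \<otimes> y)"
          using z x y by (simp add: nat_pow_mult[symmetric] r_distr m_ac)
        then have "z [^] (m + n) \<otimes> (x \<oplus> y) \<in> PIdl c"
          using mn z by (auto intro!: c.I_l_closed)
        then show ?thesis by blast
      qed
      then show "x \<otimes>\<^bsub>add_monoid R\<^esub> y \<in> transform R I c"
        using x y by (auto simp: transform_def)
    qed (use assms neg in \<open>auto simp: transform_def simp flip: a_inv_def\<close>)
  next
    fix a x assume *: "a \<in> transform R I c" "x \<in> carrier R"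
    then have a: "a \<in> carrier R" by (auto simp: transform_def)
    have "\<exists>n::nat. z [^] n \<otimes> (x \<otimes> a) \<in> PIdl c" if zI: "z \<in> I" for z
    proof -
      have z: "z \<in> carrier R" using assms zI by auto
      obtain n :: nat where "z [^] n \<otimes> a \<in> PIdl c" using transformD[OF *(1) zI] by blast
      then have "x \<otimes> (z [^] n \<otimes> a) \<in> PIdl c" using * by (auto intro: c.I_l_closed)
      then have "z [^] n \<otimes> (x \<otimes> a) \<in> PIdl c" using * a z by (simp add: m_ac)
      then show ?thesis by blast
    qed
    then show "x \<otimes> a \<in> transform R I c" using * a by (auto simp: transform_def)
    then show "a \<otimes> x \<in> transform R I c" using * a by (simp add: m_comm)
  qed
qed

lemma transform_carrier: "y \<in> transform R I c \<Longrightarrow> y \<in> carrier R"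
  by (simp add: transform_def)

lemma affine_ideal_carrier:
  assumes "\<one> \<noteq> \<zero>" shows "affine_ideal R (carrier R)"
  unfolding affine_ideal_def
proof (intro bexI[of _ \<one>])
  let ?X = "{x \<otimes> y |x y. x \<in> carrier R \<and> y \<in> transform R (carrier R) \<one>}"
  have "\<one> \<in> transform R (carrier R) \<one>" by (auto simp: transform_def PIdl_iff)
  then have "\<one> \<otimes> \<one> \<in> ?X" using one_closed by blast
  then have "\<one> \<in> ?X" by simp
  moreover have "?X \<subseteq> carrier R" by (auto dest: transform_carrier)
  ultimately show "\<one> \<in> Idl ?X" using genideal_self by blast
qed (use assms in auto)

end

lemma (in domain) PIdl_cancel:
  assumes "a \<in> carrier R" "b \<in> carrier R" "c \<in> carrier R" "c \<noteq> \<zero>"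
  shows "c \<otimes> b \<in> PIdl (c \<otimes> a) \<longleftrightarrow> b \<in> PIdl a"
proof -
  have "c \<otimes> b = x \<otimes> (c \<otimes> a) \<longleftrightarrow> b = x \<otimes> a" if "x \<in> carrier R" for x
    using m_lcancel[of c b "x \<otimes> a"] assms that by (simp add: m_ac)
  then show ?thesis by (auto simp: PIdl_iff)
qed

text \<open>The analogue of the fact that two affine open sets meet in an affine one. The witnesses
  multiply: for generators \<open>x y\<close> and \<open>x' y'\<close> the product
  \<open>x x'\<close> lies in \<open>I \<inter> J\<close>, and \<open>y y'\<close> lies in the
  transform of \<open>c d\<close> because the exponents can be added.\<close>

lemma (in domain) affine_ideal_Int:
  assumes "ideal I R" "ideal J R" "affine_ideal R I" "affine_ideal R J"
  shows "affine_ideal R (I \<inter> J)"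
proof -
  interpret I: ideal I R by fact
  interpret J: ideal J R by fact
  let ?X = "\<lambda>I c. {x \<otimes> y |x y. x \<in> I \<and> y \<in> transform R I c}"
  obtain c d where c: "c \<in> carrier R" "c \<noteq> \<zero>" "c \<in> Idl (?X I c)"
    and d: "d \<in> carrier R" "d \<noteq> \<zero>" "d \<in> Idl (?X J d)"
    using assms by (auto simp: affine_ideal_def)
  have sub: "?X I c \<subseteq> carrier R" "?X J d \<subseteq> carrier R" "?X (I \<inter> J) (c \<otimes> d) \<subseteq> carrier R"
    by (auto dest: transform_carrier simp: I.Icarr J.Icarr)
  have "c \<otimes> d \<in> Idl (?X (I \<inter> J) (c \<otimes> d))"
  proof (rule genideal_mult[OF genideal_ideal[OF sub(3)] sub(1,2) _ c(3) d(3)])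
    fix u v assume "u \<in> ?X I c" "v \<in> ?X J d"
    then obtain x y x' y' where x: "u = x \<otimes> y" "x \<in> I" "y \<in> transform R I c"
      and y: "v = x' \<otimes> y'" "x' \<in> J" "y' \<in> transform R J d" by blast
    have car: "x \<in> carrier R" "y \<in> carrier R" "x' \<in> carrier R" "y' \<in> carrier R"
      using x y by (auto dest: transform_carrier simp: I.Icarr J.Icarr)
    have "\<exists>n::nat. z [^] n \<otimes> (y \<otimes> y') \<in> PIdl (c \<otimes> d)" if z: "z \<in> I \<inter> J" for z
    proof -
      have zc: "z \<in> carrier R" using z I.Icarr by auto
      obtain m n :: nat where mn: "z [^] m \<otimes> y \<in> PIdl c" "z [^] n \<otimes> y' \<in> PIdl d"
        using transformD[OF x(3), of z] transformD[OF y(3), of z] z by blast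
      have "z [^] (m + n) \<otimes> (y \<otimes> y') = (z [^] m \<otimes> y) \<otimes> (z [^] n \<otimes> y')"
        using zc car by (simp add: nat_pow_mult[symmetric] m_ac)
      also have "\<dots> \<in> PIdl (c \<otimes> d)" using PIdl_mult_mult mn c d by blast
      finally show ?thesis by blast
    qed
    then have 1: "y \<otimes> y' \<in> transform R (I \<inter> J) (c \<otimes> d)" using car by (auto simp: transform_def)
    have 2: "x \<otimes> x' \<in> I \<inter> J"
      using I.I_r_closed[OF x(2) car(3)] J.I_l_closed[OF y(2) car(1)] by simp
    have "u \<otimes> v = (x \<otimes> x') \<otimes> (y \<otimes> y')" using x y car by (simp add: m_ac)
    then have "u \<otimes> v \<in> ?X (I \<inter> J) (c \<otimes> d)" using 1 2 unfolding mem_Collect_eq by metis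
    then show "u \<otimes> v \<in> Idl (?X (I \<inter> J) (c \<otimes> d))" using genideal_self[OF sub(3)] by blast
  qed
  moreover have "c \<otimes> d \<in> carrier R - {\<zero>}" using c d integral[of c d] by auto
  ultimately show ?thesis unfolding affine_ideal_def by (rule bexI)
qed

section \<open>Noetherian domains: the maximal condition and minimal primes\<close>

locale noeth_domain = domain +
  assumes finitely_generated: "ideal I R \<Longrightarrow> \<exists>A. A \<subseteq> carrier R \<and> finite A \<and> I = Idl A"
begin

text \<open>Zorn's lemma applies because the union of a chain of ideals is finitely generated, so a
  member of the chain already contains the generators and equals the union.\<close>

lemma maximal_ideal_exists:
  assumes "\<F> \<noteq> {}" "\<And>J. J \<in> \<F> \<Longrightarrow> ideal J R"
  shows "\<exists>M\<in>\<F>. \<forall>J\<in>\<F>. M \<subseteq> J \<longrightarrow> J = M"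
proof (rule subset_Zorn)
  fix C assume C: "subset.chain \<F> C"
  show "\<exists>U\<in>\<F>. \<forall>J\<in>C. J \<subseteq> U"
  proof (cases "C = {}")
    case True then show ?thesis using assms by auto
  next
    case False
    have sub: "C \<subseteq> \<F>" using C by (auto simp: pred_on.chain_def)
    have chain: "I \<subseteq> J \<or> J \<subseteq> I" if "I \<in> C" "J \<in> C" for I J
      using C that by (simp add: subset_chain_def)
    have "ideal (\<Union>C) R" using False sub chain assms(2) by (intro directed_Union_ideal) auto
    then obtain A where A: "A \<subseteq> carrier R" "finite A" "\<Union>C = Idl A" using finitely_generated by metis
    have "\<exists>I\<in>C. B \<subseteq> I" if "finite B" "B \<subseteq> \<Union>C" for B
      using that
    proof (induction B)
      case empty then show ?case using False by auto
    next
      case (insert b B)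
      then obtain I J where "I \<in> C" "B \<subseteq> I" "J \<in> C" "b \<in> J" by auto
      then show ?case using chain[of I J] by (metis insert_subset subsetD subset_trans)
    qed
    then obtain I where I: "I \<in> C" "A \<subseteq> I" using A genideal_self by metis
    then have "\<Union>C \<subseteq> I" using genideal_minimal[of I A] sub assms(2) A(3) by auto
    then show ?thesis using I sub by (intro bexI[of _ I]) auto
  qed
qed

text \<open>Noetherian induction. A maximal counterexample \<open>M\<close> is proper and not prime,
  so \<open>a b\<close> is in \<open>M\<close> with \<open>a\<close>, \<open>b\<close> outside;
  every prime over \<open>M\<close> contains \<open>M + (a)\<close> or \<open>M + (b)\<close>, and
  the finite sets of these two larger ideals can be united.\<close>

lemma finitely_many_primes:
  assumes "ideal J R"
  shows "\<exists>\<P>. finite \<P> \<and> (\<forall>P\<in>\<P>. primeideal P R \<and> J \<subseteq> P) \<and>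
    (\<forall>Q. primeideal Q R \<and> J \<subseteq> Q \<longrightarrow> (\<exists>P\<in>\<P>. P \<subseteq> Q))"
proof (rule ccontr)
  define good where "good J \<longleftrightarrow> (\<exists>\<P>. finite \<P> \<and> (\<forall>P\<in>\<P>. primeideal P R \<and> J \<subseteq> P) \<and>
    (\<forall>Q. primeideal Q R \<and> J \<subseteq> Q \<longrightarrow> (\<exists>P\<in>\<P>. P \<subseteq> Q)))" for J
  assume "\<not> (\<exists>\<P>. finite \<P> \<and> (\<forall>P\<in>\<P>. primeideal P R \<and> J \<subseteq> P) \<and>
    (\<forall>Q. primeideal Q R \<and> J \<subseteq> Q \<longrightarrow> (\<exists>P\<in>\<P>. P \<subseteq> Q)))"
  then have "\<not> good J" unfolding good_def .
  then have "{J. ideal J R \<and> \<not> good J} \<noteq> {}" using assms by blast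
  then have "\<exists>M\<in>{J. ideal J R \<and> \<not> good J}. \<forall>J\<in>{J. ideal J R \<and> \<not> good J}. M \<subseteq> J \<longrightarrow> J = M"
    by (rule maximal_ideal_exists) auto
  then obtain M where M': "M \<in> {J. ideal J R \<and> \<not> good J}"
    and max': "\<forall>J\<in>{J. ideal J R \<and> \<not> good J}. M \<subseteq> J \<longrightarrow> J = M" by (elim bexE)
  have M: "ideal M R" "\<not> good M" using M' by simp_all
  have max: "good J" if "ideal J R" "M \<subseteq> J" "J \<noteq> M" for J
    using bspec[OF max', of J] that by auto
  interpret ideal M R by fact
  have "\<not> primeideal M R"
  proof
    assume "primeideal M R"
    then have "good M" unfolding good_def by (intro exI[of _ "{M}"]) auto
    then show False using M by simp
  qed
  moreover have "carrier R \<noteq> M"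
  proof
    assume *: "carrier R = M"
    have "\<not> (primeideal Q R \<and> M \<subseteq> Q)" for Q
      using * primeideal.I_notcarr ideal.Icarr primeideal.axioms(1)
      by (metis subsetI subset_antisym)
    then have "good M" unfolding good_def by (intro exI[of _ "{}"]) auto
    then show False using M by simp
  qed
  ultimately obtain a b where ab: "a \<in> carrier R" "b \<in> carrier R" "a \<otimes> b \<in> M" "a \<notin> M" "b \<notin> M"
    using primeidealI[OF M(1) is_cring] by blast
  have "good (M <+>\<^bsub>R\<^esub> PIdl a)" "good (M <+>\<^bsub>R\<^esub> PIdl b)"
    using max[OF add_PIdl(1,2)[OF M(1)]] add_PIdl(3)[OF M(1)] ab by metis+
  then obtain A B where A: "finite A" "\<And>P. P \<in> A \<Longrightarrow> primeideal P R \<and> M <+>\<^bsub>R\<^esub> PIdl a \<subseteq> P"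
      "\<And>Q. primeideal Q R \<and> M <+>\<^bsub>R\<^esub> PIdl a \<subseteq> Q \<Longrightarrow> (\<exists>P\<in>A. P \<subseteq> Q)"
    and B: "finite B" "\<And>P. P \<in> B \<Longrightarrow> primeideal P R \<and> M <+>\<^bsub>R\<^esub> PIdl b \<subseteq> P"
      "\<And>Q. primeideal Q R \<and> M <+>\<^bsub>R\<^esub> PIdl b \<subseteq> Q \<Longrightarrow> (\<exists>P\<in>B. P \<subseteq> Q)" unfolding good_def by metis
  have "good M"
    unfolding good_def
  proof (intro exI[of _ "A \<union> B"] conjI ballI allI impI)
    show "finite (A \<union> B)" using A B by auto
    show "primeideal P R" "M \<subseteq> P" if "P \<in> A \<union> B" for P
      using that A(2) B(2) add_PIdl(2)[OF M(1)] ab by blast+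
    fix Q assume Q: "primeideal Q R \<and> M \<subseteq> Q"
    then interpret Q: primeideal Q R by simp
    have sub: "M <+>\<^bsub>R\<^esub> PIdl c \<subseteq> Q" if c: "c \<in> Q" for c
    proof
      fix z assume "z \<in> M <+>\<^bsub>R\<^esub> PIdl c"
      then obtain m x where "m \<in> M" "x \<in> carrier R" "z = m \<oplus> x \<otimes> c"
        using add_PIdl_iff[OF Q.Icarr[OF c]] by blast
      then show "z \<in> Q" using Q c Q.I_l_closed by auto
    qed
    have "a \<in> Q \<or> b \<in> Q" using Q.I_prime[OF ab(1,2)] Q ab(3) by auto
    then have "(\<exists>P\<in>A. P \<subseteq> Q) \<or> (\<exists>P\<in>B. P \<subseteq> Q)"
      using sub[of a] sub[of b] A(3)[of Q] B(3)[of Q] Q by auto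
    then show "\<exists>P\<in>A \<union> B. P \<subseteq> Q" by (metis UnCI)
  qed
  then show False using M by simp
qed

text \<open>Every prime over \<open>J\<close> contains a member of a finite set, hence an
  inclusion-minimal member; the latter is minimal over \<open>J\<close> for the same reason.\<close>

lemma finitely_many_minimal_primes:
  assumes "ideal J R"
  shows "\<exists>\<P>. finite \<P> \<and> (\<forall>P\<in>\<P>. minimal_prime R J P) \<and>
    (\<forall>Q. primeideal Q R \<and> J \<subseteq> Q \<longrightarrow> (\<exists>P\<in>\<P>. P \<subseteq> Q))"
proof -
  obtain \<P> where fin: "finite \<P>" and P: "\<And>P. P \<in> \<P> \<Longrightarrow> primeideal P R \<and> J \<subseteq> P"
    and Q: "\<And>Q. primeideal Q R \<Longrightarrow> J \<subseteq> Q \<Longrightarrow> \<exists>P\<in>\<P>. P \<subseteq> Q"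
    using finitely_many_primes[OF assms] by metis
  let ?M = "{P \<in> \<P>. minimal_prime R J P}"
  have "\<exists>P\<in>?M. P \<subseteq> Q" if "primeideal Q R" "J \<subseteq> Q" for Q
  proof -
    let ?N = "{P \<in> \<P>. P \<subseteq> Q}"
    have "finite ?N" "?N \<noteq> {}" using fin Q[OF that] by auto
    then have "\<exists>m\<in>?N. \<forall>b\<in>?N. b \<le> m \<longrightarrow> m = b" by (rule finite_has_minimal)
    then obtain P0 where P0: "P0 \<in> \<P>" "P0 \<subseteq> Q" and "\<forall>b\<in>?N. b \<le> P0 \<longrightarrow> P0 = b"
      by auto
    then have min: "P = P0" if "P \<in> \<P>" "P \<subseteq> Q" "P \<subseteq> P0" for P
      using that by auto
    have "minimal_prime R J P0"
      unfolding minimal_prime_def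
    proof (intro conjI allI impI)
      fix Q' assume *: "primeideal Q' R \<and> J \<subseteq> Q' \<and> Q' \<subseteq> P0"
      then obtain P' where "P' \<in> \<P>" "P' \<subseteq> Q'" using Q by blast
      moreover from this have "P' = P0" using min P0 * by blast
      ultimately show "Q' = P0" using * by blast
    qed (use P P0 in auto)
    then show ?thesis using P0 by blast
  qed
  then show ?thesis using fin by (intro exI[of _ ?M]) auto
qed

lemma minimal_prime_exists:
  assumes "ideal J R" "primeideal Q R" "J \<subseteq> Q"
  shows "\<exists>P. minimal_prime R J P \<and> P \<subseteq> Q"
  using finitely_many_minimal_primes[OF assms(1)] assms(2,3) by blast

end

section \<open>Associated primes of principal ideals in a normal domain\<close>

text \<open>The ideal of denominators of the fraction \<open>b / a\<close>.\<close>

definition colon :: "('a, 'm) ring_scheme \<Rightarrow> 'a \<Rightarrow> 'a \<Rightarrow> 'a set" where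
  "colon R a b = {z \<in> carrier R. z \<otimes>\<^bsub>R\<^esub> b \<in> PIdl\<^bsub>R\<^esub> a}"

text \<open>This says that \<open>R\<close> is completely integrally closed: \<open>b / a\<close> lies in \<open>R\<close> as soon as
  all its powers have a common denominator \<open>p\<close>.\<close>

definition power_bounded_closed :: "('a, 'm) ring_scheme \<Rightarrow> bool" where
  "power_bounded_closed R \<longleftrightarrow> (\<forall>a\<in>carrier R. \<forall>b\<in>carrier R. \<forall>p\<in>carrier R.
     a \<noteq> \<zero>\<^bsub>R\<^esub> \<and> p \<noteq> \<zero>\<^bsub>R\<^esub> \<and>
     (\<forall>n::nat. b [^]\<^bsub>R\<^esub> n \<otimes>\<^bsub>R\<^esub> p \<in> PIdl\<^bsub>R\<^esub> (a [^]\<^bsub>R\<^esub> n)) \<longrightarrow> b \<in> PIdl\<^bsub>R\<^esub> a)"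

lemma power_bounded_closedD:
  assumes "power_bounded_closed R" "a \<in> carrier R" "b \<in> carrier R" "p \<in> carrier R"
    "a \<noteq> \<zero>\<^bsub>R\<^esub>" "p \<noteq> \<zero>\<^bsub>R\<^esub>" "\<And>n::nat. b [^]\<^bsub>R\<^esub> n \<otimes>\<^bsub>R\<^esub> p \<in> PIdl\<^bsub>R\<^esub> (a [^]\<^bsub>R\<^esub> n)"
  shows "b \<in> PIdl\<^bsub>R\<^esub> a"
  using assms(1)[unfolded power_bounded_closed_def, rule_format, OF assms(2-4)] assms(5-7) by blast

lemma (in cring) colon_is_ideal: "a \<in> carrier R \<Longrightarrow> b \<in> carrier R \<Longrightarrow> ideal (colon R a b) R"
  unfolding colon_def by (rule colon_ideal[OF cgenideal_ideal])

lemma (in domain) pow_nonzero: "a \<in> carrier R \<Longrightarrow> a \<noteq> \<zero> \<Longrightarrow> a [^] (n::nat) \<noteq> \<zero>"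
  by (induction n) (auto simp: integral_iff)

lemma (in domain) cancel_left:
  "a \<otimes> b = a \<otimes> c \<Longrightarrow> a \<noteq> \<zero> \<Longrightarrow> a \<in> carrier R \<Longrightarrow> b \<in> carrier R \<Longrightarrow> c \<in> carrier R \<Longrightarrow> b = c"
  using m_lcancel by blast

context noeth_domain
begin

text \<open>The ascending chain condition in the form in which it is used: an infinite sequence has
  a term that is a combination of its predecessors.\<close>

lemma ideal_seq_stationary:
  assumes "\<And>n::nat. q n \<in> carrier R"
  shows "\<exists>n. q (Suc n) \<in> Idl (q ` {..n})"
proof -
  let ?I = "\<lambda>n. Idl (q ` {..n})"
  have car: "q ` A \<subseteq> carrier R" for A using assms by auto
  have id: "ideal (?I n) R" for n by (rule genideal_ideal[OF car])
  have "\<exists>M\<in>range ?I. \<forall>J\<in>range ?I. M \<subseteq> J \<longrightarrow> J = M"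
    by (rule maximal_ideal_exists) (use id in auto)
  then obtain n where n: "\<And>m. ?I n \<subseteq> ?I m \<Longrightarrow> ?I m = ?I n" by auto
  have "?I n \<subseteq> ?I (Suc n)" by (rule subset_Idl_subset[OF car image_mono]) auto
  moreover have "q (Suc n) \<in> ?I (Suc n)"
    by (rule subsetD[OF genideal_self[OF car]]) auto
  ultimately show ?thesis using n by blast
qed

text \<open>A minimal prime is associated: a maximal one among the ideals \<open>(a : c b)\<close>
  contained in \<open>P\<close> is prime and contains \<open>(a : b)\<close>, hence it is
  \<open>P\<close> by minimality.\<close>

lemma minimal_prime_colon:
  assumes a: "a \<in> carrier R" and b: "b \<in> carrier R" and P: "minimal_prime R (colon R a b) P"
  shows "\<exists>c\<in>carrier R. P = colon R a (c \<otimes> b)"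
proof -
  have pP: "primeideal P R" and sub: "colon R a b \<subseteq> P"
    and min: "\<And>Q. primeideal Q R \<Longrightarrow> colon R a b \<subseteq> Q \<Longrightarrow> Q \<subseteq> P \<Longrightarrow> Q = P"
    using P by (auto simp: minimal_prime_def)
  interpret P: primeideal P R by fact
  let ?F = "{colon R a (c \<otimes> b) | c. c \<in> carrier R \<and> colon R a (c \<otimes> b) \<subseteq> P}"
  have "colon R a (\<one> \<otimes> b) \<in> ?F" using sub b by (intro CollectI exI[of _ \<one>]) auto
  then have "?F \<noteq> {}" by blast
  moreover have "ideal J R" if "J \<in> ?F" for J using that a b colon_is_ideal by auto
  ultimately have "\<exists>M\<in>?F. \<forall>J\<in>?F. M \<subseteq> J \<longrightarrow> J = M" by (rule maximal_ideal_exists)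
  then obtain M where "M \<in> ?F" and M: "\<forall>J\<in>?F. M \<subseteq> J \<longrightarrow> J = M" by (elim bexE)
  then obtain c where c: "c \<in> carrier R" "colon R a (c \<otimes> b) \<subseteq> P" and Mc: "M = colon R a (c \<otimes> b)"
    by blast
  have max: "colon R a (d \<otimes> b) = colon R a (c \<otimes> b)"
    if "d \<in> carrier R" "colon R a (d \<otimes> b) \<subseteq> P" "colon R a (c \<otimes> b) \<subseteq> colon R a (d \<otimes> b)" for d
    using bspec[OF M, of "colon R a (d \<otimes> b)"] that Mc by blast
  let ?M = "colon R a (c \<otimes> b)"
  have idM: "ideal ?M R" using a b c colon_is_ideal by auto
  have mem: "z \<in> colon R a (u \<otimes> c \<otimes> b) \<longleftrightarrow> z \<otimes> u \<in> ?M" if "z \<in> carrier R" "u \<in> carrier R" for z u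
    using that b c by (simp add: colon_def m_assoc)
  have colon_car: "z \<in> carrier R" if "z \<in> colon R x y" for x y z
    using that by (simp add: colon_def)
  have bigger: "?M \<subseteq> colon R a (u \<otimes> c \<otimes> b)" if u: "u \<in> carrier R" for u
  proof
    fix z assume z: "z \<in> ?M"
    then have "z \<otimes> u \<in> ?M" using ideal.I_r_closed[OF idM] u by blast
    then show "z \<in> colon R a (u \<otimes> c \<otimes> b)" using mem u colon_car[OF z] by blast
  qed
  \<comment> \<open>Elements outside \<open>P\<close> are not zero divisors modulo
    \<open>?M\<close>: replacing \<open>c\<close> by \<open>u c\<close> keeps the colon ideal inside
    \<open>P\<close>, so by maximality it does not grow.\<close>
  have stable: "z \<in> ?M" if u: "u \<in> carrier R" "u \<notin> P" and z: "z \<in> carrier R" "z \<otimes> u \<in> ?M" for u z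
  proof -
    have "colon R a (u \<otimes> c \<otimes> b) \<subseteq> P"
    proof
      fix y assume y: "y \<in> colon R a (u \<otimes> c \<otimes> b)"
      then have "y \<otimes> u \<in> P" using mem[of y u] u colon_car[OF y] c(2) by blast
      then show "y \<in> P" using P.I_prime[of y u] u colon_car[OF y] by blast
    qed
    then have "colon R a (u \<otimes> c \<otimes> b) = ?M" using max[of "u \<otimes> c"] bigger[OF u(1)] u c by simp
    then show ?thesis using mem[of z u] z u by blast
  qed
  have "primeideal ?M R"
  proof (rule primeidealI[OF idM is_cring])
    show "carrier R \<noteq> ?M" using c(2) P.I_notcarr P.Icarr by blast
    fix x y assume xy: "x \<in> carrier R" "y \<in> carrier R" "x \<otimes> y \<in> ?M"
    show "x \<in> ?M \<or> y \<in> ?M"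
    proof (cases "colon R a (y \<otimes> c \<otimes> b) \<subseteq> P")
      case True
      then have "colon R a (y \<otimes> c \<otimes> b) = ?M"
        using max[of "y \<otimes> c"] bigger[OF xy(2)] xy c by simp
      then show ?thesis using mem[of x y] xy by blast
    next
      case False
      then obtain u where u: "u \<in> colon R a (y \<otimes> c \<otimes> b)" "u \<notin> P" by blast
      then have uc: "u \<in> carrier R" using colon_car by blast
      then have "u \<otimes> y \<in> ?M" using mem u xy by blast
      then have "y \<otimes> u \<in> ?M" using uc xy by (simp add: m_comm)
      then show ?thesis using stable[OF uc u(2) xy(2)] by blast
    qed
  qed
  moreover have "colon R a b \<subseteq> ?M"
  proof
    fix z assume z: "z \<in> colon R a b"
    have zc: "z \<in> carrier R" and *: "z \<otimes> b \<in> PIdl a" using z by (auto simp: colon_def)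
    have "z \<otimes> (c \<otimes> b) = c \<otimes> (z \<otimes> b)" using zc b c by (simp add: m_lcomm)
    then show "z \<in> ?M" using PIdl_mult[OF a * c(1)] zc by (simp add: colon_def)
  qed
  ultimately have "?M = P" using c(2) by (rule min)
  then show ?thesis by (intro bexI[OF _ c(1)]) simp
qed

text \<open>An associated prime of a principal ideal is locally principal: otherwise multiplication
  by \<open>b / a\<close> would map \<open>P = (a : b)\<close> into itself.\<close>

lemma associated_prime_uniformizer:
  assumes closed: "power_bounded_closed R"
    and a: "a \<in> carrier R" "a \<noteq> \<zero>" and b: "b \<in> carrier R" 
    and P: "primeideal P R" and P_eq: "P = colon R a b"
  shows "\<exists>x\<in>P. \<exists>u\<in>carrier R - P. \<forall>z\<in>P. u \<otimes> z \<in> PIdl x"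
proof (rule ccontr)
  assume neg: "\<not> ?thesis"
  have memD: "x \<otimes> b \<in> PIdl a" if "x \<in> P" for x
    using that unfolding P_eq colon_def by simp
  have memI: "x \<in> P" if "x \<otimes> b \<in> PIdl a" "x \<in> carrier R" for x
    using that unfolding P_eq colon_def by simp
  interpret P: primeideal P R by fact
  have div: "\<exists>y\<in>carrier R. x \<otimes> b = y \<otimes> a" if "x \<in> P" for x
    using memD[OF that] unfolding PIdl_iff .
  \<comment> \<open>This says that multiplication by \<open>b / a\<close> maps \<open>P\<close> into
    itself. If \<open>y = x b / a\<close> were outside \<open>P\<close>, then \<open>y\<close> could
    serve as the \<open>u\<close> belonging to \<open>x\<close>, because
    \<open>y z = x (z b / a)\<close> for every \<open>z\<close> in \<open>P\<close>.\<close>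
  have step: "y \<in> P" if x: "x \<in> P" and y: "y \<in> carrier R" "x \<otimes> b = y \<otimes> a" for x y
  proof (rule ccontr)
    assume "y \<notin> P"
    moreover have "y \<otimes> z \<in> PIdl x" if z: "z \<in> P" for z
    proof -
      obtain w where w: "w \<in> carrier R" "z \<otimes> b = w \<otimes> a" using div[OF z] by blast
      have c: "x \<in> carrier R" "z \<in> carrier R" using x z P.Icarr by auto
      have "a \<otimes> (y \<otimes> z) = (y \<otimes> a) \<otimes> z" using a y c by (simp add: m_ac)
      also have "\<dots> = x \<otimes> (z \<otimes> b)" unfolding y(2)[symmetric] using c b by (simp add: m_ac)
      also have "\<dots> = a \<otimes> (w \<otimes> x)" unfolding w(2) using c w a by (simp add: m_ac)
      finally have "y \<otimes> z = w \<otimes> x"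
        by (rule cancel_left) (use a y(1) c w(1) in auto)
      then show ?thesis using w(1) PIdl_mult_left[OF c(1)] by simp
    qed
    ultimately have "\<exists>u\<in>carrier R - P. \<forall>z\<in>P. u \<otimes> z \<in> PIdl x"
      using y(1) by (intro bexI[of _ y] ballI) auto
    then show False using neg x by (metis (no_types, lifting))
  qed
  have "b \<in> PIdl a"
  proof (cases "\<exists>p\<in>P. p \<noteq> \<zero>")
    case True
    then obtain p where p: "p \<in> P" "p \<noteq> \<zero>" by blast
    have pc: "p \<in> carrier R" using p P.Icarr by auto
    \<comment> \<open>By stability of \<open>P\<close>, the element \<open>p\<close> is a common
      denominator of all powers of \<open>b / a\<close>.\<close>
    have "\<exists>y\<in>P. b [^] n \<otimes> p = y \<otimes> a [^] n" for n :: nat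
    proof (induction n)
      case 0 then show ?case using p pc by auto
    next
      case (Suc n)
      then obtain y where y: "y \<in> P" "b [^] n \<otimes> p = y \<otimes> a [^] n" by blast
      obtain w where w: "w \<in> carrier R" "y \<otimes> b = w \<otimes> a" using div[OF y(1)] by blast
      have yc: "y \<in> carrier R" using y P.Icarr by auto
      have "b [^] Suc n \<otimes> p = b \<otimes> (b [^] n \<otimes> p)" using b pc by (simp add: m_ac)
      also have "\<dots> = (y \<otimes> b) \<otimes> a [^] n" unfolding y(2) using b yc a by (simp add: m_ac)
      also have "\<dots> = w \<otimes> a [^] Suc n" unfolding w(2) using w a by (simp add: m_ac)
      finally show ?case using step[OF y(1) w] by blast
    qed
    then have "\<forall>n::nat. b [^] n \<otimes> p \<in> PIdl (a [^] n)"
      using PIdl_mult_left[OF nat_pow_closed[OF a(1)] P.Icarr] by metis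
    then show ?thesis by (intro power_bounded_closedD[OF closed a(1) b pc a(2) p(2)]) blast
  next
    case False
    \<comment> \<open>\<open>P\<close> cannot be zero: it contains the nonzero
      \<open>a\<close>.\<close>
    have "a \<otimes> b \<in> PIdl a" using a b PIdl_mult_left[of a b] by (simp add: m_comm)
    then have "a \<in> P" using a by (intro memI)
    then show ?thesis using False a by blast
  qed
  then have "\<one> \<in> P" using b by (intro memI) auto
  then show False using P.one_imp_carrier P.I_notcarr by blast
qed

end

text \<open>A prime ideal \<open>P\<close> whose localization is a discrete valuation ring with uniformizer \<open>x\<close>.\<close>

locale dvr_prime = noeth_domain R + primeideal P R for P and R (structure) +
  fixes x u
  assumes x_mem: "x \<in> P" and u_car: "u \<in> carrier R" and u_nmem: "u \<notin> P"
    and unif: "z \<in> P \<Longrightarrow> u \<otimes> z \<in> PIdl x"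
    and nonzero: "\<exists>z\<in>P. z \<noteq> \<zero>"
begin

lemma x_car: "x \<in> carrier R" using x_mem Icarr by auto

lemma prime_mult: "s \<in> carrier R \<Longrightarrow> t \<in> carrier R \<Longrightarrow> s \<notin> P \<Longrightarrow> t \<notin> P \<Longrightarrow> s \<otimes> t \<notin> P"
  using I_prime by blast

lemma x_nonzero: "x \<noteq> \<zero>"
proof
  assume x0: "x = \<zero>"
  obtain z where z: "z \<in> P" "z \<noteq> \<zero>" using nonzero by blast
  then have "u \<otimes> z = \<zero>" using unif[OF z(1)] unfolding x0 PIdl_zero by simp
  then have "u = \<zero>" using z u_car Icarr[OF z(1)] integral by blast
  then show False using u_nmem zero_closed by simp
qed

text \<open>Up to units of the localization at \<open>P\<close>, \<open>a\<close> is a power of the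
  uniformizer. Otherwise \<open>x\<close> could be split off without end, giving
  \<open>u^n a = q n x^n\<close> with \<open>q n\<close> in \<open>P\<close> for all
  \<open>n\<close>; the ascending chain condition on the \<open>q n\<close> contradicts
  this.\<close>

lemma order_exists:
  assumes a: "a \<in> carrier R" "a \<noteq> \<zero>"
  shows "\<exists>n. \<exists>s\<in>carrier R - P. \<exists>t\<in>carrier R - P. s \<otimes> a = t \<otimes> x [^] (n::nat)"
proof (rule ccontr)
  assume neg: "\<not> ?thesis"
  have unP: "u [^] n \<in> carrier R - P" for n :: nat
    using prime_pow_mem[OF primeideal u_car] u_nmem u_car by auto
  have "\<exists>q. \<forall>n::nat. q n \<in> P \<and> u [^] n \<otimes> a = q n \<otimes> x [^] n"
  proof (rule choice, rule allI)
    fix n :: nat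
    show "\<exists>q. q \<in> P \<and> u [^] n \<otimes> a = q \<otimes> x [^] n"
    proof (induction n)
      case 0
      have "\<one> \<otimes> a = a \<otimes> x [^] (0::nat)" using a by simp
      moreover have "\<one> \<in> carrier R - P" using one_imp_carrier I_notcarr by auto
      ultimately have "a \<in> P" using neg a(1) by (metis (no_types, lifting) DiffI)
      then show ?case using a by (intro exI[of _ a]) simp
    next
      case (Suc n)
      then obtain q where q: "q \<in> P" "u [^] n \<otimes> a = q \<otimes> x [^] n" by blast
      obtain w where w: "w \<in> carrier R" "u \<otimes> q = w \<otimes> x" using unif[OF q(1)] by (auto simp: PIdl_iff)
      have qc: "q \<in> carrier R" using q Icarr by auto
      have "u [^] Suc n \<otimes> a = u \<otimes> (u [^] n \<otimes> a)" using a u_car by (simp add: m_ac)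
      also have "\<dots> = (u \<otimes> q) \<otimes> x [^] n" unfolding q using qc u_car x_car by (simp add: m_ac)
      also have "\<dots> = w \<otimes> x [^] Suc n" unfolding w using w x_car by (simp add: m_ac)
      finally have *: "u [^] Suc n \<otimes> a = w \<otimes> x [^] Suc n" .
      then have "w \<in> P" using neg unP[of "Suc n"] w(1) by (metis (no_types, lifting) DiffI)
      then show ?case using * by (intro exI[of _ w]) simp
    qed
  qed
  then obtain q where q: "\<And>n. q n \<in> P" "\<And>n::nat. u [^] n \<otimes> a = q n \<otimes> x [^] n" by blast
  have qc: "q n \<in> carrier R" for n using q Icarr by blast
  then obtain n where n: "q (Suc n) \<in> Idl (q ` {..n})" using ideal_seq_stationary by blast
  let ?xn = "x [^] Suc n"
  have idK: "ideal (PIdl (x \<otimes> a)) R" using cgenideal_ideal x_car a by blast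
  \<comment> \<open>For \<open>i \<le> n\<close> the product
    \<open>q i x^(n+1) = u^i x^(n+1-i) a\<close> has a factor \<open>x\<close> to spare. As
    \<open>q (Suc n)\<close> is a combination of these \<open>q i\<close>, it follows that
    \<open>u^(n+1) a\<close> is in \<open>(x a)\<close>, so \<open>u^(n+1)\<close> would be in
    \<open>(x)\<close> and hence in \<open>P\<close>.\<close>
  have "q ` {..n} \<subseteq> {z \<in> carrier R. z \<otimes> ?xn \<in> PIdl (x \<otimes> a)}"
  proof clarify
    fix i assume i: "i \<le> n"
    have "q i \<otimes> ?xn = (q i \<otimes> x [^] i) \<otimes> (x [^] (n - i) \<otimes> x)"
      using i qc x_car by (simp add: nat_pow_mult m_assoc[symmetric]) (simp add: m_assoc nat_pow_mult)
    also have "\<dots> = (u [^] i \<otimes> x [^] (n - i)) \<otimes> (x \<otimes> a)"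
      unfolding q(2)[symmetric] using x_car u_car a by (simp add: m_ac)
    also have "\<dots> \<in> PIdl (x \<otimes> a)" using x_car u_car a by (intro PIdl_mult_left) auto
    finally show "q i \<in> carrier R \<and> q i \<otimes> ?xn \<in> PIdl (x \<otimes> a)" using qc by blast
  qed
  then have "Idl (q ` {..n}) \<subseteq> {z \<in> carrier R. z \<otimes> ?xn \<in> PIdl (x \<otimes> a)}"
    using colon_ideal[OF idK, of ?xn] x_car by (intro genideal_minimal) auto
  then have "u [^] Suc n \<otimes> a \<in> PIdl (x \<otimes> a)" using n q(2)[of "Suc n"] by auto
  then have "a \<otimes> u [^] Suc n \<in> PIdl (a \<otimes> x)" using a u_car x_car by (simp add: m_comm)
  then have "u [^] Suc n \<in> PIdl x" using PIdl_cancel[of x "u [^] Suc n" a] a u_car x_car by simp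
  then have "u [^] Suc n \<in> P" using ideal_mono_PIdl[OF is_ideal x_mem] by blast
  then show False using unP by blast
qed

text \<open>A nonzero element of \<open>Q\<close> is a power of \<open>x\<close> up to factors
  outside \<open>P\<close>, so \<open>Q\<close> contains \<open>x\<close>, and then all of
  \<open>P\<close> since \<open>u z\<close> is in \<open>(x)\<close> for \<open>z\<close> in
  \<open>P\<close>.\<close>

lemma height_one:
  assumes Q: "primeideal Q R" "Q \<subset> P" shows "Q = {\<zero>}"
proof (rule ccontr)
  interpret Q: primeideal Q R by fact
  assume "Q \<noteq> {\<zero>}"
  then obtain a where a: "a \<in> Q" "a \<noteq> \<zero>" using Q.zero_closed by blast
  then have ac: "a \<in> carrier R" using Q.Icarr by auto
  obtain n :: nat and s t where st: "s \<in> carrier R - P" "t \<in> carrier R - P" "s \<otimes> a = t \<otimes> x [^] n"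
    using order_exists[OF ac a(2)] by blast
  have "t \<otimes> x [^] n \<in> Q" unfolding st(3)[symmetric] using Q.I_l_closed[OF a(1), of s] st(1) by simp
  then have "x [^] n \<in> Q" using Q.I_prime[of t "x [^] n"] st Q(2) x_car by blast
  then have xQ: "x \<in> Q" using prime_pow_mem[OF Q(1) x_car] by blast
  have "P \<subseteq> Q"
  proof
    fix z assume z: "z \<in> P"
    have "u \<otimes> z \<in> Q" using ideal_mono_PIdl[OF Q.is_ideal xQ unif[OF z]] .
    then show "z \<in> Q" using Q.I_prime[of u z] u_car Icarr[OF z] u_nmem Q(2) by blast
  qed
  then show False using Q by blast
qed

text \<open>The symbolic powers of \<open>P\<close>.\<close>

definition V :: "nat \<Rightarrow> 'a set" where
  "V n = {a \<in> carrier R. \<exists>s\<in>carrier R - P. s \<otimes> a \<in> PIdl (x [^] n)}"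

lemma V_carrier: "a \<in> V n \<Longrightarrow> a \<in> carrier R" by (simp add: V_def)

lemma V_I: "s \<otimes> a \<in> PIdl (x [^] n) \<Longrightarrow> s \<in> carrier R - P \<Longrightarrow> a \<in> carrier R \<Longrightarrow> a \<in> V n"
  by (auto simp: V_def)

lemma V_mult:
  assumes "a \<in> V m" "b \<in> V n" shows "a \<otimes> b \<in> V (m + n)"
proof -
  obtain s t where s: "s \<in> carrier R - P" "s \<otimes> a \<in> PIdl (x [^] m)"
    and t: "t \<in> carrier R - P" "t \<otimes> b \<in> PIdl (x [^] n)"
    using assms by (auto simp: V_def)
  have c: "a \<in> carrier R" "b \<in> carrier R" using assms V_carrier by auto
  have "(s \<otimes> t) \<otimes> (a \<otimes> b) = (s \<otimes> a) \<otimes> (t \<otimes> b)" using s t c by (simp add: m_ac)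
  moreover have "(s \<otimes> a) \<otimes> (t \<otimes> b) \<in> PIdl (x [^] (m + n))"
    using PIdl_mult_mult[OF _ _ s(2) t(2)] x_car by (simp add: nat_pow_mult)
  ultimately have "(s \<otimes> t) \<otimes> (a \<otimes> b) \<in> PIdl (x [^] (m + n))" by simp
  moreover have "s \<otimes> t \<in> carrier R - P" using s t prime_mult[of s t] by auto
  ultimately show ?thesis by (rule V_I) (use c in auto)
qed

lemma V_0: "V 0 = carrier R"
proof -
  have "\<one> \<in> carrier R - P" using one_imp_carrier I_notcarr by auto
  moreover have "\<one> \<otimes> a \<in> PIdl (x [^] (0::nat))" if "a \<in> carrier R" for a
    using that by (auto simp: PIdl_iff)
  ultimately show ?thesis unfolding V_def by blast
qed

lemma V_mono: "m \<le> n \<Longrightarrow> V n \<subseteq> V m"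
proof
  fix a assume mn: "m \<le> n" and a: "a \<in> V n"
  have "x [^] n = x [^] (n - m) \<otimes> x [^] m" using mn x_car by (simp add: nat_pow_mult)
  then have "x [^] n \<in> PIdl (x [^] m)" using x_car by (auto simp: PIdl_iff)
  then have "PIdl (x [^] n) \<subseteq> PIdl (x [^] m)"
    using cgenideal_ideal x_car by (intro cgenideal_minimal) auto
  then show "a \<in> V m" using a unfolding V_def by blast
qed

lemma V_add:
  assumes "a \<in> V n" "b \<in> V n" shows "a \<oplus> b \<in> V n"
proof -
  obtain s t where s: "s \<in> carrier R - P" "s \<otimes> a \<in> PIdl (x [^] n)"
    and t: "t \<in> carrier R - P" "t \<otimes> b \<in> PIdl (x [^] n)"
    using assms by (auto simp: V_def)
  have c: "a \<in> carrier R" "b \<in> carrier R" using assms V_carrier by auto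
  have "(s \<otimes> t) \<otimes> (a \<oplus> b) = t \<otimes> (s \<otimes> a) \<oplus> s \<otimes> (t \<otimes> b)"
    using s t c by (simp add: r_distr m_ac)
  moreover have "\<dots> \<in> PIdl (x [^] n)"
    using PIdl_add[OF _ PIdl_mult[OF _ s(2)] PIdl_mult[OF _ t(2)]] s(1) t(1) x_car by simp
  ultimately have "(s \<otimes> t) \<otimes> (a \<oplus> b) \<in> PIdl (x [^] n)" by simp
  moreover have "s \<otimes> t \<in> carrier R - P" using s t prime_mult[of s t] by auto
  ultimately show ?thesis by (rule V_I) (use c in auto)
qed

lemma V_ideal: "ideal (V n) R"
proof (rule idealI[OF ring_axioms])
  show l: "y \<otimes> a \<in> V n" if "a \<in> V n" "y \<in> carrier R" for a y
    using V_mult[of y 0 a n] that V_0 by simp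
  then show "a \<otimes> y \<in> V n" if "a \<in> V n" "y \<in> carrier R" for a y
    using that m_comm[OF V_carrier] by metis
  have "\<ominus> a \<in> V n" if a: "a \<in> V n" for a
    using l[OF a, of "\<ominus> \<one>"] V_carrier[OF a] by (simp add: l_minus)
  moreover have "\<zero> \<in> V n"
  proof -
    have "\<zero> \<in> PIdl (x [^] n)" using PIdl_mult_left[of "x [^] n" \<zero>] x_car by simp
    then have "\<one> \<otimes> \<zero> \<in> PIdl (x [^] n)" by simp
    moreover have "\<one> \<in> carrier R - P" using one_imp_carrier I_notcarr by auto
    ultimately show ?thesis unfolding V_def by blast
  qed
  ultimately show "subgroup (V n) (add_monoid R)"
    using V_carrier V_add by (intro subgroup.intro) (auto simp flip: a_inv_def)
qed

text \<open>The cofactor \<open>y\<close> of \<open>x^n\<close> is outside \<open>P\<close>, as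
  otherwise \<open>u y\<close> would supply one more factor \<open>x\<close>.\<close>

lemma V_exact:
  assumes a: "a \<in> V n" "a \<notin> V (Suc n)"
  shows "\<exists>s\<in>carrier R - P. \<exists>t\<in>carrier R - P. s \<otimes> a = t \<otimes> x [^] n"
proof -
  obtain s y where s: "s \<in> carrier R - P" "y \<in> carrier R" "s \<otimes> a = y \<otimes> x [^] n"
    using a(1) by (auto simp: V_def PIdl_iff)
  have ac: "a \<in> carrier R" using a V_carrier by auto
  have "y \<notin> P"
  proof
    assume "y \<in> P"
    then obtain w where w: "w \<in> carrier R" "u \<otimes> y = w \<otimes> x" using unif by (auto simp: PIdl_iff)
    have "(u \<otimes> s) \<otimes> a = (u \<otimes> y) \<otimes> x [^] n"
      using s ac u_car x_car by (simp add: m_assoc)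
    also have "\<dots> = w \<otimes> x [^] Suc n" unfolding w(2) using w x_car by (simp add: m_ac)
    finally have "(u \<otimes> s) \<otimes> a \<in> PIdl (x [^] Suc n)" using w by (auto simp: PIdl_iff)
    moreover have "u \<otimes> s \<in> carrier R - P" using s u_car u_nmem prime_mult by auto
    ultimately have "a \<in> V (Suc n)" using ac unfolding V_def by blast
    then show False using a by blast
  qed
  then show ?thesis using s by blast
qed

lemma not_V_Suc:
  assumes "a \<in> carrier R" "s \<in> carrier R - P" "t \<in> carrier R - P" "s \<otimes> a = t \<otimes> x [^] n"
  shows "a \<notin> V (Suc n)"
proof
  assume "a \<in> V (Suc n)"
  then obtain r y where r: "r \<in> carrier R - P" "y \<in> carrier R" "r \<otimes> a = y \<otimes> x [^] Suc n"
    by (auto simp: V_def PIdl_iff)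
  have c: "r \<in> carrier R" "s \<in> carrier R" "t \<in> carrier R" "x [^] n \<in> carrier R"
    using r assms x_car by auto
  have "x [^] n \<otimes> (r \<otimes> t) = r \<otimes> (s \<otimes> a)"
    unfolding assms(4) using c by (simp add: m_ac)
  also have "\<dots> = s \<otimes> (r \<otimes> a)" using c assms(1) by (simp add: m_ac)
  also have "\<dots> = x [^] n \<otimes> (s \<otimes> y \<otimes> x)" unfolding r(3) using c r(2) x_car by (simp add: m_ac)
  finally have "r \<otimes> t = s \<otimes> y \<otimes> x"
    by (rule cancel_left) (use pow_nonzero[OF x_car x_nonzero] c r(2) x_car in auto)
  then have "r \<otimes> t \<in> P" using I_l_closed[OF x_mem, of "s \<otimes> y"] r assms by simp
  then show False using prime_mult r assms by blast
qed

text \<open>Orders add, as for a valuation. Gauss's lemma depends on this; for symbolic powers of a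
  general prime only the inclusion \<open>V_mult\<close> would be available.\<close>

lemma V_mult_exact:
  assumes a: "a \<in> V m" "a \<notin> V (Suc m)" and b: "b \<in> V n" "b \<notin> V (Suc n)"
  shows "a \<otimes> b \<notin> V (Suc (m + n))"
proof -
  obtain s t where s: "s \<in> carrier R - P" "t \<in> carrier R - P" "s \<otimes> a = t \<otimes> x [^] m"
    using V_exact[OF a] by blast
  obtain s' t' where s': "s' \<in> carrier R - P" "t' \<in> carrier R - P" "s' \<otimes> b = t' \<otimes> x [^] n"
    using V_exact[OF b] by blast
  have c: "a \<in> carrier R" "b \<in> carrier R" using a b V_carrier by auto
  have d: "s \<in> carrier R" "s' \<in> carrier R" "t \<in> carrier R" "t' \<in> carrier R" using s s' by auto
  have "(s \<otimes> s') \<otimes> (a \<otimes> b) = (s \<otimes> a) \<otimes> (s' \<otimes> b)" using c d by (simp add: m_ac)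
  also have "\<dots> = (t \<otimes> t') \<otimes> (x [^] m \<otimes> x [^] n)"
    unfolding s(3) s'(3) using d x_car by (simp add: m_ac)
  also have "\<dots> = (t \<otimes> t') \<otimes> x [^] (m + n)" using x_car by (simp add: nat_pow_mult)
  finally show ?thesis
    using s(1,2) s'(1,2) c d prime_mult[of s s'] prime_mult[of t t']
    by (intro not_V_Suc[of "a \<otimes> b" "s \<otimes> s'" "t \<otimes> t'"]) simp_all
qed

lemma V_separated:
  assumes "a \<in> carrier R" "a \<noteq> \<zero>" shows "\<exists>n. a \<in> V n \<and> a \<notin> V (Suc n)"
proof -
  obtain n :: nat and s t where st: "s \<in> carrier R - P" "t \<in> carrier R - P" "s \<otimes> a = t \<otimes> x [^] n"
    using order_exists[OF assms] by blast
  have "a \<in> V n" using st assms by (auto simp: V_def PIdl_iff)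
  moreover have "a \<notin> V (Suc n)" using not_V_Suc st assms by blast
  ultimately show ?thesis by blast
qed

end

context noeth_domain
begin

text \<open>The point where closedness under power-bounded fractions is turned into valuations. The
  presentation of \<open>P\<close> as a colon ideal is kept because \<open>gauss_lemma\<close>
  derives its contradiction from it.\<close>

lemma minimal_prime_colon_dvr:
  assumes "power_bounded_closed R" "a \<in> carrier R" "a \<noteq> \<zero>" "b \<in> carrier R"
    and "minimal_prime R (colon R a b) P"
  shows "\<exists>c\<in>carrier R. \<exists>x u. P = colon R a (c \<otimes> b) \<and> dvr_prime P R x u"
proof -
  obtain c where c: "c \<in> carrier R" "P = colon R a (c \<otimes> b)"
    using minimal_prime_colon assms by blast
  have P: "primeideal P R" using assms by (simp add: minimal_prime_def)
  have "\<exists>x\<in>P. \<exists>u\<in>carrier R - P. \<forall>z\<in>P. u \<otimes> z \<in> PIdl x"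
    by (rule associated_prime_uniformizer[OF assms(1-3) _ P c(2)]) (use assms c in auto)
  then obtain x u where xu: "x \<in> P" "u \<in> carrier R - P" "\<forall>z\<in>P. u \<otimes> z \<in> PIdl x" by auto
  have "a \<otimes> (c \<otimes> b) \<in> PIdl a"
    using PIdl_mult_left[of a "c \<otimes> b"] m_comm[of a "c \<otimes> b"] assms(2,4) c(1) by simp
  then have aP: "a \<in> P" unfolding c(2) colon_def using assms(2) by simp
  then have "dvr_prime P R x u"
    using xu aP assms(3) by (intro dvr_prime.intro dvr_prime_axioms.intro P noeth_domain_axioms) auto
  then show ?thesis using c by (intro bexI[OF _ c(1)] exI conjI)
qed

lemma minimal_prime_colon_height_one:
  assumes "power_bounded_closed R" "a \<in> carrier R" "a \<noteq> \<zero>" "b \<in> carrier R"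
    and "minimal_prime R (colon R a b) P" "primeideal Q R" "Q \<subset> P"
  shows "Q = {\<zero>}"
  using minimal_prime_colon_dvr[OF assms(1-5)] dvr_prime.height_one assms(6,7) by metis

end

section \<open>Graded rings\<close>

lemma (in abelian_group) finsum_mem:
  assumes "additive_subgroup M G" "finite A" "\<And>i. i \<in> A \<Longrightarrow> c i \<in> M"
  shows "finsum G c A \<in> M"
  using assms(2,3)
proof (induction A)
  case empty then show ?case using additive_subgroup.zero_closed[OF assms(1)] by simp
next
  case (insert i A)
  have "c \<in> A \<rightarrow> carrier G" "c i \<in> carrier G"
    using insert additive_subgroup.a_Hcarr[OF assms(1)] by auto
  then have "finsum G c (insert i A) = c i \<oplus> finsum G c A" using insert by simp
  then show ?case using insert additive_subgroup.a_closed[OF assms(1)] by simp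
qed

lemma (in abelian_group) finsum_support:
  assumes "finite A" "{i. c i \<noteq> \<zero>} \<subseteq> A" "\<And>i. c i \<in> carrier G"
  shows "finsum G c {i. c i \<noteq> \<zero>} = finsum G c A"
  using assms by (intro add.finprod_mono_neutral_cong_left) auto

context graded_ring
begin

definition comp :: "'a \<Rightarrow> nat \<Rightarrow> 'a" where
  "comp x = (THE c. (\<forall>d. c d \<in> G d) \<and> finite {d. c d \<noteq> \<zero>} \<and> x = finsum R c {d. c d \<noteq> \<zero>})"

definition Hom :: "'a set" where "Hom = (\<Union>d. G d)"

section \<open>Homogeneous components\<close>

lemma G_carrier: "x \<in> G d \<Longrightarrow> x \<in> carrier R"
  using additive_subgroup.a_Hcarr[OF component_subgroup] .

lemma Hom_carrier: "x \<in> Hom \<Longrightarrow> x \<in> carrier R"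
  using G_carrier by (auto simp: Hom_def)

lemma G_Hom: "x \<in> G d \<Longrightarrow> x \<in> Hom" by (auto simp: Hom_def)

lemma zero_G: "\<zero> \<in> G d" using additive_subgroup.zero_closed[OF component_subgroup] .

lemma add_G: "x \<in> G d \<Longrightarrow> y \<in> G d \<Longrightarrow> x \<oplus> y \<in> G d"
  using additive_subgroup.a_closed[OF component_subgroup] .

lemma comp_props:
  assumes "x \<in> carrier R"
  shows "comp x d \<in> G d" "finite {d. comp x d \<noteq> \<zero>}" "x = finsum R (comp x) {d. comp x d \<noteq> \<zero>}"
  using theI'[OF direct_sum[OF assms]] unfolding comp_def[symmetric] by auto

lemma comp_carrier [simp]: "x \<in> carrier R \<Longrightarrow> comp x d \<in> carrier R"
  using comp_props G_carrier by metis

lemma comp_unique: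
  assumes "\<And>d. c d \<in> G d" "finite A" "{d. c d \<noteq> \<zero>} \<subseteq> A" "x = finsum R c A"
  shows "comp x = c"
proof -
  have c: "c d \<in> carrier R" for d using assms(1) G_carrier by metis
  have x: "x \<in> carrier R" unfolding assms(4) using c by (intro finsum_closed) auto
  have "finite {d. c d \<noteq> \<zero>}" using assms finite_subset by metis
  moreover have "x = finsum R c {d. c d \<noteq> \<zero>}"
    unfolding assms(4) using finsum_support[OF assms(2,3) c] by simp
  ultimately show ?thesis
    unfolding comp_def using assms(1) by (intro the1_equality[OF direct_sum[OF x]]) auto
qed

lemma comp_G:
  assumes "x \<in> G d" shows "comp x e = (if e = d then x else \<zero>)"
proof -
  have "comp x = (\<lambda>e. if e = d then x else \<zero>)"
    by (rule comp_unique[of _ "{d}"]) (use assms zero_G G_carrier in auto)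
  then show ?thesis by simp
qed

lemma comp_finsum:
  assumes "x \<in> carrier R" "finite A" "{d. comp x d \<noteq> \<zero>} \<subseteq> A"
  shows "x = finsum R (comp x) A"
  using comp_props(3)[OF assms(1)] finsum_support[OF assms(2,3)] assms(1) by simp

lemma comp_add:
  assumes "x \<in> carrier R" "y \<in> carrier R"
  shows "comp (x \<oplus> y) d = comp x d \<oplus> comp y d"
proof -
  let ?A = "{d. comp x d \<noteq> \<zero>} \<union> {d. comp y d \<noteq> \<zero>}"
  have fin: "finite ?A" using comp_props(2)[OF assms(1)] comp_props(2)[OF assms(2)] by simp
  have "comp (x \<oplus> y) = (\<lambda>d. comp x d \<oplus> comp y d)"
  proof (rule comp_unique[OF _ fin])
    show "comp x d \<oplus> comp y d \<in> G d" for d using comp_props(1) assms add_G by metis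
    show "{d. comp x d \<oplus> comp y d \<noteq> \<zero>} \<subseteq> ?A" by auto
    have "x \<oplus> y = finsum R (comp x) ?A \<oplus> finsum R (comp y) ?A"
      using comp_finsum[OF assms(1) fin] comp_finsum[OF assms(2) fin] by simp
    then show "x \<oplus> y = finsum R (\<lambda>d. comp x d \<oplus> comp y d) ?A"
      using assms by (subst finsum_addf) auto
  qed
  then show ?thesis by simp
qed

lemma mem_of_comps:
  assumes "additive_subgroup M R" "x \<in> carrier R" "\<And>d. comp x d \<in> M"
  shows "x \<in> M"
  using finsum_mem[OF assms(1) comp_props(2)[OF assms(2)], of "comp x"] assms(3)
    comp_props(3)[OF assms(2)] by simp

lemma hom_induct [consumes 1, case_names hom add]:
  assumes x: "x \<in> carrier R" and hom: "\<And>d y. y \<in> G d \<Longrightarrow> P y"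
    and add: "\<And>y z. y \<in> carrier R \<Longrightarrow> z \<in> carrier R \<Longrightarrow> P y \<Longrightarrow> P z \<Longrightarrow> P (y \<oplus> z)"
  shows "P x"
proof -
  have "P (finsum R (comp x) A)" if "finite A" for A
    using that
  proof (induction A)
    case empty then show ?case using hom[OF zero_G] by simp
  next
    case (insert d A)
    have "finsum R (comp x) (insert d A) = comp x d \<oplus> finsum R (comp x) A"
      using insert x by simp
    moreover have "P (comp x d \<oplus> finsum R (comp x) A)"
      using insert.IH hom[OF comp_props(1)[OF x]] x by (intro add) auto
    ultimately show ?case by simp
  qed
  then show ?thesis using comp_props(2,3)[OF x] by metis
qed

lemma comp_eqI:
  assumes "x \<in> carrier R" "y \<in> carrier R" "\<And>d. comp x d = comp y d"
  shows "x = y"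
proof -
  have "comp x = comp y" using assms(3) by auto
  then show ?thesis using comp_props(3) assms by metis
qed

lemma comp_zero [simp]: "comp \<zero> d = \<zero>" using comp_G[OF zero_G] by simp

lemma comp_minus:
  assumes "x \<in> carrier R" shows "comp (\<ominus> x) d = \<ominus> comp x d"
proof -
  have "comp x d \<oplus> comp (\<ominus> x) d = \<zero>" using comp_add[of x "\<ominus> x" d] assms by (simp add: r_neg)
  then show ?thesis using minus_equality[of "comp (\<ominus> x) d" "comp x d"] assms by (simp add: a_comm)
qed

lemma comp_mult_hom:
  assumes x: "x \<in> carrier R" and y: "y \<in> G e"
  shows "comp (x \<otimes> y) d = (if e \<le> d then comp x (d - e) \<otimes> y else \<zero>)"
  using x
proof (induction x rule: hom_induct)
  case (hom k z)
  have "z \<otimes> y \<in> G (k + e)" using component_mult hom y by auto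
  then show ?case using comp_G[OF hom] comp_G[of "z \<otimes> y" "k + e"] G_carrier[OF y] by auto
next
  case (add u v)
  then show ?case using G_carrier[OF y] by (simp add: l_distr comp_add)
qed

text \<open>The axioms of a grading do not place the unit in degree zero. Comparing degrees in
  \<open>1 y = y\<close> for homogeneous \<open>y\<close> shows that the degree-zero component of 1
  acts as the identity, hence it is 1.\<close>

lemma one_G: "\<one> \<in> G 0"
proof -
  have "comp \<one> 0 \<otimes> x = x" if "x \<in> carrier R" for x
    using that
  proof (induction x rule: hom_induct)
    case (hom d y)
    then have "comp (\<one> \<otimes> y) d = y" using comp_G[OF hom] G_carrier[OF hom] by simp
    then show ?case using comp_mult_hom[OF one_closed hom, of d] by simp
  next
    case (add y z) then show ?case by (simp add: r_distr)
  qed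
  from this[of \<one>] have "\<one> = comp \<one> 0" by simp
  then show ?thesis using comp_props(1)[OF one_closed] by metis
qed

lemma pow_G: "x \<in> G d \<Longrightarrow> x [^] (n::nat) \<in> G (n * d)"
proof (induction n)
  case 0 then show ?case using one_G by simp
next
  case (Suc n)
  then have "x [^] n \<otimes> x \<in> G (n * d + d)" using component_mult by blast
  then show ?case by (simp add: add.commute)
qed

text \<open>The truncated difference \<open>n - i\<close> is a true one because \<open>i\<close>
  runs up to \<open>n\<close> only.\<close>

lemma convolution:
  assumes f: "f \<in> carrier R" and g: "g \<in> carrier R"
  shows "comp (f \<otimes> g) n = finsum R (\<lambda>i. comp f i \<otimes> comp g (n - i)) {..n}"
  using f
proof (induction f rule: hom_induct)
  case (hom e f)
  have fc: "f \<in> carrier R" using G_carrier[OF hom] .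
  have "comp (f \<otimes> g) n = (if e \<le> n then comp g (n - e) \<otimes> f else \<zero>)"
    using comp_mult_hom[OF g hom] m_comm[OF fc g] by simp
  also have "\<dots> = finsum R (\<lambda>i. if i = e then f \<otimes> comp g (n - i) else \<zero>) {..n}"
  proof (cases "e \<le> n")
    case True
    have "finsum R (\<lambda>i. if e = i then f \<otimes> comp g (n - i) else \<zero>) {..n} = f \<otimes> comp g (n - e)"
      using True fc g by (intro add.finprod_singleton) auto
    moreover have "(\<lambda>i. if e = i then f \<otimes> comp g (n - i) else \<zero>) = (\<lambda>i. if i = e then f \<otimes> comp g (n - i) else \<zero>)"
      by auto
    ultimately show ?thesis using True fc g by (simp add: m_comm)
  next
    case False
    have "finsum R (\<lambda>i. if i = e then f \<otimes> comp g (n - i) else \<zero>) {..n} = finsum R (\<lambda>i. \<zero>) {..n}"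
      using False by (intro add.finprod_cong') auto
    then show ?thesis using False by simp
  qed
  also have "\<dots> = finsum R (\<lambda>i. comp f i \<otimes> comp g (n - i)) {..n}"
    using comp_G[OF hom] fc g by (intro add.finprod_cong') auto
  finally show ?case .
next
  case (add f f')
  have "finsum R (\<lambda>i. comp (f \<oplus> f') i \<otimes> comp g (n - i)) {..n} =
    finsum R (\<lambda>i. comp f i \<otimes> comp g (n - i) \<oplus> comp f' i \<otimes> comp g (n - i)) {..n}"
    using add g by (intro add.finprod_cong') (auto simp: comp_add l_distr)
  also have "\<dots> = finsum R (\<lambda>i. comp f i \<otimes> comp g (n - i)) {..n} \<oplus>
      finsum R (\<lambda>i. comp f' i \<otimes> comp g (n - i)) {..n}"
    using add g by (intro finsum_addf) auto
  finally show ?case using add g by (simp add: comp_add l_distr)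
qed

text \<open>The leading-term argument modulo \<open>N\<close>: in degree \<open>i0 + j0\<close>
  every other summand of the convolution has a first index above \<open>i0\<close> or a second one
  above \<open>j0\<close>. \<open>N\<close> need only be an additive subgroup, and it need not be
  homogeneous; it will be a prime or a symbolic power.\<close>

lemma top_comp:
  assumes N: "additive_subgroup N R" and f: "f \<in> carrier R" and g: "g \<in> carrier R"
    and top: "\<And>i j. i > i0 \<or> j > j0 \<Longrightarrow> comp f i \<otimes> comp g j \<in> N"
    and fg: "comp (f \<otimes> g) (i0 + j0) \<in> N"
  shows "comp f i0 \<otimes> comp g j0 \<in> N"
proof -
  let ?c = "\<lambda>i. comp f i \<otimes> comp g (i0 + j0 - i)" and ?A = "{..i0 + j0} - {i0}"
  have "{..i0 + j0} = insert i0 ?A" by auto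
  then have "comp (f \<otimes> g) (i0 + j0) = finsum R ?c (insert i0 ?A)"
    using convolution[OF f g, of "i0 + j0"] by simp
  also have "\<dots> = ?c i0 \<oplus> finsum R ?c ?A" using f g by (intro finsum_insert) auto
  finally have eq: "comp (f \<otimes> g) (i0 + j0) = ?c i0 \<oplus> finsum R ?c ?A" .
  have "finsum R ?c ?A \<in> N"
  proof (rule finsum_mem[OF N])
    fix i assume "i \<in> ?A"
    then have "i > i0 \<or> i0 + j0 - i > j0" by auto
    then show "?c i \<in> N" by (rule top)
  qed simp
  then have 1: "\<ominus> finsum R ?c ?A \<in> N" using additive_subgroup.a_inv_closed[OF N] by simp
  have "?c i0 = comp (f \<otimes> g) (i0 + j0) \<oplus> (\<ominus> finsum R ?c ?A)"
    unfolding eq using f g by (simp add: a_assoc r_neg)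
  also have "\<dots> \<in> N" using additive_subgroup.a_closed[OF N fg 1] .
  finally show ?thesis by simp
qed

text \<open>For an ideal \<open>Q\<close> this is the largest homogeneous ideal inside
  \<open>Q\<close>. It is defined for any set because \<open>point_of_prime\<close> applies it to an
  additive subgroup that is not known to be an ideal.\<close>

definition comp_core :: "'a set \<Rightarrow> 'a set" where
  "comp_core Q = {x \<in> carrier R. \<forall>d. comp x d \<in> Q}"

section \<open>Homogeneous cores and homogeneous primes\<close>

lemma comp_comp: "x \<in> carrier R \<Longrightarrow> comp (comp x d) e = (if e = d then comp x d else \<zero>)"
  by (rule comp_G[OF comp_props(1)])

text \<open>An arbitrary multiplier is split into homogeneous ones by \<open>hom_induct\<close>, and
  each shifts the components of \<open>x\<close>; so it is enough to control products of homogeneous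
  elements.\<close>

lemma comp_core_ideal:
  assumes Q: "additive_subgroup Q R" and mult: "\<And>d x y. y \<in> Hom \<Longrightarrow> x \<in> Q \<Longrightarrow> x \<in> Hom \<Longrightarrow> x \<otimes> y \<in> Q"
  shows "ideal (comp_core Q) R"
proof -
  have z: "\<zero> \<in> Q" using additive_subgroup.zero_closed[OF Q] .
  have r: "x \<otimes> y \<in> comp_core Q" if y: "y \<in> carrier R" and x: "x \<in> comp_core Q" for x y
    using y
  proof (induction y rule: hom_induct)
    case (hom e y)
    have xc: "x \<in> carrier R" using x by (simp add: comp_core_def)
    have "comp (x \<otimes> y) d \<in> Q" for d
    proof -
      have "comp x (d - e) \<otimes> y \<in> Q"
        using mult[OF G_Hom[OF hom]] x G_Hom[OF comp_props(1)[OF xc]] unfolding comp_core_def by blast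
      then show ?thesis using comp_mult_hom[OF xc hom] z by simp
    qed
    then show ?case using xc G_carrier[OF hom] by (simp add: comp_core_def)
  next
    case (add u v)
    then show ?case using x additive_subgroup.a_closed[OF Q]
      by (auto simp: comp_core_def r_distr comp_add)
  qed
  show ?thesis
  proof (rule idealI[OF ring_axioms])
    show "subgroup (comp_core Q) (add_monoid R)"
      using z additive_subgroup.a_closed[OF Q] additive_subgroup.a_inv_closed[OF Q]
      by (intro subgroup.intro) (auto simp: comp_core_def comp_add comp_minus simp flip: a_inv_def)
    fix a y assume a: "a \<in> comp_core Q" and y: "y \<in> carrier R"
    show "a \<otimes> y \<in> comp_core Q" using r[OF y a] .
    moreover have "a \<in> carrier R" using a by (simp add: comp_core_def)
    ultimately show "y \<otimes> a \<in> comp_core Q" using y by (simp add: m_comm)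
  qed
qed

lemma comp_core_of_ideal: "ideal I R \<Longrightarrow> ideal (comp_core I) R"
  by (rule comp_core_ideal) (auto simp: ideal.axioms(1) Hom_carrier ideal.I_r_closed)

text \<open>The core of \<open>I\<close> is an ideal containing the homogeneous elements of
  \<open>I\<close>; if these generate \<open>I\<close>, the core is all of \<open>I\<close>.\<close>

lemma homogeneous_ideal_iff:
  "homogeneous_ideal R G I \<longleftrightarrow> ideal I R \<and> (\<forall>x\<in>I. \<forall>d. comp x d \<in> I)"
proof
  assume "homogeneous_ideal R G I"
  then have I: "ideal I R" and eq: "Idl (I \<inter> Hom) = I" by (auto simp: homogeneous_ideal_def Hom_def)
  have "I \<inter> Hom \<subseteq> comp_core I"
  proof
    fix x assume "x \<in> I \<inter> Hom"
    then obtain d where x: "x \<in> I" "x \<in> G d" by (auto simp: Hom_def)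
    then show "x \<in> comp_core I"
      using comp_G[OF x(2)] G_carrier[OF x(2)] additive_subgroup.zero_closed[OF ideal.axioms(1)[OF I]]
      by (simp add: comp_core_def)
  qed
  then have "Idl (I \<inter> Hom) \<subseteq> comp_core I" by (rule genideal_minimal[OF comp_core_of_ideal[OF I]])
  then show "ideal I R \<and> (\<forall>x\<in>I. \<forall>d. comp x d \<in> I)" using I eq by (auto simp: comp_core_def)
next
  assume *: "ideal I R \<and> (\<forall>x\<in>I. \<forall>d. comp x d \<in> I)"
  then have I: "ideal I R" by simp
  have sub: "I \<inter> Hom \<subseteq> carrier R" using Hom_carrier by auto
  have "x \<in> Idl (I \<inter> Hom)" if x: "x \<in> I" for x
  proof (rule mem_of_comps[OF ideal.axioms(1)[OF genideal_ideal[OF sub]]])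
    show xc: "x \<in> carrier R" using ideal.Icarr[OF I x] .
    show "comp x d \<in> Idl (I \<inter> Hom)" for d
      using * x G_Hom[OF comp_props(1)[OF xc]] genideal_self[OF sub] by blast
  qed
  moreover have "Idl (I \<inter> Hom) \<subseteq> I" by (rule genideal_minimal[OF I]) auto
  ultimately show "homogeneous_ideal R G I"
    using I unfolding homogeneous_ideal_def Hom_def by blast
qed

lemma comp_core_homogeneous: "ideal (comp_core Q) R \<Longrightarrow> additive_subgroup Q R \<Longrightarrow> homogeneous_ideal R G (comp_core Q)"
  unfolding homogeneous_ideal_iff
  using comp_comp additive_subgroup.zero_closed by (fastforce simp: comp_core_def)

lemma comp_core_subset: "additive_subgroup Q R \<Longrightarrow> comp_core Q \<subseteq> Q"
  using mem_of_comps by (auto simp: comp_core_def)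

lemma comp_core_Hom: "additive_subgroup Q R \<Longrightarrow> x \<in> Hom \<Longrightarrow> x \<in> comp_core Q \<longleftrightarrow> x \<in> Q"
proof -
  assume Q: "additive_subgroup Q R" and "x \<in> Hom"
  then obtain d where x: "x \<in> G d" by (auto simp: Hom_def)
  have "(\<forall>e. comp x e \<in> Q) \<longleftrightarrow> x \<in> Q"
    using additive_subgroup.zero_closed[OF Q] by (simp add: comp_G[OF x])
  then show ?thesis using G_carrier[OF x] by (simp add: comp_core_def)
qed

lemma comp_core_mono: "homogeneous_ideal R G I \<Longrightarrow> I \<subseteq> Q \<Longrightarrow> I \<subseteq> comp_core Q"
  unfolding homogeneous_ideal_iff comp_core_def using ideal.Icarr[of I R] by (auto simp: subset_iff)

text \<open>For \<open>f\<close> and \<open>g\<close> outside \<open>I\<close>, take their last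
  components outside \<open>I\<close>; by \<open>top_comp\<close> the product of these two
  components lies in \<open>I\<close>, against primality on homogeneous elements.\<close>

lemma homogeneous_prime:
  assumes I: "homogeneous_ideal R G I" and one: "\<one> \<notin> I"
    and prime: "\<And>a b. a \<in> Hom \<Longrightarrow> b \<in> Hom \<Longrightarrow> a \<otimes> b \<in> I \<Longrightarrow> a \<in> I \<or> b \<in> I"
  shows "primeideal I R"
proof (rule primeidealI)
  show id: "ideal I R" using I by (simp add: homogeneous_ideal_iff)
  have comps: "\<And>x d. x \<in> I \<Longrightarrow> comp x d \<in> I" using I by (simp add: homogeneous_ideal_iff)
  have add: "additive_subgroup I R" using id ideal.axioms(1) by auto
  show "cring R" by (rule is_cring)
  show "carrier R \<noteq> I" using one by auto
  have max: "\<exists>i0. comp f i0 \<notin> I \<and> (\<forall>i>i0. comp f i \<in> I)" if f: "f \<in> carrier R" "f \<notin> I" for f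
  proof -
    let ?A = "{i. comp f i \<notin> I}"
    have "?A \<noteq> {}" using mem_of_comps[OF add f(1)] f(2) by auto
    moreover have "?A \<subseteq> {i. comp f i \<noteq> \<zero>}" using additive_subgroup.zero_closed[OF add] by auto
    then have fin: "finite ?A" using comp_props(2)[OF f(1)] finite_subset by auto
    ultimately have "Max ?A \<in> ?A" by (intro Max_in)
    moreover have "comp f i \<in> I" if "i > Max ?A" for i
      using Max_ge[OF fin, of i] that by auto
    ultimately show ?thesis by blast
  qed
  fix f g assume f: "f \<in> carrier R" and g: "g \<in> carrier R" and fg: "f \<otimes> g \<in> I"
  show "f \<in> I \<or> g \<in> I"
  proof (rule ccontr)
    assume "\<not> (f \<in> I \<or> g \<in> I)"
    then obtain i0 j0 where i0: "comp f i0 \<notin> I" "\<And>i. i > i0 \<Longrightarrow> comp f i \<in> I"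
      and j0: "comp g j0 \<notin> I" "\<And>j. j > j0 \<Longrightarrow> comp g j \<in> I" using max f g by metis
    have "comp f i \<otimes> comp g j \<in> I" if "i > i0 \<or> j > j0" for i j
      using that ideal.I_l_closed[OF id j0(2), of j "comp f i"]
        ideal.I_r_closed[OF id i0(2), of i "comp g j"] f g by auto
    then have "comp f i0 \<otimes> comp g j0 \<in> I" using top_comp[OF add f g _ comps[OF fg]] by blast
    then show False using prime G_Hom[OF comp_props(1)] f g i0(1) j0(1) by metis
  qed
qed

lemma comp_core_prime:
  assumes "primeideal Q R" shows "primeideal (comp_core Q) R" "homogeneous_ideal R G (comp_core Q)"
proof -
  interpret Q: primeideal Q R by fact
  show hom: "homogeneous_ideal R G (comp_core Q)"
    using comp_core_homogeneous[OF comp_core_of_ideal[OF Q.is_ideal]] Q.additive_subgroup_axioms by blast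
  show "primeideal (comp_core Q) R"
  proof (rule homogeneous_prime[OF hom])
    show "\<one> \<notin> comp_core Q"
      using comp_core_subset[OF Q.additive_subgroup_axioms] Q.one_imp_carrier Q.I_notcarr by auto
    fix a b assume ab: "a \<in> Hom" "b \<in> Hom" "a \<otimes> b \<in> comp_core Q"
    then have "a \<otimes> b \<in> Q" using comp_core_subset[OF Q.additive_subgroup_axioms] by auto
    then have "a \<in> Q \<or> b \<in> Q" using Q.I_prime[OF Hom_carrier[OF ab(1)] Hom_carrier[OF ab(2)]] by simp
    then show "a \<in> comp_core Q \<or> b \<in> comp_core Q"
      using comp_core_Hom[OF Q.additive_subgroup_axioms] ab by simp
  qed
qed

text \<open>The core of \<open>P\<close> is a prime between \<open>I\<close> and
  \<open>P\<close>.\<close>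

lemma minimal_prime_homogeneous:
  assumes "homogeneous_ideal R G I" "minimal_prime R I P"
  shows "homogeneous_ideal R G P"
proof -
  have P: "primeideal P R" and "I \<subseteq> P"
    and min: "\<And>Q. primeideal Q R \<Longrightarrow> I \<subseteq> Q \<Longrightarrow> Q \<subseteq> P \<Longrightarrow> Q = P"
    using assms(2) by (auto simp: minimal_prime_def)
  have "additive_subgroup P R" using P by (simp add: primeideal_def ideal_def)
  then have "comp_core P = P"
    using min[OF comp_core_prime(1)[OF P]] comp_core_mono[OF assms(1) \<open>I \<subseteq> P\<close>] comp_core_subset by blast
  then show ?thesis using comp_core_prime(2)[OF P] by simp
qed

lemma PIdl_homogeneous:
  assumes "h \<in> G e" shows "homogeneous_ideal R G (PIdl h)"
  unfolding homogeneous_ideal_iff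
proof (intro conjI ballI allI)
  have h: "h \<in> carrier R" using G_carrier[OF assms] .
  show "ideal (PIdl h) R" using cgenideal_ideal[OF h] .
  fix y d assume "y \<in> PIdl h"
  then obtain x where x: "x \<in> carrier R" "y = x \<otimes> h" by (auto simp: PIdl_iff)
  have "\<zero> \<in> PIdl h" using PIdl_mult_left[OF h zero_closed] h by simp
  then show "comp y d \<in> PIdl h" unfolding x comp_mult_hom[OF x(1) assms] using x h
    by (simp add: PIdl_mult_left)
qed

text \<open>The right-hand side is an ideal because in degree zero the convolution has a single
  summand.\<close>

lemma irrelevant_ideal_eq: "irrelevant_ideal R G = {x \<in> carrier R. comp x 0 = \<zero>}"
proof
  let ?M = "{x \<in> carrier R. comp x 0 = \<zero>}"
  let ?X = "\<Union>d\<in>{1..}. G d"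
  have X: "?X \<subseteq> carrier R" using G_carrier by auto
  have mult: "comp (x \<otimes> y) 0 = \<zero>" if "x \<in> ?M" "y \<in> carrier R" for x y
  proof -
    have x: "x \<in> carrier R" "comp x 0 = \<zero>" using that by auto
    have "comp (x \<otimes> y) 0 = comp x 0 \<otimes> comp y 0"
      using convolution[OF x(1) that(2), of 0] x that(2) by simp
    then show ?thesis using x that(2) by simp
  qed
  have id: "ideal ?M R"
  proof (rule idealI[OF ring_axioms])
    show "subgroup ?M (add_monoid R)"
      by (intro subgroup.intro) (auto simp: comp_add comp_minus simp flip: a_inv_def)
  qed (use mult in \<open>auto simp: m_comm\<close>)
  have "?X \<subseteq> ?M" using comp_G X by fastforce
  then show "irrelevant_ideal R G \<subseteq> ?M"
    unfolding irrelevant_ideal_def by (rule genideal_minimal[OF id])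
  show "?M \<subseteq> irrelevant_ideal R G"
  proof
    fix x assume x: "x \<in> ?M"
    have add: "additive_subgroup (Idl ?X) R" using ideal.axioms(1)[OF genideal_ideal[OF X]] .
    have "comp x d \<in> Idl ?X" for d
    proof (cases "d = 0")
      case True then show ?thesis using x additive_subgroup.zero_closed[OF add] by simp
    next
      case False
      then have "comp x d \<in> ?X" using comp_props(1) x by fastforce
      then show ?thesis using genideal_self[OF X] by blast
    qed
    then show "x \<in> irrelevant_ideal R G"
      unfolding irrelevant_ideal_def using mem_of_comps[OF add] x by blast
  qed
qed

end

section \<open>Affine ideals in noetherian domains\<close>

text \<open>Combined with \<open>colon_ideal\<close>, this allows an identity of fractions with
  denominator \<open>c\<close> to be checked on generators and then divided by
  \<open>c\<close>.\<close>

lemma (in cring) ideal_mult_elem: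
  assumes J: "ideal J R" and c: "c \<in> carrier R"
  shows "ideal ((\<lambda>b. b \<otimes> c) ` J) R"
proof (rule idealI[OF ring_axioms])
  interpret J: ideal J R by fact
  show "subgroup ((\<lambda>b. b \<otimes> c) ` J) (add_monoid R)"
  proof (rule subgroup.intro)
    show "(\<lambda>b. b \<otimes> c) ` J \<subseteq> carrier (add_monoid R)" using J.Icarr c by auto
    show "\<one>\<^bsub>add_monoid R\<^esub> \<in> (\<lambda>b. b \<otimes> c) ` J"
      using J.zero_closed c by (auto intro!: image_eqI[of _ _ \<zero>])
    fix x assume "x \<in> (\<lambda>b. b \<otimes> c) ` J"
    then obtain a where a: "a \<in> J" "x = a \<otimes> c" by auto
    have ac: "a \<in> carrier R" using J.Icarr[OF a(1)] .
    have "\<ominus> x = (\<ominus> a) \<otimes> c" unfolding a(2) using ac c by (simp add: l_minus)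
    then have "\<ominus> x \<in> (\<lambda>b. b \<otimes> c) ` J" using J.a_inv_closed[OF a(1)] by (rule image_eqI)
    then show "inv\<^bsub>add_monoid R\<^esub> x \<in> (\<lambda>b. b \<otimes> c) ` J" by (simp flip: a_inv_def)
    fix y assume "y \<in> (\<lambda>b. b \<otimes> c) ` J"
    then obtain b where b: "b \<in> J" "y = b \<otimes> c" by auto
    have "x \<oplus> y = (a \<oplus> b) \<otimes> c" unfolding a(2) b(2) using ac J.Icarr[OF b(1)] c by (simp add: l_distr)
    then show "x \<otimes>\<^bsub>add_monoid R\<^esub> y \<in> (\<lambda>b. b \<otimes> c) ` J"
      using J.a_closed[OF a(1) b(1)] by simp
  qed
  fix x y assume "x \<in> (\<lambda>b. b \<otimes> c) ` J" and y: "y \<in> carrier R"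
  then obtain a where a: "a \<in> J" "x = a \<otimes> c" by auto
  have "y \<otimes> x = (y \<otimes> a) \<otimes> c" "x \<otimes> y = (y \<otimes> a) \<otimes> c"
    unfolding a(2) using y J.Icarr[OF a(1)] c by (simp_all add: m_ac)
  then show "y \<otimes> x \<in> (\<lambda>b. b \<otimes> c) ` J" "x \<otimes> y \<in> (\<lambda>b. b \<otimes> c) ` J"
    using J.I_l_closed[OF a(1) y] by auto
qed

context noeth_domain
begin

text \<open>Finite generation is used twice: of \<open>I\<close>, to get one exponent for all
  \<open>z\<close> with \<open>y\<close> fixed, and of the transform, to get one for all
  \<open>y\<close>.\<close>

lemma transform_uniform:
  assumes I: "ideal I R" and c: "c \<in> carrier R"
  shows "\<exists>m::nat. \<forall>y\<in>transform R I c. \<forall>z\<in>I. z [^] m \<otimes> y \<in> PIdl c"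
proof -
  have Ic: "I \<subseteq> carrier R" using ideal.Icarr[OF I] by auto
  have PI: "ideal (PIdl c) R" using cgenideal_ideal[OF c] .
  obtain A where A: "A \<subseteq> carrier R" "finite A" "I = Idl A" using finitely_generated[OF I] by auto
  obtain B where B: "B \<subseteq> carrier R" "finite B" "transform R I c = Idl B"
    using finitely_generated[OF transform_ideal[OF Ic c]] by auto
  have BT: "y \<in> transform R I c" if "y \<in> B" for y using that B genideal_self[OF B(1)] by auto
  have "\<exists>m::nat. \<forall>z\<in>I. z [^] m \<otimes> y \<in> PIdl c" if y: "y \<in> B" for y
  proof -
    have yc: "y \<in> carrier R" using y B by auto
    let ?K = "{a \<in> carrier R. a \<otimes> y \<in> PIdl c}"
    have K: "ideal ?K R" by (rule colon_ideal[OF PI yc])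
    have "\<exists>n::nat. z [^] n \<in> ?K" if z: "z \<in> A" for z
      using transformD[OF BT[OF y], of z] z A genideal_self[OF A(1)] by auto
    then have "\<exists>n::nat. \<forall>z\<in>Idl A. z [^] n \<in> ?K" by (rule finite_genideal_pow[OF A(2,1) K])
    then show ?thesis using A(3) by auto
  qed
  then obtain m where m: "\<And>y z. y \<in> B \<Longrightarrow> z \<in> I \<Longrightarrow> z [^] (m y :: nat) \<otimes> y \<in> PIdl c" by metis
  let ?n = "Max (insert 0 (m ` B))"
  let ?L = "{y \<in> carrier R. \<forall>z\<in>I. y \<otimes> z [^] ?n \<in> PIdl c}"
  have "B \<subseteq> ?L"
  proof
    fix y assume y: "y \<in> B"
    have yc: "y \<in> carrier R" using y B by auto
    have "y \<otimes> z [^] ?n \<in> PIdl c" if z: "z \<in> I" for z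
    proof -
      have zc: "z \<in> carrier R" using z Ic by auto
      have "m y \<le> ?n" using y B(2) by (intro Max_ge) auto
      moreover have "z [^] m y \<in> {a \<in> carrier R. a \<otimes> y \<in> PIdl c}" using m[OF y z] zc by simp
      ultimately have "z [^] ?n \<in> {a \<in> carrier R. a \<otimes> y \<in> PIdl c}"
        using pow_mem_mono[OF colon_ideal[OF PI yc] zc] by blast
      then show ?thesis using yc zc by (simp add: m_comm)
    qed
    then show "y \<in> ?L" using yc by blast
  qed
  moreover have "ideal ?L R" using PI Ic by (intro Inter_colon_ideal) auto
  ultimately have sub: "transform R I c \<subseteq> ?L" unfolding B(3) by (intro genideal_minimal)
  have "z [^] ?n \<otimes> y \<in> PIdl c" if "y \<in> transform R I c" "z \<in> I" for y z
  proof -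
    have "z \<in> carrier R" using that Ic by auto
    moreover have "y \<in> carrier R" "y \<otimes> z [^] ?n \<in> PIdl c" using sub that by auto
    ultimately show ?thesis by (simp add: m_comm)
  qed
  then show ?thesis by blast
qed

text \<open>The denominator \<open>c\<close> of the criterion can be traded for a power of any
  nonzero \<open>h\<close> in \<open>I\<close>: with the uniform exponent \<open>n\<close>, each
  \<open>y / c\<close> becomes \<open>w / h^n\<close> where \<open>w = h^n y / c\<close> lies in
  \<open>R\<close>, and the bound on the exponents of the elements of \<open>I\<close>
  survives.\<close>

lemma affine_ideal_power:
  assumes I: "ideal I R" and aff: "affine_ideal R I" and h: "h \<in> I" "h \<noteq> \<zero>"
  shows "\<exists>m. h [^] Suc m \<in> Idl {z \<otimes> w | z w. z \<in> I \<and> w \<in> carrier R \<and>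
    (\<forall>z'\<in>I. z' [^] Suc m \<otimes> w \<in> PIdl (h [^] Suc m))}"
proof -
  have Ic: "\<And>z. z \<in> I \<Longrightarrow> z \<in> carrier R" using ideal.Icarr[OF I] by auto
  obtain c where c: "c \<in> carrier R" "c \<noteq> \<zero>"
    "c \<in> Idl {x \<otimes> y | x y. x \<in> I \<and> y \<in> transform R I c}"
    using aff by (auto simp: affine_ideal_def)
  obtain m :: nat where m: "\<And>y z. y \<in> transform R I c \<Longrightarrow> z \<in> I \<Longrightarrow> z [^] m \<otimes> y \<in> PIdl c"
    using transform_uniform[OF I c(1)] by blast
  \<comment> \<open>A positive exponent, since \<open>nonhomogeneous_prime_affine\<close> later
    cancels one factor \<open>h\<close>.\<close>
  define n where "n = Suc m"
  have n: "z [^] n \<otimes> y \<in> PIdl c" if y: "y \<in> transform R I c" and z: "z \<in> I" for y z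
  proof -
    have cc: "z \<in> carrier R" "y \<in> carrier R" using Ic[OF z] transform_carrier[OF y] by auto
    have "z [^] n \<otimes> y = z \<otimes> (z [^] m \<otimes> y)" unfolding n_def using cc by (simp add: m_ac)
    then show ?thesis using PIdl_mult[OF c(1) m[OF y z] cc(1)] by simp
  qed
  define W where "W = {w \<in> carrier R. \<forall>z'\<in>I. z' [^] n \<otimes> w \<in> PIdl (h [^] n)}"
  define X where "X = {z \<otimes> w | z w. z \<in> I \<and> w \<in> W}"
  have hc: "h \<in> carrier R" using Ic h by simp
  have hn: "h [^] n \<in> carrier R" "h [^] n \<noteq> \<zero>" using hc h pow_nonzero by auto
  have X: "X \<subseteq> carrier R" unfolding X_def W_def using Ic by auto
  have idX: "ideal (Idl X) R" using genideal_ideal[OF X] .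
  \<comment> \<open>Expresses that \<open>a h^n / c\<close> lies in the ideal generated by
    \<open>X\<close>. This holds for the generators of the ideal containing \<open>c\<close>, hence
    for \<open>c\<close> itself, and then \<open>c\<close> cancels.\<close>
  let ?K = "{a \<in> carrier R. a \<otimes> h [^] n \<in> (\<lambda>b. b \<otimes> c) ` (Idl X)}"
  have K: "ideal ?K R" using ideal_mult_elem[OF idX c(1)] hn by (intro colon_ideal) auto
  have "{x \<otimes> y | x y. x \<in> I \<and> y \<in> transform R I c} \<subseteq> ?K"
  proof clarify
    fix z y assume z: "z \<in> I" and y: "y \<in> transform R I c"
    have cc: "z \<in> carrier R" "y \<in> carrier R" using Ic[OF z] transform_carrier[OF y] by auto
    obtain w where w: "w \<in> carrier R" "h [^] n \<otimes> y = w \<otimes> c"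
      using n[OF y h(1)] by (auto simp: PIdl_iff)
    have "z' [^] n \<otimes> w \<in> PIdl (h [^] n)" if z': "z' \<in> I" for z'
    proof -
      obtain v where v: "v \<in> carrier R" "z' [^] n \<otimes> y = v \<otimes> c" using n[OF y z'] by (auto simp: PIdl_iff)
      have zc: "z' [^] n \<in> carrier R" using Ic[OF z'] by simp
      have "c \<otimes> (z' [^] n \<otimes> w) = z' [^] n \<otimes> (w \<otimes> c)" using zc w c(1) by (simp add: m_ac)
      also have "\<dots> = h [^] n \<otimes> (z' [^] n \<otimes> y)" unfolding w(2)[symmetric] using zc hn cc by (simp add: m_ac)
      also have "\<dots> = c \<otimes> (v \<otimes> h [^] n)" unfolding v(2) using v(1) hn c(1) by (simp add: m_ac)
      finally have "z' [^] n \<otimes> w = v \<otimes> h [^] n"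
        by (rule cancel_left) (use c zc w v hn in auto)
      then show ?thesis using PIdl_mult_left[OF hn(1) v(1)] by simp
    qed
    then have "w \<in> W" unfolding W_def using w(1) by simp
    then have "z \<otimes> w \<in> X" unfolding X_def using z by blast
    then have "z \<otimes> w \<in> Idl X" using genideal_self[OF X] by auto
    moreover have "z \<otimes> y \<otimes> h [^] n = (z \<otimes> w) \<otimes> c"
    proof -
      have "z \<otimes> y \<otimes> h [^] n = z \<otimes> (h [^] n \<otimes> y)" using cc hn by (simp add: m_ac)
      also have "\<dots> = (z \<otimes> w) \<otimes> c" unfolding w(2) using cc w(1) c(1) by (simp add: m_ac)
      finally show ?thesis .
    qed
    ultimately show "z \<otimes> y \<in> carrier R \<and> z \<otimes> y \<otimes> h [^] n \<in> (\<lambda>b. b \<otimes> c) ` (Idl X)" using cc by simp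
  qed
  then have "c \<in> ?K" by (rule subsetD[OF genideal_minimal[OF K] c(3)])
  then obtain b where b: "b \<in> Idl X" "c \<otimes> h [^] n = b \<otimes> c" by auto
  have bc: "b \<in> carrier R" using ideal.Icarr[OF idX b(1)] .
  have "c \<otimes> h [^] n = c \<otimes> b" unfolding b(2) using bc c(1) by (simp add: m_comm)
  then have "h [^] n = b" by (rule cancel_left) (use c hn bc in auto)
  then have "h [^] n \<in> Idl X" using b(1) by simp
  then show ?thesis unfolding X_def W_def n_def by (intro exI[of _ m]) simp
qed

end

section \<open>Primes without homogeneous elements\<close>

locale graded_noeth_domain = graded_ring R G + noeth_domain R for R (structure) and G

context graded_noeth_domain
begin

text \<open>The content of the family at \<open>P\<close>: \<open>k\<close> is the least order of
  its members, and \<open>i0\<close> the last index at which it is attained.\<close>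

lemma (in dvr_prime) order_of_family:
  assumes fin: "finite {i::nat. f i \<noteq> \<zero>}" and car: "\<And>i. f i \<in> carrier R" and ne: "f i1 \<noteq> \<zero>"
  shows "\<exists>k i0. (\<forall>i. f i \<in> V k) \<and> f i0 \<notin> V (Suc k) \<and> (\<forall>i>i0. f i \<in> V (Suc k))"
proof -
  define k where "k = (LEAST k. \<exists>i. f i \<notin> V (Suc k))"
  have "\<exists>k i. f i \<notin> V (Suc k)" using V_separated[OF car ne] by blast
  then have "\<exists>i. f i \<notin> V (Suc k)" unfolding k_def by (rule LeastI_ex)
  have all: "f i \<in> V k" for i
  proof (cases k)
    case 0 then show ?thesis using car V_0 by simp
  next
    case (Suc l)
    then have "l < (LEAST k. \<exists>i. f i \<notin> V (Suc k))" unfolding k_def by simp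
    then have "\<not> (\<exists>i. f i \<notin> V (Suc l))" by (rule not_less_Least)
    then show ?thesis using Suc by simp
  qed
  let ?A = "{i. f i \<notin> V (Suc k)}"
  have "\<zero> \<in> V (Suc k)" using additive_subgroup.zero_closed[OF ideal.axioms(1)[OF V_ideal]] .
  then have "?A \<subseteq> {i. f i \<noteq> \<zero>}" by auto
  then have finA: "finite ?A" using fin finite_subset by auto
  have "Max ?A \<in> ?A" using finA \<open>\<exists>i. f i \<notin> V (Suc k)\<close> by (intro Max_in) auto
  moreover have "f i \<in> V (Suc k)" if "i > Max ?A" for i using Max_ge[OF finA, of i] that by auto
  ultimately show ?thesis using all by blast
qed

text \<open>If some \<open>f_i g_j\<close> were not divisible by \<open>h\<close>, a minimal prime
  \<open>P\<close> of \<open>(h : f_i g_j)\<close> would be a valuation prime. The contents of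
  \<open>f\<close> and \<open>g\<close> at \<open>P\<close> add up to at least the order of
  \<open>h\<close>, so an element outside \<open>P\<close> carries \<open>f_i g_j\<close> into
  \<open>(h)\<close>, against the choice of \<open>P\<close>.\<close>

lemma gauss_lemma:
  assumes closed: "power_bounded_closed R" and h: "h \<in> G e" "h \<noteq> \<zero>"
    and f: "f \<in> carrier R" and g: "g \<in> carrier R" and fg: "f \<otimes> g \<in> PIdl h"
  shows "comp f i \<otimes> comp g j \<in> PIdl h"
proof (rule ccontr)
  let ?b = "comp f i \<otimes> comp g j"
  assume neg: "?b \<notin> PIdl h"
  have hc: "h \<in> carrier R" and bc: "?b \<in> carrier R" using G_carrier[OF h(1)] f g by auto
  have zh: "\<zero> \<in> PIdl h" using PIdl_mult_left[OF hc zero_closed] hc by simp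
  have id: "ideal (colon R h ?b) R" using colon_is_ideal[OF hc bc] .
  have "\<one> \<notin> colon R h ?b" using neg bc by (simp add: colon_def)
  then obtain Q where "primeideal Q R" "colon R h ?b \<subseteq> Q" using proper_ideal_prime[OF id] by blast
  then obtain P where P: "minimal_prime R (colon R h ?b) P" using minimal_prime_exists[OF id] by blast
  then obtain c x u where c: "c \<in> carrier R" and P_eq: "P = colon R h (c \<otimes> ?b)" and "dvr_prime P R x u"
    using minimal_prime_colon_dvr[OF closed hc h(2) bc P] by blast
  then interpret D: dvr_prime P R x u by simp
  have nz: "comp f i \<noteq> \<zero>" "comp g j \<noteq> \<zero>" using neg zh f g by auto
  obtain k i0 where k: "\<And>i. comp f i \<in> D.V k" "comp f i0 \<notin> D.V (Suc k)"
      "\<And>i. i > i0 \<Longrightarrow> comp f i \<in> D.V (Suc k)"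
    using D.order_of_family[OF comp_props(2)[OF f] _ nz(1)] f by auto
  obtain l j0 where l: "\<And>i. comp g i \<in> D.V l" "comp g j0 \<notin> D.V (Suc l)"
      "\<And>i. i > j0 \<Longrightarrow> comp g i \<in> D.V (Suc l)"
    using D.order_of_family[OF comp_props(2)[OF g] _ nz(2)] g by auto
  obtain n where n: "h \<in> D.V n" "h \<notin> D.V (Suc n)" using D.V_separated[OF hc h(2)] by blast
  \<comment> \<open>If the order \<open>n\<close> of \<open>h\<close> exceeded \<open>k + l\<close>,
    all components of \<open>f g\<close>, which lie in the homogeneous ideal \<open>(h)\<close>,
    would have order above \<open>k + l\<close>. The leading-term argument passes this on to
    \<open>f_i0 g_j0\<close>, whose order is exactly \<open>k + l\<close>.\<close>
  have "n \<le> k + l"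
  proof (rule ccontr)
    assume "\<not> n \<le> k + l"
    then have sub: "D.V n \<subseteq> D.V (Suc (k + l))" by (intro D.V_mono) simp
    have "comp (f \<otimes> g) (i0 + j0) \<in> PIdl h"
      using PIdl_homogeneous[OF h(1)] fg by (simp add: homogeneous_ideal_iff)
    then have 1: "comp (f \<otimes> g) (i0 + j0) \<in> D.V (Suc (k + l))"
      using sub cgenideal_minimal[OF D.V_ideal n(1)] by blast
    have "comp f i \<otimes> comp g j \<in> D.V (Suc (k + l))" if "i > i0 \<or> j > j0" for i j
      using that D.V_mult[OF k(3) l(1), of i j] D.V_mult[OF k(1) l(3), of j i] by auto
    then have "comp f i0 \<otimes> comp g j0 \<in> D.V (Suc (k + l))"
      using top_comp[OF ideal.axioms(1)[OF D.V_ideal] f g _ 1] by blast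
    then show False using D.V_mult_exact[OF k(1,2) l(1,2)] by simp
  qed
  then have "?b \<in> D.V n" using D.V_mult[OF k(1) l(1)] D.V_mono by blast
  then obtain s y where s: "s \<in> carrier R - P" "y \<in> carrier R" "s \<otimes> ?b = y \<otimes> x [^] n"
    by (auto simp: D.V_def PIdl_iff)
  obtain r t where r: "r \<in> carrier R - P" "t \<in> carrier R - P" "r \<otimes> h = t \<otimes> x [^] n"
    using D.V_exact[OF n] by blast
  have cc: "s \<in> carrier R" "r \<in> carrier R" "t \<in> carrier R" "x [^] n \<in> carrier R" "c \<in> carrier R"
    using s r c D.x_car by auto
  \<comment> \<open>The power \<open>x^n\<close> is eliminated between \<open>s b = y x^n\<close>
    and \<open>r h = t x^n\<close>, which puts \<open>t s\<close> into the colon ideal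
    \<open>P\<close> although both factors are outside.\<close>
  have "(t \<otimes> s) \<otimes> (c \<otimes> ?b) = c \<otimes> (t \<otimes> (s \<otimes> ?b))" using cc bc by (simp add: m_ac)
  also have "\<dots> = (c \<otimes> y) \<otimes> (t \<otimes> x [^] n)" unfolding s(3) using cc s(2) by (simp add: m_ac)
  also have "\<dots> = (c \<otimes> y \<otimes> r) \<otimes> h" unfolding r(3)[symmetric] using cc s(2) hc by (simp add: m_ac)
  also have "\<dots> \<in> PIdl h" using cc s(2) by (intro PIdl_mult_left[OF hc]) simp
  finally have "t \<otimes> s \<in> colon R h (c \<otimes> ?b)"
    unfolding colon_def using m_closed[OF cc(3,1)] by (intro CollectI conjI)
  then have "t \<otimes> s \<in> P" unfolding P_eq[symmetric] .
  then show False using D.prime_mult[of t s] s(1) r(2) by blast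
qed

lemma PIdl_of_comps:
  assumes "h \<in> carrier R" "f \<in> carrier R" "y \<in> carrier R" "\<And>j. y \<otimes> comp f j \<in> PIdl h"
  shows "y \<otimes> f \<in> PIdl h"
proof -
  have "f \<in> {a \<in> carrier R. a \<otimes> y \<in> PIdl h}"
  proof (rule mem_of_comps[OF ideal.axioms(1)[OF colon_ideal[OF cgenideal_ideal]]])
    show "comp f j \<in> {a \<in> carrier R. a \<otimes> y \<in> PIdl h}" for j
      using assms(4)[of j] m_comm[of y "comp f j"] assms(2,3) by simp
  qed (use assms in auto)
  then show ?thesis using m_comm[of y f] assms(2,3) by simp
qed

text \<open>\<open>n\<close> is the width of a window containing the support. Zero fits into every
  window, so a width below the minimum for nonzero elements of \<open>P\<close> forces zero.\<close>

definition supp_in :: "'a \<Rightarrow> nat \<Rightarrow> nat \<Rightarrow> bool" where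
  "supp_in x a n \<longleftrightarrow> (\<forall>d. comp x d \<noteq> \<zero> \<longrightarrow> a \<le> d \<and> d \<le> a + n)"

text \<open>Pseudo-division by an \<open>f\<close> of least width in \<open>P\<close> gives, for
  each \<open>x\<close> in \<open>P\<close>, a homogeneous \<open>h \<noteq> 0\<close> with
  \<open>h x = f g\<close>. By Gauss \<open>h\<close> divides every \<open>f_j g_i\<close>, hence
  \<open>f_j g\<close>, and cancelling \<open>h\<close> in \<open>h x f_j = f (f_j g)\<close> gives
  the divisibility by \<open>f\<close>.\<close>

lemma nonhomogeneous_prime_generator:
  assumes closed: "power_bounded_closed R" and P: "primeideal P R" and nz: "P \<noteq> {\<zero>}"
    and PH: "P \<inter> Hom \<subseteq> {\<zero>}"
  shows "\<exists>f\<in>P. f \<noteq> \<zero> \<and> (\<forall>x\<in>P. \<forall>j. x \<otimes> comp f j \<in> PIdl f)"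
proof -
  interpret P: primeideal P R by fact
  let ?ex = "\<lambda>n. \<exists>f\<in>P. f \<noteq> \<zero> \<and> (\<exists>a. supp_in f a n)"
  have bounded: "\<exists>n. supp_in x 0 n" if x: "x \<in> carrier R" for x
  proof -
    have "supp_in x 0 (Max (insert 0 {d. comp x d \<noteq> \<zero>}))"
      unfolding supp_in_def using comp_props(2)[OF x] by (auto intro!: Max_ge)
    then show ?thesis by blast
  qed
  obtain f0 where "f0 \<in> P" "f0 \<noteq> \<zero>" using nz P.zero_closed by blast
  then have "\<exists>n. ?ex n" using bounded[OF P.Icarr] by blast
  then have "?ex (LEAST n. ?ex n)" by (rule LeastI_ex)
  then obtain w f u where f: "f \<in> P" "f \<noteq> \<zero>" "supp_in f u w" and w: "w = (LEAST n. ?ex n)" by blast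
  have least: "x = \<zero>" if "x \<in> P" "supp_in x a n" "n < w" for x a n
    using not_less_Least[of n ?ex] that unfolding w by blast
  have fc: "f \<in> carrier R" using P.Icarr[OF f(1)] .
  let ?s = "comp f (u + w)"
  have sG: "?s \<in> G (u + w)" and sc: "?s \<in> carrier R" using comp_props(1)[OF fc] fc by auto
  \<comment> \<open>The last place of the window is occupied, as otherwise a narrower window would
    contain the support of \<open>f\<close>.\<close>
  have s0: "?s \<noteq> \<zero>"
  proof
    assume s0: "?s = \<zero>"
    show False
    proof (cases w)
      case 0
      have "comp f d = \<zero>" for d using f(3) s0 unfolding supp_in_def 0 by (cases "d = u") auto
      then have "f = \<zero>" using comp_eqI[OF fc zero_closed] by simp
      then show False using f by simp
    next
      case (Suc v)
      have "supp_in f u v" unfolding supp_in_def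
      proof (intro allI impI)
        fix d assume d: "comp f d \<noteq> \<zero>"
        then have "d \<noteq> u + w" using s0 by auto
        then show "u \<le> d \<and> d \<le> u + v" using f(3) d Suc unfolding supp_in_def by force
      qed
      then show False using least[of f u v] f Suc by simp
    qed
  qed
  \<comment> \<open>Width zero would make \<open>f\<close> a nonzero homogeneous element of
    \<open>P\<close>.\<close>
  have w0: "w > 0"
  proof (rule ccontr)
    assume "\<not> w > 0"
    then have w: "w = 0" by simp
    have cf: "comp f d = (if d = u then comp f (u + 0) else \<zero>)" for d
      using f(3) unfolding supp_in_def w by auto
    have "comp f d = comp ?s d" for d
      unfolding comp_G[OF sG, of d] unfolding w using cf[of d] by simp
    then have "f = ?s" by (rule comp_eqI[OF fc sc])
    then have "f \<in> Hom" using G_Hom[OF sG] by simp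
    then show False using PH f(1,2) by blast
  qed
  \<comment> \<open>Induction on the width of \<open>x\<close>. Below the width of \<open>f\<close>
    the element vanishes, and \<open>h = 1\<close>, \<open>g = 0\<close> will do; otherwise the top
    components are cancelled crosswise, each step contributing the homogeneous factor
    \<open>?s\<close> to \<open>h\<close>.\<close>
  have division: "\<exists>h\<in>Hom. h \<noteq> \<zero> \<and> (\<exists>g\<in>carrier R. h \<otimes> x = f \<otimes> g)" if "x \<in> P" "supp_in x v n" for x v n
    using that
  proof (induction n arbitrary: x v)
    case 0
    then have "x = \<zero>" using least w0 by blast
    then show ?case using fc G_Hom[OF one_G]
      by (intro bexI[of _ \<one>] conjI bexI[of _ \<zero>]) auto
  next
    case (Suc m)
    have xc: "x \<in> carrier R" using P.Icarr[OF Suc.prems(1)] .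
    show ?case
    proof (cases "Suc m < w")
      case True
      then have "x = \<zero>" using least Suc.prems by blast
      then show ?thesis using fc G_Hom[OF one_G]
        by (intro bexI[of _ \<one>] conjI bexI[of _ \<zero>]) auto
    next
      case False
      let ?a = "comp x (v + Suc m)"
      have aG: "?a \<in> G (v + Suc m)" and ac: "?a \<in> carrier R" using comp_props(1)[OF xc] xc by auto
      define x' where "x' = x \<otimes> ?s \<oplus> \<ominus> (f \<otimes> ?a)"
      have x'P: "x' \<in> P" unfolding x'_def
        using P.I_r_closed[OF Suc.prems(1) sc] P.I_r_closed[OF f(1) ac] P.a_inv_closed P.a_closed by auto
      have cx: "comp x' d = (if u + w \<le> d then comp x (d - (u + w)) \<otimes> ?s else \<zero>) \<oplus>
         \<ominus> (if v + Suc m \<le> d then comp f (d - (v + Suc m)) \<otimes> ?a else \<zero>)" for d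
      proof -
        have "comp x' d = comp (x \<otimes> ?s) d \<oplus> \<ominus> comp (f \<otimes> ?a) d"
          unfolding x'_def using xc fc ac sc by (simp add: comp_add comp_minus)
        then show ?thesis unfolding comp_mult_hom[OF xc sG] comp_mult_hom[OF fc aG] .
      qed
      have top: "comp x' (v + Suc m + (u + w)) = \<zero>"
        unfolding cx using m_comm[OF ac sc] r_neg[OF m_closed[OF ac sc]] by (simp add: add.commute)
      \<comment> \<open>Both terms of \<open>x'\<close> end in degree
        \<open>v + Suc m + u + w\<close>, where they cancel. The lower end is
        \<open>v + u + w\<close> for the first term, and no smaller for the second because
        \<open>w \<le> Suc m\<close>.\<close>
      have "supp_in x' (v + u + w) m"
        unfolding supp_in_def
      proof (intro allI impI)
        fix d assume d: "comp x' d \<noteq> \<zero>"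
        have ne: "d \<noteq> v + Suc m + (u + w)" using top d by auto
        have "u + w \<le> d \<and> comp x (d - (u + w)) \<noteq> \<zero> \<or>
          v + Suc m \<le> d \<and> comp f (d - (v + Suc m)) \<noteq> \<zero>"
        proof (rule ccontr)
          assume neg: "\<not> ?thesis"
          have "(if u + w \<le> d then comp x (d - (u + w)) \<otimes> ?s else \<zero>) = \<zero>" using neg sc by simp
          moreover have "(if v + Suc m \<le> d then comp f (d - (v + Suc m)) \<otimes> ?a else \<zero>) = \<zero>"
            using neg ac by simp
          ultimately have "comp x' d = \<zero>" unfolding cx by simp
          then show False using d by simp
        qed
        then consider "u + w \<le> d" "comp x (d - (u + w)) \<noteq> \<zero>"
          | "v + Suc m \<le> d" "comp f (d - (v + Suc m)) \<noteq> \<zero>" by blast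
        then show "v + u + w \<le> d \<and> d \<le> v + u + w + m"
        proof cases
          case 1
          then have "v \<le> d - (u + w) \<and> d - (u + w) \<le> v + Suc m"
            using Suc.prems(2) unfolding supp_in_def by blast
          then show ?thesis using 1 ne by linarith
        next
          case 2
          then have "u \<le> d - (v + Suc m) \<and> d - (v + Suc m) \<le> u + w"
            using f(3) unfolding supp_in_def by blast
          then show ?thesis using 2 ne False by linarith
        qed
      qed
      then obtain h g where h: "h \<in> Hom" "h \<noteq> \<zero>" "g \<in> carrier R" "h \<otimes> x' = f \<otimes> g"
        using Suc.IH[OF x'P] by blast
      have hc: "h \<in> carrier R" using Hom_carrier[OF h(1)] .
      have "(h \<otimes> ?s) \<otimes> x = h \<otimes> x' \<oplus> f \<otimes> (h \<otimes> ?a)"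
        unfolding x'_def using hc sc xc fc ac by (simp add: r_distr r_minus m_ac a_assoc l_neg)
      also have "\<dots> = f \<otimes> (g \<oplus> h \<otimes> ?a)" unfolding h(4) using fc h(3) hc ac by (simp add: r_distr)
      finally have "(h \<otimes> ?s) \<otimes> x = f \<otimes> (g \<oplus> h \<otimes> ?a)" .
      moreover have "h \<otimes> ?s \<in> Hom" using h(1) sG component_mult unfolding Hom_def by blast
      moreover have "h \<otimes> ?s \<noteq> \<zero>" using integral[of h ?s] h(2) s0 hc sc by auto
      moreover have "g \<oplus> h \<otimes> ?a \<in> carrier R" using h(3) hc ac by simp
      ultimately show ?thesis by (intro bexI[of _ "h \<otimes> ?s"] conjI bexI[of _ "g \<oplus> h \<otimes> ?a"])
    qed
  qed
  have "x \<otimes> comp f j \<in> PIdl f" if x: "x \<in> P" for x j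
  proof -
    have xc: "x \<in> carrier R" using P.Icarr[OF x] .
    obtain n where n: "supp_in x 0 n" using bounded[OF xc] by blast
    obtain h g where h: "h \<in> Hom" "h \<noteq> \<zero>" "g \<in> carrier R" "h \<otimes> x = f \<otimes> g"
      using division[OF x n] by blast
    have hc: "h \<in> carrier R" using Hom_carrier[OF h(1)] .
    obtain e where e: "h \<in> G e" using h(1) by (auto simp: Hom_def)
    \<comment> \<open>Homogeneity of \<open>h\<close> is what makes Gauss's lemma applicable
      here.\<close>
    have "f \<otimes> g \<in> PIdl h" using PIdl_mult_left[OF hc xc] h(4) hc xc by (simp add: m_comm)
    then have "comp f j \<otimes> comp g i \<in> PIdl h" for i using gauss_lemma[OF closed e h(2) fc h(3)] by blast
    then have "comp f j \<otimes> g \<in> PIdl h" using PIdl_of_comps[OF hc h(3)] fc by simp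
    then obtain z where z: "z \<in> carrier R" "comp f j \<otimes> g = z \<otimes> h" by (auto simp: PIdl_iff)
    have jc: "comp f j \<in> carrier R" using fc by simp
    have "h \<otimes> (x \<otimes> comp f j) = (h \<otimes> x) \<otimes> comp f j" using hc xc jc by (simp add: m_assoc)
    also have "\<dots> = f \<otimes> (comp f j \<otimes> g)" unfolding h(4) using fc h(3) jc by (simp add: m_ac)
    also have "\<dots> = h \<otimes> (z \<otimes> f)" unfolding z(2) using z(1) hc fc by (simp add: m_ac)
    finally have "x \<otimes> comp f j = z \<otimes> f" by (rule cancel_left) (use h(2) hc xc jc z(1) fc in auto)
    then show ?thesis using PIdl_mult_left[OF fc z(1)] by simp
  qed
  then show ?thesis using f by blast
qed

end

section \<open>From the homogeneous colon ideals to a prime without homogeneous elements\<close>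

context graded_noeth_domain
begin

text \<open>With \<open>C\<close> the fractional ideal of all \<open>a\<close> such that \<open>a\<close> times each component of \<open>f\<close> lies in \<open>R\<close>, we have
  \<open>P = f C\<close>, and for a component \<open>f\<^sub>i\<close> the homogeneous ideal \<open>f\<^sub>i C\<close> is the one assumed to be affine.
  In terms of \<open>C\<close> that assumption says \<open>f\<^sub>i\<^sup>m \<in> C W (m + 1)\<close> for some \<open>m\<close>, where \<open>W M\<close> is the set of all \<open>y\<close> with
  \<open>C\<^sup>M y \<subseteq> R\<close>. As multiplication by any component maps \<open>W M\<close> into \<open>W (M + 1)\<close>, a large power
  of \<open>f\<close>, being a sum of monomials in the components, has the same property.\<close>

lemma nonhomogeneous_prime_affine:
  assumes closed: "power_bounded_closed R" and P: "primeideal P R" and nz: "P \<noteq> {\<zero>}"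
    and PH: "P \<inter> Hom \<subseteq> {\<zero>}"
    and aff: "\<And>f i. f \<in> carrier R \<Longrightarrow> comp f i \<noteq> \<zero> \<Longrightarrow>
      affine_ideal R {z \<in> carrier R. \<forall>j. z \<otimes> comp f j \<in> PIdl (comp f i)}"
  shows "affine_ideal R P"
proof -
  interpret P: primeideal P R by fact
  obtain f where f: "f \<in> P" "f \<noteq> \<zero>" and div: "\<And>x j. x \<in> P \<Longrightarrow> x \<otimes> comp f j \<in> PIdl f"
    using nonhomogeneous_prime_generator[OF closed P nz PH] by blast
  have fc: "f \<in> carrier R" using P.Icarr[OF f(1)] .
  define W where "W M = {y \<in> carrier R. \<forall>x\<in>P. y \<otimes> x [^] M \<in> PIdl (f [^] M)}" for M :: nat
  define X where "X M = {x \<otimes> y | x y. x \<in> P \<and> y \<in> W M}" for M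
  \<comment> \<open>As \<open>P = f C\<close>, this is the set of ring elements in
    \<open>C W (N + 1)\<close>, written without fractions. The claims to be proved are
    \<open>f_i^m \<in> T m\<close> and then \<open>f^N \<in> T N\<close>.\<close>
  define T where "T N = {a \<in> carrier R. a \<otimes> f \<in> Idl (X (Suc N))}" for N
  \<comment> \<open>\<open>F\<close> collects the multipliers that raise the index of
    \<open>W\<close> by one. It contains the components of \<open>f\<close> and is closed under
    sums, so partial sums of components can be treated like single ones.\<close>
  define F where "F = {a \<in> carrier R. \<forall>M. \<forall>y\<in>W M. a \<otimes> y \<in> W (Suc M)}"
  have fM: "f [^] M \<in> carrier R" for M :: nat using fc by simp
  have W_ideal: "ideal (W M) R" for M
    unfolding W_def by (rule Inter_colon_ideal[OF cgenideal_ideal[OF fM]]) (simp add: P.Icarr)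
  have W_carrier: "y \<in> carrier R" if "y \<in> W M" for y M using ideal.Icarr[OF W_ideal that] .
  have X_carrier: "X M \<subseteq> carrier R" for M
    unfolding X_def using P.Icarr W_carrier by auto
  have X_ideal: "ideal (Idl (X M)) R" for M by (rule genideal_ideal[OF X_carrier])
  have T_ideal: "ideal (T N) R" for N unfolding T_def by (rule colon_ideal[OF X_ideal fc])
  have zero_T: "\<zero> \<in> T N" for N using additive_subgroup.zero_closed[OF ideal.axioms(1)[OF T_ideal]] .
  have comp_F: "comp f j \<in> F" for j
    unfolding F_def
  proof (intro CollectI conjI allI ballI)
    show jc: "comp f j \<in> carrier R" using fc by simp
    fix M y assume y: "y \<in> W M"
    have yc: "y \<in> carrier R" using W_carrier[OF y] .
    have "comp f j \<otimes> y \<otimes> x [^] Suc M \<in> PIdl (f [^] Suc M)" if x: "x \<in> P" for x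
    proof -
      have xc: "x \<in> carrier R" using P.Icarr[OF x] .
      have "comp f j \<otimes> y \<otimes> x [^] Suc M = (y \<otimes> x [^] M) \<otimes> (x \<otimes> comp f j)"
        using jc yc xc by (simp add: m_ac)
      moreover have "y \<otimes> x [^] M \<in> PIdl (f [^] M)" using y x unfolding W_def by blast
      ultimately show ?thesis using PIdl_mult_mult[OF fM fc _ div[OF x]] by simp
    qed
    then show "comp f j \<otimes> y \<in> W (Suc M)" unfolding W_def using jc yc by simp
  qed
  have F_carrier: "a \<in> carrier R" if "a \<in> F" for a using that unfolding F_def by simp
  have F_W: "a \<otimes> y \<in> W (Suc M)" if "a \<in> F" "y \<in> W M" for a y M using that unfolding F_def by blast
  have F_add: "a \<oplus> b \<in> F" if a: "a \<in> F" and b: "b \<in> F" for a b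
    unfolding F_def
  proof (intro CollectI conjI allI ballI)
    show "a \<oplus> b \<in> carrier R" using F_carrier a b by simp
    fix M y assume y: "y \<in> W M"
    have "(a \<oplus> b) \<otimes> y = a \<otimes> y \<oplus> b \<otimes> y" using F_carrier[OF a] F_carrier[OF b] W_carrier[OF y] by (rule l_distr)
    then show "(a \<oplus> b) \<otimes> y \<in> W (Suc M)"
      using additive_subgroup.a_closed[OF ideal.axioms(1)[OF W_ideal] F_W[OF a y] F_W[OF b y]] by simp
  qed
  have F_X: "b \<otimes> a \<in> Idl (X (Suc M))" if a: "a \<in> F" and b: "b \<in> Idl (X M)" for a b M
  proof -
    have ac: "a \<in> carrier R" using F_carrier[OF a] .
    have "X M \<subseteq> {b \<in> carrier R. b \<otimes> a \<in> Idl (X (Suc M))}"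
    proof
      fix u assume "u \<in> X M"
      then obtain x y where u: "u = x \<otimes> y" "x \<in> P" "y \<in> W M" unfolding X_def by blast
      have c: "x \<in> carrier R" "y \<in> carrier R" using P.Icarr[OF u(2)] W_carrier[OF u(3)] .
      have "u \<otimes> a = x \<otimes> (a \<otimes> y)" unfolding u(1) using c ac by (simp add: m_ac)
      moreover have "x \<otimes> (a \<otimes> y) \<in> X (Suc M)" unfolding X_def using u(2) F_W[OF a u(3)] by blast
      ultimately have "u \<otimes> a \<in> Idl (X (Suc M))" using genideal_self[OF X_carrier] by auto
      moreover have "u \<in> carrier R" unfolding u(1) using c by simp
      ultimately show "u \<in> {b \<in> carrier R. b \<otimes> a \<in> Idl (X (Suc M))}" by simp
    qed
    from subsetD[OF genideal_minimal[OF colon_ideal[OF X_ideal ac] this] b] show ?thesis by simp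
  qed
  have T_carrier: "c \<in> carrier R" if "c \<in> T N" for c N using that unfolding T_def by simp
  have F_T: "a \<otimes> c \<in> T (Suc N)" if a: "a \<in> F" and c: "c \<in> T N" for a c N
  proof -
    have cc: "a \<in> carrier R" "c \<in> carrier R" using F_carrier[OF a] T_carrier[OF c] .
    have "c \<otimes> f \<in> Idl (X (Suc N))" using c unfolding T_def by simp
    then have "c \<otimes> f \<otimes> a \<in> Idl (X (Suc (Suc N)))" by (rule F_X[OF a])
    moreover have "c \<otimes> f \<otimes> a = a \<otimes> c \<otimes> f" using cc fc by (simp add: m_ac)
    ultimately show ?thesis unfolding T_def using cc by simp
  qed
  have F_pow_T: "a [^] r \<otimes> c \<in> T (N + r)" if a: "a \<in> F" and c: "c \<in> T N" for a c N and r :: nat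
  proof (induction r)
    case 0 then show ?case using c T_carrier by simp
  next
    case (Suc r)
    have "a [^] Suc r \<otimes> c = a \<otimes> (a [^] r \<otimes> c)"
      using F_carrier[OF a] T_carrier[OF c] by (simp add: m_ac)
    then show ?case using F_T[OF a Suc] by simp
  qed
  \<comment> \<open>A monomial of degree \<open>p + q\<close> in \<open>a\<close> and
    \<open>b\<close> contains \<open>a^p\<close> or \<open>b^q\<close>; the remaining factors raise
    the index of \<open>T\<close> by exactly their number.\<close>
  have pow_sum: "(a \<oplus> b) [^] (p + q) \<in> T (p + q)"
    if a: "a \<in> F" "a [^] p \<in> T p" and b: "b \<in> F" "b [^] q \<in> T q" for a b and p q :: nat
  proof -
    have c: "a \<in> carrier R" "b \<in> carrier R" using F_carrier a b by auto
    have "a [^] i \<otimes> b [^] j \<otimes> (a \<oplus> b) [^] k \<in> T (p + q)" if "i + j + k = p + q" for i j k :: nat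
      using that
    proof (induction k arbitrary: i j)
      case 0
      show ?case
      proof (cases "p \<le> i")
        case True
        have "a [^] (i - p) \<otimes> (b [^] j \<otimes> a [^] p) \<in> T (p + j + (i - p))"
          by (intro F_pow_T a b)
        moreover have "a [^] (i - p) \<otimes> (b [^] j \<otimes> a [^] p) = a [^] i \<otimes> b [^] j"
        proof -
          have "a [^] (i - p) \<otimes> (b [^] j \<otimes> a [^] p) = (a [^] (i - p) \<otimes> a [^] p) \<otimes> b [^] j"
            using c by (simp add: m_ac)
          then show ?thesis using c True by (simp add: nat_pow_mult)
        qed
        moreover have "p + j + (i - p) = p + q" using True 0 by simp
        ultimately show ?thesis using c by simp
      next
        case False
        then have q: "q \<le> j" using 0 by simp
        have "b [^] (j - q) \<otimes> (a [^] i \<otimes> b [^] q) \<in> T (q + i + (j - q))"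
          by (intro F_pow_T a b)
        moreover have "b [^] (j - q) \<otimes> (a [^] i \<otimes> b [^] q) = a [^] i \<otimes> b [^] j"
        proof -
          have "b [^] (j - q) \<otimes> (a [^] i \<otimes> b [^] q) = a [^] i \<otimes> (b [^] (j - q) \<otimes> b [^] q)"
            using c by (simp add: m_ac)
          then show ?thesis using c q by (simp add: nat_pow_mult)
        qed
        moreover have "q + i + (j - q) = p + q" using q 0 by simp
        ultimately show ?thesis using c by simp
      qed
    next
      case (Suc k)
      let ?c = "(a \<oplus> b) [^] k"
      have "a [^] i \<otimes> b [^] j \<otimes> (a \<oplus> b) [^] Suc k
        = a [^] Suc i \<otimes> b [^] j \<otimes> ?c \<oplus> a [^] i \<otimes> b [^] Suc j \<otimes> ?c"
        using c by (simp add: r_distr l_distr m_ac)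
      moreover have "a [^] Suc i \<otimes> b [^] j \<otimes> ?c \<in> T (p + q)" "a [^] i \<otimes> b [^] Suc j \<otimes> ?c \<in> T (p + q)"
        using Suc.IH[of "Suc i" j] Suc.IH[of i "Suc j"] Suc.prems by auto
      ultimately show ?case
        using additive_subgroup.a_closed[OF ideal.axioms(1)[OF T_ideal]] by simp
    qed
    from this[of 0 0 "p + q"] show ?thesis using c by simp
  qed
  have comp_T: "\<exists>m::nat. comp f i [^] m \<in> T m" for i
  proof (cases "comp f i = \<zero>")
    case True
    then have "comp f i [^] (1::nat) = \<zero>" by simp
    then show ?thesis using zero_T by metis
  next
    case False
    define h where "h = comp f i"
    have h: "h \<in> carrier R" "h \<noteq> \<zero>" using fc False unfolding h_def by auto
    have "h \<in> Hom" unfolding h_def using G_Hom[OF comp_props(1)[OF fc]] .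
    then have hP: "h \<notin> P" using PH h by blast
    define I where "I = {z \<in> carrier R. \<forall>j. z \<otimes> comp f j \<in> PIdl h}"
    have I: "ideal I R"
    proof -
      have "ideal {z \<in> carrier R. \<forall>j\<in>UNIV. z \<otimes> comp f j \<in> PIdl h} R"
        by (rule Inter_colon_ideal[OF cgenideal_ideal[OF h(1)]]) (simp add: fc)
      then show ?thesis unfolding I_def by simp
    qed
    have hI: "h \<in> I"
      unfolding I_def using h(1) PIdl_mult_left[OF h(1) comp_carrier[OF fc]] m_comm[OF h(1) comp_carrier[OF fc]]
      by simp
    have affI: "affine_ideal R I" unfolding I_def h_def by (rule aff[OF fc False])
    define Y where "Y n = {w \<in> carrier R. \<forall>z\<in>I. z [^] n \<otimes> w \<in> PIdl (h [^] n)}" for n :: nat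
    obtain m where m: "h [^] Suc m \<in> Idl {z \<otimes> w | z w. z \<in> I \<and> w \<in> Y (Suc m)}"
      using affine_ideal_power[OF I affI hI h(2)] unfolding Y_def by auto
    let ?n = "Suc m"
    \<comment> \<open>The same fraction of \<open>C\<close> is written as \<open>x / f\<close> with
      \<open>x\<close> in \<open>P\<close> and as \<open>z / h\<close> with \<open>z\<close> in
      \<open>I\<close>. So \<open>z = x h / f\<close>, and powers of \<open>x / f\<close> and
      \<open>z / h\<close> have the same multipliers into the ring.\<close>
    have Y_W: "w \<in> W ?n" if w: "w \<in> Y ?n" for w
    proof -
      have wc: "w \<in> carrier R" using w unfolding Y_def by simp
      have "w \<otimes> x [^] ?n \<in> PIdl (f [^] ?n)" if x: "x \<in> P" for x
      proof -
        have xc: "x \<in> carrier R" using P.Icarr[OF x] .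
        obtain z where z: "z \<in> carrier R" "x \<otimes> h = z \<otimes> f"
          using div[OF x, of i] unfolding h_def PIdl_iff by blast
        have "z \<otimes> comp f j \<in> PIdl h" for j
        proof -
          obtain v where v: "v \<in> carrier R" "x \<otimes> comp f j = v \<otimes> f"
            using div[OF x, of j] unfolding PIdl_iff by blast
          have jc: "comp f j \<in> carrier R" using fc by simp
          have "f \<otimes> (z \<otimes> comp f j) = (z \<otimes> f) \<otimes> comp f j" using fc z(1) jc by (simp add: m_ac)
          also have "\<dots> = h \<otimes> (x \<otimes> comp f j)" unfolding z(2)[symmetric] using xc h(1) jc by (simp add: m_ac)
          also have "\<dots> = f \<otimes> (v \<otimes> h)" unfolding v(2) using v(1) fc h(1) by (simp add: m_ac)
          finally have "z \<otimes> comp f j = v \<otimes> h" by (rule cancel_left) (use f(2) fc z(1) jc v(1) h(1) in auto)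
          then show ?thesis using PIdl_mult_left[OF h(1) v(1)] by simp
        qed
        then have "z \<in> I" unfolding I_def using z(1) by simp
        then have "z [^] ?n \<otimes> w \<in> PIdl (h [^] ?n)" using w unfolding Y_def by blast
        then obtain v where v: "v \<in> carrier R" "z [^] ?n \<otimes> w = v \<otimes> h [^] ?n" unfolding PIdl_iff by blast
        have pc: "x [^] ?n \<in> carrier R" "h [^] ?n \<in> carrier R" "z [^] ?n \<in> carrier R" "f [^] ?n \<in> carrier R"
          using xc h(1) z(1) fc nat_pow_closed by blast+
        have "h [^] ?n \<otimes> (w \<otimes> x [^] ?n) = w \<otimes> (x [^] ?n \<otimes> h [^] ?n)" using pc wc by (simp add: m_ac del: nat_pow_Suc)
        also have "x [^] ?n \<otimes> h [^] ?n = (x \<otimes> h) [^] ?n" by (rule nat_pow_distrib[OF xc h(1), symmetric])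
        also have "\<dots> = z [^] ?n \<otimes> f [^] ?n" unfolding z(2) by (rule nat_pow_distrib[OF z(1) fc])
        also have "w \<otimes> (z [^] ?n \<otimes> f [^] ?n) = f [^] ?n \<otimes> (z [^] ?n \<otimes> w)"
          using pc wc by (simp add: m_ac del: nat_pow_Suc)
        also have "\<dots> = h [^] ?n \<otimes> (v \<otimes> f [^] ?n)"
          unfolding v(2) using pc v(1) by (simp add: m_ac del: nat_pow_Suc)
        finally have "w \<otimes> x [^] ?n = v \<otimes> f [^] ?n"
          by (rule cancel_left) (use pc wc v(1) pow_nonzero[OF h, of ?n] in \<open>auto simp del: nat_pow_Suc\<close>)
        then show ?thesis using PIdl_mult_left[OF pc(4) v(1)] by simp
      qed
      then show ?thesis unfolding W_def using wc by blast
    qed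
    \<comment> \<open>Expresses \<open>a f / h\<close> as an element of the ideal generated by
      \<open>X ?n\<close>. Applied to \<open>a = h^(m+1)\<close> it gives \<open>h^m f\<close> in
      that ideal, that is \<open>h^m \<in> T m\<close>.\<close>
    let ?K = "{a \<in> carrier R. a \<otimes> f \<in> (\<lambda>b. b \<otimes> h) ` (Idl (X ?n))}"
    have K: "ideal ?K R" by (rule colon_ideal[OF ideal_mult_elem[OF X_ideal h(1)] fc])
    have "{z \<otimes> w | z w. z \<in> I \<and> w \<in> Y ?n} \<subseteq> ?K"
    proof
      fix u assume "u \<in> {z \<otimes> w | z w. z \<in> I \<and> w \<in> Y ?n}"
      then obtain z w where u: "u = z \<otimes> w" "z \<in> I" "w \<in> Y ?n" by blast
      have zc: "z \<in> carrier R" using ideal.Icarr[OF I u(2)] .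
      have wc: "w \<in> carrier R" using W_carrier[OF Y_W[OF u(3)]] .
      have "z \<otimes> f \<in> PIdl h" using PIdl_of_comps[OF h(1) fc zc] u(2) unfolding I_def by blast
      then obtain x where x: "x \<in> carrier R" "z \<otimes> f = x \<otimes> h" unfolding PIdl_iff by blast
      have "x \<otimes> h \<in> P" unfolding x(2)[symmetric] using P.I_l_closed[OF f(1) zc] .
      \<comment> \<open>The converse passage \<open>x = z f / h\<close> stays in \<open>P\<close>
        because the homogeneous \<open>h\<close> is outside \<open>P\<close>.\<close>
      then have xP: "x \<in> P" using P.I_prime[OF x(1) h(1)] hP by blast
      have "u \<otimes> f = w \<otimes> (z \<otimes> f)" unfolding u(1) using zc wc fc by (simp add: m_ac)
      also have "\<dots> = (x \<otimes> w) \<otimes> h" unfolding x(2) using x(1) wc h(1) by (simp add: m_ac)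
      finally have eq: "u \<otimes> f = (x \<otimes> w) \<otimes> h" .
      have "x \<otimes> w \<in> X ?n" unfolding X_def using xP Y_W[OF u(3)] by blast
      then have "x \<otimes> w \<in> Idl (X ?n)" using genideal_self[OF X_carrier] by auto
      then have "u \<otimes> f \<in> (\<lambda>b. b \<otimes> h) ` (Idl (X ?n))" by (rule image_eqI[of _ "\<lambda>b. b \<otimes> h", OF eq])
      moreover have "u \<in> carrier R" unfolding u(1) using zc wc by simp
      ultimately show "u \<in> ?K" by simp
    qed
    then have "h [^] ?n \<in> ?K" by (rule subsetD[OF genideal_minimal[OF K] m])
    then obtain b where b: "b \<in> Idl (X ?n)" "h [^] ?n \<otimes> f = b \<otimes> h" by auto
    have bc: "b \<in> carrier R" using ideal.Icarr[OF X_ideal b(1)] .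
    have "h \<otimes> (h [^] m \<otimes> f) = h [^] ?n \<otimes> f" using h(1) fc by (simp add: m_ac)
    also have "\<dots> = h \<otimes> b" unfolding b(2) using bc h(1) by (simp add: m_comm)
    finally have "h [^] m \<otimes> f = b" by (rule cancel_left) (use h fc bc in auto)
    then have "h [^] m \<in> T m" unfolding T_def using b(1) h(1) by simp
    then show ?thesis unfolding h_def by blast
  qed
  have sum_T: "finsum R (comp f) A \<in> F \<and> (\<exists>m::nat. finsum R (comp f) A [^] m \<in> T m)" if "finite A" for A
    using that
  proof (induction A)
    case empty
    have "\<zero> \<in> F" unfolding F_def
      using additive_subgroup.zero_closed[OF ideal.axioms(1)[OF W_ideal]] W_carrier by simp
    moreover have "\<zero> [^] (1::nat) \<in> T 1" using zero_T by simp
    ultimately show ?case unfolding finsum_empty by (intro conjI exI)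
  next
    case (insert d A)
    have eq: "finsum R (comp f) (insert d A) = comp f d \<oplus> finsum R (comp f) A"
      using insert(1,2) fc by simp
    obtain p q :: nat where "comp f d [^] p \<in> T p" "finsum R (comp f) A [^] q \<in> T q"
      using comp_T insert(3) by blast
    then show ?case
      unfolding eq using F_add[OF comp_F] pow_sum[OF comp_F] insert(3) by blast
  qed
  \<comment> \<open>The partial sums end with \<open>f\<close> itself. Hence \<open>f^(N+1)\<close>
    lies in the ideal generated by \<open>P W (N + 1)\<close> and serves as the denominator in the
    criterion for \<open>P\<close>.\<close>
  then obtain N :: nat where N: "f [^] N \<in> T N"
    using comp_props(2)[OF fc] comp_props(3)[OF fc] by metis
  let ?c = "f [^] Suc N"
  have mem: "?c \<in> Idl (X (Suc N))" using N unfolding T_def by simp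
  have "W (Suc N) \<subseteq> transform R P ?c"
  proof
    fix y assume y: "y \<in> W (Suc N)"
    have yc: "y \<in> carrier R" using W_carrier[OF y] .
    have "x [^] Suc N \<otimes> y \<in> PIdl ?c" if x: "x \<in> P" for x
    proof -
      have "y \<otimes> x [^] Suc N \<in> PIdl ?c" using y x unfolding W_def by blast
      moreover have "x [^] Suc N \<in> carrier R" using P.Icarr[OF x] nat_pow_closed by blast
      ultimately show ?thesis using yc m_comm by metis
    qed
    then show "y \<in> transform R P ?c" unfolding transform_def using yc by blast
  qed
  then have "X (Suc N) \<subseteq> {x \<otimes> y | x y. x \<in> P \<and> y \<in> transform R P ?c}" unfolding X_def by blast
  moreover have "{x \<otimes> y | x y. x \<in> P \<and> y \<in> transform R P ?c} \<subseteq> carrier R"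
    using P.Icarr transform_carrier by auto
  ultimately have "?c \<in> Idl {x \<otimes> y | x y. x \<in> P \<and> y \<in> transform R P ?c}"
    using subset_Idl_subset mem by blast
  moreover have "?c \<in> carrier R - {\<zero>}" using fM pow_nonzero[OF fc f(2)] by blast
  ultimately show ?thesis unfolding affine_ideal_def by blast
qed

end

section \<open>Finitely generated algebras over a field are noetherian\<close>

text \<open>Submodules over a subring \<open>A\<close>; closure under negatives comes from scaling
  by -1.\<close>

definition submod :: "('a, 'm) ring_scheme \<Rightarrow> 'a set \<Rightarrow> 'a set \<Rightarrow> bool" where
  "submod R A D \<longleftrightarrow> D \<subseteq> carrier R \<and> \<zero>\<^bsub>R\<^esub> \<in> D \<and> (\<forall>x\<in>D. \<forall>y\<in>D. x \<oplus>\<^bsub>R\<^esub> y \<in> D) \<and>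
    (\<forall>a\<in>A. \<forall>x\<in>D. a \<otimes>\<^bsub>R\<^esub> x \<in> D)"

text \<open>Finite generation of \<open>D\<close> by \<open>E\<close> is stated by minimality among
  submodules, which avoids linear combinations.\<close>

definition noetherian_subring :: "('a, 'm) ring_scheme \<Rightarrow> 'a set \<Rightarrow> bool" where
  "noetherian_subring R A \<longleftrightarrow> (\<forall>D. submod R A D \<and> D \<subseteq> A \<longrightarrow>
     (\<exists>E. finite E \<and> E \<subseteq> D \<and> (\<forall>M. submod R A M \<and> E \<subseteq> M \<longrightarrow> D \<subseteq> M)))"

text \<open>The values at \<open>b\<close> of the polynomials of degree less than \<open>n\<close>
  with coefficients in \<open>A\<close>.\<close>

primrec polys :: "('a, 'm) ring_scheme \<Rightarrow> 'a set \<Rightarrow> 'a \<Rightarrow> nat \<Rightarrow> 'a set" where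
  "polys R A b 0 = {\<zero>\<^bsub>R\<^esub>}"
| "polys R A b (Suc n) = {a \<otimes>\<^bsub>R\<^esub> b [^]\<^bsub>R\<^esub> n \<oplus>\<^bsub>R\<^esub> y | a y. a \<in> A \<and> y \<in> polys R A b n}"

declare polys.simps(2) [simp del]

section \<open>Hilbert's basis theorem for the adjunction of one element\<close>

locale subring_extension = cring R for R (structure) +
  fixes A b
  assumes A: "subring A R" and b: "b \<in> carrier R"
begin

abbreviation "p \<equiv> polys R A b"

definition Ab :: "'a set" where "Ab = (\<Union>n. p n)"

lemma A_car: "a \<in> A \<Longrightarrow> a \<in> carrier R" using subringE(1)[OF A] by auto

lemma bn: "b [^] (n::nat) \<in> carrier R" using b by simp

lemma p_Suc_I: "a \<in> A \<Longrightarrow> y \<in> p n \<Longrightarrow> a \<otimes> b [^] n \<oplus> y \<in> p (Suc n)"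
  unfolding polys.simps by blast

lemma p_Suc_E:
  assumes "x \<in> p (Suc n)" obtains a y where "a \<in> A" "y \<in> p n" "x = a \<otimes> b [^] n \<oplus> y"
  using assms unfolding polys.simps by blast

lemma p_car: "x \<in> p n \<Longrightarrow> x \<in> carrier R"
proof (induction n arbitrary: x)
  case (Suc n)
  obtain a y where "a \<in> A" "y \<in> p n" "x = a \<otimes> b [^] n \<oplus> y" using Suc.prems by (rule p_Suc_E)
  then show ?case using Suc.IH A_car bn by simp
qed simp

lemma zero_p: "\<zero> \<in> p n"
proof (induction n)
  case (Suc n)
  then show ?case using p_Suc_I[OF subringE(2)[OF A] Suc] bn by simp
qed simp

lemma p_Suc: "x \<in> p n \<Longrightarrow> x \<in> p (Suc n)"
  using p_Suc_I[OF subringE(2)[OF A], of x n] p_car bn by simp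

lemma p_mono: "m \<le> n \<Longrightarrow> p m \<subseteq> p n"
  by (rule lift_Suc_mono_le[of p]) (use p_Suc in blast)

lemma p_add: "x \<in> p n \<Longrightarrow> y \<in> p n \<Longrightarrow> x \<oplus> y \<in> p n"
proof (induction n arbitrary: x y)
  case (Suc n)
  obtain a u where x: "a \<in> A" "u \<in> p n" "x = a \<otimes> b [^] n \<oplus> u" using Suc.prems(1) by (rule p_Suc_E)
  obtain a' v where y: "a' \<in> A" "v \<in> p n" "y = a' \<otimes> b [^] n \<oplus> v" using Suc.prems(2) by (rule p_Suc_E)
  have "x \<oplus> y = (a \<oplus> a') \<otimes> b [^] n \<oplus> (u \<oplus> v)"
    unfolding x(3) y(3) using A_car[OF x(1)] A_car[OF y(1)] p_car[OF x(2)] p_car[OF y(2)] bn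
    by (simp add: l_distr a_ac)
  then show ?case using p_Suc_I[OF subringE(7)[OF A x(1) y(1)] Suc.IH[OF x(2) y(2)]] by simp
qed simp

lemma p_scale: "x \<in> p n \<Longrightarrow> c \<in> A \<Longrightarrow> c \<otimes> x \<in> p n"
proof (induction n arbitrary: x)
  case 0 then show ?case using A_car by simp
next
  case (Suc n)
  obtain a u where x: "a \<in> A" "u \<in> p n" "x = a \<otimes> b [^] n \<oplus> u" using Suc.prems(1) by (rule p_Suc_E)
  have "c \<otimes> x = (c \<otimes> a) \<otimes> b [^] n \<oplus> c \<otimes> u"
    unfolding x(3) using A_car[OF x(1)] A_car[OF Suc.prems(2)] p_car[OF x(2)] bn
    by (simp add: r_distr m_assoc)
  then show ?case
    using p_Suc_I[OF subringE(6)[OF A Suc.prems(2) x(1)] Suc.IH[OF x(2) Suc.prems(2)]] by simp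
qed

lemma p_shift: "x \<in> p n \<Longrightarrow> b \<otimes> x \<in> p (Suc n)"
proof (induction n arbitrary: x)
  case 0 then show ?case using b zero_p[of "Suc 0"] by simp
next
  case (Suc n)
  obtain a u where x: "a \<in> A" "u \<in> p n" "x = a \<otimes> b [^] n \<oplus> u" using Suc.prems(1) by (rule p_Suc_E)
  have "b \<otimes> x = a \<otimes> b [^] Suc n \<oplus> b \<otimes> u"
    unfolding x(3) using A_car[OF x(1)] p_car[OF x(2)] b
    by (simp add: r_distr m_ac)
  then show ?case using p_Suc_I[OF x(1) Suc.IH[OF x(2)]] by simp
qed

lemma p_shift_pow: "x \<in> p n \<Longrightarrow> b [^] (k::nat) \<otimes> x \<in> p (n + k)"
proof (induction k)
  case 0 then show ?case using p_car by simp
next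
  case (Suc k)
  have "b [^] Suc k \<otimes> x = b \<otimes> (b [^] k \<otimes> x)" using p_car[OF Suc.prems] b by (simp add: m_ac)
  then show ?case using p_shift[OF Suc.IH[OF Suc.prems]] by simp
qed

lemma p_mult: "x \<in> p m \<Longrightarrow> z \<in> p n \<Longrightarrow> x \<otimes> z \<in> p (m + n)"
proof (induction m arbitrary: x)
  case 0 then show ?case using p_car zero_p by simp
next
  case (Suc m)
  obtain a u where x: "a \<in> A" "u \<in> p m" "x = a \<otimes> b [^] m \<oplus> u" using Suc.prems(1) by (rule p_Suc_E)
  have z: "z \<in> carrier R" using p_car[OF Suc.prems(2)] .
  have "x \<otimes> z = a \<otimes> (b [^] m \<otimes> z) \<oplus> u \<otimes> z"
    unfolding x(3) using A_car[OF x(1)] p_car[OF x(2)] bn z by (simp add: l_distr m_assoc)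
  moreover have "a \<otimes> (b [^] m \<otimes> z) \<in> p (Suc m + n)"
    using p_Suc[OF p_scale[OF p_shift_pow[OF Suc.prems(2)] x(1)]] by (simp add: add.commute)
  moreover have "u \<otimes> z \<in> p (Suc m + n)" using p_Suc[OF Suc.IH[OF x(2) Suc.prems(2)]] by simp
  ultimately show ?case using p_add by simp
qed

lemma A_Ab: "A \<subseteq> Ab"
proof
  fix a assume a: "a \<in> A"
  then have "a \<otimes> b [^] (0::nat) \<oplus> \<zero> \<in> p (Suc 0)" by (intro p_Suc_I zero_p)
  then have "a \<in> p (Suc 0)" using A_car[OF a] by simp
  then show "a \<in> Ab" unfolding Ab_def by blast
qed

lemma b_Ab: "b \<in> Ab"
proof -
  have "\<one> \<otimes> b [^] (1::nat) \<oplus> \<zero> \<in> p (Suc 1)" using subringE(3)[OF A] by (intro p_Suc_I zero_p)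
  then have "b \<in> p (Suc 1)" using b by simp
  then show ?thesis unfolding Ab_def by blast
qed

lemma subring_Ab: "subring Ab R"
proof (rule subringI)
  show "Ab \<subseteq> carrier R" unfolding Ab_def using p_car by auto
  show "\<one> \<in> Ab" using A_Ab subringE(3)[OF A] by auto
  show "\<ominus> x \<in> Ab" if "x \<in> Ab" for x
  proof -
    obtain n where n: "x \<in> p n" using \<open>x \<in> Ab\<close> unfolding Ab_def by blast
    have "\<ominus> x = (\<ominus> \<one>) \<otimes> x" using p_car[OF n] by (simp add: l_minus)
    then show ?thesis using p_scale[OF n subringE(5)[OF A subringE(3)[OF A]]] unfolding Ab_def by auto
  qed
  fix x y assume "x \<in> Ab" "y \<in> Ab"
  then obtain m n where mn: "x \<in> p m" "y \<in> p n" unfolding Ab_def by blast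
  show "x \<otimes> y \<in> Ab" using p_mult[OF mn] unfolding Ab_def by blast
  have "x \<in> p (max m n)" "y \<in> p (max m n)" using mn p_mono[of m "max m n"] p_mono[of n "max m n"] by auto
  then show "x \<oplus> y \<in> Ab" using p_add unfolding Ab_def by blast
qed

text \<open>Leading coefficients of the elements of \<open>D\<close> that can be written with degree
  at most \<open>n\<close>. As \<open>b\<close> may be algebraic over \<open>A\<close>, an element
  can have several such expressions; all of them count.\<close>

definition lead :: "nat \<Rightarrow> 'a set \<Rightarrow> 'a set" where
  "lead n D = {a \<in> A. \<exists>y\<in>p n. a \<otimes> b [^] n \<oplus> y \<in> D}"

lemma lead_submod:
  assumes D: "submod R Ab D" shows "submod R A (lead n D)"
  unfolding submod_def
proof (intro conjI ballI)
  show "lead n D \<subseteq> carrier R" unfolding lead_def using A_car by auto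
  have "\<zero> \<otimes> b [^] n \<oplus> \<zero> \<in> D" using D bn unfolding submod_def by simp
  then show "\<zero> \<in> lead n D" unfolding lead_def using zero_p subringE(2)[OF A] by blast
next
  fix u v assume "u \<in> lead n D" "v \<in> lead n D"
  then obtain y z where u: "u \<in> A" "y \<in> p n" "u \<otimes> b [^] n \<oplus> y \<in> D"
    and v: "v \<in> A" "z \<in> p n" "v \<otimes> b [^] n \<oplus> z \<in> D" unfolding lead_def by blast
  have "(u \<oplus> v) \<otimes> b [^] n \<oplus> (y \<oplus> z) = (u \<otimes> b [^] n \<oplus> y) \<oplus> (v \<otimes> b [^] n \<oplus> z)"
    using A_car[OF u(1)] A_car[OF v(1)] p_car[OF u(2)] p_car[OF v(2)] bn by (simp add: l_distr a_ac)
  then have "(u \<oplus> v) \<otimes> b [^] n \<oplus> (y \<oplus> z) \<in> D" using D u(3) v(3) unfolding submod_def by simp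
  then show "u \<oplus> v \<in> lead n D"
    unfolding lead_def using subringE(7)[OF A u(1) v(1)] p_add[OF u(2) v(2)] by blast
next
  fix c u assume c: "c \<in> A" and "u \<in> lead n D"
  then obtain y where u: "u \<in> A" "y \<in> p n" "u \<otimes> b [^] n \<oplus> y \<in> D" unfolding lead_def by blast
  have "(c \<otimes> u) \<otimes> b [^] n \<oplus> c \<otimes> y = c \<otimes> (u \<otimes> b [^] n \<oplus> y)"
    using A_car[OF u(1)] A_car[OF c] p_car[OF u(2)] bn by (simp add: r_distr m_assoc)
  moreover have "c \<in> Ab" using c A_Ab by blast
  ultimately have "(c \<otimes> u) \<otimes> b [^] n \<oplus> c \<otimes> y \<in> D" using D u(3) unfolding submod_def by simp
  then show "c \<otimes> u \<in> lead n D"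
    unfolding lead_def using subringE(6)[OF A c u(1)] p_scale[OF u(2) c] by blast
qed

lemma lead_Suc:
  assumes D: "submod R Ab D" shows "lead n D \<subseteq> lead (Suc n) D"
proof
  fix u assume "u \<in> lead n D"
  then obtain y where u: "u \<in> A" "y \<in> p n" "u \<otimes> b [^] n \<oplus> y \<in> D" unfolding lead_def by blast
  have "u \<otimes> b [^] Suc n \<oplus> b \<otimes> y = b \<otimes> (u \<otimes> b [^] n \<oplus> y)"
    using A_car[OF u(1)] p_car[OF u(2)] b by (simp add: r_distr m_ac)
  then have "u \<otimes> b [^] Suc n \<oplus> b \<otimes> y \<in> D" using D u(3) b_Ab unfolding submod_def by simp
  then show "u \<in> lead (Suc n) D" unfolding lead_def using u(1) p_shift[OF u(2)] by blast
qed

lemma submod_Int: "submod R B M \<Longrightarrow> submod R B D \<Longrightarrow> submod R B (M \<inter> D)"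
  unfolding submod_def by blast

lemma submod_minus:
  assumes D: "submod R Ab D" and x: "x \<in> D" shows "\<ominus> x \<in> D"
proof -
  have "x \<in> carrier R" using assms unfolding submod_def by blast
  then have "\<ominus> x = (\<ominus> \<one>) \<otimes> x" by (simp add: l_minus)
  moreover have "\<ominus> \<one> \<in> Ab" using subringE(5)[OF subring_Ab subringE(3)[OF subring_Ab]] .
  ultimately show ?thesis using assms unfolding submod_def by simp
qed

text \<open>Descent on the degree: from an element of \<open>D\<close> one subtracts an element of
  \<open>N\<close> with the same leading coefficient, and the difference is in \<open>D\<close> with
  smaller degree.\<close>

lemma lead_determines:
  assumes D: "submod R Ab D" and N: "submod R Ab N" "N \<subseteq> D" and le: "\<And>n. lead n D \<subseteq> lead n N"
    and DAb: "D \<subseteq> Ab"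
  shows "D \<subseteq> N"
proof -
  have "x \<in> N" if "x \<in> D" "x \<in> p n" for x n
    using that
  proof (induction n arbitrary: x)
    case 0 then show ?case using N unfolding submod_def by simp
  next
    case (Suc n)
    obtain a y where x: "a \<in> A" "y \<in> p n" "x = a \<otimes> b [^] n \<oplus> y" using Suc.prems(2) by (rule p_Suc_E)
    have "a \<in> lead n D" unfolding lead_def using x Suc.prems(1) by blast
    then have "a \<in> lead n N" using le by blast
    then obtain z where z: "z \<in> p n" "a \<otimes> b [^] n \<oplus> z \<in> N" unfolding lead_def by blast
    let ?t = "a \<otimes> b [^] n"
    have c: "?t \<in> carrier R" "y \<in> carrier R" "z \<in> carrier R"
      using A_car[OF x(1)] bn p_car x(2) z(1) by auto
    have "y \<oplus> \<ominus> z = x \<oplus> \<ominus> (?t \<oplus> z)"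
    proof -
      have "x \<oplus> \<ominus> (?t \<oplus> z) = (?t \<oplus> \<ominus> ?t) \<oplus> (y \<oplus> \<ominus> z)"
        unfolding x(3) minus_add[OF c(1,3)] using c a_inv_closed by (simp add: a_ac del: r_neg)
      then show ?thesis using c by (simp add: r_neg)
    qed
    moreover have "x \<oplus> \<ominus> (?t \<oplus> z) \<in> D"
      using Suc.prems(1) submod_minus[OF D] z(2) N(2) D unfolding submod_def by blast
    moreover have "y \<oplus> \<ominus> z \<in> p n"
    proof -
      have "\<ominus> z = (\<ominus> \<one>) \<otimes> z" using c by (simp add: l_minus)
      then have "\<ominus> z \<in> p n" using p_scale[OF z(1) subringE(5)[OF A subringE(3)[OF A]]] by simp
      then show ?thesis using p_add x(2) by blast
    qed
    ultimately have "y \<oplus> \<ominus> z \<in> N" using Suc.IH by simp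
    then have "(?t \<oplus> z) \<oplus> (y \<oplus> \<ominus> z) \<in> N" using z(2) N(1) unfolding submod_def by blast
    moreover have "(?t \<oplus> z) \<oplus> (y \<oplus> \<ominus> z) = x"
    proof -
      have "(?t \<oplus> z) \<oplus> (y \<oplus> \<ominus> z) = (?t \<oplus> y) \<oplus> (z \<oplus> \<ominus> z)"
        using c a_inv_closed by (simp add: a_ac del: r_neg)
      then show ?thesis unfolding x(3) using c by (simp add: r_neg)
    qed
    ultimately show ?case by simp
  qed
  then show ?thesis using DAb unfolding Ab_def by blast
qed

text \<open>The modules of leading coefficients increase with \<open>n\<close>, and their union
  \<open>L\<close> is finitely generated, so it is reached at some \<open>n0\<close>. Lifts to
  \<open>D\<close> of generators of the finitely many modules up to \<open>n0\<close> then generate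
  \<open>D\<close>.\<close>

lemma noetherian_extension:
  assumes noeth: "noetherian_subring R A"
  shows "noetherian_subring R Ab"
  unfolding noetherian_subring_def
proof (intro allI impI, elim conjE)
  fix D assume D: "submod R Ab D" and DAb: "D \<subseteq> Ab"
  have lead_le: "m \<le> n \<Longrightarrow> lead m N \<subseteq> lead n N" if "submod R Ab N" for m n N
    by (rule lift_Suc_mono_le[of "\<lambda>n. lead n N"]) (use lead_Suc[OF that] in blast)
  have leadA: "lead n D \<subseteq> A" for n unfolding lead_def by blast
  have gen: "\<exists>E. finite E \<and> E \<subseteq> L \<and> (\<forall>M. submod R A M \<and> E \<subseteq> M \<longrightarrow> L \<subseteq> M)"
    if "submod R A L" "L \<subseteq> A" for L
    using noeth that unfolding noetherian_subring_def by blast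
  define L where "L = (\<Union>n. lead n D)"
  have "submod R A L"
    unfolding submod_def
  proof (intro conjI ballI)
    show "L \<subseteq> carrier R" "\<zero> \<in> L" using lead_submod[OF D] unfolding L_def submod_def by blast+
    show "c \<otimes> x \<in> L" if "c \<in> A" "x \<in> L" for c x
      using that lead_submod[OF D] unfolding L_def submod_def by blast
    fix x y assume "x \<in> L" "y \<in> L"
    then obtain m n where "x \<in> lead m D" "y \<in> lead n D" unfolding L_def by blast
    then have "x \<in> lead (max m n) D" "y \<in> lead (max m n) D"
      using lead_le[OF D, of m "max m n"] lead_le[OF D, of n "max m n"] by auto
    then show "x \<oplus> y \<in> L" using lead_submod[OF D] unfolding L_def submod_def by blast
  qed
  moreover have "L \<subseteq> A" unfolding L_def using leadA by blast
  ultimately have "\<exists>E. finite E \<and> E \<subseteq> L \<and> (\<forall>M. submod R A M \<and> E \<subseteq> M \<longrightarrow> L \<subseteq> M)" by (rule gen)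
  then obtain E where E: "finite E" "E \<subseteq> L"
    and E_gen: "\<forall>M. submod R A M \<and> E \<subseteq> M \<longrightarrow> L \<subseteq> M" by (elim exE conjE)
  obtain n0 where n0: "E \<subseteq> lead n0 D"
  proof -
    have "\<exists>n. \<forall>e\<in>E. e \<in> lead n D"
      using E(1,2)
    proof (induction E)
      case (insert e E)
      then obtain m n where "\<forall>e\<in>E. e \<in> lead n D" "e \<in> lead m D" unfolding L_def by blast
      then show ?case
        using lead_le[OF D, of m "max m n"] lead_le[OF D, of n "max m n"]
        by (intro exI[of _ "max m n"]) auto
    qed simp
    then show thesis using that by blast
  qed
  have "\<exists>E. finite E \<and> E \<subseteq> lead n D \<and> (\<forall>M. submod R A M \<and> E \<subseteq> M \<longrightarrow> lead n D \<subseteq> M)" for n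
    using gen[OF lead_submod[OF D] leadA] .
  then have "\<exists>E'. \<forall>n. finite (E' n) \<and> E' n \<subseteq> lead n D \<and>
      (\<forall>M. submod R A M \<and> E' n \<subseteq> M \<longrightarrow> lead n D \<subseteq> M)" by (intro choice allI)
  then obtain E' where E'_all: "\<forall>n. finite (E' n) \<and> E' n \<subseteq> lead n D \<and>
      (\<forall>M. submod R A M \<and> E' n \<subseteq> M \<longrightarrow> lead n D \<subseteq> M)" ..
  have E': "finite (E' n)" "E' n \<subseteq> lead n D" "submod R A M \<Longrightarrow> E' n \<subseteq> M \<Longrightarrow> lead n D \<subseteq> M" for n M
    using spec[OF E'_all, of n] by simp_all
  \<comment> \<open>A lift of the leading coefficient \<open>e\<close>: an element of
    \<open>D\<close> of degree at most \<open>n\<close> whose leading coefficient is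
    \<open>e\<close>.\<close>
  define d where "d n e = (SOME d. d \<in> D \<and> (\<exists>y\<in>p n. d = e \<otimes> b [^] n \<oplus> y))" for n :: nat and e
  have d: "d n e \<in> D \<and> (\<exists>y\<in>p n. d n e = e \<otimes> b [^] n \<oplus> y)" if e: "e \<in> E' n" for n e
  proof -
    have "e \<in> lead n D" using e E'(2) by blast
    then have "\<exists>d. d \<in> D \<and> (\<exists>y\<in>p n. d = e \<otimes> b [^] n \<oplus> y)" unfolding lead_def by blast
    then show ?thesis unfolding d_def by (rule someI_ex)
  qed
  define Fin where "Fin = (\<Union>n\<le>n0. d n ` E' n)"
  have "finite Fin" unfolding Fin_def using E'(1) by simp
  moreover have "Fin \<subseteq> D" unfolding Fin_def using d by blast
  moreover have "D \<subseteq> M" if M: "submod R Ab M" "Fin \<subseteq> M" for M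
  proof -
    have N: "submod R Ab (M \<inter> D)" using submod_Int M D by blast
    have small: "lead n D \<subseteq> lead n (M \<inter> D)" if n: "n \<le> n0" for n
    proof (rule E'(3)[OF lead_submod[OF N]])
      show "E' n \<subseteq> lead n (M \<inter> D)"
      proof
        fix e assume e: "e \<in> E' n"
        obtain y where y: "y \<in> p n" "d n e = e \<otimes> b [^] n \<oplus> y" using d[OF e] by blast
        have "d n e \<in> M" using M(2) e n unfolding Fin_def by blast
        then have "e \<otimes> b [^] n \<oplus> y \<in> M \<inter> D" using d[OF e] y(2) by simp
        moreover have "e \<in> A" using e E'(2) leadA by blast
        ultimately show "e \<in> lead n (M \<inter> D)" unfolding lead_def using y(1) by blast
      qed
    qed
    have "lead n D \<subseteq> lead n (M \<inter> D)" for n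
    proof (cases "n \<le> n0")
      case True then show ?thesis by (rule small)
    next
      case False
      \<comment> \<open>Beyond \<open>n0\<close> no further generators are required, as those of
        \<open>L\<close> already occur at \<open>n0\<close> and persist upwards.\<close>
      then have "E \<subseteq> lead n (M \<inter> D)" using n0 small[of n0] lead_le[OF N, of n0 n] by auto
      then have "L \<subseteq> lead n (M \<inter> D)" using E_gen lead_submod[OF N] by simp
      then show ?thesis unfolding L_def by blast
    qed
    then have "D \<subseteq> M \<inter> D" by (intro lead_determines[OF D N _ _ DAb]) auto
    then show ?thesis by blast
  qed
  ultimately show "\<exists>E. finite E \<and> E \<subseteq> D \<and> (\<forall>M. submod R Ab M \<and> E \<subseteq> M \<longrightarrow> D \<subseteq> M)" by blast
qed

end

lemma (in domain) subfield_noetherian: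
  assumes K: "subfield K R" shows "noetherian_subring R K"
  unfolding noetherian_subring_def
proof (intro allI impI, elim conjE)
  fix D assume D: "submod R K D" and DK: "D \<subseteq> K"
  show "\<exists>E. finite E \<and> E \<subseteq> D \<and> (\<forall>M. submod R K M \<and> E \<subseteq> M \<longrightarrow> D \<subseteq> M)"
  proof (cases "D \<subseteq> {\<zero>}")
    case True then show ?thesis by (intro exI[of _ "{}"]) (auto simp: submod_def)
  next
    case False
    then obtain d where d: "d \<in> D" "d \<noteq> \<zero>" by blast
    have dK: "d \<in> K - {\<zero>}" using d DK by blast
    have i: "inv d \<in> K" "inv d \<otimes> d = \<one>" using subfield_m_inv[OF K dK] by auto
    have Kc: "K \<subseteq> carrier R" using subfieldE(3)[OF K] .
    have "D \<subseteq> M" if M: "submod R K M" "d \<in> M" for M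
    proof
      fix x assume "x \<in> D"
      then have x: "x \<in> K" using DK by blast
      have "x \<otimes> inv d \<in> K" using subringE(6)[OF subfieldE(1)[OF K] x i(1)] .
      then have "x \<otimes> inv d \<otimes> d \<in> M" using M unfolding submod_def by blast
      moreover have "x \<otimes> inv d \<otimes> d = x" using x i Kc dK m_assoc[of x "inv d" d] by auto
      ultimately show "x \<in> M" by simp
    qed
    then show ?thesis using d by (intro exI[of _ "{d}"]) auto
  qed
qed

text \<open>The generators are adjoined to \<open>K\<close> one at a time; the noetherian subring
  finally obtained contains all of them and so is the whole ring, and its submodules are the
  ideals.\<close>

lemma (in domain) finitely_generated_algebra_noetherian:
  assumes K: "subfield K R" and B: "finite B" "B \<subseteq> carrier R" and gen: "generate_ring R (K \<union> B) = carrier R"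
  shows "noeth_domain R"
proof -
  have "\<exists>A. subring A R \<and> K \<union> B \<subseteq> A \<and> noetherian_subring R A"
    using B
  proof (induction B)
    case empty
    then show ?case using subfieldE(1)[OF K] subfield_noetherian[OF K] by auto
  next
    case (insert b B)
    then obtain A where A: "subring A R" "K \<union> B \<subseteq> A" "noetherian_subring R A" by auto
    have bc: "b \<in> carrier R" using insert.prems by simp
    interpret E: subring_extension R A b
      by (intro subring_extension.intro subring_extension_axioms.intro is_cring A(1) bc)
    have "K \<union> insert b B \<subseteq> E.Ab" using E.A_Ab E.b_Ab A(2) by blast
    then show ?case using E.subring_Ab E.noetherian_extension[OF A(3)] by blast
  qed
  then obtain A where A: "subring A R" "K \<union> B \<subseteq> A" "noetherian_subring R A" by blast
  have "K \<union> B \<subseteq> carrier R" using A subringE(1) by blast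
  then have Ac: "A = carrier R"
    using generate_ring_min_subring1[OF _ A(1,2)] gen subringE(1)[OF A(1)] by auto
  show ?thesis
  proof (intro noeth_domain.intro noeth_domain_axioms.intro domain_axioms)
    have sub: "submod R (carrier R) J" if "ideal J R" for J
      unfolding submod_def
      using ideal.Icarr[OF that] additive_subgroup.zero_closed[OF ideal.axioms(1)[OF that]]
        additive_subgroup.a_closed[OF ideal.axioms(1)[OF that]] ideal.I_l_closed[OF that] by auto
    fix I assume I: "ideal I R"
    have Ic: "I \<subseteq> carrier R" using ideal.Icarr[OF I] by auto
    have "\<exists>E. finite E \<and> E \<subseteq> I \<and> (\<forall>M. submod R (carrier R) M \<and> E \<subseteq> M \<longrightarrow> I \<subseteq> M)"
      using A(3)[unfolded noetherian_subring_def Ac, rule_format, OF conjI[OF sub[OF I] Ic]] .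
    then obtain E where E: "finite E" "E \<subseteq> I"
      and E_gen: "\<forall>M. submod R (carrier R) M \<and> E \<subseteq> M \<longrightarrow> I \<subseteq> M" by (elim exE conjE)
    have Ec: "E \<subseteq> carrier R" using E(2) ideal.Icarr[OF I] by auto
    have "I \<subseteq> Idl E" using E_gen sub[OF genideal_ideal[OF Ec]] genideal_self[OF Ec] by simp
    moreover have "Idl E \<subseteq> I" using genideal_minimal[OF I E(2)] .
    ultimately show "\<exists>A\<subseteq>carrier R. finite A \<and> I = Idl A" using Ec E(1) by blast
  qed
qed

section \<open>Localizations\<close>

locale mult_subset = cring R for R (structure) +
  fixes T
  assumes T_car: "T \<subseteq> carrier R" and T_one: "\<one> \<in> T"
    and T_mult: "s \<in> T \<Longrightarrow> t \<in> T \<Longrightarrow> s \<otimes> t \<in> T"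
begin

abbreviation "Fr \<equiv> fraction R T"
abbreviation "Lo \<equiv> localization R T"

lemma Tc: "t \<in> T \<Longrightarrow> t \<in> carrier R" using T_car by auto

lemma fraction_iff:
  assumes "a \<in> carrier R" "s \<in> T"
  shows "(b, t) \<in> Fr a s \<longleftrightarrow> b \<in> carrier R \<and> t \<in> T \<and> (\<exists>u\<in>T. u \<otimes> (t \<otimes> a) = u \<otimes> (s \<otimes> b))"
proof -
  have "u \<otimes> (t \<otimes> a \<ominus> s \<otimes> b) = \<zero> \<longleftrightarrow> u \<otimes> (t \<otimes> a) = u \<otimes> (s \<otimes> b)"
    if "b \<in> carrier R" "t \<in> T" "u \<in> T" for u
  proof -
    have c: "t \<otimes> a \<in> carrier R" "s \<otimes> b \<in> carrier R" "u \<in> carrier R" using that assms Tc by auto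
    have "u \<otimes> (t \<otimes> a \<ominus> s \<otimes> b) = u \<otimes> (t \<otimes> a) \<ominus> u \<otimes> (s \<otimes> b)"
      unfolding minus_eq using c by (simp add: r_distr r_minus)
    then show ?thesis using c by simp
  qed
  then show ?thesis unfolding fraction_def by auto
qed

lemma fraction_self: "a \<in> carrier R \<Longrightarrow> s \<in> T \<Longrightarrow> (a, s) \<in> Fr a s"
  using fraction_iff T_one by auto

lemma fraction_subset:
  assumes a: "a \<in> carrier R" "s \<in> T" and b: "b \<in> carrier R" "t \<in> T"
    and u: "u \<in> T" "u \<otimes> (t \<otimes> a) = u \<otimes> (s \<otimes> b)"
  shows "Fr a s \<subseteq> Fr b t"
proof
  fix x assume x: "x \<in> Fr a s"
  obtain c r where x_eq: "x = (c, r)" by fastforce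
  then obtain v where c: "c \<in> carrier R" "r \<in> T" "v \<in> T" "v \<otimes> (r \<otimes> a) = v \<otimes> (s \<otimes> c)"
    using x fraction_iff[OF a] by auto
  have k: "s \<in> carrier R" "t \<in> carrier R" "u \<in> carrier R" "r \<in> carrier R" "v \<in> carrier R"
    using a b u c Tc by auto
  have "u \<otimes> v \<otimes> s \<otimes> (r \<otimes> b) = (v \<otimes> r) \<otimes> (u \<otimes> (s \<otimes> b))" using k b(1) by (simp add: m_ac)
  also have "\<dots> = (u \<otimes> t) \<otimes> (v \<otimes> (r \<otimes> a))" unfolding u(2)[symmetric] using k a(1) by (simp add: m_ac)
  also have "\<dots> = u \<otimes> v \<otimes> s \<otimes> (t \<otimes> c)" unfolding c(4) using k c(1) by (simp add: m_ac)
  finally have "u \<otimes> v \<otimes> s \<otimes> (r \<otimes> b) = u \<otimes> v \<otimes> s \<otimes> (t \<otimes> c)" .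
  moreover have "u \<otimes> v \<otimes> s \<in> T" using T_mult u c a by simp
  ultimately show "x \<in> Fr b t" unfolding x_eq using fraction_iff[OF b] c(1,2) by blast
qed

lemma fraction_eqI:
  assumes "a \<in> carrier R" "s \<in> T" "b \<in> carrier R" "t \<in> T"
    and "u \<in> T" "u \<otimes> (t \<otimes> a) = u \<otimes> (s \<otimes> b)"
  shows "Fr a s = Fr b t"
  using fraction_subset[OF assms] fraction_subset[OF assms(3,4,1,2,5) assms(6)[symmetric]] by blast

lemma fraction_eqD:
  assumes "a \<in> carrier R" "s \<in> T" "b \<in> carrier R" "t \<in> T" "Fr a s = Fr b t"
  shows "\<exists>u\<in>T. u \<otimes> (t \<otimes> a) = u \<otimes> (s \<otimes> b)"
proof -
  have "(b, t) \<in> Fr a s" using fraction_self[OF assms(3,4)] assms(5) by simp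
  then show ?thesis using fraction_iff[OF assms(1,2)] by simp
qed

lemma carrier_iff: "x \<in> carrier Lo \<longleftrightarrow> (\<exists>a\<in>carrier R. \<exists>s\<in>T. x = Fr a s)"
  by (auto simp: localization_def)

lemma fraction_carrier: "a \<in> carrier R \<Longrightarrow> s \<in> T \<Longrightarrow> Fr a s \<in> carrier Lo"
  using carrier_iff by blast

lemma one_eq: "\<one>\<^bsub>Lo\<^esub> = Fr \<one> \<one>" and zero_eq: "\<zero>\<^bsub>Lo\<^esub> = Fr \<zero> \<one>"
  by (simp_all add: localization_def)

text \<open>The operations of \<open>localization\<close> are unions over all representatives;
  independence of the representative makes such a union collapse to one value.\<close>

lemma Union_const:
  assumes "(a, s) \<in> x" "(b, t) \<in> y"
    and "\<And>a' s' b' t'. (a', s') \<in> x \<Longrightarrow> (b', t') \<in> y \<Longrightarrow> f a' s' b' t' = c"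
  shows "(\<Union>(a, s)\<in>x. \<Union>(b, t)\<in>y. f a s b t) = c"
  using assms by fast

lemma mult_eq:
  assumes a: "a \<in> carrier R" "s \<in> T" and b: "b \<in> carrier R" "t \<in> T"
  shows "Fr a s \<otimes>\<^bsub>Lo\<^esub> Fr b t = Fr (a \<otimes> b) (s \<otimes> t)"
proof -
  have "(\<Union>(a', s')\<in>Fr a s. \<Union>(b', t')\<in>Fr b t. Fr (a' \<otimes> b') (s' \<otimes> t')) = Fr (a \<otimes> b) (s \<otimes> t)"
  proof (rule Union_const[OF fraction_self[OF a] fraction_self[OF b]])
    fix a' s' b' t' assume "(a', s') \<in> Fr a s" "(b', t') \<in> Fr b t"
    then obtain u v where a': "a' \<in> carrier R" "s' \<in> T" "u \<in> T" "u \<otimes> (s' \<otimes> a) = u \<otimes> (s \<otimes> a')"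
      and b': "b' \<in> carrier R" "t' \<in> T" "v \<in> T" "v \<otimes> (t' \<otimes> b) = v \<otimes> (t \<otimes> b')"
      using fraction_iff a b by auto
    have k: "s \<in> carrier R" "t \<in> carrier R" "u \<in> carrier R" "s' \<in> carrier R" "t' \<in> carrier R" "v \<in> carrier R"
      using a b a' b' Tc by auto
    have "u \<otimes> v \<otimes> (s \<otimes> t \<otimes> (a' \<otimes> b')) = (u \<otimes> (s \<otimes> a')) \<otimes> (v \<otimes> (t \<otimes> b'))"
      using k a'(1) b'(1) by (simp add: m_ac)
    also have "\<dots> = u \<otimes> v \<otimes> (s' \<otimes> t' \<otimes> (a \<otimes> b))"
      unfolding a'(4)[symmetric] b'(4)[symmetric] using k a(1) b(1) by (simp add: m_ac)
    finally show "Fr (a' \<otimes> b') (s' \<otimes> t') = Fr (a \<otimes> b) (s \<otimes> t)"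
      using a a' b b' T_mult by (intro fraction_eqI[of _ _ _ _ "u \<otimes> v"]) auto
  qed
  then show ?thesis by (simp add: localization_def)
qed

lemma add_eq:
  assumes a: "a \<in> carrier R" "s \<in> T" and b: "b \<in> carrier R" "t \<in> T"
  shows "Fr a s \<oplus>\<^bsub>Lo\<^esub> Fr b t = Fr (t \<otimes> a \<oplus> s \<otimes> b) (s \<otimes> t)"
proof -
  have "(\<Union>(a', s')\<in>Fr a s. \<Union>(b', t')\<in>Fr b t. Fr (t' \<otimes> a' \<oplus> s' \<otimes> b') (s' \<otimes> t')) = Fr (t \<otimes> a \<oplus> s \<otimes> b) (s \<otimes> t)"
  proof (rule Union_const[OF fraction_self[OF a] fraction_self[OF b]])
    fix a' s' b' t' assume "(a', s') \<in> Fr a s" "(b', t') \<in> Fr b t"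
    then obtain u v where a': "a' \<in> carrier R" "s' \<in> T" "u \<in> T" "u \<otimes> (s' \<otimes> a) = u \<otimes> (s \<otimes> a')"
      and b': "b' \<in> carrier R" "t' \<in> T" "v \<in> T" "v \<otimes> (t' \<otimes> b) = v \<otimes> (t \<otimes> b')"
      using fraction_iff a b by auto
    have k: "s \<in> carrier R" "t \<in> carrier R" "u \<in> carrier R" "s' \<in> carrier R" "t' \<in> carrier R" "v \<in> carrier R"
      using a b a' b' Tc by auto
    have "u \<otimes> v \<otimes> (s \<otimes> t \<otimes> (t' \<otimes> a' \<oplus> s' \<otimes> b')) =
      (v \<otimes> t \<otimes> t') \<otimes> (u \<otimes> (s \<otimes> a')) \<oplus> (u \<otimes> s \<otimes> s') \<otimes> (v \<otimes> (t \<otimes> b'))"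
      using k a'(1) b'(1) by (simp add: r_distr m_ac)
    also have "\<dots> = u \<otimes> v \<otimes> (s' \<otimes> t' \<otimes> (t \<otimes> a \<oplus> s \<otimes> b))"
      unfolding a'(4)[symmetric] b'(4)[symmetric] using k a(1) b(1) by (simp add: r_distr m_ac)
    finally show "Fr (t' \<otimes> a' \<oplus> s' \<otimes> b') (s' \<otimes> t') = Fr (t \<otimes> a \<oplus> s \<otimes> b) (s \<otimes> t)"
      using a a' b b' k T_mult by (intro fraction_eqI[of _ _ _ _ "u \<otimes> v"]) auto
  qed
  then show ?thesis by (simp add: localization_def)
qed

lemma fraction_eq_direct:
  assumes "a \<in> carrier R" "s \<in> T" "b \<in> carrier R" "t \<in> T" "t \<otimes> a = s \<otimes> b"
  shows "Fr a s = Fr b t"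
  using fraction_eqI[OF assms(1-4) T_one] assms(5) by simp

lemma localization_cring: "cring Lo"
proof (rule cringI)
  show "abelian_group Lo"
  proof (rule abelian_groupI)
    fix x y assume "x \<in> carrier Lo" "y \<in> carrier Lo"
    then obtain a s b t where 1: "a \<in> carrier R" "s \<in> T" "b \<in> carrier R" "t \<in> T"
      and x: "x = Fr a s" "y = Fr b t" unfolding carrier_iff by blast
    note c = 1 Tc[OF 1(2)] Tc[OF 1(4)]
    show "x \<oplus>\<^bsub>Lo\<^esub> y \<in> carrier Lo"
      unfolding x add_eq[OF 1] using c T_mult by (intro fraction_carrier) auto
    show "x \<oplus>\<^bsub>Lo\<^esub> y = y \<oplus>\<^bsub>Lo\<^esub> x"
      unfolding x add_eq[OF 1] add_eq[OF 1(3,4,1,2)] using c by (simp add: a_comm m_comm)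
    fix z assume "z \<in> carrier Lo"
    then obtain d r where 2: "d \<in> carrier R" "r \<in> T" and z: "z = Fr d r" unfolding carrier_iff by blast
    have st: "t \<otimes> a \<oplus> s \<otimes> b \<in> carrier R" "s \<otimes> t \<in> T" "r \<otimes> b \<oplus> t \<otimes> d \<in> carrier R" "t \<otimes> r \<in> T"
      using c 2 Tc[OF 2(2)] T_mult by auto
    show "x \<oplus>\<^bsub>Lo\<^esub> y \<oplus>\<^bsub>Lo\<^esub> z = x \<oplus>\<^bsub>Lo\<^esub> (y \<oplus>\<^bsub>Lo\<^esub> z)"
      unfolding x z add_eq[OF 1] add_eq[OF 1(3,4) 2] add_eq[OF st(1,2) 2] add_eq[OF 1(1,2) st(3,4)]
      using c 2 Tc[OF 2(2)] by (simp add: r_distr m_ac a_ac)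
  next
    show "\<zero>\<^bsub>Lo\<^esub> \<in> carrier Lo" unfolding zero_eq using T_one by (intro fraction_carrier) auto
    fix x assume "x \<in> carrier Lo"
    then obtain a s where 1: "a \<in> carrier R" "s \<in> T" and x: "x = Fr a s" unfolding carrier_iff by blast
    note c = 1 Tc[OF 1(2)]
    show "\<zero>\<^bsub>Lo\<^esub> \<oplus>\<^bsub>Lo\<^esub> x = x" unfolding x zero_eq add_eq[OF zero_closed T_one 1] using c by simp
    have "Fr (\<ominus> a) s \<oplus>\<^bsub>Lo\<^esub> x = Fr (s \<otimes> \<ominus> a \<oplus> s \<otimes> a) (s \<otimes> s)"
      unfolding x by (rule add_eq) (use c in auto)
    also have "\<dots> = \<zero>\<^bsub>Lo\<^esub>" unfolding zero_eq
      by (rule fraction_eq_direct) (use c T_mult T_one in \<open>auto simp: r_minus l_neg\<close>)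
    finally show "\<exists>y\<in>carrier Lo. y \<oplus>\<^bsub>Lo\<^esub> x = \<zero>\<^bsub>Lo\<^esub>" using fraction_carrier[of "\<ominus> a" s] c by blast
  qed
next
  show "Group.comm_monoid Lo"
  proof (rule comm_monoidI)
    show "\<one>\<^bsub>Lo\<^esub> \<in> carrier Lo" unfolding one_eq using T_one by (intro fraction_carrier) auto
    fix x y assume "x \<in> carrier Lo" "y \<in> carrier Lo"
    then obtain a s b t where 1: "a \<in> carrier R" "s \<in> T" "b \<in> carrier R" "t \<in> T"
      and x: "x = Fr a s" "y = Fr b t" unfolding carrier_iff by blast
    note c = 1 Tc[OF 1(2)] Tc[OF 1(4)]
    show "x \<otimes>\<^bsub>Lo\<^esub> y \<in> carrier Lo"
      unfolding x mult_eq[OF 1] using c T_mult by (intro fraction_carrier) auto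
    show "x \<otimes>\<^bsub>Lo\<^esub> y = y \<otimes>\<^bsub>Lo\<^esub> x"
      unfolding x mult_eq[OF 1] mult_eq[OF 1(3,4,1,2)] using c by (simp add: m_comm)
    show "\<one>\<^bsub>Lo\<^esub> \<otimes>\<^bsub>Lo\<^esub> x = x" unfolding x one_eq mult_eq[OF one_closed T_one 1(1,2)] using c by simp
    fix z assume "z \<in> carrier Lo"
    then obtain d r where 2: "d \<in> carrier R" "r \<in> T" and z: "z = Fr d r" unfolding carrier_iff by blast
    have st: "a \<otimes> b \<in> carrier R" "s \<otimes> t \<in> T" "b \<otimes> d \<in> carrier R" "t \<otimes> r \<in> T"
      using c 2 T_mult by auto
    show "x \<otimes>\<^bsub>Lo\<^esub> y \<otimes>\<^bsub>Lo\<^esub> z = x \<otimes>\<^bsub>Lo\<^esub> (y \<otimes>\<^bsub>Lo\<^esub> z)"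
      unfolding x z mult_eq[OF 1] mult_eq[OF 1(3,4) 2] mult_eq[OF st(1,2) 2] mult_eq[OF 1(1,2) st(3,4)]
      using c 2 Tc[OF 2(2)] by (simp add: m_assoc)
  qed
next
  fix x y z assume "x \<in> carrier Lo" "y \<in> carrier Lo" "z \<in> carrier Lo"
  then obtain a s b t d r where 1: "a \<in> carrier R" "s \<in> T" "b \<in> carrier R" "t \<in> T" and 2: "d \<in> carrier R" "r \<in> T"
    and x: "x = Fr a s" "y = Fr b t" "z = Fr d r" unfolding carrier_iff by blast
  note c = 1 2 Tc[OF 1(2)] Tc[OF 1(4)] Tc[OF 2(2)]
  have st: "t \<otimes> a \<oplus> s \<otimes> b \<in> carrier R" "s \<otimes> t \<in> T" using c T_mult by auto
  have sr: "a \<otimes> d \<in> carrier R" "s \<otimes> r \<in> T" "b \<otimes> d \<in> carrier R" "t \<otimes> r \<in> T" using c T_mult by auto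
  show "(x \<oplus>\<^bsub>Lo\<^esub> y) \<otimes>\<^bsub>Lo\<^esub> z = x \<otimes>\<^bsub>Lo\<^esub> z \<oplus>\<^bsub>Lo\<^esub> y \<otimes>\<^bsub>Lo\<^esub> z"
    unfolding x add_eq[OF 1] mult_eq[OF st 2] mult_eq[OF 1(1,2) 2] mult_eq[OF 1(3,4) 2] add_eq[OF sr]
    by (rule fraction_eq_direct) (use c T_mult in \<open>auto simp: r_distr l_distr m_ac\<close>)
qed

end

section \<open>The fraction field\<close>

lemma (in ring_hom_cring) hom_power: "x \<in> carrier R \<Longrightarrow> h (x [^] (n::nat)) = h x [^]\<^bsub>S\<^esub> n"
  by (induction n) auto

context domain
begin

lemma fractions_mult_subset: "mult_subset R (carrier R - {\<zero>})"
  by unfold_locales (auto simp: integral_iff)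

lemma fraction_field_field: "field (fraction_field R)"
proof -
  interpret T: mult_subset R "carrier R - {\<zero>}" by (rule fractions_mult_subset)
  interpret L: cring "fraction_field R" unfolding fraction_field_def by (rule T.localization_cring)
  show ?thesis
  proof (rule L.cring_fieldI2)
    show "\<zero>\<^bsub>fraction_field R\<^esub> \<noteq> \<one>\<^bsub>fraction_field R\<^esub>"
    proof
      assume "\<zero>\<^bsub>fraction_field R\<^esub> = \<one>\<^bsub>fraction_field R\<^esub>"
      then have "T.Fr \<zero> \<one> = T.Fr \<one> \<one>" unfolding fraction_field_def T.zero_eq T.one_eq .
      then have "\<exists>u\<in>carrier R - {\<zero>}. u \<otimes> (\<one> \<otimes> \<zero>) = u \<otimes> (\<one> \<otimes> \<one>)"
        by (intro T.fraction_eqD) auto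
      then show False by auto
    qed
    fix x assume x: "x \<in> carrier (fraction_field R)" "x \<noteq> \<zero>\<^bsub>fraction_field R\<^esub>"
    then obtain a s where a: "a \<in> carrier R" "s \<in> carrier R - {\<zero>}" "x = T.Fr a s"
      unfolding fraction_field_def T.carrier_iff by blast
    have "a \<noteq> \<zero>"
    proof
      assume "a = \<zero>"
      then have "x = T.Fr \<zero> \<one>" unfolding a(3) using a(2) by (intro T.fraction_eq_direct) auto
      then show False using x(2) unfolding fraction_field_def T.zero_eq by simp
    qed
    then have as: "a \<in> carrier R - {\<zero>}" "s \<in> carrier R" using a by auto
    have "x \<otimes>\<^bsub>fraction_field R\<^esub> T.Fr s a = T.Fr (a \<otimes> s) (s \<otimes> a)"
      unfolding a(3) fraction_field_def by (rule T.mult_eq[OF a(1,2) as(2,1)])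
    also have "\<dots> = T.Fr \<one> \<one>"
      using a as by (intro T.fraction_eq_direct) (auto simp: m_comm integral_iff)
    finally have "x \<otimes>\<^bsub>fraction_field R\<^esub> T.Fr s a = \<one>\<^bsub>fraction_field R\<^esub>"
      unfolding fraction_field_def T.one_eq .
    moreover have "T.Fr s a \<in> carrier (fraction_field R)"
      unfolding fraction_field_def by (rule T.fraction_carrier[OF as(2,1)])
    ultimately show "\<exists>y\<in>carrier (fraction_field R). x \<otimes>\<^bsub>fraction_field R\<^esub> y = \<one>\<^bsub>fraction_field R\<^esub>" by blast
  qed
qed

lemma to_fraction_field_hom: "to_fraction_field R \<in> ring_hom R (fraction_field R)"
proof -
  interpret T: mult_subset R "carrier R - {\<zero>}" by (rule fractions_mult_subset)
  have one: "\<one> \<in> carrier R - {\<zero>}" by simp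
  show ?thesis
  proof (rule ring_hom_memI)
    fix a b assume a: "a \<in> carrier R" and b: "b \<in> carrier R"
    show "to_fraction_field R a \<in> carrier (fraction_field R)"
      unfolding to_fraction_field_def fraction_field_def by (rule T.fraction_carrier[OF a one])
    show "to_fraction_field R (a \<otimes> b) = to_fraction_field R a \<otimes>\<^bsub>fraction_field R\<^esub> to_fraction_field R b"
      unfolding to_fraction_field_def fraction_field_def T.mult_eq[OF a one b one] by simp
    show "to_fraction_field R (a \<oplus> b) = to_fraction_field R a \<oplus>\<^bsub>fraction_field R\<^esub> to_fraction_field R b"
      unfolding to_fraction_field_def fraction_field_def T.add_eq[OF a one b one] using a b by simp
  qed (simp add: to_fraction_field_def fraction_field_def T.one_eq)
qed

lemma to_fraction_field_inj: "inj_on (to_fraction_field R) (carrier R)"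
proof (rule inj_onI)
  interpret T: mult_subset R "carrier R - {\<zero>}" by (rule fractions_mult_subset)
  fix a b assume ab: "a \<in> carrier R" "b \<in> carrier R" "to_fraction_field R a = to_fraction_field R b"
  then have "T.Fr a \<one> = T.Fr b \<one>" by (simp add: to_fraction_field_def)
  then have "\<exists>u\<in>carrier R - {\<zero>}. u \<otimes> (\<one> \<otimes> a) = u \<otimes> (\<one> \<otimes> b)"
    using ab by (intro T.fraction_eqD) auto
  then show "a = b" using ab m_lcancel by auto
qed

text \<open>With \<open>y = b / a\<close>, all \<open>z n = p y^n\<close> lie in \<open>R\<close>.
  By the chain condition some \<open>z (Suc n)\<close> is a combination of the earlier ones, and
  cancelling \<open>p\<close> leaves a monic equation for \<open>y\<close>.\<close>

lemma integrally_closed_imp_power_bounded_closed: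
  assumes noeth: "noeth_domain R" and closed: "integrally_closed_domain R"
  shows "power_bounded_closed R"
  unfolding power_bounded_closed_def
proof (intro ballI impI, elim conjE)
  interpret noeth_domain R by fact
  define L where "L = fraction_field R"
  define \<iota> where "\<iota> = to_fraction_field R"
  interpret L: field L unfolding L_def by (rule fraction_field_field)
  interpret h: ring_hom_cring R L \<iota>
    unfolding L_def \<iota>_def
    using fraction_field_field to_fraction_field_hom
    by (intro ring_hom_cringI ring_hom_ringI2 ring_axioms is_cring) (auto intro: fieldE cring.axioms(1))
  have inj: "\<iota> x = \<iota> y \<longleftrightarrow> x = y" if "x \<in> carrier R" "y \<in> carrier R" for x y
    using inj_onD[OF to_fraction_field_inj] that unfolding \<iota>_def by blast
  have nz: "\<iota> x \<noteq> \<zero>\<^bsub>L\<^esub>" if "x \<in> carrier R" "x \<noteq> \<zero>" for x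
    using inj[OF that(1) zero_closed] that(2) by simp
  fix a b p
  assume a: "a \<in> carrier R" "a \<noteq> \<zero>" and b: "b \<in> carrier R" and p: "p \<in> carrier R" "p \<noteq> \<zero>"
    and pow: "\<forall>n::nat. b [^] n \<otimes> p \<in> PIdl (a [^] n)"
  define y where "y = \<iota> b \<otimes>\<^bsub>L\<^esub> inv\<^bsub>L\<^esub> (\<iota> a)"
  have ia: "\<iota> a \<in> Units L" using nz[OF a] a(1) by (simp add: L.field_Units)
  have ic: "inv\<^bsub>L\<^esub> (\<iota> a) \<in> carrier L" "\<iota> a \<otimes>\<^bsub>L\<^esub> inv\<^bsub>L\<^esub> (\<iota> a) = \<one>\<^bsub>L\<^esub>"
    using L.Units_inv_closed[OF ia] L.Units_r_inv[OF ia] .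
  have yc: "y \<in> carrier L" unfolding y_def using b ic by simp
  have ya: "\<iota> a \<otimes>\<^bsub>L\<^esub> y = \<iota> b"
    unfolding y_def using L.m_lcomm[of "\<iota> a" "\<iota> b" "inv\<^bsub>L\<^esub> (\<iota> a)"] a(1) b ic by simp
  have "\<exists>z. \<forall>n::nat. z n \<in> carrier R \<and> b [^] n \<otimes> p = z n \<otimes> a [^] n"
    using pow by (intro choice allI) (auto simp: PIdl_iff)
  then obtain z where z: "\<And>n. z n \<in> carrier R" "\<And>n::nat. b [^] n \<otimes> p = z n \<otimes> a [^] n" by blast
  have zy: "\<iota> (z n) = \<iota> p \<otimes>\<^bsub>L\<^esub> y [^]\<^bsub>L\<^esub> n" for n :: nat
  proof -
    have an: "\<iota> a [^]\<^bsub>L\<^esub> n \<in> carrier L" "\<iota> a [^]\<^bsub>L\<^esub> n \<noteq> \<zero>\<^bsub>L\<^esub>"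
      using a L.pow_nonzero[OF h.hom_closed[OF a(1)] nz[OF a]] by auto
    have "\<iota> a [^]\<^bsub>L\<^esub> n \<otimes>\<^bsub>L\<^esub> (\<iota> p \<otimes>\<^bsub>L\<^esub> y [^]\<^bsub>L\<^esub> n) = \<iota> p \<otimes>\<^bsub>L\<^esub> (\<iota> a \<otimes>\<^bsub>L\<^esub> y) [^]\<^bsub>L\<^esub> n"
      using a(1) p(1) yc by (simp add: L.nat_pow_distrib L.m_ac)
    also have "\<dots> = \<iota> (b [^] n \<otimes> p)"
      unfolding ya using b p(1) by (simp add: h.hom_power L.m_comm)
    also have "\<dots> = \<iota> a [^]\<^bsub>L\<^esub> n \<otimes>\<^bsub>L\<^esub> \<iota> (z n)"
      unfolding z(2) using z(1) a(1) by (simp add: h.hom_power L.m_comm)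
    finally show ?thesis
      by (rule L.cancel_left[symmetric]) (use an p(1) yc z(1) in auto)
  qed
  obtain n where n: "z (Suc n) \<in> Idl (z ` {..n})" using ideal_seq_stationary[of z] z(1) by blast
  define lin where "lin c = finsum L (\<lambda>i. \<iota> (c i) \<otimes>\<^bsub>L\<^esub> y [^]\<^bsub>L\<^esub> i) {..<Suc n}" for c :: "nat \<Rightarrow> 'a"
  have yi: "y [^]\<^bsub>L\<^esub> i \<in> carrier L" for i :: nat using yc by simp
  \<comment> \<open>The ring elements of the form \<open>p\<close> times a combination of the powers
    of \<open>y\<close> up to the \<open>n\<close>-th. This is an ideal containing
    \<open>z 0\<close>, ..., \<open>z n\<close>, so membership in the ideal they generate gives
    coefficients without any expansion of that ideal.\<close>
  define D where "D = {x \<in> carrier R. \<exists>c \<in> {..<Suc n} \<rightarrow> carrier R. \<iota> x = \<iota> p \<otimes>\<^bsub>L\<^esub> lin c}"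
  have linc: "lin c \<in> carrier L" if "c \<in> {..<Suc n} \<rightarrow> carrier R" for c
    unfolding lin_def using that yi by (intro L.finsum_closed) (auto simp: Pi_iff)
  have lin_scale: "\<iota> x \<otimes>\<^bsub>L\<^esub> lin c = lin (\<lambda>i. x \<otimes> c i)"
    if c: "c \<in> {..<Suc n} \<rightarrow> carrier R" and x: "x \<in> carrier R" for c x
  proof -
    have "\<iota> x \<otimes>\<^bsub>L\<^esub> lin c = finsum L (\<lambda>i. \<iota> x \<otimes>\<^bsub>L\<^esub> (\<iota> (c i) \<otimes>\<^bsub>L\<^esub> y [^]\<^bsub>L\<^esub> i)) {..<Suc n}"
      unfolding lin_def using c x yi by (intro L.finsum_rdistr) (auto simp: Pi_iff)
    also have "\<dots> = lin (\<lambda>i. x \<otimes> c i)"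
      unfolding lin_def using c x yi by (intro L.add.finprod_cong') (auto simp: Pi_iff L.m_assoc)
    finally show ?thesis .
  qed
  have lin_add: "lin c \<oplus>\<^bsub>L\<^esub> lin c' = lin (\<lambda>i. c i \<oplus> c' i)"
    if c: "c \<in> {..<Suc n} \<rightarrow> carrier R" and c': "c' \<in> {..<Suc n} \<rightarrow> carrier R" for c c'
  proof -
    have "lin c \<oplus>\<^bsub>L\<^esub> lin c' = finsum L (\<lambda>i. \<iota> (c i) \<otimes>\<^bsub>L\<^esub> y [^]\<^bsub>L\<^esub> i \<oplus>\<^bsub>L\<^esub> \<iota> (c' i) \<otimes>\<^bsub>L\<^esub> y [^]\<^bsub>L\<^esub> i) {..<Suc n}"
      unfolding lin_def using c c' yi by (intro L.finsum_addf[symmetric]) (auto simp: Pi_iff)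
    also have "\<dots> = lin (\<lambda>i. c i \<oplus> c' i)"
      unfolding lin_def using c c' yi by (intro L.add.finprod_cong') (auto simp: Pi_iff L.l_distr)
    finally show ?thesis .
  qed
  have scale_D: "r \<otimes> x \<in> D" if x: "x \<in> D" and r: "r \<in> carrier R" for x r
  proof -
    obtain c where c: "x \<in> carrier R" "c \<in> {..<Suc n} \<rightarrow> carrier R" "\<iota> x = \<iota> p \<otimes>\<^bsub>L\<^esub> lin c"
      using x unfolding D_def by blast
    have "\<iota> (r \<otimes> x) = \<iota> p \<otimes>\<^bsub>L\<^esub> (\<iota> r \<otimes>\<^bsub>L\<^esub> lin c)"
      using c(1) r p(1) linc[OF c(2)] by (simp add: c(3) L.m_lcomm)
    then have "\<iota> (r \<otimes> x) = \<iota> p \<otimes>\<^bsub>L\<^esub> lin (\<lambda>i. r \<otimes> c i)" unfolding lin_scale[OF c(2) r] .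
    moreover have "(\<lambda>i. r \<otimes> c i) \<in> {..<Suc n} \<rightarrow> carrier R" using c(2) r by auto
    ultimately show ?thesis unfolding D_def using c(1) r by blast
  qed
  have add_D: "x \<oplus> x' \<in> D" if x: "x \<in> D" and x': "x' \<in> D" for x x'
  proof -
    obtain c where c: "x \<in> carrier R" "c \<in> {..<Suc n} \<rightarrow> carrier R" "\<iota> x = \<iota> p \<otimes>\<^bsub>L\<^esub> lin c"
      using x unfolding D_def by blast
    obtain c' where c': "x' \<in> carrier R" "c' \<in> {..<Suc n} \<rightarrow> carrier R" "\<iota> x' = \<iota> p \<otimes>\<^bsub>L\<^esub> lin c'"
      using x' unfolding D_def by blast
    have "\<iota> (x \<oplus> x') = \<iota> p \<otimes>\<^bsub>L\<^esub> (lin c \<oplus>\<^bsub>L\<^esub> lin c')"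
      using c(1) c'(1) p(1) linc[OF c(2)] linc[OF c'(2)] by (simp add: c(3) c'(3) L.r_distr)
    then have "\<iota> (x \<oplus> x') = \<iota> p \<otimes>\<^bsub>L\<^esub> lin (\<lambda>i. c i \<oplus> c' i)" unfolding lin_add[OF c(2) c'(2)] .
    moreover have "(\<lambda>i. c i \<oplus> c' i) \<in> {..<Suc n} \<rightarrow> carrier R" using c(2) c'(2) by auto
    ultimately show ?thesis unfolding D_def using c(1) c'(1) by blast
  qed
  have z_D: "z i \<in> D" if i: "i \<le> n" for i
  proof -
    let ?c = "\<lambda>j. if i = j then \<one> else \<zero>"
    have "lin ?c = finsum L (\<lambda>j. if i = j then y [^]\<^bsub>L\<^esub> j else \<zero>\<^bsub>L\<^esub>) {..<Suc n}"
      unfolding lin_def using yi by (intro L.add.finprod_cong') auto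
    also have "\<dots> = y [^]\<^bsub>L\<^esub> i" using i yi by (intro L.add.finprod_singleton) auto
    finally have "\<iota> (z i) = \<iota> p \<otimes>\<^bsub>L\<^esub> lin ?c" using zy by simp
    moreover have "?c \<in> {..<Suc n} \<rightarrow> carrier R" by auto
    ultimately show ?thesis unfolding D_def using z(1) by blast
  qed
  have D_car: "x \<in> carrier R" if "x \<in> D" for x using that unfolding D_def by blast
  have "ideal D R"
  proof (rule idealI[OF ring_axioms])
    show "subgroup D (add_monoid R)"
    proof (rule subgroup.intro)
      show "D \<subseteq> carrier (add_monoid R)" using D_car by auto
      show "x \<otimes>\<^bsub>add_monoid R\<^esub> y \<in> D" if "x \<in> D" "y \<in> D" for x y using add_D that by simp
      show "\<one>\<^bsub>add_monoid R\<^esub> \<in> D" using scale_D[OF z_D[of 0] zero_closed] z(1) by simp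
      fix x assume x: "x \<in> D"
      have "\<ominus> x = (\<ominus> \<one>) \<otimes> x" using D_car[OF x] by (simp add: l_minus)
      then have "\<ominus> x \<in> D" using scale_D[OF x] by simp
      then show "inv\<^bsub>add_monoid R\<^esub> x \<in> D" by (simp flip: a_inv_def)
    qed
    show "x \<otimes> r \<in> D" "r \<otimes> x \<in> D" if "x \<in> D" "r \<in> carrier R" for x r
      using scale_D[OF that] m_comm[OF that(2) D_car[OF that(1)]] by simp_all
  qed
  moreover have "z ` {..n} \<subseteq> D" using z_D by auto
  ultimately have "z (Suc n) \<in> D" by (rule subsetD[OF genideal_minimal n])
  then obtain c where c: "c \<in> {..<Suc n} \<rightarrow> carrier R" "\<iota> (z (Suc n)) = \<iota> p \<otimes>\<^bsub>L\<^esub> lin c"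
    unfolding D_def by blast
  have "\<iota> p \<otimes>\<^bsub>L\<^esub> y [^]\<^bsub>L\<^esub> Suc n = \<iota> p \<otimes>\<^bsub>L\<^esub> lin c" using c(2) zy[of "Suc n"] by metis
  then have eq: "y [^]\<^bsub>L\<^esub> Suc n = lin c"
    by (rule L.cancel_left) (use nz[OF p] p(1) yc linc[OF c(1)] in simp_all)
  \<comment> \<open>The definition of integrality has all terms on one side, hence the change of
    sign.\<close>
  let ?c = "\<lambda>i. (\<ominus> \<one>) \<otimes> c i"
  have cc: "?c \<in> {..<Suc n} \<rightarrow> carrier R" using c(1) by auto
  have "lin ?c = \<iota> (\<ominus> \<one>) \<otimes>\<^bsub>L\<^esub> lin c" using lin_scale[OF c(1), of "\<ominus> \<one>"] by simp
  also have "\<dots> = \<ominus>\<^bsub>L\<^esub> lin c" using linc[OF c(1)] by (simp add: L.l_minus)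
  finally have "y [^]\<^bsub>L\<^esub> Suc n \<oplus>\<^bsub>L\<^esub> lin ?c = \<zero>\<^bsub>L\<^esub>"
    unfolding eq using linc[OF c(1)] by (simp add: L.r_neg)
  then have "integral_over_base R y"
    unfolding integral_over_base_def L_def[symmetric] \<iota>_def[symmetric] lin_def
    by (intro exI[of _ "Suc n"] bexI[OF _ cc])
  then have "y \<in> \<iota> ` carrier R"
    using closed yc unfolding integrally_closed_domain_def L_def \<iota>_def by simp
  then obtain s where s: "s \<in> carrier R" "y = \<iota> s" by blast
  then have "\<iota> (s \<otimes> a) = \<iota> b" using ya a(1) by (simp add: L.m_comm)
  then have "b = s \<otimes> a" using inj[of "s \<otimes> a" b] s(1) a(1) b by simp
  then show "b \<in> PIdl a" using PIdl_mult_left[OF a(1) s(1)] by simp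
qed

end

section \<open>Sections of a sheaf of fractions on an irreducible space\<close>

text \<open>All sections over non-empty open sets are induced by elements of a field \<open>L\<close> containing \<open>R\<close>.\<close>

locale fraction_model = R?: cring R + L: field L + h: ring_hom_cring R L \<iota>
  for R :: "('a, 'm) ring_scheme" (structure) and L :: "('l, 'n) ring_scheme" and \<iota> +
  fixes X :: "'p topology" and T :: "'p \<Rightarrow> 'a set" and F :: "('a \<times> 'a) set"
  assumes inj: "inj_on \<iota> (carrier R)"
    and T: "p \<in> topspace X \<Longrightarrow> mult_subset R (T p)" and T_zero: "p \<in> topspace X \<Longrightarrow> \<zero> \<notin> T p"
    and F: "F \<subseteq> carrier R \<times> carrier R"
    and open_denominator: "(a, f) \<in> F \<Longrightarrow> openin X {q \<in> topspace X. f \<in> T q}"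
    and irreducible: "openin X V \<Longrightarrow> openin X W \<Longrightarrow> V \<noteq> {} \<Longrightarrow> W \<noteq> {} \<Longrightarrow> V \<inter> W \<noteq> {}"
begin

text \<open>The equivalence class of pairs that represents \<open>z\<close> in the localization at
  \<open>p\<close>; it is empty when \<open>z\<close> has no denominator in
  \<open>T p\<close>.\<close>

definition germ :: "'p \<Rightarrow> 'l \<Rightarrow> ('a \<times> 'a) set" where
  "germ p z = {(b, t). b \<in> carrier R \<and> t \<in> T p \<and> \<iota> t \<otimes>\<^bsub>L\<^esub> z = \<iota> b}"

text \<open>The elements of the field that define a section over \<open>V\<close>, by a condition at
  each point separately. Local constancy of the pair \<open>(a, f)\<close> is automatic, as
  \<open>f\<close> remains a denominator on an open set.\<close>

definition regular :: "'p set \<Rightarrow> 'l set" where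
  "regular V = {z \<in> carrier L. \<forall>p\<in>V. \<exists>(a, f)\<in>F. f \<in> T p \<and> \<iota> f \<otimes>\<^bsub>L\<^esub> z = \<iota> a}"

definition sect :: "'p set \<Rightarrow> 'l \<Rightarrow> 'p \<Rightarrow> ('a \<times> 'a) set" where
  "sect V z = (\<lambda>p\<in>V. germ p z)"

lemma iota_eq: "x \<in> carrier R \<Longrightarrow> y \<in> carrier R \<Longrightarrow> \<iota> x = \<iota> y \<longleftrightarrow> x = y"
  using inj_onD[OF inj] by blast

lemma iota_nonzero: "x \<in> carrier R \<Longrightarrow> x \<noteq> \<zero> \<Longrightarrow> \<iota> x \<noteq> \<zero>\<^bsub>L\<^esub>"
  using iota_eq[of x \<zero>] by simp

lemma germ_eq:
  assumes p: "p \<in> topspace X" and z: "z \<in> carrier L" and a: "a \<in> carrier R" "s \<in> T p" "\<iota> s \<otimes>\<^bsub>L\<^esub> z = \<iota> a"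
  shows "germ p z = fraction R (T p) a s"
proof -
  interpret T: mult_subset R "T p" by (rule T[OF p])
  have sc: "s \<in> carrier R" using T.Tc[OF a(2)] .
  have "\<iota> t \<otimes>\<^bsub>L\<^esub> z = \<iota> b \<longleftrightarrow> (\<exists>u\<in>T p. u \<otimes> (t \<otimes> a) = u \<otimes> (s \<otimes> b))"
    if b: "b \<in> carrier R" "t \<in> T p" for b t
  proof -
    have tc: "t \<in> carrier R" using T.Tc[OF b(2)] .
    have s0: "\<iota> s \<noteq> \<zero>\<^bsub>L\<^esub>" using iota_nonzero[OF sc] T_zero[OF p] a(2) by auto
    have eq: "\<iota> s \<otimes>\<^bsub>L\<^esub> (\<iota> t \<otimes>\<^bsub>L\<^esub> z) = \<iota> t \<otimes>\<^bsub>L\<^esub> \<iota> a"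
      unfolding a(3)[symmetric] using sc tc z by (simp add: L.m_lcomm)
    have "\<iota> t \<otimes>\<^bsub>L\<^esub> z = \<iota> b \<longleftrightarrow> \<iota> s \<otimes>\<^bsub>L\<^esub> (\<iota> t \<otimes>\<^bsub>L\<^esub> z) = \<iota> s \<otimes>\<^bsub>L\<^esub> \<iota> b"
      using L.m_lcancel[OF s0] sc tc z b(1) by simp
    also have "\<dots> \<longleftrightarrow> \<iota> (t \<otimes> a) = \<iota> (s \<otimes> b)" unfolding eq using tc a(1) sc b(1) by simp
    also have "\<dots> \<longleftrightarrow> t \<otimes> a = s \<otimes> b" using tc a(1) sc b(1) by (intro iota_eq) auto
    also have "\<dots> \<longleftrightarrow> (\<exists>u\<in>T p. u \<otimes> (t \<otimes> a) = u \<otimes> (s \<otimes> b))"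
    proof
      assume "t \<otimes> a = s \<otimes> b" then show "\<exists>u\<in>T p. u \<otimes> (t \<otimes> a) = u \<otimes> (s \<otimes> b)" using T.T_one by auto
    next
      assume "\<exists>u\<in>T p. u \<otimes> (t \<otimes> a) = u \<otimes> (s \<otimes> b)"
      then obtain u where u: "u \<in> T p" "u \<otimes> (t \<otimes> a) = u \<otimes> (s \<otimes> b)" by blast
      have uc: "u \<in> carrier R" "\<iota> u \<noteq> \<zero>\<^bsub>L\<^esub>"
        using T.Tc[OF u(1)] iota_nonzero[of u] T_zero[OF p] u(1) by auto
      have "\<iota> u \<otimes>\<^bsub>L\<^esub> \<iota> (t \<otimes> a) = \<iota> u \<otimes>\<^bsub>L\<^esub> \<iota> (s \<otimes> b)"
        using arg_cong[OF u(2), of \<iota>] uc(1) tc a(1) sc b(1) by simp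
      then have "\<iota> (t \<otimes> a) = \<iota> (s \<otimes> b)"
        by (rule L.cancel_left) (use uc tc a(1) sc b(1) in auto)
      then show "t \<otimes> a = s \<otimes> b" by (rule iffD1[OF iota_eq, rotated 2]) (use tc a(1) sc b(1) in auto)
    qed
    finally show ?thesis .
  qed
  then show ?thesis
    unfolding germ_def using T.fraction_iff[OF a(1,2)] by auto
qed

lemma regularD:
  assumes "z \<in> regular V" "p \<in> V"
  obtains a f where "(a, f) \<in> F" "f \<in> T p" "\<iota> f \<otimes>\<^bsub>L\<^esub> z = \<iota> a" "a \<in> carrier R" "f \<in> carrier R"
  using assms F unfolding regular_def by fast

lemma regular_carrier: "z \<in> regular V \<Longrightarrow> z \<in> carrier L" unfolding regular_def by blast

lemma regular_mono: "W \<subseteq> V \<Longrightarrow> regular V \<subseteq> regular W" unfolding regular_def by blast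

lemma germ_inj:
  assumes p: "p \<in> topspace X" and z: "z \<in> carrier L" "z' \<in> carrier L"
    and a: "(a, f) \<in> germ p z" and eq: "germ p z = germ p z'"
  shows "z = z'"
proof -
  have f: "f \<in> T p" "\<iota> f \<otimes>\<^bsub>L\<^esub> z = \<iota> a" "\<iota> f \<otimes>\<^bsub>L\<^esub> z' = \<iota> a"
    using a eq unfolding germ_def by auto
  interpret T: mult_subset R "T p" by (rule T[OF p])
  have fc: "f \<in> carrier R" using T.Tc[OF f(1)] .
  have "\<iota> f \<noteq> \<zero>\<^bsub>L\<^esub>" using iota_nonzero[OF fc] T_zero[OF p] f(1) by auto
  then show ?thesis using L.cancel_left[of "\<iota> f" z z'] f z fc by simp
qed

lemma sect_restrict: "W \<subseteq> V \<Longrightarrow> restrict (sect V z) W = sect W z"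
  unfolding sect_def by (auto simp: fun_eq_iff)

lemma germ_fraction:
  assumes p: "p \<in> topspace X" and V: "p \<in> V" and z: "z \<in> regular V"
  obtains a f where "(a, f) \<in> F" "f \<in> T p" "\<iota> f \<otimes>\<^bsub>L\<^esub> z = \<iota> a" "a \<in> carrier R"
    "germ p z = fraction R (T p) a f"
proof -
  obtain a f where *: "(a, f) \<in> F" "f \<in> T p" "\<iota> f \<otimes>\<^bsub>L\<^esub> z = \<iota> a" "a \<in> carrier R"
    using regularD[OF z V] by metis
  then show thesis using that germ_eq[OF p regular_carrier[OF z] *(4,2,3)] by blast
qed

lemma germ_mult:
  assumes p: "p \<in> topspace X" and V: "p \<in> V" and z: "z \<in> regular V" "z' \<in> regular V"
  shows "germ p (z \<otimes>\<^bsub>L\<^esub> z') = germ p z \<otimes>\<^bsub>localization R (T p)\<^esub> germ p z'"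
proof -
  interpret T: mult_subset R "T p" by (rule T[OF p])
  obtain a f where a: "f \<in> T p" "\<iota> f \<otimes>\<^bsub>L\<^esub> z = \<iota> a" "a \<in> carrier R" "germ p z = T.Fr a f"
    using germ_fraction[OF p V z(1)] by metis
  obtain b g where b: "g \<in> T p" "\<iota> g \<otimes>\<^bsub>L\<^esub> z' = \<iota> b" "b \<in> carrier R" "germ p z' = T.Fr b g"
    using germ_fraction[OF p V z(2)] by metis
  have c: "f \<in> carrier R" "g \<in> carrier R" "z \<in> carrier L" "z' \<in> carrier L"
    using T.Tc a b regular_carrier z by auto
  have "\<iota> (f \<otimes> g) \<otimes>\<^bsub>L\<^esub> (z \<otimes>\<^bsub>L\<^esub> z') = (\<iota> f \<otimes>\<^bsub>L\<^esub> z) \<otimes>\<^bsub>L\<^esub> (\<iota> g \<otimes>\<^bsub>L\<^esub> z')"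
    using c by (simp add: L.m_ac)
  also have "\<dots> = \<iota> (a \<otimes> b)" unfolding a(2) b(2) using a(3) b(3) by simp
  finally have eq: "\<iota> (f \<otimes> g) \<otimes>\<^bsub>L\<^esub> (z \<otimes>\<^bsub>L\<^esub> z') = \<iota> (a \<otimes> b)" .
  have "germ p (z \<otimes>\<^bsub>L\<^esub> z') = T.Fr (a \<otimes> b) (f \<otimes> g)"
    by (rule germ_eq[OF p _ _ T.T_mult[OF a(1) b(1)] eq]) (use c a b in auto)
  then show ?thesis unfolding a(4) b(4) T.mult_eq[OF a(3,1) b(3,1)] .
qed

lemma germ_add:
  assumes p: "p \<in> topspace X" and V: "p \<in> V" and z: "z \<in> regular V" "z' \<in> regular V"
  shows "germ p (z \<oplus>\<^bsub>L\<^esub> z') = germ p z \<oplus>\<^bsub>localization R (T p)\<^esub> germ p z'"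
proof -
  interpret T: mult_subset R "T p" by (rule T[OF p])
  obtain a f where a: "f \<in> T p" "\<iota> f \<otimes>\<^bsub>L\<^esub> z = \<iota> a" "a \<in> carrier R" "germ p z = T.Fr a f"
    using germ_fraction[OF p V z(1)] by metis
  obtain b g where b: "g \<in> T p" "\<iota> g \<otimes>\<^bsub>L\<^esub> z' = \<iota> b" "b \<in> carrier R" "germ p z' = T.Fr b g"
    using germ_fraction[OF p V z(2)] by metis
  have c: "f \<in> carrier R" "g \<in> carrier R" "z \<in> carrier L" "z' \<in> carrier L"
    using T.Tc a b regular_carrier z by auto
  have "\<iota> (f \<otimes> g) \<otimes>\<^bsub>L\<^esub> (z \<oplus>\<^bsub>L\<^esub> z') = \<iota> g \<otimes>\<^bsub>L\<^esub> (\<iota> f \<otimes>\<^bsub>L\<^esub> z) \<oplus>\<^bsub>L\<^esub> \<iota> f \<otimes>\<^bsub>L\<^esub> (\<iota> g \<otimes>\<^bsub>L\<^esub> z')"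
    using c by (simp add: L.r_distr L.m_ac)
  also have "\<dots> = \<iota> (g \<otimes> a \<oplus> f \<otimes> b)" unfolding a(2) b(2) using a(3) b(3) c by simp
  finally have eq: "\<iota> (f \<otimes> g) \<otimes>\<^bsub>L\<^esub> (z \<oplus>\<^bsub>L\<^esub> z') = \<iota> (g \<otimes> a \<oplus> f \<otimes> b)" .
  have "germ p (z \<oplus>\<^bsub>L\<^esub> z') = T.Fr (g \<otimes> a \<oplus> f \<otimes> b) (f \<otimes> g)"
    by (rule germ_eq[OF p _ _ T.T_mult[OF a(1) b(1)] eq]) (use c a b in auto)
  then show ?thesis unfolding a(4) b(4) T.add_eq[OF a(3,1) b(3,1)] .
qed

text \<open>A pair representing \<open>z\<close> at \<open>p\<close> represents it wherever its
  denominator is admissible, and these points form an open set by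
  \<open>open_denominator\<close>.\<close>

lemma sect_carrier:
  assumes V: "openin X V" and z: "z \<in> regular V"
  shows "sect V z \<in> carrier (fraction_sections R X T F V)"
proof -
  have Vs: "p \<in> topspace X" if "p \<in> V" for p using openin_subset[OF V] that by blast
  have 1: "sect V z \<in> (\<Pi>\<^sub>E p\<in>V. carrier (localization R (T p)))"
  proof (rule PiE_I)
    fix p assume p: "p \<in> V"
    interpret T: mult_subset R "T p" by (rule T[OF Vs[OF p]])
    obtain a f where "f \<in> T p" "a \<in> carrier R" "germ p z = T.Fr a f"
      using germ_fraction[OF Vs[OF p] p z] by metis
    then show "sect V z p \<in> carrier (localization R (T p))"
      unfolding sect_def using p T.fraction_carrier by simp
  qed (simp add: sect_def)
  have 2: "\<exists>W. openin X W \<and> p \<in> W \<and> W \<subseteq> V \<and>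
      (\<exists>(a, f)\<in>F. \<forall>q\<in>W. f \<in> T q \<and> sect V z q = fraction R (T q) a f)" if p: "p \<in> V" for p
  proof -
    obtain a f where a: "(a, f) \<in> F" "f \<in> T p" "\<iota> f \<otimes>\<^bsub>L\<^esub> z = \<iota> a" "a \<in> carrier R"
      using germ_fraction[OF Vs[OF p] p z] by metis
    let ?W = "V \<inter> {q \<in> topspace X. f \<in> T q}"
    have "openin X ?W" using V open_denominator[OF a(1)] by blast
    moreover have "p \<in> ?W" using p Vs a(2) by blast
    moreover have "\<forall>q\<in>?W. f \<in> T q \<and> sect V z q = fraction R (T q) a f"
      using germ_eq[OF _ regular_carrier[OF z] a(4) _ a(3)] by (auto simp: sect_def)
    ultimately show ?thesis using a(1) by blast
  qed
  show ?thesis unfolding fraction_sections_def using 1 2 by simp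
qed

text \<open>The fraction that represents \<open>s\<close> near one point fixes \<open>z\<close> in
  the field. By irreducibility the neighbourhood of any other point meets the first one, and there
  the two fractions agree.\<close>

lemma sect_surj:
  assumes V: "openin X V" "V \<noteq> {}" and s: "s \<in> carrier (fraction_sections R X T F V)"
  shows "\<exists>z\<in>regular V. s = sect V z"
proof -
  have Vs: "p \<in> topspace X" if "p \<in> V" for p using openin_subset[OF V(1)] that by blast
  have s1: "s \<in> (\<Pi>\<^sub>E p\<in>V. carrier (localization R (T p)))"
    and s2: "\<And>p. p \<in> V \<Longrightarrow> \<exists>W. openin X W \<and> p \<in> W \<and> W \<subseteq> V \<and>
      (\<exists>(a, f)\<in>F. \<forall>q\<in>W. f \<in> T q \<and> s q = fraction R (T q) a f)"
    using s unfolding fraction_sections_def by auto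
  obtain p0 where p0: "p0 \<in> V" using V(2) by blast
  obtain V0 a0 f0 where V0: "openin X V0" "p0 \<in> V0" "V0 \<subseteq> V" "(a0, f0) \<in> F"
    and s0: "\<And>q. q \<in> V0 \<Longrightarrow> f0 \<in> T q \<and> s q = fraction R (T q) a0 f0"
    using s2[OF p0] by blast
  have c0: "a0 \<in> carrier R" "f0 \<in> carrier R" using V0(4) F by auto
  have "f0 \<noteq> \<zero>" using s0[OF V0(2)] T_zero[OF Vs[OF p0]] by auto
  then have u: "\<iota> f0 \<in> Units L" using iota_nonzero[OF c0(2)] c0(2) by (simp add: L.field_Units)
  have ic: "inv\<^bsub>L\<^esub> (\<iota> f0) \<in> carrier L" "\<iota> f0 \<otimes>\<^bsub>L\<^esub> inv\<^bsub>L\<^esub> (\<iota> f0) = \<one>\<^bsub>L\<^esub>"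
    using L.Units_inv_closed[OF u] L.Units_r_inv[OF u] .
  define z where "z = \<iota> a0 \<otimes>\<^bsub>L\<^esub> inv\<^bsub>L\<^esub> (\<iota> f0)"
  have z: "z \<in> carrier L" unfolding z_def using c0 ic by simp
  have zf: "\<iota> f0 \<otimes>\<^bsub>L\<^esub> z = \<iota> a0" 
    unfolding z_def using L.m_lcomm[of "\<iota> f0" "\<iota> a0" "inv\<^bsub>L\<^esub> (\<iota> f0)"] c0 ic by simp
  have loc: "\<exists>(a, f)\<in>F. f \<in> T p \<and> \<iota> f \<otimes>\<^bsub>L\<^esub> z = \<iota> a \<and> s p = fraction R (T p) a f" if p: "p \<in> V" for p
  proof -
    obtain W a f where W: "openin X W" "p \<in> W" "W \<subseteq> V" "(a, f) \<in> F"
      and sW: "\<And>q. q \<in> W \<Longrightarrow> f \<in> T q \<and> s q = fraction R (T q) a f"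
      using s2[OF p] by blast
    have c: "a \<in> carrier R" "f \<in> carrier R" using W(4) F by auto
    obtain q where q: "q \<in> V0" "q \<in> W" using irreducible[OF V0(1) W(1)] V0(2) W(2) by blast
    have qX: "q \<in> topspace X" using Vs V0(3) q(1) by blast
    have f: "f0 \<in> T q" "f \<in> T q" using s0[OF q(1)] sW[OF q(2)] by auto
    have "germ q z = fraction R (T q) a0 f0" by (rule germ_eq[OF qX z c0(1) f(1) zf])
    also have "\<dots> = fraction R (T q) a f" using s0[OF q(1)] sW[OF q(2)] by simp
    finally have "(a, f) \<in> germ q z" using mult_subset.fraction_self[OF T[OF qX] c(1) f(2)] by simp
    then have "\<iota> f \<otimes>\<^bsub>L\<^esub> z = \<iota> a" unfolding germ_def by simp
    then show ?thesis using W(4) sW[OF W(2)] by blast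
  qed
  have zreg: "z \<in> regular V" unfolding regular_def using z loc by blast
  moreover have "s = sect V z"
  proof (rule PiE_ext[OF s1])
    show "sect V z \<in> (\<Pi>\<^sub>E p\<in>V. carrier (localization R (T p)))"
      using sect_carrier[OF V(1) zreg] unfolding fraction_sections_def by simp
    fix p assume p: "p \<in> V"
    obtain a f where a: "(a, f) \<in> F" "f \<in> T p" "\<iota> f \<otimes>\<^bsub>L\<^esub> z = \<iota> a" "s p = fraction R (T p) a f"
      using loc[OF p] by blast
    have "a \<in> carrier R" using a(1) F by auto
    then show "s p = sect V z p"
      using germ_eq[OF Vs[OF p] z _ a(2,3)] a(4) p by (simp add: sect_def)
  qed
  ultimately show ?thesis by blast
qed

lemma regular_subring:
  assumes V: "V \<subseteq> topspace X" "V \<noteq> {}"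
    and F_mult: "\<And>a f b g. (a, f) \<in> F \<Longrightarrow> (b, g) \<in> F \<Longrightarrow> (a \<otimes> b, f \<otimes> g) \<in> F"
    and F_add: "\<And>a f b g. (a, f) \<in> F \<Longrightarrow> (b, g) \<in> F \<Longrightarrow> (g \<otimes> a \<oplus> f \<otimes> b, f \<otimes> g) \<in> F"
    and F_minus: "\<And>a f. (a, f) \<in> F \<Longrightarrow> (\<ominus> a, f) \<in> F" and F_one: "(\<one>, \<one>) \<in> F"
  shows "subring (regular V) L"
proof (rule L.subringI)
  show "regular V \<subseteq> carrier L" using regular_carrier by blast
  have "\<exists>(a, f)\<in>F. f \<in> T p \<and> \<iota> f \<otimes>\<^bsub>L\<^esub> \<one>\<^bsub>L\<^esub> = \<iota> a" if "p \<in> V" for p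
  proof -
    have "\<one> \<in> T p" using mult_subset.T_one[OF T] V(1) that by blast
    then show ?thesis using F_one by (intro bexI[of _ "(\<one>, \<one>)"]) auto
  qed
  then show "\<one>\<^bsub>L\<^esub> \<in> regular V" unfolding regular_def by blast
  fix z assume z: "z \<in> regular V"
  have zc: "z \<in> carrier L" using regular_carrier[OF z] .
  have "\<exists>(a, f)\<in>F. f \<in> T p \<and> \<iota> f \<otimes>\<^bsub>L\<^esub> (\<ominus>\<^bsub>L\<^esub> z) = \<iota> a" if p: "p \<in> V" for p
  proof -
    obtain a f where a: "(a, f) \<in> F" "f \<in> T p" "\<iota> f \<otimes>\<^bsub>L\<^esub> z = \<iota> a" "a \<in> carrier R" "f \<in> carrier R"
      by (rule regularD[OF z p])
    have "\<iota> f \<otimes>\<^bsub>L\<^esub> (\<ominus>\<^bsub>L\<^esub> z) = \<iota> (\<ominus> a)" using a zc by (simp add: L.r_minus)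
    then show ?thesis using F_minus[OF a(1)] a(2) by blast
  qed
  then show "\<ominus>\<^bsub>L\<^esub> z \<in> regular V" unfolding regular_def using zc by blast
  fix z' assume z': "z' \<in> regular V"
  have zc': "z' \<in> carrier L" using regular_carrier[OF z'] .
  have "\<exists>(a, f)\<in>F. f \<in> T p \<and> \<iota> f \<otimes>\<^bsub>L\<^esub> (z \<otimes>\<^bsub>L\<^esub> z') = \<iota> a"
       "\<exists>(a, f)\<in>F. f \<in> T p \<and> \<iota> f \<otimes>\<^bsub>L\<^esub> (z \<oplus>\<^bsub>L\<^esub> z') = \<iota> a" if p: "p \<in> V" for p
  proof -
    obtain a f where a: "(a, f) \<in> F" "f \<in> T p" "\<iota> f \<otimes>\<^bsub>L\<^esub> z = \<iota> a" "a \<in> carrier R" "f \<in> carrier R"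
      by (rule regularD[OF z p])
    obtain b g where b: "(b, g) \<in> F" "g \<in> T p" "\<iota> g \<otimes>\<^bsub>L\<^esub> z' = \<iota> b" "b \<in> carrier R" "g \<in> carrier R"
      by (rule regularD[OF z' p])
    have fg: "f \<otimes> g \<in> T p" using mult_subset.T_mult[OF T a(2) b(2)] V(1) p by blast
    have "\<iota> (f \<otimes> g) \<otimes>\<^bsub>L\<^esub> (z \<otimes>\<^bsub>L\<^esub> z') = (\<iota> f \<otimes>\<^bsub>L\<^esub> z) \<otimes>\<^bsub>L\<^esub> (\<iota> g \<otimes>\<^bsub>L\<^esub> z')"
      using a(5) b(5) zc zc' by (simp add: L.m_ac)
    also have "\<dots> = \<iota> (a \<otimes> b)" unfolding a(3) b(3) using a(4) b(4) by simp
    finally show "\<exists>(a, f)\<in>F. f \<in> T p \<and> \<iota> f \<otimes>\<^bsub>L\<^esub> (z \<otimes>\<^bsub>L\<^esub> z') = \<iota> a"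
      using F_mult[OF a(1) b(1)] fg by blast
    have "\<iota> (f \<otimes> g) \<otimes>\<^bsub>L\<^esub> (z \<oplus>\<^bsub>L\<^esub> z') = \<iota> g \<otimes>\<^bsub>L\<^esub> (\<iota> f \<otimes>\<^bsub>L\<^esub> z) \<oplus>\<^bsub>L\<^esub> \<iota> f \<otimes>\<^bsub>L\<^esub> (\<iota> g \<otimes>\<^bsub>L\<^esub> z')"
      using a(5) b(5) zc zc' by (simp add: L.r_distr L.m_ac)
    also have "\<dots> = \<iota> (g \<otimes> a \<oplus> f \<otimes> b)" unfolding a(3) b(3) using a(4,5) b(4,5) by simp
    finally show "\<exists>(a, f)\<in>F. f \<in> T p \<and> \<iota> f \<otimes>\<^bsub>L\<^esub> (z \<oplus>\<^bsub>L\<^esub> z') = \<iota> a"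
      using F_add[OF a(1) b(1)] fg by blast
  qed
  then show "z \<otimes>\<^bsub>L\<^esub> z' \<in> regular V" "z \<oplus>\<^bsub>L\<^esub> z' \<in> regular V"
    unfolding regular_def using zc zc' by blast+
qed

text \<open>Over the empty set there is only one section whereas every element of the field is
  regular, so the empty set has to be excluded.\<close>

lemma sect_iso:
  assumes V: "openin X V" "V \<noteq> {}"
  shows "sect V \<in> ring_iso (L\<lparr>carrier := regular V\<rparr>) (fraction_sections R X T F V)"
proof (rule ring_iso_memI)
  have Vs: "p \<in> topspace X" if "p \<in> V" for p using openin_subset[OF V(1)] that by blast
  obtain p0 where p0: "p0 \<in> V" using V(2) by blast
  fix z assume "z \<in> carrier (L\<lparr>carrier := regular V\<rparr>)"
  then have z: "z \<in> regular V" by simp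
  show "sect V z \<in> carrier (fraction_sections R X T F V)" by (rule sect_carrier[OF V(1) z])
  fix z' assume "z' \<in> carrier (L\<lparr>carrier := regular V\<rparr>)"
  then have z': "z' \<in> regular V" by simp
  show "sect V (z \<otimes>\<^bsub>L\<lparr>carrier := regular V\<rparr>\<^esub> z') = sect V z \<otimes>\<^bsub>fraction_sections R X T F V\<^esub> sect V z'"
    using germ_mult[OF Vs _ z z'] by (auto simp: sect_def fraction_sections_def fun_eq_iff)
  show "sect V (z \<oplus>\<^bsub>L\<lparr>carrier := regular V\<rparr>\<^esub> z') = sect V z \<oplus>\<^bsub>fraction_sections R X T F V\<^esub> sect V z'"
    using germ_add[OF Vs _ z z'] by (auto simp: sect_def fraction_sections_def fun_eq_iff)
next
  have Vs: "p \<in> topspace X" if "p \<in> V" for p using openin_subset[OF V(1)] that by blast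
  have "germ p \<one>\<^bsub>L\<^esub> = \<one>\<^bsub>localization R (T p)\<^esub>" if p: "p \<in> V" for p
  proof -
    interpret T: mult_subset R "T p" by (rule T[OF Vs[OF p]])
    show ?thesis unfolding T.one_eq by (rule germ_eq[OF Vs[OF p]]) (use T.T_one in auto)
  qed
  then show "sect V \<one>\<^bsub>L\<lparr>carrier := regular V\<rparr>\<^esub> = \<one>\<^bsub>fraction_sections R X T F V\<^esub>"
    by (auto simp: sect_def fraction_sections_def fun_eq_iff)
  show "bij_betw (sect V) (carrier (L\<lparr>carrier := regular V\<rparr>)) (carrier (fraction_sections R X T F V))"
    unfolding bij_betw_def
  proof
    show "inj_on (sect V) (carrier (L\<lparr>carrier := regular V\<rparr>))"
    proof (rule inj_onI)
      fix z z' assume "z \<in> carrier (L\<lparr>carrier := regular V\<rparr>)" "z' \<in> carrier (L\<lparr>carrier := regular V\<rparr>)"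
        and eq: "sect V z = sect V z'"
      then have z: "z \<in> regular V" "z' \<in> regular V" by auto
      obtain p where p: "p \<in> V" using V(2) by blast
      have "germ p z = germ p z'" using fun_cong[OF eq, of p] p by (simp add: sect_def)
      moreover obtain a f where "f \<in> T p" "\<iota> f \<otimes>\<^bsub>L\<^esub> z = \<iota> a" "a \<in> carrier R"
        using germ_fraction[OF Vs[OF p] p z(1)] by metis
      then have "(a, f) \<in> germ p z" unfolding germ_def by simp
      ultimately show "z = z'" using germ_inj[OF Vs[OF p]] z regular_carrier by blast
    qed
    show "sect V ` carrier (L\<lparr>carrier := regular V\<rparr>) = carrier (fraction_sections R X T F V)"
      using sect_carrier[OF V(1)] sect_surj[OF V] by auto
  qed
qed

end

section \<open>Zariski topologies\<close>

lemma (in graded_ring) Hom_one: "\<one> \<in> Hom" using one_G G_Hom by blast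

lemma (in graded_ring) Hom_mult: "x \<in> Hom \<Longrightarrow> y \<in> Hom \<Longrightarrow> x \<otimes> y \<in> Hom"
  using component_mult unfolding Hom_def by blast

lemma (in graded_ring) homogeneous_subset_iff:
  assumes p: "homogeneous_ideal R G p" and q: "additive_subgroup q R"
  shows "p \<inter> Hom \<subseteq> q \<longleftrightarrow> p \<subseteq> q"
proof
  assume sub: "p \<inter> Hom \<subseteq> q"
  have id: "ideal p R" and comps: "\<And>x d. x \<in> p \<Longrightarrow> comp x d \<in> p"
    using p by (auto simp: homogeneous_ideal_iff)
  show "p \<subseteq> q"
  proof
    fix x assume x: "x \<in> p"
    have xc: "x \<in> carrier R" using ideal.Icarr[OF id x] .
    have "comp x d \<in> q" for d using sub comps[OF x] G_Hom[OF comp_props(1)[OF xc]] by blast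
    then show "x \<in> q" by (rule mem_of_comps[OF q xc])
  qed
qed blast

text \<open>The parameter \<open>J\<close> lets one theory serve twice: with the irrelevant ideal it
  gives Proj, and with the whole ring and the grading concentrated in degree zero it gives
  Spec.\<close>

locale hom_spectrum = graded_ring R G + domain R
  for R :: "('a, 'm) ring_scheme" (structure) and G +
  fixes J :: "'a set"
begin

definition Pts :: "'a set set" where
  "Pts = {p. primeideal p R \<and> homogeneous_ideal R G p \<and> \<not> J \<subseteq> p}"

definition Top :: "'a set topology" where "Top = zariski_topology Pts Hom"

section \<open>Points, closures and codimension in a homogeneous spectrum\<close>

lemma PtsD:
  assumes "p \<in> Pts"
  shows "primeideal p R" "homogeneous_ideal R G p" "\<not> J \<subseteq> p" "ideal p R" "additive_subgroup p R" "\<one> \<notin> p" "\<zero> \<in> p"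
proof -
  show 1: "primeideal p R" "homogeneous_ideal R G p" "\<not> J \<subseteq> p" using assms by (auto simp: Pts_def)
  interpret primeideal p R by (rule 1)
  show "ideal p R" "additive_subgroup p R" by (rule is_ideal, rule additive_subgroup_axioms)
  show "\<one> \<notin> p" using one_imp_carrier I_notcarr by blast
  show "\<zero> \<in> p" by (rule zero_closed)
qed

lemma openin_Top: "openin Top U \<longleftrightarrow> (\<exists>E\<subseteq>Hom. U = Pts - {p \<in> Pts. E \<subseteq> p})"
proof -
  have "istopology (\<lambda>U. \<exists>E\<subseteq>Hom. U = Pts - {p \<in> Pts. E \<subseteq> p})"
    by (rule istopology_zariski[of _ R]) (auto simp: Pts_def Hom_carrier Hom_mult)
  then show ?thesis unfolding Top_def zariski_topology_def by simp
qed

lemma topspace_Top: "topspace Top = Pts"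
proof
  show "topspace Top \<subseteq> Pts" using openin_topspace[of Top] unfolding openin_Top by blast
  have "Pts = Pts - {p \<in> Pts. {\<one>} \<subseteq> p}" using PtsD(6) by blast
  then have "openin Top Pts" unfolding openin_Top using Hom_one by blast
  then show "Pts \<subseteq> topspace Top" by (rule openin_subset)
qed

lemma closedin_Top: "closedin Top C \<longleftrightarrow> (\<exists>E\<subseteq>Hom. C = {p \<in> Pts. E \<subseteq> p})"
  unfolding closedin_def topspace_Top openin_Top
proof safe
  fix E assume C: "C \<subseteq> Pts" "Pts - C = Pts - {p \<in> Pts. E \<subseteq> p}" and E: "E \<subseteq> Hom"
  then have "C = {p \<in> Pts. E \<subseteq> p}" by blast
  then show "\<exists>E\<subseteq>Hom. C = {p \<in> Pts. E \<subseteq> p}" using E by blast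
qed blast

definition cl :: "'a set \<Rightarrow> 'a set set" where "cl p = {q \<in> Pts. p \<subseteq> q}"

lemma closedin_ideal:
  assumes "homogeneous_ideal R G I" shows "closedin Top {q \<in> Pts. I \<subseteq> q}"
proof -
  have "{q \<in> Pts. I \<subseteq> q} = {q \<in> Pts. I \<inter> Hom \<subseteq> q}"
    using homogeneous_subset_iff[OF assms PtsD(5)] by blast
  then show ?thesis unfolding closedin_Top by blast
qed

lemma closed_cl: "p \<in> Pts \<Longrightarrow> closedin Top (cl p)"
  unfolding cl_def using closedin_ideal PtsD(2) by blast

lemma cl_subset: "closedin Top C \<Longrightarrow> p \<in> C \<Longrightarrow> cl p \<subseteq> C"
  unfolding closedin_Top cl_def by blast

lemma cl_self: "p \<in> Pts \<Longrightarrow> p \<in> cl p" unfolding cl_def by blast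

lemma irreducible_cl:
  assumes p: "p \<in> Pts" shows "irreducible_in Top (cl p)"
  unfolding irreducible_in_def topspace_Top
proof (intro conjI allI impI)
  show "cl p \<subseteq> Pts" unfolding cl_def by simp
  show "cl p \<noteq> {}" using cl_self[OF p] by auto
  fix A B assume *: "closedin Top A \<and> closedin Top B \<and> cl p \<subseteq> A \<union> B"
  then have "p \<in> A \<or> p \<in> B" using cl_self[OF p] by auto
  then show "cl p \<subseteq> A \<or> cl p \<subseteq> B" using cl_subset * by auto
qed

lemma Inter_homogeneous:
  assumes "C \<subseteq> Pts" "C \<noteq> {}" shows "homogeneous_ideal R G (\<Inter>C)"
  unfolding homogeneous_ideal_iff
proof
  show "ideal (\<Inter>C) R" using assms PtsD(4) by (intro i_Intersect) auto
  show "\<forall>x\<in>\<Inter>C. \<forall>d. comp x d \<in> \<Inter>C"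
    using assms PtsD(2) unfolding homogeneous_ideal_iff by blast
qed

text \<open>If \<open>a b\<close> lies in every point of \<open>C\<close>, then \<open>C\<close> is
  covered by the closed sets of \<open>a\<close> and of \<open>b\<close>; irreducibility gives
  primality on homogeneous elements, which is enough. \<open>C\<close> may fail to be
  closed.\<close>

lemma generic_point:
  assumes "irreducible_in Top C" shows "\<Inter>C \<in> Pts"
proof -
  have C: "C \<subseteq> Pts" "C \<noteq> {}"
    and irr: "\<And>A B. closedin Top A \<Longrightarrow> closedin Top B \<Longrightarrow> C \<subseteq> A \<union> B \<Longrightarrow> C \<subseteq> A \<or> C \<subseteq> B"
    using assms unfolding irreducible_in_def topspace_Top by auto
  obtain p where p: "p \<in> C" using C(2) by blast
  have hom: "homogeneous_ideal R G (\<Inter>C)" by (rule Inter_homogeneous[OF C])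
  have "primeideal (\<Inter>C) R"
  proof (rule homogeneous_prime[OF hom])
    show "\<one> \<notin> \<Inter>C" using p C(1) PtsD(6) by blast
    fix a b assume ab: "a \<in> Hom" "b \<in> Hom" "a \<otimes> b \<in> \<Inter>C"
    let ?V = "\<lambda>a. {q \<in> Pts. {a} \<subseteq> q}"
    have "closedin Top (?V a)" "closedin Top (?V b)" unfolding closedin_Top using ab by blast+
    moreover have "C \<subseteq> ?V a \<union> ?V b"
    proof
      fix q assume q: "q \<in> C"
      then have "a \<in> q \<or> b \<in> q"
        using primeideal.I_prime[OF PtsD(1), of q a b] C(1) ab Hom_carrier by blast
      then show "q \<in> ?V a \<union> ?V b" using q C(1) by blast
    qed
    ultimately have "C \<subseteq> ?V a \<or> C \<subseteq> ?V b" by (rule irr)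
    then show "a \<in> \<Inter>C \<or> b \<in> \<Inter>C" by blast
  qed
  moreover have "\<not> J \<subseteq> \<Inter>C" using p C(1) PtsD(3) by blast
  ultimately show ?thesis using hom unfolding Pts_def by blast
qed

lemma Inter_mem_closed:
  assumes "closedin Top C" "\<Inter>D \<in> Pts" "D \<subseteq> C" shows "\<Inter>D \<in> C"
proof -
  obtain E where E: "E \<subseteq> Hom" "C = {p \<in> Pts. E \<subseteq> p}" using assms(1) unfolding closedin_Top by blast
  then have "E \<subseteq> \<Inter>D" using assms(3) by blast
  then show ?thesis using E(2) assms(2) by blast
qed

lemma irreducible_closed_eq:
  assumes "closedin Top C" "irreducible_in Top C"
  shows "\<exists>p\<in>Pts. C = cl p"
proof -
  have p: "\<Inter>C \<in> Pts" by (rule generic_point[OF assms(2)])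
  have CP: "C \<subseteq> Pts" using assms(2) unfolding irreducible_in_def topspace_Top by blast
  have "cl (\<Inter>C) \<subseteq> C" using cl_subset[OF assms(1)] Inter_mem_closed[OF assms(1) p subset_refl] by blast
  moreover have "C \<subseteq> cl (\<Inter>C)" unfolding cl_def using CP by blast
  ultimately show ?thesis using p by blast
qed

lemma cl_subset_iff: "p \<in> Pts \<Longrightarrow> cl p \<subseteq> cl q \<longleftrightarrow> q \<subseteq> p"
  unfolding cl_def by blast

text \<open>The competing sets \<open>D\<close> in the definition of a component need not be closed,
  but the generic point of \<open>D\<close> belongs to the closed set \<open>Z\<close>, so
  \<open>D\<close> lies in the closure of a point of \<open>Z\<close>.\<close>

lemma irreducible_component_iff:
  assumes Z: "closedin Top Z"
  shows "irreducible_component Top Z C \<longleftrightarrow> (\<exists>p\<in>Z. (\<forall>q\<in>Z. q \<subseteq> p \<longrightarrow> q = p) \<and> C = cl p)"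
proof
  have ZP: "Z \<subseteq> Pts" using closedin_subset[OF Z] unfolding topspace_Top .
  {
    assume "irreducible_component Top Z C"
    then have C: "C \<subseteq> Z" "irreducible_in Top C"
      and max: "\<And>D. D \<subseteq> Z \<Longrightarrow> irreducible_in Top D \<Longrightarrow> C \<subseteq> D \<Longrightarrow> D = C"
      unfolding irreducible_component_def by blast+
    let ?p = "\<Inter>C"
    have p: "?p \<in> Pts" by (rule generic_point[OF C(2)])
    have pZ: "?p \<in> Z" by (rule Inter_mem_closed[OF Z p C(1)])
    have sub: "C \<subseteq> cl q" if "q \<subseteq> ?p" for q unfolding cl_def using that C(1) ZP by blast
    have eq: "cl q = C" if "q \<in> Z" "q \<subseteq> ?p" for q
      using max[OF cl_subset[OF Z that(1)] irreducible_cl sub[OF that(2)]] ZP that(1) by blast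
    have "q = ?p" if q: "q \<in> Z" "q \<subseteq> ?p" for q
    proof -
      have "cl q = cl ?p" using eq[OF q] eq[OF pZ subset_refl] by simp
      then have "q \<in> cl ?p" using cl_self q(1) ZP by blast
      then show ?thesis using q(2) unfolding cl_def by blast
    qed
    then show "\<exists>p\<in>Z. (\<forall>q\<in>Z. q \<subseteq> p \<longrightarrow> q = p) \<and> C = cl p"
      using pZ eq[OF pZ subset_refl] by blast
  }
  assume "\<exists>p\<in>Z. (\<forall>q\<in>Z. q \<subseteq> p \<longrightarrow> q = p) \<and> C = cl p"
  then obtain p where p: "p \<in> Z" "\<And>q. q \<in> Z \<Longrightarrow> q \<subseteq> p \<Longrightarrow> q = p" "C = cl p" by blast
  have pP: "p \<in> Pts" using p(1) ZP by blast
  show "irreducible_component Top Z C"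
    unfolding irreducible_component_def
  proof (intro conjI allI impI)
    show "C \<subseteq> Z" unfolding p(3) by (rule cl_subset[OF Z p(1)])
    show "irreducible_in Top C" unfolding p(3) by (rule irreducible_cl[OF pP])
    fix D assume D: "D \<subseteq> Z \<and> irreducible_in Top D \<and> C \<subseteq> D"
    have q: "\<Inter>D \<in> Pts" using generic_point D by blast
    then have qZ: "\<Inter>D \<in> Z" using Inter_mem_closed[OF Z] D by blast
    have "p \<in> D" using D p(3) cl_self[OF pP] by blast
    then have "\<Inter>D = p" using p(2)[OF qZ] by blast
    then have "D \<subseteq> cl p" unfolding cl_def using D ZP by blast
    then show "D = C" using D p(3) by blast
  qed
qed

definition codim_one :: "'a set \<Rightarrow> bool" where
  "codim_one p \<longleftrightarrow> p \<noteq> {\<zero>} \<and> (\<forall>q\<in>Pts. q \<subset> p \<longrightarrow> q = {\<zero>})"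

lemma zero_Pts:
  assumes "Pts \<noteq> {}" shows "{\<zero>} \<in> Pts"
proof -
  obtain p where p: "p \<in> Pts" using assms by blast
  have "homogeneous_ideal R G {\<zero>}" unfolding homogeneous_ideal_iff using zeroideal by simp
  moreover have "\<not> J \<subseteq> {\<zero>}" using PtsD(3,7)[OF p] by blast
  ultimately show ?thesis using zeroprimeideal unfolding Pts_def by blast
qed

definition has_chain :: "'a set \<Rightarrow> nat \<Rightarrow> bool" where
  "has_chain p n \<longleftrightarrow> (\<exists>C :: nat \<Rightarrow> 'a set set. C 0 = cl p \<and>
     (\<forall>i\<le>n. closedin Top (C i) \<and> irreducible_in Top (C i)) \<and> (\<forall>i<n. C i \<subset> C (Suc i)))"

lemma codimension_cl: "codimension Top (cl p) = Sup {enat n | n. has_chain p n}"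
  unfolding codimension_def has_chain_def by simp

lemma chain_points:
  assumes p: "p \<in> Pts" and ch: "has_chain p n" and n: "1 \<le> n"
  shows "\<exists>q\<in>Pts. q \<subset> p \<and> (2 \<le> n \<longrightarrow> (\<exists>r\<in>Pts. r \<subset> q))"
proof -
  obtain C where C: "C 0 = cl p" "\<And>i. i \<le> n \<Longrightarrow> closedin Top (C i) \<and> irreducible_in Top (C i)"
    "\<And>i. i < n \<Longrightarrow> C i \<subset> C (Suc i)" using ch unfolding has_chain_def by blast
  have pt: "\<exists>q\<in>Pts. C i = cl q" if "i \<le> n" for i using irreducible_closed_eq C(2)[OF that] by blast
  obtain q where q: "q \<in> Pts" "C 1 = cl q" using pt[OF n] by blast
  have "cl p \<subset> cl q" using C(3)[of 0] n C(1) q(2) by simp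
  then have qp: "q \<subset> p" using cl_subset_iff[OF p, of q] cl_subset_iff[OF q(1), of p] by blast
  have "\<exists>r\<in>Pts. r \<subset> q" if n2: "2 \<le> n"
  proof -
    obtain r where r: "r \<in> Pts" "C 2 = cl r" using pt[OF n2] by blast
    have "cl q \<subset> cl r" using C(3)[of 1] n2 q(2) r(2) by (simp add: numeral_2_eq_2)
    then have "r \<subset> q" using cl_subset_iff[OF q(1), of r] cl_subset_iff[OF r(1), of q] by blast
    then show ?thesis using r(1) by blast
  qed
  then show ?thesis using q(1) qp by blast
qed

lemma has_chain_1:
  assumes p: "p \<in> Pts" "p \<noteq> {\<zero>}" shows "has_chain p 1"
  unfolding has_chain_def
proof (intro exI[of _ "\<lambda>i. if i = 0 then cl p else cl {\<zero>}"] conjI allI impI)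
  have z: "{\<zero>} \<in> Pts" using zero_Pts p(1) by blast
  fix i :: nat
  show "closedin Top (if i = 0 then cl p else cl {\<zero>})" "irreducible_in Top (if i = 0 then cl p else cl {\<zero>})"
    using closed_cl irreducible_cl p(1) z by auto
  have "cl p \<subset> cl {\<zero>}"
    using cl_subset_iff[OF p(1), of "{\<zero>}"] cl_subset_iff[OF z, of p] PtsD(7)[OF p(1)] p(2) by blast
  then show "i < 1 \<Longrightarrow> (if i = 0 then cl p else cl {\<zero>}) \<subset> (if Suc i = 0 then cl p else cl {\<zero>})" by simp
qed simp

lemma has_chain_2:
  assumes p: "p \<in> Pts" and q: "q \<in> Pts" "q \<subset> p" "q \<noteq> {\<zero>}" shows "has_chain p 2"
  unfolding has_chain_def
proof (intro exI[of _ "\<lambda>i. if i = 0 then cl p else if i = 1 then cl q else cl {\<zero>}"] conjI allI impI)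
  have z: "{\<zero>} \<in> Pts" using zero_Pts p(1) by blast
  let ?C = "\<lambda>i::nat. if i = 0 then cl p else if i = 1 then cl q else cl {\<zero>}"
  fix i :: nat
  show "closedin Top (?C i)" "irreducible_in Top (?C i)"
    using closed_cl irreducible_cl p(1) q(1) z by auto
  have "cl q \<subset> cl {\<zero>}"
    using cl_subset_iff[OF q(1), of "{\<zero>}"] cl_subset_iff[OF z, of q] PtsD(7)[OF q(1)] q(3) by blast
  moreover have "cl p \<subset> cl q"
    using cl_subset_iff[OF p, of q] cl_subset_iff[OF q(1), of p] q(2) by blast
  ultimately show "i < 2 \<Longrightarrow> ?C i \<subset> ?C (Suc i)" by (cases i) auto
qed simp

text \<open>Growing chains of closed sets are shrinking chains of points. The zero ideal is a point
  as soon as there is any, so a chain of length one ends there, and one of length two exists exactly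
  when a nonzero point lies strictly below \<open>p\<close>.\<close>

lemma codimension_one_iff:
  assumes p: "p \<in> Pts" shows "codimension Top (cl p) = 1 \<longleftrightarrow> codim_one p"
proof
  assume "codimension Top (cl p) = 1"
  then have S: "Sup {enat n | n. has_chain p n} = 1" unfolding codimension_cl .
  have le: "n \<le> 1" if "has_chain p n" for n
  proof -
    have "enat n \<le> Sup {enat n | n. has_chain p n}" using that by (intro Sup_upper) blast
    then show ?thesis unfolding S by (simp add: one_enat_def)
  qed
  show "codim_one p" unfolding codim_one_def
  proof (intro conjI ballI impI)
    show "p \<noteq> {\<zero>}"
    proof
      assume p0: "p = {\<zero>}"
      have "n = 0" if ch: "has_chain p n" for n
      proof (rule ccontr)
        assume "n \<noteq> 0"
        then obtain q where "q \<in> Pts" "q \<subset> p" using chain_points[OF p ch] by auto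
        then show False using PtsD(7) unfolding p0 by blast
      qed
      then have "Sup {enat n | n. has_chain p n} \<le> 0" by (intro Sup_least) (auto simp: zero_enat_def)
      then show False unfolding S by simp
    qed
    fix q assume q: "q \<in> Pts" "q \<subset> p"
    show "q = {\<zero>}" using has_chain_2[OF p q] le[of 2] by auto
  qed
next
  assume c: "codim_one p"
  have le: "n \<le> 1" if ch: "has_chain p n" for n
  proof (rule ccontr)
    assume "\<not> n \<le> 1"
    then obtain q r where q: "q \<in> Pts" "q \<subset> p" and r: "r \<in> Pts" "r \<subset> q"
      using chain_points[OF p ch] by auto
    have "q = {\<zero>}" using c q unfolding codim_one_def by simp
    then show False using r PtsD(7)[OF r(1)] by auto
  qed
  have "Sup {enat n | n. has_chain p n} = 1"
  proof (rule antisym)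
    show "Sup {enat n | n. has_chain p n} \<le> 1"
      using le by (intro Sup_least) (auto simp: one_enat_def)
    have "enat 1 \<in> {enat n | n. has_chain p n}"
      using has_chain_1[OF p] c unfolding codim_one_def by blast
    then show "1 \<le> Sup {enat n | n. has_chain p n}" unfolding one_enat_def by (rule Sup_upper)
  qed
  then show "codimension Top (cl p) = 1" unfolding codimension_cl .
qed

lemma hypersurface_iff:
  "hypersurface Top Z \<longleftrightarrow> closedin Top Z \<and>
     (\<forall>p\<in>Z. (\<forall>q\<in>Z. q \<subseteq> p \<longrightarrow> q = p) \<longrightarrow> codim_one p)"
proof -
  have "(\<forall>C. irreducible_component Top Z C \<longrightarrow> codimension Top C = 1) \<longleftrightarrow>
      (\<forall>p\<in>Z. (\<forall>q\<in>Z. q \<subseteq> p \<longrightarrow> q = p) \<longrightarrow> codim_one p)" if Z: "closedin Top Z"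
  proof -
    have ZP: "Z \<subseteq> Pts" using closedin_subset[OF Z] unfolding topspace_Top .
    show ?thesis
      unfolding irreducible_component_iff[OF Z] using codimension_one_iff ZP by blast
  qed
  then show ?thesis unfolding hypersurface_def by blast
qed

section \<open>The structure sheaf of a homogeneous spectrum\<close>

definition Dens :: "'a set \<Rightarrow> 'a set" where "Dens p = Hom - p"

definition Pairs :: "('a \<times> 'a) set" where "Pairs = (\<Union>d. G d \<times> G d)"

definition Space :: "('a set, 'a set \<Rightarrow> ('a \<times> 'a) set) ringed_space" where
  "Space = fraction_space R Top Dens Pairs"

text \<open>The ambient field is the full fraction field, also for Proj; the restriction to
  fractions of degree zero is left to \<open>Pairs\<close>.\<close>

sublocale fraction_model R "fraction_field R" "to_fraction_field R" Top Dens Pairs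
proof (intro fraction_model.intro fraction_model_axioms.intro)
  have f: "field (fraction_field R)" by (rule fraction_field_field)
  then have cr: "cring (fraction_field R)" by (rule fieldE(1))
  show "cring R" by (rule is_cring)
  show "field (fraction_field R)" by (rule f)
  show "ring_hom_cring R (fraction_field R) (to_fraction_field R)"
    by (intro ring_hom_cringI ring_hom_ringI2 ring_axioms is_cring cr cring.axioms(1)[OF cr] to_fraction_field_hom)
  show "inj_on (to_fraction_field R) (carrier R)" by (rule to_fraction_field_inj)
  fix p assume "p \<in> topspace Top"
  then have p: "p \<in> Pts" unfolding topspace_Top .
  show "mult_subset R (Dens p)"
  proof (intro mult_subset.intro mult_subset_axioms.intro is_cring)
    show "Dens p \<subseteq> carrier R" unfolding Dens_def using Hom_carrier by blast
    show "\<one> \<in> Dens p" unfolding Dens_def using Hom_one PtsD(6)[OF p] by blast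
    show "s \<otimes> t \<in> Dens p" if "s \<in> Dens p" "t \<in> Dens p" for s t
      using that Hom_mult Hom_carrier primeideal.I_prime[OF PtsD(1)[OF p], of s t] unfolding Dens_def by blast
  qed
  show "\<zero> \<notin> Dens p" unfolding Dens_def using PtsD(7)[OF p] by blast
next
  show "Pairs \<subseteq> carrier R \<times> carrier R" unfolding Pairs_def using G_carrier by blast
  fix a f assume "(a, f) \<in> Pairs"
  then have f: "f \<in> Hom" unfolding Pairs_def Hom_def by blast
  have "{q \<in> topspace Top. f \<in> Dens q} = Pts - {p \<in> Pts. {f} \<subseteq> p}"
    unfolding topspace_Top Dens_def using f by blast
  then show "openin Top {q \<in> topspace Top. f \<in> Dens q}" unfolding openin_Top using f by blast
next
  fix V W assume V: "openin Top V" "V \<noteq> {}" and W: "openin Top W" "W \<noteq> {}"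
  \<comment> \<open>The zero ideal is a generic point of the whole space.\<close>
  have "{\<zero>} \<in> U" if U: "openin Top U" "U \<noteq> {}" for U
  proof -
    obtain E where E: "U = Pts - {p \<in> Pts. E \<subseteq> p}" using U(1) unfolding openin_Top by blast
    obtain q where q: "q \<in> Pts" "\<not> E \<subseteq> q" using U(2) E by blast
    have "\<not> E \<subseteq> {\<zero>}" using q(2) PtsD(7)[OF q(1)] by blast
    then show ?thesis using zero_Pts q(1) unfolding E by blast
  qed
  then show "V \<inter> W \<noteq> {}" using V W by blast
qed

end

section \<open>Affine open subsets: the ideal becomes the unit ideal\<close>

context cring
begin

section \<open>Constant sections on the spectrum of an arbitrary commutative ring\<close>

lemma openin_Spec:
  "openin (points (Spec R)) U \<longleftrightarrow> (\<exists>E\<subseteq>carrier R. U = {p. primeideal p R} - {p. primeideal p R \<and> E \<subseteq> p})"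
proof -
  have "istopology (\<lambda>U. \<exists>E\<subseteq>carrier R. U = {p. primeideal p R} - {p \<in> {p. primeideal p R}. E \<subseteq> p})"
    by (rule istopology_zariski[of _ R]) auto
  then show ?thesis unfolding Spec_def fraction_space_def zariski_topology_def by simp
qed

lemma prime_one: "primeideal p R \<Longrightarrow> \<one> \<notin> p"
  using ideal.one_imp_carrier[OF primeideal.axioms(1)] primeideal.I_notcarr by metis

lemma topspace_Spec: "topspace (points (Spec R)) = {p. primeideal p R}"
proof
  show "topspace (points (Spec R)) \<subseteq> {p. primeideal p R}"
    using openin_topspace[of "points (Spec R)"] unfolding openin_Spec by auto
  have "{p. primeideal p R} = {p. primeideal p R} - {p. primeideal p R \<and> {\<one>} \<subseteq> p}"
    using prime_one by auto
  then have "openin (points (Spec R)) {p. primeideal p R}" unfolding openin_Spec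
    by (intro exI[of _ "{\<one>}"]) auto
  then show "{p. primeideal p R} \<subseteq> topspace (points (Spec R))" by (rule openin_subset)
qed

lemma prime_mult_subset: "primeideal p R \<Longrightarrow> mult_subset R (carrier R - p)"
  using prime_one[of p] primeideal.I_prime[of p R]
  by (intro mult_subset.intro mult_subset_axioms.intro is_cring) blast+

definition cst :: "'a set set \<Rightarrow> 'a \<Rightarrow> 'a set \<Rightarrow> ('a \<times> 'a) set" where
  "cst V r = (\<lambda>p\<in>V. fraction R (carrier R - p) r \<one>)"

lemma sections_Spec: "sections (Spec R) =
    fraction_sections R (points (Spec R)) (\<lambda>p. carrier R - p) (carrier R \<times> carrier R)"
  by (simp add: Spec_def fraction_space_def)

lemma restr_Spec: "restr (Spec R) V W s = restrict s W"
  by (simp add: Spec_def fraction_space_def)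

lemma cst_hom:
  assumes V: "openin (points (Spec R)) V"
  shows "cst V \<in> ring_hom R (sections (Spec R) V)"
proof -
  have Vs: "primeideal p R" if "p \<in> V" for p using openin_subset[OF V] that unfolding topspace_Spec by auto
  show ?thesis
  proof (rule ring_hom_memI)
    fix a assume a: "a \<in> carrier R"
    have "cst V a \<in> (\<Pi>\<^sub>E p\<in>V. carrier (localization R (carrier R - p)))"
    proof (rule PiE_I)
      fix p assume p: "p \<in> V"
      interpret T: mult_subset R "carrier R - p" by (rule prime_mult_subset[OF Vs[OF p]])
      show "cst V a p \<in> carrier (localization R (carrier R - p))"
        unfolding cst_def using p T.fraction_carrier[OF a T.T_one] by simp
    qed (simp add: cst_def)
    moreover have "\<forall>p\<in>V. \<exists>W. openin (points (Spec R)) W \<and> p \<in> W \<and> W \<subseteq> V \<and>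
      (\<exists>(a', f)\<in>carrier R \<times> carrier R. \<forall>q\<in>W. f \<in> carrier R - q \<and> cst V a q = fraction R (carrier R - q) a' f)"
    proof
      fix p assume p: "p \<in> V"
      have "\<forall>q\<in>V. \<one> \<in> carrier R - q \<and> cst V a q = fraction R (carrier R - q) a \<one>"
        unfolding cst_def using prime_one[OF Vs] by simp
      then show "\<exists>W. openin (points (Spec R)) W \<and> p \<in> W \<and> W \<subseteq> V \<and>
          (\<exists>(a', f)\<in>carrier R \<times> carrier R. \<forall>q\<in>W. f \<in> carrier R - q \<and> cst V a q = fraction R (carrier R - q) a' f)"
        using V p a by (intro exI[of _ V] conjI bexI[of _ "(a, \<one>)"]) auto
    qed
    ultimately show "cst V a \<in> carrier (sections (Spec R) V)"
      unfolding sections_Spec fraction_sections_def by simp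
    fix b assume b: "b \<in> carrier R"
    have "cst V (a \<otimes> b) p = cst V a p \<otimes>\<^bsub>localization R (carrier R - p)\<^esub> cst V b p"
      "cst V (a \<oplus> b) p = cst V a p \<oplus>\<^bsub>localization R (carrier R - p)\<^esub> cst V b p" if p: "p \<in> V" for p
    proof -
      interpret T: mult_subset R "carrier R - p" by (rule prime_mult_subset[OF Vs[OF p]])
      show "cst V (a \<otimes> b) p = cst V a p \<otimes>\<^bsub>localization R (carrier R - p)\<^esub> cst V b p"
        unfolding cst_def using p T.mult_eq[OF a T.T_one b T.T_one] by simp
      show "cst V (a \<oplus> b) p = cst V a p \<oplus>\<^bsub>localization R (carrier R - p)\<^esub> cst V b p"
        unfolding cst_def using p T.add_eq[OF a T.T_one b T.T_one] a b by simp
    qed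
    then show "cst V (a \<otimes> b) = cst V a \<otimes>\<^bsub>sections (Spec R) V\<^esub> cst V b"
      "cst V (a \<oplus> b) = cst V a \<oplus>\<^bsub>sections (Spec R) V\<^esub> cst V b"
      unfolding sections_Spec fraction_sections_def by (auto simp: fun_eq_iff) (simp_all add: cst_def)
  next
    have "cst V \<one> p = \<one>\<^bsub>localization R (carrier R - p)\<^esub>" if p: "p \<in> V" for p
    proof -
      interpret T: mult_subset R "carrier R - p" by (rule prime_mult_subset[OF Vs[OF p]])
      show ?thesis unfolding cst_def T.one_eq using p by simp
    qed
    then have "cst V \<one> = (\<lambda>p\<in>V. \<one>\<^bsub>localization R (carrier R - p)\<^esub>)"
      by (intro extensionalityI[of _ V]) (auto simp: cst_def)
    then show "cst V \<one> = \<one>\<^bsub>sections (Spec R) V\<^esub>"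
      unfolding sections_Spec fraction_sections_def by simp
  qed
qed

text \<open>Proved directly, as the ring furnished by an abstract affineness assumption is not known
  to be a domain, so \<open>fraction_model\<close> does not apply to it.\<close>

lemma sections_mult_closed:
  assumes V: "openin (points (Spec R)) V"
    and s: "s \<in> carrier (sections (Spec R) V)" and t: "t \<in> carrier (sections (Spec R) V)"
  shows "s \<otimes>\<^bsub>sections (Spec R) V\<^esub> t \<in> carrier (sections (Spec R) V)"
proof -
  have Vs: "primeideal p R" if "p \<in> V" for p using openin_subset[OF V] that unfolding topspace_Spec by auto
  define F where "F = carrier R \<times> carrier R"
  let ?st = "s \<otimes>\<^bsub>sections (Spec R) V\<^esub> t"
  have st: "?st = (\<lambda>p\<in>V. s p \<otimes>\<^bsub>localization R (carrier R - p)\<^esub> t p)"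
    unfolding sections_Spec fraction_sections_def by simp
  have loc: "\<exists>W. openin (points (Spec R)) W \<and> p \<in> W \<and> W \<subseteq> V \<and>
      (\<exists>(a, f)\<in>F. \<forall>q\<in>W. f \<in> carrier R - q \<and> u q = fraction R (carrier R - q) a f)"
    if "u \<in> carrier (sections (Spec R) V)" "p \<in> V" for u p
    using that unfolding sections_Spec fraction_sections_def F_def by simp
  have 1: "\<exists>W. openin (points (Spec R)) W \<and> p \<in> W \<and> W \<subseteq> V \<and>
      (\<exists>(a, f)\<in>F. \<forall>q\<in>W. f \<in> carrier R - q \<and> ?st q = fraction R (carrier R - q) a f)" if p: "p \<in> V" for p
  proof -
    obtain W a f where W: "openin (points (Spec R)) W" "p \<in> W" "W \<subseteq> V" "(a, f) \<in> F"
      "\<And>q. q \<in> W \<Longrightarrow> f \<in> carrier R - q \<and> s q = fraction R (carrier R - q) a f" using loc[OF s p] by blast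
    obtain W' b g where W': "openin (points (Spec R)) W'" "p \<in> W'" "(b, g) \<in> F"
      "\<And>q. q \<in> W' \<Longrightarrow> g \<in> carrier R - q \<and> t q = fraction R (carrier R - q) b g" using loc[OF t p] by blast
    have "f \<otimes> g \<in> carrier R - q \<and> ?st q = fraction R (carrier R - q) (a \<otimes> b) (f \<otimes> g)" if q: "q \<in> W \<inter> W'" for q
    proof -
      interpret T: mult_subset R "carrier R - q" by (rule prime_mult_subset[OF Vs]) (use q W(3) in blast)
      have c: "a \<in> carrier R" "b \<in> carrier R" using W(4) W'(3) unfolding F_def by auto
      have "f \<in> carrier R - q" "s q = T.Fr a f" "g \<in> carrier R - q" "t q = T.Fr b g"
        using W(5)[of q] W'(4)[of q] q by auto
      then show ?thesis unfolding st using q W(3) T.mult_eq[OF c(1) _ c(2)] T.T_mult by auto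
    qed
    moreover have "(a \<otimes> b, f \<otimes> g) \<in> F" using W(4) W'(3) unfolding F_def by auto
    ultimately show ?thesis
      using W(1,2,3) W'(1,2) by (intro exI[of _ "W \<inter> W'"] conjI bexI[of _ "(a \<otimes> b, f \<otimes> g)"]) auto
  qed
  have 2: "?st \<in> (\<Pi>\<^sub>E p\<in>V. carrier (localization R (carrier R - p)))"
  proof (rule PiE_I)
    fix p assume p: "p \<in> V"
    interpret T: mult_subset R "carrier R - p" by (rule prime_mult_subset[OF Vs[OF p]])
    interpret Lo: cring T.Lo by (rule T.localization_cring)
    have "s p \<in> carrier T.Lo" "t p \<in> carrier T.Lo"
      using s t p unfolding sections_Spec fraction_sections_def by auto
    then show "?st p \<in> carrier T.Lo" unfolding st using p by simp
  qed (simp add: st)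
  have "?st \<in> carrier (fraction_sections R (points (Spec R)) (\<lambda>p. carrier R - p) F V)"
    unfolding fraction_sections_def using 1 2 by simp
  then show ?thesis unfolding sections_Spec F_def .
qed

text \<open>If \<open>r\<close> were in \<open>q\<close>, clearing denominators in
  \<open>r v = 1\<close> at \<open>q\<close> would put a product of denominators into
  \<open>q\<close>.\<close>

lemma cst_unit:
  assumes V: "openin (points (Spec R)) V" "q \<in> V" and r: "r \<in> carrier R"
    and v: "v \<in> carrier (sections (Spec R) V)"
    and one: "cst V r \<otimes>\<^bsub>sections (Spec R) V\<^esub> v = \<one>\<^bsub>sections (Spec R) V\<^esub>"
  shows "r \<notin> q"
proof
  assume rq: "r \<in> q"
  have q: "primeideal q R" using openin_subset[OF V(1)] V(2) unfolding topspace_Spec by auto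
  interpret q: primeideal q R by fact
  interpret T: mult_subset R "carrier R - q" by (rule prime_mult_subset[OF q])
  have "v q \<in> carrier T.Lo" using v V(2) unfolding sections_Spec fraction_sections_def by auto
  then obtain b t where b: "b \<in> carrier R" "t \<in> carrier R - q" "v q = T.Fr b t" unfolding T.carrier_iff by blast
  have "(cst V r \<otimes>\<^bsub>sections (Spec R) V\<^esub> v) q = \<one>\<^bsub>sections (Spec R) V\<^esub> q" using one by simp
  then have "cst V r q \<otimes>\<^bsub>T.Lo\<^esub> v q = \<one>\<^bsub>T.Lo\<^esub>"
    unfolding sections_Spec fraction_sections_def using V(2) by simp
  then have "T.Fr r \<one> \<otimes>\<^bsub>T.Lo\<^esub> T.Fr b t = T.Fr \<one> \<one>"
    unfolding b(3) T.one_eq cst_def using V(2) by simp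
  then have "T.Fr (r \<otimes> b) (\<one> \<otimes> t) = T.Fr \<one> \<one>" unfolding T.mult_eq[OF r T.T_one b(1,2)] .
  then have "\<exists>u\<in>carrier R - q. u \<otimes> (\<one> \<otimes> (r \<otimes> b)) = u \<otimes> (\<one> \<otimes> t \<otimes> \<one>)"
    by (rule T.fraction_eqD[rotated 4]) (use r b T.T_one in auto)
  then obtain u where u: "u \<in> carrier R - q" "u \<otimes> (r \<otimes> b) = u \<otimes> t" using r b by auto
  have "u \<otimes> (r \<otimes> b) \<in> q" using q.I_l_closed q.I_r_closed[OF rq b(1)] u(1) by simp
  then have "u \<otimes> t \<in> q" unfolding u(2) .
  then show False using T.T_mult[OF u(1) b(2)] by simp
qed

end

lemma (in graded_noeth_domain) finite_homogeneous_generators: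
  assumes I: "homogeneous_ideal R G I"
  shows "\<exists>A. finite A \<and> A \<subseteq> I \<inter> Hom \<and> I = Idl A"
proof -
  have id: "ideal I R" and comps: "\<And>x d. x \<in> I \<Longrightarrow> comp x d \<in> I"
    using I by (auto simp: homogeneous_ideal_iff)
  obtain A where A: "A \<subseteq> carrier R" "finite A" "I = Idl A" using finitely_generated[OF id] by auto
  have AI: "A \<subseteq> I" using genideal_self[OF A(1)] A(3) by simp
  let ?B = "\<Union>x\<in>A. comp x ` {d. comp x d \<noteq> \<zero>}"
  have fin: "finite ?B" using A(2) comp_props(2) A(1) by auto
  have BI: "?B \<subseteq> I \<inter> Hom"
  proof
    fix y assume "y \<in> ?B"
    then obtain x d where x: "x \<in> A" "y = comp x d" by blast
    have "x \<in> carrier R" using x A(1) by blast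
    then show "y \<in> I \<inter> Hom" using comps[of x d] x AI G_Hom[OF comp_props(1)] by auto
  qed
  then have Bc: "?B \<subseteq> carrier R" using Hom_carrier by blast
  have idB: "ideal (Idl ?B) R" by (rule genideal_ideal[OF Bc])
  have "A \<subseteq> Idl ?B"
  proof
    fix x assume x: "x \<in> A"
    show "x \<in> Idl ?B"
    proof (rule mem_of_comps[OF ideal.axioms(1)[OF idB]])
      show "x \<in> carrier R" using x A(1) by blast
      show "comp x d \<in> Idl ?B" for d
      proof (cases "comp x d = \<zero>")
        case True then show ?thesis using additive_subgroup.zero_closed[OF ideal.axioms(1)[OF idB]] by simp
      next
        case False then have "comp x d \<in> ?B" using x by blast
        then show ?thesis by (rule subsetD[OF genideal_self[OF Bc]])
      qed
    qed
  qed
  then have "I \<subseteq> Idl ?B" unfolding A(3) by (rule genideal_minimal[OF idB])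
  moreover have "Idl ?B \<subseteq> I" using BI by (intro genideal_minimal[OF id]) blast
  ultimately show ?thesis using fin BI by blast
qed

locale affine_criterion = graded_noeth_domain R G + hom_spectrum R G J
  for R :: "('a, 'm) ring_scheme" (structure) and G and J +
  fixes I :: "'a set"
  assumes I: "homogeneous_ideal R G I" and IJ: "I \<subseteq> J" and I_nz: "\<not> I \<subseteq> {\<zero>}"
begin

abbreviation L where "L \<equiv> fraction_field R"
abbreviation \<iota> where "\<iota> \<equiv> to_fraction_field R"

text \<open>The condition on \<open>J\<close> that defines points is implied here:
  \<open>I \<subseteq> J\<close>, so a prime not containing \<open>I\<close> does not contain
  \<open>J\<close>.\<close>

definition U :: "'a set set" where "U = {p. primeideal p R \<and> homogeneous_ideal R G p \<and> \<not> I \<subseteq> p}"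

definition OU :: "('a set, 'a set \<Rightarrow> ('a \<times> 'a) set) ringed_space" where
  "OU = open_complement Space {p \<in> Pts. I \<subseteq> p}"

section \<open>The open set \<open>U\<close> and its stalks inside the fraction field\<close>

lemma I_ideal: "ideal I R" and I_comps: "x \<in> I \<Longrightarrow> comp x d \<in> I"
  using I by (auto simp: homogeneous_ideal_iff)

lemma I_car: "x \<in> I \<Longrightarrow> x \<in> carrier R" using ideal.Icarr[OF I_ideal] .

lemma U_Pts: "U = Pts - {p \<in> Pts. I \<subseteq> p}" unfolding U_def Pts_def using IJ by blast

lemma U_sub: "p \<in> U \<Longrightarrow> p \<in> Pts" unfolding U_Pts by blast

lemma U_not: "p \<in> U \<Longrightarrow> \<not> I \<subseteq> p" unfolding U_def by blast

lemma open_U: "openin Top U"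
  unfolding U_Pts using closedin_ideal[OF I] unfolding closedin_def topspace_Top by blast

lemma U_ne: "U \<noteq> {}"
proof -
  have "homogeneous_ideal R G {\<zero>}" unfolding homogeneous_ideal_iff using zeroideal by simp
  then show ?thesis unfolding U_def using zeroprimeideal I_nz by blast
qed

lemma points_OU: "points OU = subtopology Top U"
  unfolding OU_def open_complement_def open_subspace_def Space_def fraction_space_def
  by (simp add: topspace_Top U_Pts)

lemma topspace_OU: "topspace (points OU) = U"
  unfolding points_OU using Int_absorb1[OF openin_subset[OF open_U]] by simp

lemma openin_OU: "openin (points OU) V \<longleftrightarrow> openin Top V \<and> V \<subseteq> U"
  unfolding points_OU by (rule openin_open_subtopology[OF open_U])

lemma sections_OU: "sections OU = fraction_sections R Top Dens Pairs"
  unfolding OU_def open_complement_def open_subspace_def Space_def fraction_space_def by simp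

lemma restr_OU: "restr OU V W s = restrict s W"
  unfolding OU_def open_complement_def open_subspace_def Space_def fraction_space_def by simp

lemma U_hom_element:
  assumes "p \<in> U" shows "\<exists>d. \<exists>a\<in>G d. a \<in> I \<and> a \<notin> p"
proof -
  have "\<not> I \<inter> Hom \<subseteq> p"
    using homogeneous_subset_iff[OF I PtsD(5)[OF U_sub[OF assms]]] U_not[OF assms] by simp
  then show ?thesis unfolding Hom_def by blast
qed

text \<open>Lets \<open>radical_prime\<close>, which speaks of all primes, be combined with
  information available only at homogeneous ones.\<close>

lemma core_U:
  assumes Q: "primeideal Q R" and h: "h \<in> I" "h \<notin> Q" shows "comp_core Q \<in> U"
proof -
  have "additive_subgroup Q R" using Q by (simp add: primeideal_def ideal_def)
  then have "\<not> I \<subseteq> comp_core Q" using comp_core_subset h by blast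
  then show ?thesis unfolding U_def using comp_core_prime[OF Q] by blast
qed

lemma core_Hom: "primeideal Q R \<Longrightarrow> x \<in> Hom \<Longrightarrow> x \<in> comp_core Q \<longleftrightarrow> x \<in> Q"
  using comp_core_Hom[of Q x] by (simp add: primeideal_def ideal_def)

text \<open>Membership of \<open>z\<close> in the stalk of the structure sheaf at
  \<open>p\<close>.\<close>

definition St :: "'a set \<Rightarrow> ('a \<times> 'a) set \<Rightarrow> bool" where
  "St p z \<longleftrightarrow> z \<in> carrier L \<and> (\<exists>d. \<exists>b\<in>G d. \<exists>t\<in>G d. t \<notin> p \<and> \<iota> t \<otimes>\<^bsub>L\<^esub> z = \<iota> b)"

text \<open>\<open>z\<close> is a unit of the stalk at \<open>p\<close>.\<close>

definition Iv :: "'a set \<Rightarrow> ('a \<times> 'a) set \<Rightarrow> bool" where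
  "Iv p z \<longleftrightarrow> z \<in> carrier L \<and> (\<exists>d. \<exists>b\<in>G d. \<exists>t\<in>G d. b \<notin> p \<and> t \<notin> p \<and> \<iota> t \<otimes>\<^bsub>L\<^esub> z = \<iota> b)"

lemma regular_iff: "z \<in> regular V \<longleftrightarrow> z \<in> carrier L \<and> (\<forall>p\<in>V. St p z)"
proof -
  have "z \<in> regular V \<longleftrightarrow> z \<in> carrier L \<and> (\<forall>p\<in>V. \<exists>(a, f)\<in>Pairs. f \<in> Dens p \<and> \<iota> f \<otimes>\<^bsub>L\<^esub> z = \<iota> a)"
    unfolding regular_def by blast
  also have "\<dots> \<longleftrightarrow> z \<in> carrier L \<and> (\<forall>p\<in>V. St p z)"
    unfolding St_def Pairs_def Dens_def using G_Hom by fast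
  finally show ?thesis .
qed

lemma St_I: "z \<in> carrier L \<Longrightarrow> b \<in> G d \<Longrightarrow> t \<in> G d \<Longrightarrow> t \<notin> p \<Longrightarrow> \<iota> t \<otimes>\<^bsub>L\<^esub> z = \<iota> b \<Longrightarrow> St p z"
  unfolding St_def by blast

lemma St_E:
  assumes "St p z" obtains d b t where "b \<in> G d" "t \<in> G d" "t \<notin> p" "\<iota> t \<otimes>\<^bsub>L\<^esub> z = \<iota> b" "z \<in> carrier L"
  using assms unfolding St_def by blast

lemma iota_cancel:
  assumes "a \<in> carrier R" "a \<noteq> \<zero>" "\<iota> a \<otimes>\<^bsub>L\<^esub> x = \<iota> a \<otimes>\<^bsub>L\<^esub> y" "x \<in> carrier L" "y \<in> carrier L"
  shows "x = y"
  using L.cancel_left[OF assms(3) iota_nonzero[OF assms(1,2)] h.hom_closed[OF assms(1)] assms(4,5)] .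

lemma cross_eq:
  assumes c: "d \<in> carrier R" "y \<in> carrier R" "t \<in> carrier R" "b \<in> carrier R" "z \<in> carrier L"
    and eq: "\<iota> d \<otimes>\<^bsub>L\<^esub> z = \<iota> y" "\<iota> t \<otimes>\<^bsub>L\<^esub> z = \<iota> b"
  shows "t \<otimes> y = d \<otimes> b"
proof -
  have "\<iota> t \<otimes>\<^bsub>L\<^esub> (\<iota> d \<otimes>\<^bsub>L\<^esub> z) = \<iota> d \<otimes>\<^bsub>L\<^esub> (\<iota> t \<otimes>\<^bsub>L\<^esub> z)" using c by (intro L.m_lcomm) auto
  then have "\<iota> (t \<otimes> y) = \<iota> (d \<otimes> b)" unfolding eq using c by simp
  then show ?thesis by (rule iffD1[OF iota_eq, rotated 2]) (use c in auto)
qed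

lemma nonmem_nonzero: "p \<in> Pts \<Longrightarrow> t \<notin> p \<Longrightarrow> t \<noteq> \<zero>" using PtsD(7) by blast

lemma Iv_iff_rep:
  assumes p: "p \<in> Pts" and rep: "b \<in> G d" "t \<in> G d" "t \<notin> p" "\<iota> t \<otimes>\<^bsub>L\<^esub> z = \<iota> b" "z \<in> carrier L"
  shows "Iv p z \<longleftrightarrow> b \<notin> p"
proof
  assume "b \<notin> p" then show "Iv p z" unfolding Iv_def using rep by blast
next
  assume "Iv p z"
  then obtain e b' t' where *: "b' \<in> G e" "t' \<in> G e" "b' \<notin> p" "t' \<notin> p" "\<iota> t' \<otimes>\<^bsub>L\<^esub> z = \<iota> b'"
    unfolding Iv_def by blast
  have c: "b \<in> carrier R" "t \<in> carrier R" "b' \<in> carrier R" "t' \<in> carrier R" using rep(1,2) *(1,2) G_carrier by blast+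
  have eq: "t' \<otimes> b = t \<otimes> b'" by (rule cross_eq[OF c(2,1,4,3) rep(5,4) *(5)])
  interpret p: primeideal p R by (rule PtsD(1)[OF p])
  show "b \<notin> p"
  proof
    assume "b \<in> p"
    then have "t \<otimes> b' \<in> p" unfolding eq[symmetric] using p.I_l_closed c(4) by blast
    then show False using p.I_prime[OF c(2,3)] rep(3) *(3) by blast
  qed
qed

text \<open>If a prime \<open>Q\<close> contains all \<open>b\<close> with \<open>b y\<close> in
  \<open>(d)\<close> but misses some \<open>h\<close> in \<open>I\<close>, its core is a point of
  \<open>U\<close>. There \<open>z\<close> has a denominator \<open>t\<close> outside
  \<open>Q\<close>, and \<open>t y = d b\<close> places \<open>t\<close> in
  \<open>Q\<close>.\<close>

lemma regular_transform:
  assumes z: "z \<in> regular U" and d: "d \<in> carrier R" "y \<in> carrier R" "\<iota> d \<otimes>\<^bsub>L\<^esub> z = \<iota> y"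
  shows "y \<in> transform R I d"
proof -
  let ?B = "{b \<in> carrier R. b \<otimes> y \<in> PIdl d}"
  have B: "ideal ?B R" by (rule colon_ideal[OF cgenideal_ideal[OF d(1)] d(2)])
  have zc: "z \<in> carrier L" by (rule regular_carrier[OF z])
  have "\<exists>n::nat. h [^] n \<in> ?B" if h: "h \<in> I" for h
  proof (rule radical_prime[OF B I_car[OF h]])
    fix Q assume Q: "primeideal Q R" "?B \<subseteq> Q"
    show "h \<in> Q"
    proof (rule ccontr)
      assume "h \<notin> Q"
      then have "comp_core Q \<in> U" using core_U[OF Q(1) h] by simp
      then have "St (comp_core Q) z" using z unfolding regular_iff by blast
      then obtain e b t where t: "b \<in> G e" "t \<in> G e" "t \<notin> comp_core Q" "\<iota> t \<otimes>\<^bsub>L\<^esub> z = \<iota> b"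
        by (rule St_E)
      have c: "b \<in> carrier R" "t \<in> carrier R" using t G_carrier by blast+
      have "t \<otimes> y = d \<otimes> b" by (rule cross_eq[OF d(1,2) c(2,1) zc d(3) t(4)])
      then have "t \<otimes> y \<in> PIdl d" using PIdl_mult_left[OF d(1) c(1)] d(1) c(1) by (simp add: m_comm)
      then have "t \<in> Q" using Q(2) c(2) by blast
      then show False using core_Hom[OF Q(1) G_Hom[OF t(2)]] t(3) by blast
    qed
  qed
  then show ?thesis unfolding transform_def using d(2) by blast
qed

text \<open>If \<open>a\<close> is invertible wherever \<open>z\<close> is, then a power of \<open>z\<close> is \<open>a\<close> times a section of the
  twisted sheaf, that is an element \<open>y / c\<close> with \<open>y\<close> in the transform.\<close>

lemma power_divisible:
  assumes z: "z \<in> regular U" and a: "a \<in> I" "a \<in> Hom" "a \<noteq> \<zero>"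
    and inv: "\<And>p. p \<in> U \<Longrightarrow> Iv p z \<Longrightarrow> a \<notin> p"
  shows "\<exists>n::nat. \<exists>c\<in>carrier R - {\<zero>}. \<exists>y\<in>transform R I c. \<iota> c \<otimes>\<^bsub>L\<^esub> z [^]\<^bsub>L\<^esub> n = \<iota> (a \<otimes> y)"
proof -
  have zc: "z \<in> carrier L" by (rule regular_carrier[OF z])
  have ac: "a \<in> carrier R" by (rule I_car[OF a(1)])
  obtain p0 where p0: "p0 \<in> U" using U_ne by blast
  have "St p0 z" using z p0 unfolding regular_iff by blast
  then obtain e y0 d where d: "y0 \<in> G e" "d \<in> G e" "d \<notin> p0" "\<iota> d \<otimes>\<^bsub>L\<^esub> z = \<iota> y0" by (rule St_E)
  have c: "y0 \<in> carrier R" "d \<in> carrier R" using d G_carrier by blast+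
  have d0: "d \<noteq> \<zero>" using nonmem_nonzero[OF U_sub[OF p0] d(3)] .
  have y0: "y0 \<in> transform R I d" by (rule regular_transform[OF z c(2,1) d(4)])
  obtain A where A: "finite A" "A \<subseteq> I \<inter> Hom" "I = Idl A" using finite_homogeneous_generators[OF I] by blast
  have Ac: "A \<subseteq> carrier R" using A(2) I_car by blast
  have one: "\<exists>n::nat. \<forall>m\<ge>n. \<exists>N::nat. h [^] N \<otimes> y0 [^] m \<in> PIdl (a \<otimes> d [^] m)" if hA: "h \<in> A" for h
  proof -
    have hI: "h \<in> I" and hH: "h \<in> Hom" using hA A(2) by blast+
    have hc: "h \<in> carrier R" by (rule I_car[OF hI])
    obtain k where k: "h \<in> G k" using hH unfolding Hom_def by blast
    obtain l :: nat where "h [^] l \<otimes> y0 \<in> PIdl d" using transformD[OF y0 hI] by blast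
    then obtain s0 where s0: "s0 \<in> carrier R" "h [^] l \<otimes> y0 = s0 \<otimes> d" by (auto simp: PIdl_iff)
    \<comment> \<open>Passing to a component makes the cofactor homogeneous, so that
      \<open>z = s / h^l\<close> is a quotient of elements of equal degree.\<close>
    define s where "s = comp s0 (l * k)"
    have sG: "s \<in> G (l * k)" unfolding s_def by (rule comp_props(1)[OF s0(1)])
    have sc: "s \<in> carrier R" by (rule G_carrier[OF sG])
    have hlG: "h [^] l \<in> G (l * k)" by (rule pow_G[OF k])
    have hly: "h [^] l \<otimes> y0 \<in> G (l * k + e)" by (rule component_mult[OF hlG d(1)])
    have "h [^] l \<otimes> y0 = comp (h [^] l \<otimes> y0) (l * k + e)" using comp_G[OF hly] by simp
    also have "\<dots> = s \<otimes> d" unfolding s0(2) s_def using comp_mult_hom[OF s0(1) d(2), of "l * k + e"] by simp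
    finally have s: "h [^] l \<otimes> y0 = s \<otimes> d" .
    have hl: "h [^] l \<in> carrier R" using hc by simp
    have zs: "\<iota> (h [^] l) \<otimes>\<^bsub>L\<^esub> z = \<iota> s"
    proof -
      have "\<iota> d \<otimes>\<^bsub>L\<^esub> (\<iota> (h [^] l) \<otimes>\<^bsub>L\<^esub> z) = \<iota> (h [^] l) \<otimes>\<^bsub>L\<^esub> (\<iota> d \<otimes>\<^bsub>L\<^esub> z)"
        using c(2) hl zc by (intro L.m_lcomm) auto
      also have "\<dots> = \<iota> (h [^] l \<otimes> y0)" unfolding d(4) using hl c(1) by simp
      also have "\<dots> = \<iota> d \<otimes>\<^bsub>L\<^esub> \<iota> s" unfolding s m_comm[OF sc c(2)] using sc c(2) by simp
      finally show ?thesis by (rule iota_cancel[OF c(2) d0]) (use hl zc sc in auto)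
    qed
    \<comment> \<open>At a prime that contains \<open>a\<close> but neither \<open>s\<close> nor
      \<open>h\<close>, the quotient \<open>s / h^l\<close> is a unit, which \<open>inv\<close>
      forbids. The factor \<open>h\<close> guarantees that the core of the prime is a point of
      \<open>U\<close>.\<close>
    have "\<exists>n::nat. (s \<otimes> h) [^] n \<in> PIdl a"
    proof (rule radical_prime[OF cgenideal_ideal[OF ac]])
      show "s \<otimes> h \<in> carrier R" using sc hc by simp
      fix Q assume Q: "primeideal Q R" "PIdl a \<subseteq> Q"
      interpret Q: primeideal Q R by fact
      have aQ: "a \<in> comp_core Q" using core_Hom[OF Q(1) a(2)] Q(2) cgenideal_self[OF ac] by blast
      show "s \<otimes> h \<in> Q"
      proof (rule ccontr)
        assume neg: "s \<otimes> h \<notin> Q"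
        then have hQ: "h \<notin> Q" using Q.I_l_closed sc by blast
        have sQ: "s \<notin> Q" using neg Q.I_r_closed hc by blast
        have q: "comp_core Q \<in> U" by (rule core_U[OF Q(1) hI hQ])
        have "h [^] l \<notin> Q" using prime_pow_mem[OF Q(1) hc] hQ by blast
        then have "h [^] l \<notin> comp_core Q" using core_Hom[OF Q(1) G_Hom[OF hlG]] by blast
        moreover have "s \<notin> comp_core Q" using core_Hom[OF Q(1) G_Hom[OF sG]] sQ by blast
        ultimately have "Iv (comp_core Q) z" unfolding Iv_def using hlG sG zs zc by blast
        then show False using inv[OF q] aQ by blast
      qed
    qed
    then obtain n :: nat where n: "(s \<otimes> h) [^] n \<in> PIdl a" by blast
    \<comment> \<open>From \<open>h^l y0 = s d\<close> one gets
      \<open>h^(l m + m) y0^m = (s h)^m d^m\<close>, and the first factor on the right is divisible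
      by \<open>a\<close>.\<close>
    have "h [^] (l * m + m) \<otimes> y0 [^] m \<in> PIdl (a \<otimes> d [^] m)" if m: "m \<ge> n" for m
    proof -
      have "(s \<otimes> h) [^] m \<in> PIdl a" using pow_mem_mono[OF cgenideal_ideal[OF ac] _ n m] sc hc by simp
      moreover have "d [^] m \<in> PIdl (d [^] m)" using cgenideal_self c(2) by simp
      ultimately have 1: "(s \<otimes> h) [^] m \<otimes> d [^] m \<in> PIdl (a \<otimes> d [^] m)"
        using PIdl_mult_mult ac c(2) by simp
      have "h [^] (l * m + m) \<otimes> y0 [^] m = (h [^] l \<otimes> y0) [^] m \<otimes> h [^] m"
        using hc hl c(1) by (simp add: nat_pow_mult[symmetric] nat_pow_pow[symmetric] nat_pow_distrib m_ac)
      also have "\<dots> = (s \<otimes> h) [^] m \<otimes> d [^] m"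
        unfolding s using sc c(2) hc by (simp add: nat_pow_distrib m_ac)
      finally show ?thesis using 1 by simp
    qed
    then show ?thesis by blast
  qed
  then obtain n where n: "\<And>h m. h \<in> A \<Longrightarrow> m \<ge> (n h :: nat) \<Longrightarrow> \<exists>N::nat. h [^] N \<otimes> y0 [^] m \<in> PIdl (a \<otimes> d [^] m)"
    by metis
  define m where "m = Max (insert 0 (n ` A))"
  have m: "n h \<le> m" if "h \<in> A" for h unfolding m_def using A(1) that by (intro Max_ge) auto
  \<comment> \<open>As \<open>z = y0 / d\<close>, the power \<open>z^m\<close> equals
    \<open>a\<close> times \<open>?y / ?c\<close>.\<close>
  let ?c = "a \<otimes> d [^] m" and ?y = "y0 [^] m"
  have cc: "?c \<in> carrier R" "?y \<in> carrier R" using ac c by auto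
  have c0: "?c \<noteq> \<zero>" using integral[of a "d [^] m"] ac c(2) a(3) pow_nonzero[OF c(2) d0] by auto
  let ?B = "{b \<in> carrier R. b \<otimes> ?y \<in> PIdl ?c}"
  have B: "ideal ?B R" by (rule colon_ideal[OF cgenideal_ideal[OF cc(1)] cc(2)])
  have "\<exists>N::nat. h [^] N \<in> ?B" if h: "h \<in> A" for h using n[OF h m[OF h]] Ac h by auto
  then have "\<exists>N::nat. \<forall>h\<in>Idl A. h [^] N \<in> ?B" by (rule finite_genideal_pow[OF A(1) Ac B])
  then have "?y \<in> transform R I ?c" unfolding transform_def A(3) using cc(2) by blast
  moreover have "\<iota> ?c \<otimes>\<^bsub>L\<^esub> z [^]\<^bsub>L\<^esub> m = \<iota> (a \<otimes> ?y)"
  proof -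
    have "\<iota> ?c \<otimes>\<^bsub>L\<^esub> z [^]\<^bsub>L\<^esub> m = \<iota> a \<otimes>\<^bsub>L\<^esub> (\<iota> d \<otimes>\<^bsub>L\<^esub> z) [^]\<^bsub>L\<^esub> m"
      using ac c(2) zc by (simp add: h.hom_power L.nat_pow_distrib L.m_assoc)
    also have "\<dots> = \<iota> (a \<otimes> ?y)" unfolding d(4) using ac c(1) by (simp add: h.hom_power)
    finally show ?thesis .
  qed
  ultimately show ?thesis using cc(1) c0 by blast
qed

text \<open>The products with \<open>I\<close> of the sections \<open>y / c\<close> generate the
  fractions with denominator \<open>c\<close> and numerator in this ideal;
  \<open>c \<in> MI c\<close> is the criterion.\<close>

definition MI :: "'a \<Rightarrow> 'a set" where
  "MI c = Idl {x \<otimes> y | x y. x \<in> I \<and> y \<in> transform R I c}"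

lemma gens_car: "{x \<otimes> y | x y. x \<in> I \<and> y \<in> transform R I c} \<subseteq> carrier R"
  using I_car transform_carrier by auto

lemma MI_ideal: "ideal (MI c) R" unfolding MI_def by (rule genideal_ideal[OF gens_car])

text \<open>Multiplication by a further section \<open>y / d\<close>, with denominators multiplied.
  For \<open>y = d\<close> it is a mere change of denominator.\<close>

lemma MI_mult:
  assumes w: "w \<in> MI c" and c: "c \<in> carrier R" and d: "d \<in> carrier R" and y: "y \<in> transform R I d"
  shows "w \<otimes> y \<in> MI (c \<otimes> d)"
proof -
  have yc: "y \<in> carrier R" by (rule transform_carrier[OF y])
  have "{x \<otimes> y | x y. x \<in> I \<and> y \<in> transform R I c} \<subseteq> {b \<in> carrier R. b \<otimes> y \<in> MI (c \<otimes> d)}"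
  proof
    fix u assume "u \<in> {x \<otimes> y | x y. x \<in> I \<and> y \<in> transform R I c}"
    then obtain x v where u: "u = x \<otimes> v" "x \<in> I" "v \<in> transform R I c" by blast
    have k: "x \<in> carrier R" "v \<in> carrier R" using I_car[OF u(2)] transform_carrier[OF u(3)] .
    have "\<exists>n::nat. h [^] n \<otimes> (v \<otimes> y) \<in> PIdl (c \<otimes> d)" if h: "h \<in> I" for h
    proof -
      obtain m n :: nat where mn: "h [^] m \<otimes> v \<in> PIdl c" "h [^] n \<otimes> y \<in> PIdl d"
        using transformD[OF u(3) h] transformD[OF y h] by blast
      have hc: "h \<in> carrier R" by (rule I_car[OF h])
      have "h [^] (m + n) \<otimes> (v \<otimes> y) = (h [^] m \<otimes> v) \<otimes> (h [^] n \<otimes> y)"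
        using hc k yc by (simp add: nat_pow_mult[symmetric] m_ac)
      then show ?thesis using PIdl_mult_mult[OF c d mn] by metis
    qed
    then have "v \<otimes> y \<in> transform R I (c \<otimes> d)" unfolding transform_def using k yc by simp
    then have "x \<otimes> (v \<otimes> y) \<in> {x \<otimes> y | x y. x \<in> I \<and> y \<in> transform R I (c \<otimes> d)}" using u(2) by blast
    then have "x \<otimes> (v \<otimes> y) \<in> MI (c \<otimes> d)" unfolding MI_def by (rule subsetD[OF genideal_self[OF gens_car]])
    moreover have "u \<otimes> y = x \<otimes> (v \<otimes> y)" unfolding u(1) using k yc by (simp add: m_assoc)
    ultimately show "u \<in> {b \<in> carrier R. b \<otimes> y \<in> MI (c \<otimes> d)}" using u(1) k by simp
  qed
  then have "MI c \<subseteq> {b \<in> carrier R. b \<otimes> y \<in> MI (c \<otimes> d)}"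
    unfolding MI_def[of c] by (rule genideal_minimal[OF colon_ideal[OF MI_ideal yc]])
  then show ?thesis using w by blast
qed

lemma self_transform: "c \<in> carrier R \<Longrightarrow> c \<in> transform R I c"
  unfolding transform_def using PIdl_mult_left I_car by (auto intro!: exI[of _ 0])

text \<open>The elements of the ideal generated by \<open>I\<close> in the ideal transform.\<close>

definition unit_part :: "('a \<times> 'a) set set" where
  "unit_part = {z \<in> carrier L. \<exists>c\<in>carrier R - {\<zero>}. \<exists>w\<in>MI c. \<iota> c \<otimes>\<^bsub>L\<^esub> z = \<iota> w}"

lemma unit_part_add:
  assumes "z \<in> unit_part" "z' \<in> unit_part" shows "z \<oplus>\<^bsub>L\<^esub> z' \<in> unit_part"
proof -
  obtain c w where c: "c \<in> carrier R" "c \<noteq> \<zero>" "w \<in> MI c" "\<iota> c \<otimes>\<^bsub>L\<^esub> z = \<iota> w" "z \<in> carrier L"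
    using assms(1) unfolding unit_part_def by blast
  obtain c' w' where c': "c' \<in> carrier R" "c' \<noteq> \<zero>" "w' \<in> MI c'" "\<iota> c' \<otimes>\<^bsub>L\<^esub> z' = \<iota> w'" "z' \<in> carrier L"
    using assms(2) unfolding unit_part_def by blast
  have wc: "w \<in> carrier R" "w' \<in> carrier R" using ideal.Icarr[OF MI_ideal] c(3) c'(3) by blast+
  have "w \<otimes> c' \<in> MI (c \<otimes> c')" by (rule MI_mult[OF c(3,1) c'(1) self_transform[OF c'(1)]])
  moreover have "w' \<otimes> c \<in> MI (c' \<otimes> c)" by (rule MI_mult[OF c'(3,1) c(1) self_transform[OF c(1)]])
  ultimately have "w \<otimes> c' \<oplus> w' \<otimes> c \<in> MI (c \<otimes> c')"
    using additive_subgroup.a_closed[OF ideal.axioms(1)[OF MI_ideal]] m_comm[OF c(1) c'(1)] by metis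
  moreover have "\<iota> (c \<otimes> c') \<otimes>\<^bsub>L\<^esub> (z \<oplus>\<^bsub>L\<^esub> z') = \<iota> (w \<otimes> c' \<oplus> w' \<otimes> c)"
  proof -
    have "\<iota> (c \<otimes> c') \<otimes>\<^bsub>L\<^esub> (z \<oplus>\<^bsub>L\<^esub> z') = (\<iota> c \<otimes>\<^bsub>L\<^esub> z) \<otimes>\<^bsub>L\<^esub> \<iota> c' \<oplus>\<^bsub>L\<^esub> (\<iota> c' \<otimes>\<^bsub>L\<^esub> z') \<otimes>\<^bsub>L\<^esub> \<iota> c"
      using c(1,5) c'(1,5) by (simp add: L.r_distr L.m_ac)
    then show ?thesis unfolding c(4) c'(4) using wc c(1) c'(1) by simp
  qed
  moreover have "c \<otimes> c' \<in> carrier R - {\<zero>}" using c(1,2) c'(1,2) integral[of c c'] by auto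
  ultimately show ?thesis unfolding unit_part_def using c(5) c'(5) by blast
qed

lemma unit_part_mult:
  assumes "z \<in> unit_part" "z' \<in> regular U" shows "z' \<otimes>\<^bsub>L\<^esub> z \<in> unit_part"
proof -
  obtain c w where c: "c \<in> carrier R" "c \<noteq> \<zero>" "w \<in> MI c" "\<iota> c \<otimes>\<^bsub>L\<^esub> z = \<iota> w" "z \<in> carrier L"
    using assms(1) unfolding unit_part_def by blast
  have zc: "z' \<in> carrier L" by (rule regular_carrier[OF assms(2)])
  obtain p0 where p0: "p0 \<in> U" using U_ne by blast
  have "St p0 z'" using assms(2) p0 unfolding regular_iff by blast
  then obtain e y d where d: "y \<in> G e" "d \<in> G e" "d \<notin> p0" "\<iota> d \<otimes>\<^bsub>L\<^esub> z' = \<iota> y" by (rule St_E)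
  have k: "y \<in> carrier R" "d \<in> carrier R" using d G_carrier by blast+
  have d0: "d \<noteq> \<zero>" using nonmem_nonzero[OF U_sub[OF p0] d(3)] .
  have wc: "w \<in> carrier R" using ideal.Icarr[OF MI_ideal c(3)] .
  have "w \<otimes> y \<in> MI (c \<otimes> d)" by (rule MI_mult[OF c(3,1) k(2) regular_transform[OF assms(2) k(2,1) d(4)]])
  moreover have "\<iota> (c \<otimes> d) \<otimes>\<^bsub>L\<^esub> (z' \<otimes>\<^bsub>L\<^esub> z) = \<iota> (w \<otimes> y)"
  proof -
    have "\<iota> (c \<otimes> d) \<otimes>\<^bsub>L\<^esub> (z' \<otimes>\<^bsub>L\<^esub> z) = (\<iota> c \<otimes>\<^bsub>L\<^esub> z) \<otimes>\<^bsub>L\<^esub> (\<iota> d \<otimes>\<^bsub>L\<^esub> z')"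
      using c(1,5) k(2) zc by (simp add: L.m_ac)
    then show ?thesis unfolding c(4) d(4) using wc k(1) by simp
  qed
  moreover have "c \<otimes> d \<in> carrier R - {\<zero>}" using c(1,2) k(2) d0 integral[of c d] by auto
  ultimately show ?thesis unfolding unit_part_def using zc c(5) by blast
qed

lemma unit_part_one: "\<one>\<^bsub>L\<^esub> \<in> unit_part \<Longrightarrow> affine_ideal R I"
proof -
  assume "\<one>\<^bsub>L\<^esub> \<in> unit_part"
  then obtain c w where c: "c \<in> carrier R - {\<zero>}" "w \<in> MI c" "\<iota> c \<otimes>\<^bsub>L\<^esub> \<one>\<^bsub>L\<^esub> = \<iota> w"
    unfolding unit_part_def by blast
  have "w \<in> carrier R" using ideal.Icarr[OF MI_ideal c(2)] .
  then have "c = w" using iota_eq[of c w] c(1,3) by simp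
  then show ?thesis unfolding affine_ideal_def using c(1,2) unfolding MI_def by blast
qed

lemma regular_subring_U: "V \<subseteq> U \<Longrightarrow> V \<noteq> {} \<Longrightarrow> subring (regular V) L"
proof (rule regular_subring)
  assume "V \<subseteq> U" "V \<noteq> {}"
  then show "V \<subseteq> topspace Top" "V \<noteq> {}" unfolding topspace_Top using U_sub by blast+
next
  fix a f assume af: "(a, f) \<in> Pairs"
  then obtain d where a: "a \<in> G d" "f \<in> G d" unfolding Pairs_def by blast
  show "(\<ominus> a, f) \<in> Pairs"
    unfolding Pairs_def using additive_subgroup.a_inv_closed[OF component_subgroup a(1)] a(2) by blast
  fix b g assume "(b, g) \<in> Pairs"
  then obtain e where b: "b \<in> G e" "g \<in> G e" unfolding Pairs_def by blast
  have "g \<otimes> a \<in> G (d + e)" using component_mult[OF b(2) a(1)] by (simp add: add.commute)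
  then have "g \<otimes> a \<oplus> f \<otimes> b \<in> G (d + e)" using component_mult[OF a(2) b(1)] by (rule add_G)
  then show "(a \<otimes> b, f \<otimes> g) \<in> Pairs" "(g \<otimes> a \<oplus> f \<otimes> b, f \<otimes> g) \<in> Pairs"
    unfolding Pairs_def using component_mult[OF a(1) b(1)] component_mult[OF a(2) b(2)] by blast+
next
  show "(\<one>, \<one>) \<in> Pairs" unfolding Pairs_def using one_G by blast
qed

lemma regular_ring: "V \<subseteq> U \<Longrightarrow> V \<noteq> {} \<Longrightarrow> ring (L\<lparr>carrier := regular V\<rparr>)"
  using L.subring_is_ring[OF regular_subring_U] .

text \<open>If the elements generated by \<open>I\<close> over the ring of sections were proper,
  their preimage in \<open>B\<close> would lie in a prime corresponding to a point \<open>x\<close>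
  of \<open>U\<close>. Some homogeneous \<open>a\<close> in \<open>I\<close> does not vanish at
  \<open>x\<close>, and a basic open set of \<open>Spec B\<close> around that prime stays where
  \<open>a\<close> does not vanish; \<open>power_divisible\<close> then gives a power of its
  defining element in the preimage.\<close>

lemma affine_imp_affine_ideal:
  assumes aff: "is_affine OU" shows "affine_ideal R I"
proof -
  obtain B :: "('a set \<Rightarrow> ('a \<times> 'a) set) ring" and f \<phi> where B: "cring B" and iso: "ringed_space_iso OU (Spec B) f \<phi>"
    using aff unfolding is_affine_def by blast
  interpret B: cring B by fact
  define PB where "PB = {p. primeideal p B}"
  define pre where "pre V = {x \<in> U. f x \<in> V}" for V
  have homeo: "homeomorphic_map (points OU) (points (Spec B)) f"
    and phi: "\<And>V. openin (points (Spec B)) V \<Longrightarrow> \<phi> V \<in> ring_iso (sections (Spec B) V) (sections OU (pre V))"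
    and phi_restr: "\<And>V W s. openin (points (Spec B)) V \<Longrightarrow> openin (points (Spec B)) W \<Longrightarrow> W \<subseteq> V \<Longrightarrow>
      s \<in> carrier (sections (Spec B) V) \<Longrightarrow> \<phi> W (restrict s W) = restrict (\<phi> V s) (pre W)"
    using iso unfolding ringed_space_iso_def Let_def topspace_OU pre_def B.restr_Spec restr_OU by blast+
  have surj: "f ` U = PB" and inj: "inj_on f U"
    using homeo unfolding homeomorphic_eq_everything_map topspace_OU B.topspace_Spec PB_def by blast+
  have open_f: "openin (points (Spec B)) (f ` W)" if "openin (points OU) W" for W
    using homeo that unfolding homeomorphic_eq_everything_map open_map_def by blast
  have openPB: "openin (points (Spec B)) PB"
    using openin_topspace[of "points (Spec B)"] unfolding B.topspace_Spec PB_def .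
  have prePB: "pre PB = U" unfolding pre_def using surj by blast
  have preW: "pre (f ` W) = W" if "W \<subseteq> U" for W
    unfolding pre_def using that inj by (auto simp: inj_on_def)
  define \<tau> where "\<tau> = inv_into (regular U) (sect U)"
  have tau: "\<tau> \<in> ring_iso (sections OU U) (L\<lparr>carrier := regular U\<rparr>)"
    using ring_iso_set_sym[OF regular_ring[OF subset_refl U_ne] sect_iso[OF open_U U_ne]]
    unfolding \<tau>_def sections_OU by simp
  define \<psi> where "\<psi> r = \<tau> (\<phi> PB (B.cst PB r))" for r
  have g: "\<phi> PB \<in> ring_hom (sections (Spec B) PB) (sections OU U)"
    using phi[OF openPB] unfolding prePB ring_iso_def by blast
  have "\<tau> \<circ> (\<phi> PB \<circ> B.cst PB) \<in> ring_hom B (L\<lparr>carrier := regular U\<rparr>)"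
    using ring_hom_trans[OF ring_hom_trans[OF B.cst_hom[OF openPB] g]] tau unfolding ring_iso_def by blast
  moreover have "\<tau> \<circ> (\<phi> PB \<circ> B.cst PB) = \<psi>" unfolding \<psi>_def by (simp add: fun_eq_iff)
  ultimately have psi: "\<psi> \<in> ring_hom B (L\<lparr>carrier := regular U\<rparr>)" by simp
  have psi_reg: "\<psi> r \<in> regular U" if "r \<in> carrier B" for r using ring_hom_closed[OF psi that] by simp
  have psi_mult: "\<psi> (r \<otimes>\<^bsub>B\<^esub> s) = \<psi> r \<otimes>\<^bsub>L\<^esub> \<psi> s" if "r \<in> carrier B" "s \<in> carrier B" for r s
    using ring_hom_mult[OF psi that] by simp
  have psi_add: "\<psi> (r \<oplus>\<^bsub>B\<^esub> s) = \<psi> r \<oplus>\<^bsub>L\<^esub> \<psi> s" if "r \<in> carrier B" "s \<in> carrier B" for r s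
    using ring_hom_add[OF psi that] by simp
  have psi_one: "\<psi> \<one>\<^bsub>B\<^esub> = \<one>\<^bsub>L\<^esub>" using ring_hom_one[OF psi] by simp
  have sect_psi: "sect U (\<psi> r) = \<phi> PB (B.cst PB r)" if r: "r \<in> carrier B" for r
  proof -
    have "\<phi> PB (B.cst PB r) \<in> carrier (sections OU U)"
      using ring_hom_closed[OF g ring_hom_closed[OF B.cst_hom[OF openPB] r]] .
    then have "\<phi> PB (B.cst PB r) \<in> sect U ` regular U"
      using sect_iso[OF open_U U_ne] unfolding ring_iso_def bij_betw_def sections_OU by simp
    then show ?thesis unfolding \<psi>_def \<tau>_def by (rule f_inv_into_f)
  qed
  have key: "r \<notin> f y" if r: "r \<in> carrier B" and y: "y \<in> U" and inv: "Iv y (\<psi> r)" for r y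
  proof -
    define z where "z = \<psi> r"
    obtain d b t where rep: "b \<in> G d" "t \<in> G d" "b \<notin> y" "t \<notin> y" "\<iota> t \<otimes>\<^bsub>L\<^esub> z = \<iota> b" and zc: "z \<in> carrier L"
      using inv unfolding Iv_def z_def by blast
    have c: "b \<in> carrier R" "t \<in> carrier R" using rep(1,2) G_carrier by blast+
    have nz: "b \<noteq> \<zero>" "t \<noteq> \<zero>" using nonmem_nonzero[OF U_sub[OF y]] rep(3,4) by blast+
    define W where "W = U \<inter> {q \<in> topspace Top. b \<in> Dens q} \<inter> {q \<in> topspace Top. t \<in> Dens q}"
    have WU: "W \<subseteq> U" unfolding W_def by blast
    have yW: "y \<in> W" unfolding W_def Dens_def topspace_Top using y U_sub rep G_Hom by blast
    have Wne: "W \<noteq> {}" using yW by blast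
    have pairs: "(b, b) \<in> Pairs" "(t, t) \<in> Pairs" unfolding Pairs_def using rep(1,2) by blast+
    have openW: "openin Top W"
      unfolding W_def using open_U open_denominator[OF pairs(1)] open_denominator[OF pairs(2)] by blast
    have mem: "b \<notin> q" "t \<notin> q" if "q \<in> W" for q using that unfolding W_def Dens_def by blast+
    define w where "w = inv\<^bsub>L\<^esub> z"
    have "\<iota> t \<otimes>\<^bsub>L\<^esub> \<zero>\<^bsub>L\<^esub> = \<zero>\<^bsub>L\<^esub>" using c by simp
    then have "z \<noteq> \<zero>\<^bsub>L\<^esub>" using rep(5) iota_nonzero[OF c(1) nz(1)] by metis
    then have zu: "z \<in> Units L" using zc by (simp add: L.field_Units)
    have w: "w \<in> carrier L" "z \<otimes>\<^bsub>L\<^esub> w = \<one>\<^bsub>L\<^esub>"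
      unfolding w_def using L.Units_inv_closed[OF zu] L.Units_r_inv[OF zu] .
    have bw: "\<iota> b \<otimes>\<^bsub>L\<^esub> w = \<iota> t"
      unfolding rep(5)[symmetric] using c zc w by (simp add: L.m_assoc)
    have zW: "z \<in> regular W" using psi_reg[OF r] regular_mono[OF WU] unfolding z_def by blast
    have wW: "w \<in> regular W"
      unfolding regular_iff using St_I[OF w(1) rep(2,1) mem(1) bw] w(1) by blast
    let ?V = "f ` W"
    have oV: "openin (points (Spec B)) ?V" by (rule open_f) (simp add: openin_OU openW WU)
    have pV: "pre ?V = W" by (rule preW[OF WU])
    have phV: "\<phi> ?V \<in> ring_iso (sections (Spec B) ?V) (sections OU W)" using phi[OF oV] unfolding pV .
    have Vsub: "?V \<subseteq> PB" using surj WU by blast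
    have sc: "sect W w \<in> carrier (sections OU W)" unfolding sections_OU by (rule sect_carrier[OF openW wW])
    have "sect W w \<in> \<phi> ?V ` carrier (sections (Spec B) ?V)"
      using phV sc unfolding ring_iso_def bij_betw_def by blast
    then obtain v where v: "v \<in> carrier (sections (Spec B) ?V)" "\<phi> ?V v = sect W w"
      by (rule imageE) (rule that[OF _ sym])
    have cv: "B.cst ?V r \<in> carrier (sections (Spec B) ?V)" using ring_hom_closed[OF B.cst_hom[OF oV] r] .
    have restr_cst: "restrict (B.cst PB r) ?V = B.cst ?V r"
      unfolding B.cst_def by (simp add: Int_absorb1[OF Vsub] Int_absorb2[OF Vsub] restrict_restrict)
    have "\<phi> ?V (B.cst ?V r) = restrict (\<phi> PB (B.cst PB r)) (pre ?V)"
      using phi_restr[OF openPB oV Vsub ring_hom_closed[OF B.cst_hom[OF openPB] r]] unfolding restr_cst .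
    also have "\<dots> = sect W z"
      unfolding sect_psi[OF r, symmetric] pV z_def by (rule sect_restrict[OF WU])
    finally have phc: "\<phi> ?V (B.cst ?V r) = sect W z" .
    note sW = sect_iso[OF openW Wne, folded sections_OU]
    have sWh: "sect W \<in> ring_hom (L\<lparr>carrier := regular W\<rparr>) (sections OU W)"
      using sW unfolding ring_iso_def by blast
    have phh: "\<phi> ?V \<in> ring_hom (sections (Spec B) ?V) (sections OU W)" and
      phinj: "inj_on (\<phi> ?V) (carrier (sections (Spec B) ?V))"
      using phV unfolding ring_iso_def bij_betw_def by blast+
    have "sect W (z \<otimes>\<^bsub>L\<^esub> w) = sect W z \<otimes>\<^bsub>sections OU W\<^esub> sect W w"
      using ring_hom_mult[OF sWh, of z w] zW wW by simp
    then have "sect W \<one>\<^bsub>L\<^esub> = \<phi> ?V (B.cst ?V r) \<otimes>\<^bsub>sections OU W\<^esub> \<phi> ?V v" unfolding w(2) phc v(2) .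
    moreover have "sect W \<one>\<^bsub>L\<^esub> = \<one>\<^bsub>sections OU W\<^esub>" using ring_hom_one[OF sWh] by simp
    ultimately have "\<phi> ?V (B.cst ?V r \<otimes>\<^bsub>sections (Spec B) ?V\<^esub> v) = \<phi> ?V \<one>\<^bsub>sections (Spec B) ?V\<^esub>"
      using ring_hom_mult[OF phh cv v(1)] ring_hom_one[OF phh] by simp
    moreover have "B.cst ?V r \<otimes>\<^bsub>sections (Spec B) ?V\<^esub> v \<in> carrier (sections (Spec B) ?V)"
      "\<one>\<^bsub>sections (Spec B) ?V\<^esub> \<in> carrier (sections (Spec B) ?V)"
    proof -
      show one: "\<one>\<^bsub>sections (Spec B) ?V\<^esub> \<in> carrier (sections (Spec B) ?V)"
        using ring_hom_closed[OF B.cst_hom[OF oV] B.one_closed] ring_hom_one[OF B.cst_hom[OF oV]] by simp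
      show "B.cst ?V r \<otimes>\<^bsub>sections (Spec B) ?V\<^esub> v \<in> carrier (sections (Spec B) ?V)"
        by (rule B.sections_mult_closed[OF oV cv v(1)])
    qed
    ultimately have "B.cst ?V r \<otimes>\<^bsub>sections (Spec B) ?V\<^esub> v = \<one>\<^bsub>sections (Spec B) ?V\<^esub>"
      using phinj by (simp add: inj_on_def)
    then show "r \<notin> f y" using B.cst_unit[OF oV _ r v(1)] yW by blast
  qed
  \<comment> \<open>The preimage in \<open>B\<close> of the ideal generated by \<open>I\<close> in
    the ring of sections.\<close>
  define \<aa> where "\<aa> = {r \<in> carrier B. \<psi> r \<in> unit_part}"
  have scale: "s \<otimes>\<^bsub>B\<^esub> r \<in> \<aa>" if "r \<in> \<aa>" "s \<in> carrier B" for r s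
    using that psi_mult[of s r] unit_part_mult[OF _ psi_reg] unfolding \<aa>_def by auto
  have ideal: "ideal \<aa> B"
  proof (rule idealI[OF B.ring_axioms])
    show "subgroup \<aa> (add_monoid B)"
    proof (rule subgroup.intro)
      show "\<aa> \<subseteq> carrier (add_monoid B)" unfolding \<aa>_def by auto
      show "x \<otimes>\<^bsub>add_monoid B\<^esub> y \<in> \<aa>" if "x \<in> \<aa>" "y \<in> \<aa>" for x y
        using that psi_add[of x y] unit_part_add unfolding \<aa>_def by auto
      have z: "\<psi> \<zero>\<^bsub>B\<^esub> = \<zero>\<^bsub>L\<^esub>"
        using psi_add[of "\<zero>\<^bsub>B\<^esub>" "\<zero>\<^bsub>B\<^esub>"] regular_carrier[OF psi_reg[of "\<zero>\<^bsub>B\<^esub>"]] by simp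
      have "\<zero> \<in> MI \<one>" using additive_subgroup.zero_closed[OF ideal.axioms(1)[OF MI_ideal]] .
      then have "\<zero>\<^bsub>L\<^esub> \<in> unit_part" unfolding unit_part_def
        by (intro CollectI conjI bexI[of _ "\<one>"] bexI[of _ "\<zero>"]) auto
      then show "\<one>\<^bsub>add_monoid B\<^esub> \<in> \<aa>" unfolding \<aa>_def using z by simp
      fix x assume x: "x \<in> \<aa>"
      then have xc: "x \<in> carrier B" unfolding \<aa>_def by blast
      have "\<ominus>\<^bsub>B\<^esub> x = (\<ominus>\<^bsub>B\<^esub> \<one>\<^bsub>B\<^esub>) \<otimes>\<^bsub>B\<^esub> x" using xc by (simp add: B.l_minus)
      then have "\<ominus>\<^bsub>B\<^esub> x \<in> \<aa>" using scale[OF x] by simp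
      then show "inv\<^bsub>add_monoid B\<^esub> x \<in> \<aa>" unfolding a_inv_def .
    qed
    show "s \<otimes>\<^bsub>B\<^esub> r \<in> \<aa>" "r \<otimes>\<^bsub>B\<^esub> s \<in> \<aa>" if "r \<in> \<aa>" "s \<in> carrier B" for r s
      using scale[OF that] B.m_comm[of r s] that unfolding \<aa>_def by auto
  qed
  have "\<one>\<^bsub>B\<^esub> \<in> \<aa>"
  proof (rule ccontr)
    assume "\<one>\<^bsub>B\<^esub> \<notin> \<aa>"
    then obtain q where q: "primeideal q B" "\<aa> \<subseteq> q" using B.proper_ideal_prime[OF ideal] by blast
    then have "q \<in> f ` U" unfolding surj PB_def by blast
    then obtain x where x: "x \<in> U" "q = f x" by blast
    obtain d a where a: "a \<in> G d" "a \<in> I" "a \<notin> x" using U_hom_element[OF x(1)] by blast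
    have a0: "a \<noteq> \<zero>" by (rule nonmem_nonzero[OF U_sub[OF x(1)] a(3)])
    define W where "W = U \<inter> {q \<in> topspace Top. a \<in> Dens q}"
    have pair: "(a, a) \<in> Pairs" unfolding Pairs_def using a(1) by blast
    have "openin (points OU) W"
      unfolding openin_OU W_def using open_U open_denominator[OF pair] by blast
    then have "openin (points (Spec B)) (f ` W)" by (rule open_f)
    then obtain E where E: "E \<subseteq> carrier B" "f ` W = PB - {p. primeideal p B \<and> E \<subseteq> p}"
      unfolding B.openin_Spec PB_def by blast
    have "x \<in> W" unfolding W_def Dens_def topspace_Top using x(1) U_sub a G_Hom by blast
    then have "\<not> E \<subseteq> q" using E(2) x(2) q(1) by blast
    then obtain r where r: "r \<in> E" "r \<notin> q" by blast
    have rc: "r \<in> carrier B" using r E by blast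
    have inv: "a \<notin> y" if y: "y \<in> U" and iy: "Iv y (\<psi> r)" for y
    proof -
      have "r \<notin> f y" by (rule key[OF rc y iy])
      moreover have "f y \<in> PB" using surj y by blast
      ultimately have "f y \<in> f ` W" unfolding E(2) using r(1) by blast
      then have "y \<in> W" using inj y unfolding W_def inj_on_def by blast
      then show ?thesis unfolding W_def Dens_def by blast
    qed
    obtain n c y where n: "c \<in> carrier R - {\<zero>}" "y \<in> transform R I c" "\<iota> c \<otimes>\<^bsub>L\<^esub> \<psi> r [^]\<^bsub>L\<^esub> (n::nat) = \<iota> (a \<otimes> y)"
      using power_divisible[OF psi_reg[OF rc] a(2) G_Hom[OF a(1)] a0 inv] by blast
    have pn: "\<psi> (r [^]\<^bsub>B\<^esub> n) = \<psi> r [^]\<^bsub>L\<^esub> n" for n :: nat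
      by (induction n) (use psi_one psi_mult rc in auto)
    have "a \<otimes> y \<in> {x \<otimes> y | x y. x \<in> I \<and> y \<in> transform R I c}" using a(2) n(2) by blast
    then have "a \<otimes> y \<in> MI c" unfolding MI_def by (rule subsetD[OF genideal_self[OF gens_car]])
    then have "\<psi> (r [^]\<^bsub>B\<^esub> n) \<in> unit_part"
      unfolding unit_part_def pn using n(1,3) regular_carrier[OF psi_reg[OF rc]] by blast
    then have "r [^]\<^bsub>B\<^esub> n \<in> q" using q(2) rc unfolding \<aa>_def by auto
    then show False using B.prime_pow_mem[OF q(1) rc] r(2) by blast
  qed
  then have "\<one>\<^bsub>L\<^esub> \<in> unit_part" unfolding \<aa>_def using psi_one by simp
  then show ?thesis by (rule unit_part_one)
qed

end

section \<open>The unit ideal gives an affine open subset\<close>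

lemma (in graded_ring) degree_unique: "x \<in> G d \<Longrightarrow> x \<in> G e \<Longrightarrow> x \<noteq> \<zero> \<Longrightarrow> d = e"
  using comp_G[of x d d] comp_G[of x e d] by (auto split: if_splits)

context affine_criterion
begin

section \<open>Units of stalks and sections of the twisted sheaves\<close>

lemma prime_nmem_mult:
  assumes "p \<in> U" "x \<in> carrier R" "y \<in> carrier R" shows "x \<otimes> y \<notin> p \<longleftrightarrow> x \<notin> p \<and> y \<notin> p"
proof -
  interpret p: primeideal p R using assms(1) unfolding U_def by blast
  show ?thesis using p.I_prime[OF assms(2,3)] p.I_l_closed[OF _ assms(2), of y] p.I_r_closed[OF _ assms(3), of x] by blast
qed

lemma prime_nmem_pow:
  assumes "p \<in> U" "x \<in> carrier R" "x \<notin> p" shows "x [^] (i::nat) \<notin> p"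
  using prime_pow_mem[OF _ assms(2)] assms(1,3) unfolding U_def by blast

lemma rep_mult:
  assumes "t \<in> carrier R" "b \<in> carrier R" "t' \<in> carrier R" "b' \<in> carrier R" "z \<in> carrier L" "z' \<in> carrier L"
    "\<iota> t \<otimes>\<^bsub>L\<^esub> z = \<iota> b" "\<iota> t' \<otimes>\<^bsub>L\<^esub> z' = \<iota> b'"
  shows "\<iota> (t \<otimes> t') \<otimes>\<^bsub>L\<^esub> (z \<otimes>\<^bsub>L\<^esub> z') = \<iota> (b \<otimes> b')"
proof -
  have "\<iota> (t \<otimes> t') \<otimes>\<^bsub>L\<^esub> (z \<otimes>\<^bsub>L\<^esub> z') = (\<iota> t \<otimes>\<^bsub>L\<^esub> z) \<otimes>\<^bsub>L\<^esub> (\<iota> t' \<otimes>\<^bsub>L\<^esub> z')"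
    using assms(1,3,5,6) by (simp add: L.m_ac)
  then show ?thesis unfolding assms(7,8) using assms(2,4) by simp
qed

lemma Iv_mult:
  assumes p: "p \<in> U" and z: "St p z" "St p z'"
  shows "Iv p (z \<otimes>\<^bsub>L\<^esub> z') \<longleftrightarrow> Iv p z \<and> Iv p z'"
proof -
  obtain d b t where 1: "b \<in> G d" "t \<in> G d" "t \<notin> p" "\<iota> t \<otimes>\<^bsub>L\<^esub> z = \<iota> b" "z \<in> carrier L" using z(1) by (rule St_E)
  obtain d' b' t' where 2: "b' \<in> G d'" "t' \<in> G d'" "t' \<notin> p" "\<iota> t' \<otimes>\<^bsub>L\<^esub> z' = \<iota> b'" "z' \<in> carrier L" using z(2) by (rule St_E)
  have c: "b \<in> carrier R" "t \<in> carrier R" "b' \<in> carrier R" "t' \<in> carrier R" using 1 2 G_carrier by blast+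
  have "\<iota> (t \<otimes> t') \<otimes>\<^bsub>L\<^esub> (z \<otimes>\<^bsub>L\<^esub> z') = \<iota> (b \<otimes> b')" by (rule rep_mult[OF c(2,1,4,3) 1(5) 2(5) 1(4) 2(4)])
  then have "Iv p (z \<otimes>\<^bsub>L\<^esub> z') \<longleftrightarrow> b \<otimes> b' \<notin> p"
    using Iv_iff_rep[OF U_sub[OF p] component_mult[OF 1(1) 2(1)] component_mult[OF 1(2) 2(2)]]
      prime_nmem_mult[OF p c(2,4)] 1(3,5) 2(3,5) by blast
  then show ?thesis
    unfolding prime_nmem_mult[OF p c(1,3)] Iv_iff_rep[OF U_sub[OF p] 1] Iv_iff_rep[OF U_sub[OF p] 2] .
qed

text \<open>The non-units of a stalk are closed under addition: over a common denominator the
  numerators lie in the prime \<open>p\<close>. This makes the map to the spectrum of the sections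
  well defined.\<close>

lemma Iv_add:
  assumes p: "p \<in> U" and z: "St p z" "St p z'" and n: "\<not> Iv p z" "\<not> Iv p z'"
  shows "\<not> Iv p (z \<oplus>\<^bsub>L\<^esub> z')"
proof -
  obtain d b t where 1: "b \<in> G d" "t \<in> G d" "t \<notin> p" "\<iota> t \<otimes>\<^bsub>L\<^esub> z = \<iota> b" "z \<in> carrier L" using z(1) by (rule St_E)
  obtain d' b' t' where 2: "b' \<in> G d'" "t' \<in> G d'" "t' \<notin> p" "\<iota> t' \<otimes>\<^bsub>L\<^esub> z' = \<iota> b'" "z' \<in> carrier L" using z(2) by (rule St_E)
  have c: "b \<in> carrier R" "t \<in> carrier R" "b' \<in> carrier R" "t' \<in> carrier R" using 1 2 G_carrier by blast+
  interpret p: primeideal p R using p unfolding U_def by blast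
  have m: "b \<in> p" "b' \<in> p" using n Iv_iff_rep[OF U_sub[OF p] 1] Iv_iff_rep[OF U_sub[OF p] 2] by blast+
  have "\<iota> (t \<otimes> t') \<otimes>\<^bsub>L\<^esub> (z \<oplus>\<^bsub>L\<^esub> z') = \<iota> t' \<otimes>\<^bsub>L\<^esub> (\<iota> t \<otimes>\<^bsub>L\<^esub> z) \<oplus>\<^bsub>L\<^esub> \<iota> t \<otimes>\<^bsub>L\<^esub> (\<iota> t' \<otimes>\<^bsub>L\<^esub> z')"
    using c 1(5) 2(5) by (simp add: L.r_distr L.m_ac)
  then have eq: "\<iota> (t \<otimes> t') \<otimes>\<^bsub>L\<^esub> (z \<oplus>\<^bsub>L\<^esub> z') = \<iota> (t' \<otimes> b \<oplus> t \<otimes> b')" unfolding 1(4) 2(4) using c by simp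
  have tb: "t' \<otimes> b \<in> G (d + d')" using component_mult[OF 2(2) 1(1)] by (simp add: add.commute)
  have mem: "t' \<otimes> b \<oplus> t \<otimes> b' \<in> p" using m c p.I_l_closed p.a_closed by simp
  have "t \<otimes> t' \<notin> p" using prime_nmem_mult[OF p c(2,4)] 1(3) 2(3) by blast
  then show ?thesis
    using Iv_iff_rep[OF U_sub[OF p] add_G[OF tb component_mult[OF 1(2) 2(1)]] component_mult[OF 1(2) 2(2)] _ eq]
      mem 1(5) 2(5) by simp
qed

lemma Iv_one: "p \<in> U \<Longrightarrow> Iv p \<one>\<^bsub>L\<^esub>"
  unfolding Iv_def using one_G PtsD(6)[OF U_sub] by (intro conjI exI[of _ 0] bexI[of _ "\<one>"]) auto

lemma Iv_zero: "p \<in> U \<Longrightarrow> \<not> Iv p \<zero>\<^bsub>L\<^esub>"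
  using Iv_iff_rep[OF U_sub, of p "\<zero>" 0 "\<one>" "\<zero>\<^bsub>L\<^esub>"] zero_G one_G PtsD(6,7)[OF U_sub] by simp

lemma open_Iv: "openin Top {p \<in> U. Iv p z}"
proof (subst openin_subopen, intro ballI)
  fix p assume "p \<in> {p \<in> U. Iv p z}"
  then have p: "p \<in> U" "Iv p z" by auto
  obtain d b t where rep: "b \<in> G d" "t \<in> G d" "b \<notin> p" "t \<notin> p" "\<iota> t \<otimes>\<^bsub>L\<^esub> z = \<iota> b" "z \<in> carrier L"
    using p(2) unfolding Iv_def by blast
  define W where "W = U \<inter> {q \<in> topspace Top. b \<in> Dens q} \<inter> {q \<in> topspace Top. t \<in> Dens q}"
  have pairs: "(b, b) \<in> Pairs" "(t, t) \<in> Pairs" unfolding Pairs_def using rep(1,2) by blast+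
  have "openin Top W"
    unfolding W_def using open_U open_denominator[OF pairs(1)] open_denominator[OF pairs(2)] by blast
  moreover have "p \<in> W" unfolding W_def Dens_def topspace_Top using p U_sub rep G_Hom by blast
  moreover have "W \<subseteq> {p \<in> U. Iv p z}"
  proof
    fix q assume q: "q \<in> W"
    then have "b \<notin> q" "t \<notin> q" "q \<in> U" unfolding W_def Dens_def by blast+
    then show "q \<in> {p \<in> U. Iv p z}" unfolding Iv_def using rep by blast
  qed
  ultimately show "\<exists>T. openin Top T \<and> p \<in> T \<and> T \<subseteq> {p \<in> U. Iv p z}" by blast
qed

text \<open>The sections over \<open>U\<close> of the twisted sheaf of degree \<open>- e\<close>.\<close>

definition Tw :: "nat \<Rightarrow> ('a \<times> 'a) set set" where
  "Tw e = {g \<in> carrier L. \<forall>p\<in>U. \<exists>d. \<exists>X\<in>G (e + d). \<exists>v\<in>G d. X \<notin> p \<and> \<iota> X \<otimes>\<^bsub>L\<^esub> g = \<iota> v}"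

lemma Tw_carrier: "g \<in> Tw e \<Longrightarrow> g \<in> carrier L" unfolding Tw_def by blast

text \<open>The degree \<open>i e\<close> of \<open>b\<close> is balanced by the degree of
  \<open>g^i\<close>, so the product is a quotient of homogeneous elements of equal degree.\<close>

lemma twist_rep:
  assumes g: "g \<in> carrier L" and X: "X \<in> G (e + d)" "v \<in> G d" "\<iota> X \<otimes>\<^bsub>L\<^esub> g = \<iota> v" and b: "b \<in> G (i * e)"
  shows "b \<otimes> v [^] i \<in> G (i * (e + d))" "X [^] i \<in> G (i * (e + d))"
    "\<iota> (X [^] i) \<otimes>\<^bsub>L\<^esub> (\<iota> b \<otimes>\<^bsub>L\<^esub> g [^]\<^bsub>L\<^esub> i) = \<iota> (b \<otimes> v [^] i)"
proof -
  have c: "X \<in> carrier R" "v \<in> carrier R" "b \<in> carrier R" using X b G_carrier by blast+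
  show "b \<otimes> v [^] i \<in> G (i * (e + d))" using component_mult[OF b pow_G[OF X(2), of i]] by (simp add: distrib_left)
  show "X [^] i \<in> G (i * (e + d))" by (rule pow_G[OF X(1)])
  have "\<iota> (X [^] i) \<otimes>\<^bsub>L\<^esub> (\<iota> b \<otimes>\<^bsub>L\<^esub> g [^]\<^bsub>L\<^esub> i) = \<iota> b \<otimes>\<^bsub>L\<^esub> (\<iota> X \<otimes>\<^bsub>L\<^esub> g) [^]\<^bsub>L\<^esub> i"
    using c g by (simp add: h.hom_power L.nat_pow_distrib L.m_ac)
  also have "\<dots> = \<iota> (b \<otimes> v [^] i)" unfolding X(3) using c by (simp add: h.hom_power)
  finally show "\<iota> (X [^] i) \<otimes>\<^bsub>L\<^esub> (\<iota> b \<otimes>\<^bsub>L\<^esub> g [^]\<^bsub>L\<^esub> i) = \<iota> (b \<otimes> v [^] i)" .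
qed

lemma twist_Iv_iff:
  assumes p: "p \<in> U" and g: "g \<in> carrier L" and X: "X \<in> G (e + d)" "v \<in> G d" "X \<notin> p" "\<iota> X \<otimes>\<^bsub>L\<^esub> g = \<iota> v"
    and b: "b \<in> G (i * e)"
  shows "Iv p (\<iota> b \<otimes>\<^bsub>L\<^esub> g [^]\<^bsub>L\<^esub> i) \<longleftrightarrow> b \<notin> p \<and> v [^] i \<notin> p"
proof -
  note r = twist_rep[OF g X(1,2,4) b]
  have c: "X \<in> carrier R" "v \<in> carrier R" "b \<in> carrier R" using X b G_carrier by blast+
  have "Iv p (\<iota> b \<otimes>\<^bsub>L\<^esub> g [^]\<^bsub>L\<^esub> i) \<longleftrightarrow> b \<otimes> v [^] i \<notin> p"
    by (rule Iv_iff_rep[OF U_sub[OF p] r(1,2) prime_nmem_pow[OF p c(1) X(3)] r(3)]) (use c g in simp)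
  then show ?thesis using prime_nmem_mult[OF p c(3), of "v [^] i"] c by simp
qed

lemma twist_regular:
  assumes g: "g \<in> Tw e" and b: "b \<in> G (i * e)" shows "\<iota> b \<otimes>\<^bsub>L\<^esub> g [^]\<^bsub>L\<^esub> i \<in> regular U"
proof -
  have c: "b \<in> carrier R" "g \<in> carrier L" using b G_carrier Tw_carrier[OF g] by blast+
  have "St p (\<iota> b \<otimes>\<^bsub>L\<^esub> g [^]\<^bsub>L\<^esub> i)" if p: "p \<in> U" for p
  proof -
    obtain d X v where X: "X \<in> G (e + d)" "v \<in> G d" "X \<notin> p" "\<iota> X \<otimes>\<^bsub>L\<^esub> g = \<iota> v"
      using g p unfolding Tw_def by blast
    note r = twist_rep[OF c(2) X(1,2,4) b]
    show ?thesis
      by (rule St_I[OF _ r(1,2) prime_nmem_pow[OF p G_carrier[OF X(1)] X(3)] r(3)]) (use c in simp)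
  qed
  then show ?thesis unfolding regular_iff using c by simp
qed

lemma twist_Iv_imp:
  assumes p: "p \<in> U" and g: "g \<in> Tw e" and b: "b \<in> G (i * e)" and iv: "Iv p (\<iota> b \<otimes>\<^bsub>L\<^esub> g [^]\<^bsub>L\<^esub> i)"
  shows "b \<notin> p"
proof -
  obtain d X v where X: "X \<in> G (e + d)" "v \<in> G d" "X \<notin> p" "\<iota> X \<otimes>\<^bsub>L\<^esub> g = \<iota> v"
    using g p unfolding Tw_def by blast
  show ?thesis using twist_Iv_iff[OF p Tw_carrier[OF g] X b] iv by blast
qed

text \<open>If \<open>a g\<close> is a unit at \<open>p\<close>, the local numerator
  \<open>v\<close> of \<open>g\<close> is outside \<open>p\<close>, so \<open>g\<close> vanishes
  nowhere near \<open>p\<close> and only \<open>b\<close> decides.\<close>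

lemma twist_Iv:
  assumes p: "p \<in> U" and g: "g \<in> Tw e" and a: "a \<in> G e" and iv: "Iv p (\<iota> a \<otimes>\<^bsub>L\<^esub> g)" and b: "b \<in> G (i * e)"
  shows "Iv p (\<iota> b \<otimes>\<^bsub>L\<^esub> g [^]\<^bsub>L\<^esub> i) \<longleftrightarrow> b \<notin> p"
proof -
  obtain d X v where X: "X \<in> G (e + d)" "v \<in> G d" "X \<notin> p" "\<iota> X \<otimes>\<^bsub>L\<^esub> g = \<iota> v"
    using g p unfolding Tw_def by blast
  have gc: "g \<in> carrier L" by (rule Tw_carrier[OF g])
  have "a \<in> G (1 * e)" using a by simp
  then have "v \<notin> p" using twist_Iv_iff[OF p gc X, of a 1] iv gc G_carrier[OF X(2)] by simp
  then have "v [^] i \<notin> p" using prime_nmem_pow[OF p G_carrier[OF X(2)]] by blast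
  then show ?thesis using twist_Iv_iff[OF p gc X b] by blast
qed

text \<open>At \<open>p\<close> a homogeneous \<open>x\<close> in \<open>I\<close> outside
  \<open>p\<close> gives the denominator \<open>x^n\<close>: the hypothesis makes
  \<open>x^n w / h^n\<close> an element of the ring, of degree \<open>n m - e\<close> when
  \<open>x\<close> has degree \<open>m\<close>.\<close>

lemma quotient_twist:
  assumes h: "h \<in> I" "h \<in> G k" "h \<noteq> \<zero>" and w: "w \<in> G j" "w \<noteq> \<zero>" and ej: "e + j = n * k"
    and W: "\<And>x. x \<in> I \<inter> Hom \<Longrightarrow> x [^] (n::nat) \<otimes> w \<in> PIdl (h [^] n)"
    and g: "g \<in> carrier L" "\<iota> (h [^] n) \<otimes>\<^bsub>L\<^esub> g = \<iota> w"
  shows "g \<in> Tw e"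
proof -
  have hc: "h [^] n \<in> carrier R" "h [^] n \<noteq> \<zero>" "h [^] n \<in> G (n * k)"
    using pow_nonzero[OF I_car[OF h(1)] h(3)] I_car[OF h(1)] pow_G[OF h(2)] by auto
  have wc: "w \<in> carrier R" by (rule G_carrier[OF w(1)])
  have "\<exists>d. \<exists>X\<in>G (e + d). \<exists>v\<in>G d. X \<notin> p \<and> \<iota> X \<otimes>\<^bsub>L\<^esub> g = \<iota> v" if p: "p \<in> U" for p
  proof -
    obtain m x where x: "x \<in> G m" "x \<in> I" "x \<notin> p" using U_hom_element[OF p] by blast
    have xc: "x \<in> carrier R" by (rule I_car[OF x(2)])
    define X where "X = x [^] n"
    have X: "X \<in> G (n * m)" "X \<in> carrier R" unfolding X_def using pow_G[OF x(1)] xc by auto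
    have Xp: "X \<notin> p" unfolding X_def by (rule prime_nmem_pow[OF p xc x(3)])
    then have X0: "X \<noteq> \<zero>" by (rule nonmem_nonzero[OF U_sub[OF p]])
    obtain s where s: "s \<in> carrier R" "X \<otimes> w = s \<otimes> h [^] n"
      using W[of x] x(2) G_Hom[OF x(1)] unfolding X_def PIdl_iff by blast
    have Xw: "X \<otimes> w \<in> G (n * m + j)" by (rule component_mult[OF X(1) w(1)])
    have "X \<otimes> w = comp (s \<otimes> h [^] n) (n * m + j)" unfolding s(2)[symmetric] using comp_G[OF Xw] by simp
    also have "\<dots> = (if n * k \<le> n * m + j then comp s (n * m + j - n * k) \<otimes> h [^] n else \<zero>)"
      by (rule comp_mult_hom[OF s(1) hc(3)])
    finally have eq: "X \<otimes> w = (if n * k \<le> n * m + j then comp s (n * m + j - n * k) \<otimes> h [^] n else \<zero>)" .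
    \<comment> \<open>Since the product is nonzero, its cofactor has a non-negative degree; this
      makes the truncated differences \<open>n m + j - n k\<close> and \<open>n m - e\<close>
      genuine.\<close>
    have "X \<otimes> w \<noteq> \<zero>" using integral[of X w] X(2) wc X0 w(2) by auto
    then have le: "n * k \<le> n * m + j" using eq by (auto split: if_splits)
    define v where "v = comp s (n * m + j - n * k)"
    have v: "v \<in> G (n * m - e)" "v \<in> carrier R" "X \<otimes> w = v \<otimes> h [^] n"
    proof -
      have "n * m + j - n * k = n * m - e" using ej by linarith
      then show "v \<in> G (n * m - e)" unfolding v_def using comp_props(1)[OF s(1)] by metis
      show "v \<in> carrier R" unfolding v_def using comp_carrier[OF s(1)] .
      show "X \<otimes> w = v \<otimes> h [^] n" unfolding v_def using eq le by presburger
    qed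
    have d: "e + (n * m - e) = n * m" using le ej by linarith
    have "\<iota> (h [^] n) \<otimes>\<^bsub>L\<^esub> (\<iota> X \<otimes>\<^bsub>L\<^esub> g) = \<iota> X \<otimes>\<^bsub>L\<^esub> (\<iota> (h [^] n) \<otimes>\<^bsub>L\<^esub> g)"
      using hc(1) X(2) g(1) by (intro L.m_lcomm) auto
    also have "\<dots> = \<iota> (X \<otimes> w)" unfolding g(2) using X(2) wc by simp
    also have "\<dots> = \<iota> (h [^] n) \<otimes>\<^bsub>L\<^esub> \<iota> v" unfolding v(3) m_comm[OF v(2) hc(1)] using v(2) hc(1) by simp
    finally have "\<iota> X \<otimes>\<^bsub>L\<^esub> g = \<iota> v" by (rule iota_cancel[OF hc(1,2)]) (use X(2) g(1) v(2) in auto)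
    moreover have "X \<in> G (e + (n * m - e))" unfolding d by (rule X(1))
    ultimately show ?thesis using v(1) Xp by blast
  qed
  then show ?thesis unfolding Tw_def using g(1) by blast
qed

lemma division: "x \<in> carrier R \<Longrightarrow> y \<in> carrier R \<Longrightarrow> x \<noteq> \<zero> \<Longrightarrow> \<exists>g\<in>carrier L. \<iota> x \<otimes>\<^bsub>L\<^esub> g = \<iota> y"
proof -
  assume c: "x \<in> carrier R" "y \<in> carrier R" "x \<noteq> \<zero>"
  have u: "\<iota> x \<in> Units L" using iota_nonzero[OF c(1,3)] c(1) by (simp add: L.field_Units)
  have ic: "inv\<^bsub>L\<^esub> (\<iota> x) \<in> carrier L" "\<iota> x \<otimes>\<^bsub>L\<^esub> inv\<^bsub>L\<^esub> (\<iota> x) = \<one>\<^bsub>L\<^esub>"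
    using L.Units_inv_closed[OF u] L.Units_r_inv[OF u] .
  have "\<iota> x \<otimes>\<^bsub>L\<^esub> (\<iota> y \<otimes>\<^bsub>L\<^esub> inv\<^bsub>L\<^esub> (\<iota> x)) = \<iota> y \<otimes>\<^bsub>L\<^esub> (\<iota> x \<otimes>\<^bsub>L\<^esub> inv\<^bsub>L\<^esub> (\<iota> x))"
    using c ic by (intro L.m_lcomm) auto
  also have "\<dots> = \<iota> y" unfolding ic(2) using c(2) by simp
  finally show ?thesis using c(2) ic(1) by (intro bexI[of _ "\<iota> y \<otimes>\<^bsub>L\<^esub> inv\<^bsub>L\<^esub> (\<iota> x)"]) auto
qed

text \<open>Take the component of degree \<open>n k\<close> in an identity expressing
  \<open>h^n\<close> by products \<open>z w\<close>. It writes 1 as a sum of \<open>a g\<close>,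
  where \<open>a\<close> is a component of some \<open>z\<close> and \<open>g = w_j / h^n\<close> is
  a twisted section of the opposite degree. An arbitrary subgroup \<open>q\<close> containing all
  these products stands in for the explicit sum.\<close>

lemma unit_span:
  assumes aff: "affine_ideal R I" and q: "additive_subgroup q L"
    and gens: "\<And>e a g. a \<in> I \<Longrightarrow> a \<in> G e \<Longrightarrow> a \<noteq> \<zero> \<Longrightarrow> g \<in> Tw e \<Longrightarrow> \<iota> a \<otimes>\<^bsub>L\<^esub> g \<in> q"
  shows "\<one>\<^bsub>L\<^esub> \<in> q"
proof -
  interpret q: additive_subgroup q L by (rule q)
  obtain p0 where p0: "p0 \<in> U" using U_ne by blast
  obtain k h where h: "h \<in> G k" "h \<in> I" "h \<notin> p0" using U_hom_element[OF p0] by blast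
  have h0: "h \<noteq> \<zero>" by (rule nonmem_nonzero[OF U_sub[OF p0] h(3)])
  obtain n where n: "h [^] (n::nat) \<in> Idl {z \<otimes> w | z w. z \<in> I \<and> w \<in> carrier R \<and>
      (\<forall>z'\<in>I. z' [^] n \<otimes> w \<in> PIdl (h [^] n))}" (is "_ \<in> Idl ?X")
    using affine_ideal_power[OF I_ideal aff h(2) h0] by blast
  have hn: "h [^] n \<in> carrier R" "h [^] n \<noteq> \<zero>" "h [^] n \<in> G (n * k)"
    using pow_nonzero[OF I_car[OF h(2)] h0] I_car[OF h(2)] pow_G[OF h(1)] by auto
  \<comment> \<open>The numerators over \<open>h^n\<close> of elements of \<open>q\<close>; the goal
    becomes \<open>h^n \<in> N\<close>.\<close>
  define N where "N = {s \<in> carrier R. \<exists>z\<in>q. \<iota> (h [^] n) \<otimes>\<^bsub>L\<^esub> z = \<iota> s}"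
  have N: "additive_subgroup N R"
  proof (intro additive_subgroup.intro subgroup.intro)
    show "N \<subseteq> carrier (add_monoid R)" unfolding N_def by auto
    have "\<iota> (h [^] n) \<otimes>\<^bsub>L\<^esub> \<zero>\<^bsub>L\<^esub> = \<iota> \<zero>" using hn(1) by simp
    then show "\<one>\<^bsub>add_monoid R\<^esub> \<in> N" unfolding N_def using q.zero_closed by auto
    fix s assume "s \<in> N"
    then obtain z where s: "s \<in> carrier R" "z \<in> q" "\<iota> (h [^] n) \<otimes>\<^bsub>L\<^esub> z = \<iota> s" unfolding N_def by blast
    have zc: "z \<in> carrier L" using s(2) q.a_Hcarr by blast
    have "\<iota> (h [^] n) \<otimes>\<^bsub>L\<^esub> (\<ominus>\<^bsub>L\<^esub> z) = \<iota> (\<ominus> s)" using s(1,3) zc hn(1) by (simp add: L.r_minus)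
    moreover have "\<ominus>\<^bsub>L\<^esub> z \<in> q" using q.a_inv_closed[OF s(2)] .
    ultimately have "\<ominus> s \<in> N" unfolding N_def using s(1) by blast
    then show "inv\<^bsub>add_monoid R\<^esub> s \<in> N" unfolding a_inv_def .
    fix s' assume "s' \<in> N"
    then obtain z' where s': "s' \<in> carrier R" "z' \<in> q" "\<iota> (h [^] n) \<otimes>\<^bsub>L\<^esub> z' = \<iota> s'" unfolding N_def by blast
    have zc': "z' \<in> carrier L" using s'(2) q.a_Hcarr by blast
    have "\<iota> (h [^] n) \<otimes>\<^bsub>L\<^esub> (z \<oplus>\<^bsub>L\<^esub> z') = \<iota> (s \<oplus> s')" using s(1,3) s'(1,3) zc zc' hn(1) by (simp add: L.r_distr)
    moreover have "z \<oplus>\<^bsub>L\<^esub> z' \<in> q" using q.a_closed[OF s(2) s'(2)] .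
    ultimately show "s \<otimes>\<^bsub>add_monoid R\<^esub> s' \<in> N" unfolding N_def using s(1) s'(1) by auto
  qed
  have zN: "\<zero> \<in> N" by (rule additive_subgroup.zero_closed[OF N])
  have base: "comp (z \<otimes> w) (n * k) \<in> N"
    if z: "z \<in> I" and w: "w \<in> carrier R" "\<And>z'. z' \<in> I \<Longrightarrow> z' [^] n \<otimes> w \<in> PIdl (h [^] n)" for z w
  proof -
    have "comp z e \<otimes> comp w (n * k - e) \<in> N" if e: "e \<in> {..n * k}" for e
    proof -
      let ?a = "comp z e" and ?w = "comp w (n * k - e)"
      have a: "?a \<in> I" "?a \<in> G e" using I_comps[OF z] comp_props(1)[OF I_car[OF z]] .
      have w': "?w \<in> G (n * k - e)" by (rule comp_props(1)[OF w(1)])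
      have c: "?a \<in> carrier R" "?w \<in> carrier R" using a(2) w' G_carrier by blast+
      show ?thesis
      proof (cases "?a = \<zero> \<or> ?w = \<zero>")
        case True then show ?thesis using zN c by auto
      next
        case False
        \<comment> \<open>The divisibility passes from \<open>w\<close> to its components because
          \<open>h^n\<close> and \<open>x^n\<close> are homogeneous; for a general \<open>x\<close>
          in \<open>I\<close> this would fail.\<close>
        have W: "x [^] n \<otimes> ?w \<in> PIdl (h [^] n)" if x: "x \<in> I \<inter> Hom" for x
        proof -
          obtain m where m: "x \<in> G m" using x unfolding Hom_def by blast
          have xn: "x [^] n \<in> G (n * m)" "x [^] n \<in> carrier R" using pow_G[OF m] G_carrier[OF m] by auto
          have "w \<otimes> x [^] n \<in> PIdl (h [^] n)" using w(2)[of x] x m_comm[OF w(1) xn(2)] by simp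
          then have "comp (w \<otimes> x [^] n) (n * k - e + n * m) \<in> PIdl (h [^] n)"
            using PIdl_homogeneous[OF hn(3)] unfolding homogeneous_ideal_iff by blast
          then show ?thesis using comp_mult_hom[OF w(1) xn(1)] m_comm[OF c(2) xn(2)] by simp
        qed
        obtain g where g: "g \<in> carrier L" "\<iota> (h [^] n) \<otimes>\<^bsub>L\<^esub> g = \<iota> ?w" using division[OF hn(1) c(2) hn(2)] by blast
        have "g \<in> Tw e"
          by (rule quotient_twist[OF h(2,1) h0 w' _ _ W g]) (use False e in auto)
        then have "\<iota> ?a \<otimes>\<^bsub>L\<^esub> g \<in> q" using gens[OF a] False by blast
        moreover have "\<iota> (h [^] n) \<otimes>\<^bsub>L\<^esub> (\<iota> ?a \<otimes>\<^bsub>L\<^esub> g) = \<iota> (?a \<otimes> ?w)"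
        proof -
          have "\<iota> (h [^] n) \<otimes>\<^bsub>L\<^esub> (\<iota> ?a \<otimes>\<^bsub>L\<^esub> g) = \<iota> ?a \<otimes>\<^bsub>L\<^esub> (\<iota> (h [^] n) \<otimes>\<^bsub>L\<^esub> g)"
            using hn(1) c(1) g(1) by (intro L.m_lcomm) simp_all
          then show ?thesis unfolding g(2) using c by simp
        qed
        ultimately show ?thesis unfolding N_def using c by blast
      qed
    qed
    then show ?thesis
      unfolding convolution[OF I_car[OF z] w(1)] by (intro finsum_mem[OF N]) auto
  qed
  have Xc: "?X \<subseteq> carrier R" using I_car by auto
  \<comment> \<open>The elements whose component of degree \<open>n k\<close> is in \<open>N\<close>
    do not form an ideal. Requiring this of all multiples yields one, to which membership in a
    generated ideal can be applied.\<close>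
  define M where "M = {s \<in> carrier R. \<forall>u\<in>carrier R. comp (u \<otimes> s) (n * k) \<in> N}"
  have "ideal M R"
  proof (rule idealI[OF ring_axioms])
    show "subgroup M (add_monoid R)"
    proof (rule subgroup.intro)
      show "M \<subseteq> carrier (add_monoid R)" unfolding M_def by auto
      show "\<one>\<^bsub>add_monoid R\<^esub> \<in> M" unfolding M_def using zN by simp
      fix s assume s: "s \<in> M"
      have sc: "s \<in> carrier R" using s unfolding M_def by blast
      have "comp (u \<otimes> (\<ominus> s)) (n * k) \<in> N" if u: "u \<in> carrier R" for u
      proof -
        have "comp ((\<ominus> u) \<otimes> s) (n * k) \<in> N" using s u unfolding M_def by simp
        then show ?thesis using u sc by (simp add: l_minus r_minus)
      qed
      then have "\<ominus> s \<in> M" unfolding M_def using sc by simp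
      then show "inv\<^bsub>add_monoid R\<^esub> s \<in> M" unfolding a_inv_def .
      fix s' assume s': "s' \<in> M"
      have sc': "s' \<in> carrier R" using s' unfolding M_def by blast
      have "comp (u \<otimes> (s \<oplus> s')) (n * k) \<in> N" if u: "u \<in> carrier R" for u
      proof -
        have "comp (u \<otimes> s) (n * k) \<oplus> comp (u \<otimes> s') (n * k) \<in> N"
          using additive_subgroup.a_closed[OF N] s s' u unfolding M_def by blast
        then show ?thesis using u sc sc' comp_add[of "u \<otimes> s" "u \<otimes> s'"] by (simp add: r_distr)
      qed
      then show "s \<otimes>\<^bsub>add_monoid R\<^esub> s' \<in> M" unfolding M_def using sc sc' by simp
    qed
    show l: "x \<otimes> s \<in> M" if s: "s \<in> M" and x: "x \<in> carrier R" for s x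
    proof -
      have sc: "s \<in> carrier R" using s unfolding M_def by blast
      have "comp (u \<otimes> (x \<otimes> s)) (n * k) \<in> N" if u: "u \<in> carrier R" for u
      proof -
        have "comp ((u \<otimes> x) \<otimes> s) (n * k) \<in> N" using s u x unfolding M_def by simp
        then show ?thesis using u x sc by (simp add: m_assoc)
      qed
      then show ?thesis unfolding M_def using x sc by simp
    qed
    show "s \<otimes> x \<in> M" if s: "s \<in> M" and x: "x \<in> carrier R" for s x
    proof -
      have "s \<in> carrier R" using s unfolding M_def by blast
      then show ?thesis using l[OF s x] m_comm[of s x] x by simp
    qed
  qed
  moreover have "?X \<subseteq> M"
  proof
    fix s assume "s \<in> ?X"
    then obtain z w where s: "s = z \<otimes> w" "z \<in> I" "w \<in> carrier R" "\<And>z'. z' \<in> I \<Longrightarrow> z' [^] n \<otimes> w \<in> PIdl (h [^] n)"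
      by blast
    have zc: "z \<in> carrier R" by (rule I_car[OF s(2)])
    have "comp (u \<otimes> s) (n * k) \<in> N" if u: "u \<in> carrier R" for u
    proof -
      have "comp ((u \<otimes> z) \<otimes> w) (n * k) \<in> N" by (rule base[OF ideal.I_l_closed[OF I_ideal s(2) u] s(3,4)])
      then show ?thesis unfolding s(1) using m_assoc[OF u zc s(3)] by simp
    qed
    then show "s \<in> M" unfolding M_def using s(1,3) zc by simp
  qed
  ultimately have "Idl ?X \<subseteq> M" by (rule genideal_minimal)
  then have "comp (\<one> \<otimes> h [^] n) (n * k) \<in> N" using n unfolding M_def by blast
  then have "h [^] n \<in> N" using comp_G[OF hn(3), of "n * k"] hn(1) by simp
  then obtain z where z: "z \<in> q" "\<iota> (h [^] n) \<otimes>\<^bsub>L\<^esub> z = \<iota> (h [^] n)" unfolding N_def by blast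
  have zc: "z \<in> carrier L" using z(1) q.a_Hcarr by blast
  have "\<iota> (h [^] n) \<otimes>\<^bsub>L\<^esub> z = \<iota> (h [^] n) \<otimes>\<^bsub>L\<^esub> \<one>\<^bsub>L\<^esub>" using z(2) hn(1) by simp
  then have "z = \<one>\<^bsub>L\<^esub>" by (rule iota_cancel[OF hn(1,2)]) (use zc in auto)
  then show ?thesis using z(1) by simp
qed

end

text \<open>\<open>admissible\<close> excludes a degree \<open>e = 0\<close> together with
  denominators of positive degree, whose powers could not reach a multiple of \<open>e\<close>. It
  holds for Spec because everything has degree zero, and for Proj because \<open>I\<close> has no
  nonzero elements of degree zero.\<close>

locale affine_converse = affine_criterion +
  assumes aff: "affine_ideal R I"
    and admissible: "a \<in> I \<Longrightarrow> a \<in> G 0 \<Longrightarrow> a \<noteq> \<zero> \<Longrightarrow> t \<in> G d \<Longrightarrow> t \<noteq> \<zero> \<Longrightarrow> d = 0"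
begin

text \<open>For \<open>e > 0\<close> the factor is \<open>t^(e-1)\<close>: the power
  \<open>t^e\<close> has degree divisible by \<open>e\<close> and the same zeros as
  \<open>t\<close>.\<close>

lemma complement_degree:
  assumes a: "a \<in> I" "a \<in> G e" "a \<noteq> \<zero>" and t: "t \<in> G d" "t \<noteq> \<zero>"
  shows "\<exists>c\<in>Hom. \<exists>i. t \<otimes> c \<in> G (i * e) \<and> (\<forall>p\<in>U. t \<notin> p \<longrightarrow> t \<otimes> c \<notin> p)"
proof (cases e)
  case 0
  then have "d = 0" using admissible[OF a(1) _ a(3) t] a(2) by simp
  then show ?thesis using t(1) G_carrier[OF t(1)] 0 Hom_one by (intro bexI[of _ "\<one>"] exI[of _ 0]) auto
next
  case (Suc e')
  have tc: "t \<in> carrier R" by (rule G_carrier[OF t(1)])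
  have eq: "t \<otimes> t [^] e' = t [^] Suc e'" unfolding nat_pow_Suc using m_comm[OF tc nat_pow_closed[OF tc]] .
  have "t [^] Suc e' \<in> G (d * e)" unfolding Suc mult.commute[of d] by (rule pow_G[OF t(1)])
  moreover have "t [^] e' \<in> Hom" by (rule G_Hom[OF pow_G[OF t(1)]])
  moreover have "\<forall>p\<in>U. t \<notin> p \<longrightarrow> t [^] Suc e' \<notin> p" using prime_nmem_pow[OF _ tc] by blast
  ultimately show ?thesis unfolding eq[symmetric] by blast
qed

text \<open>The sections that are non-units at \<open>p\<close> form an additive subgroup without 1;
  if no \<open>a g\<close> were a unit at \<open>p\<close>, \<open>unit_span\<close> would put 1
  into it.\<close>

lemma twist_exists:
  assumes p: "p \<in> U"
  shows "\<exists>e a g. a \<in> I \<and> a \<in> G e \<and> a \<noteq> \<zero> \<and> g \<in> Tw e \<and> Iv p (\<iota> a \<otimes>\<^bsub>L\<^esub> g)"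
proof (rule ccontr)
  assume neg: "\<nexists>e a g. a \<in> I \<and> a \<in> G e \<and> a \<noteq> \<zero> \<and> g \<in> Tw e \<and> Iv p (\<iota> a \<otimes>\<^bsub>L\<^esub> g)"
  define q where "q = {z \<in> regular U. \<not> Iv p z}"
  have S: "St p z" if "z \<in> regular U" for z using that p unfolding regular_iff by blast
  note sub = regular_subring_U[OF subset_refl U_ne]
  have "additive_subgroup q L"
  proof (intro additive_subgroup.intro subgroup.intro)
    show "q \<subseteq> carrier (add_monoid L)" unfolding q_def using regular_carrier by auto
    show "\<one>\<^bsub>add_monoid L\<^esub> \<in> q" unfolding q_def using subringE(2)[OF sub] Iv_zero[OF p] by simp
    fix z assume z: "z \<in> q"
    then have zr: "z \<in> regular U" "\<not> Iv p z" unfolding q_def by auto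
    have one: "\<ominus>\<^bsub>L\<^esub> \<one>\<^bsub>L\<^esub> \<in> regular U" using subringE(3,5)[OF sub] by blast
    have "\<ominus>\<^bsub>L\<^esub> z = (\<ominus>\<^bsub>L\<^esub> \<one>\<^bsub>L\<^esub>) \<otimes>\<^bsub>L\<^esub> z" using regular_carrier[OF zr(1)] by (simp add: L.l_minus)
    then have "\<not> Iv p (\<ominus>\<^bsub>L\<^esub> z)" using Iv_mult[OF p S[OF one] S[OF zr(1)]] zr(2) by simp
    then have "\<ominus>\<^bsub>L\<^esub> z \<in> q" unfolding q_def using subringE(5)[OF sub zr(1)] by blast
    then show "inv\<^bsub>add_monoid L\<^esub> z \<in> q" unfolding a_inv_def .
    fix z' assume z': "z' \<in> q"
    then show "z \<otimes>\<^bsub>add_monoid L\<^esub> z' \<in> q"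
      using zr subringE(7)[OF sub zr(1)] Iv_add[OF p S[OF zr(1)] S] unfolding q_def by auto
  qed
  moreover have "\<iota> a \<otimes>\<^bsub>L\<^esub> g \<in> q" if "a \<in> I" "a \<in> G e" "a \<noteq> \<zero>" "g \<in> Tw e" for e a g
    using twist_regular[OF that(4), of a 1] that neg Tw_carrier[OF that(4)] unfolding q_def by auto
  ultimately have "\<one>\<^bsub>L\<^esub> \<in> q" by (rule unit_span[OF aff])
  then show False unfolding q_def using Iv_one[OF p] by blast
qed

text \<open>Stalks are localizations of the ring of sections: a fraction \<open>b / t\<close> is
  extended by a homogeneous \<open>x\<close> to make both degrees \<open>i e\<close>, and then by
  \<open>g^i\<close>, so that numerator and denominator become global sections.\<close>

lemma stalk_iff:
  assumes p: "p \<in> U" and z: "z \<in> carrier L"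
  shows "St p z \<longleftrightarrow> (\<exists>y\<in>regular U. \<exists>s\<in>regular U. Iv p s \<and> s \<otimes>\<^bsub>L\<^esub> z = y)"
proof
  assume "St p z"
  then obtain d b t where rep: "b \<in> G d" "t \<in> G d" "t \<notin> p" "\<iota> t \<otimes>\<^bsub>L\<^esub> z = \<iota> b" by (rule St_E)
  have c: "b \<in> carrier R" "t \<in> carrier R" using rep G_carrier by blast+
  obtain e a g where a: "a \<in> I" "a \<in> G e" "a \<noteq> \<zero>" "g \<in> Tw e" "Iv p (\<iota> a \<otimes>\<^bsub>L\<^esub> g)" using twist_exists[OF p] by blast
  have gc: "g \<in> carrier L" by (rule Tw_carrier[OF a(4)])
  obtain x i where x: "x \<in> Hom" "t \<otimes> x \<in> G (i * e)" "t \<otimes> x \<notin> p"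
    using complement_degree[OF a(1-3) rep(2) nonmem_nonzero[OF U_sub[OF p] rep(3)]] p rep(3) by blast
  obtain m where m: "x \<in> G m" using x(1) unfolding Hom_def by blast
  have xc: "x \<in> carrier R" by (rule G_carrier[OF m])
  have "t \<otimes> x \<in> G (d + m)" by (rule component_mult[OF rep(2) m])
  then have "d + m = i * e"
    using degree_unique[OF _ x(2)] nonmem_nonzero[OF U_sub[OF p] x(3)] by blast
  then have bx: "b \<otimes> x \<in> G (i * e)" using component_mult[OF rep(1) m] by simp
  let ?s = "\<iota> (t \<otimes> x) \<otimes>\<^bsub>L\<^esub> g [^]\<^bsub>L\<^esub> i" and ?y = "\<iota> (b \<otimes> x) \<otimes>\<^bsub>L\<^esub> g [^]\<^bsub>L\<^esub> i"
  have "?s \<otimes>\<^bsub>L\<^esub> z = (\<iota> t \<otimes>\<^bsub>L\<^esub> z) \<otimes>\<^bsub>L\<^esub> (\<iota> x \<otimes>\<^bsub>L\<^esub> g [^]\<^bsub>L\<^esub> i)" using c xc z gc by (simp add: L.m_ac)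
  also have "\<dots> = ?y" unfolding rep(4) using c xc gc by (simp add: L.m_assoc)
  finally have "?s \<otimes>\<^bsub>L\<^esub> z = ?y" .
  moreover have "Iv p ?s" using twist_Iv[OF p a(4,2,5) x(2)] x(3) by blast
  ultimately show "\<exists>y\<in>regular U. \<exists>s\<in>regular U. Iv p s \<and> s \<otimes>\<^bsub>L\<^esub> z = y"
    using twist_regular[OF a(4) x(2)] twist_regular[OF a(4) bx] by blast
next
  assume "\<exists>y\<in>regular U. \<exists>s\<in>regular U. Iv p s \<and> s \<otimes>\<^bsub>L\<^esub> z = y"
  then obtain y s where ys: "y \<in> regular U" "Iv p s" "s \<otimes>\<^bsub>L\<^esub> z = y" by blast
  obtain d b t where 1: "b \<in> G d" "t \<in> G d" "b \<notin> p" "t \<notin> p" "\<iota> t \<otimes>\<^bsub>L\<^esub> s = \<iota> b" "s \<in> carrier L"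
    using ys(2) unfolding Iv_def by blast
  have "St p y" using ys(1) p unfolding regular_iff by blast
  then obtain d' b' t' where 2: "b' \<in> G d'" "t' \<in> G d'" "t' \<notin> p" "\<iota> t' \<otimes>\<^bsub>L\<^esub> y = \<iota> b'" by (rule St_E)
  have c: "b \<in> carrier R" "t \<in> carrier R" "b' \<in> carrier R" "t' \<in> carrier R" using 1 2 G_carrier by blast+
  have "\<iota> (b \<otimes> t') \<otimes>\<^bsub>L\<^esub> z = (\<iota> t \<otimes>\<^bsub>L\<^esub> s) \<otimes>\<^bsub>L\<^esub> \<iota> t' \<otimes>\<^bsub>L\<^esub> z" unfolding 1(5) using c by simp
  also have "\<dots> = \<iota> t \<otimes>\<^bsub>L\<^esub> (\<iota> t' \<otimes>\<^bsub>L\<^esub> (s \<otimes>\<^bsub>L\<^esub> z))" using c 1(6) z by (simp add: L.m_ac)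
  also have "\<dots> = \<iota> (t \<otimes> b')" unfolding ys(3) 2(4) using c by simp
  finally have "\<iota> (b \<otimes> t') \<otimes>\<^bsub>L\<^esub> z = \<iota> (t \<otimes> b')" .
  moreover have "b \<otimes> t' \<notin> p" using prime_nmem_mult[OF p c(1,4)] 1(3) 2(3) by blast
  ultimately show "St p z"
    using St_I[OF z component_mult[OF 1(2) 2(1)] component_mult[OF 1(1) 2(2)]] by blast
qed

text \<open>The open set of a homogeneous \<open>t\<close> is replaced, near \<open>p\<close>, by
  that of the global section \<open>t x g^i\<close>; the latter can be a unit only where
  \<open>t\<close> does not vanish.\<close>

lemma basic_open:
  assumes W: "openin Top W" "W \<subseteq> U" and p: "p \<in> W"
  shows "\<exists>s\<in>regular U. Iv p s \<and> (\<forall>p'\<in>U. Iv p' s \<longrightarrow> p' \<in> W)"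
proof -
  have pU: "p \<in> U" using p W(2) by blast
  obtain E where E: "E \<subseteq> Hom" "W = Pts - {p \<in> Pts. E \<subseteq> p}" using W(1) unfolding openin_Top by blast
  obtain t where t: "t \<in> E" "t \<notin> p" using p E(2) by blast
  obtain d where d: "t \<in> G d" using t(1) E(1) unfolding Hom_def by blast
  have tc: "t \<in> carrier R" by (rule G_carrier[OF d])
  obtain e a g where a: "a \<in> I" "a \<in> G e" "a \<noteq> \<zero>" "g \<in> Tw e" "Iv p (\<iota> a \<otimes>\<^bsub>L\<^esub> g)" using twist_exists[OF pU] by blast
  obtain x i where x: "x \<in> Hom" "t \<otimes> x \<in> G (i * e)" "t \<otimes> x \<notin> p"
    using complement_degree[OF a(1-3) d nonmem_nonzero[OF U_sub[OF pU] t(2)]] pU t(2) by blast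
  let ?s = "\<iota> (t \<otimes> x) \<otimes>\<^bsub>L\<^esub> g [^]\<^bsub>L\<^esub> i"
  have "Iv p ?s" using twist_Iv[OF pU a(4,2,5) x(2)] x(3) by blast
  moreover have "p' \<in> W" if p': "p' \<in> U" "Iv p' ?s" for p'
  proof -
    have "t \<notin> p'"
      using twist_Iv_imp[OF p'(1) a(4) x(2) p'(2)] prime_nmem_mult[OF p'(1) tc Hom_carrier[OF x(1)]] by blast
    then show ?thesis using E(2) U_sub[OF p'(1)] t(1) by blast
  qed
  ultimately show ?thesis using twist_regular[OF a(4) x(2)] by blast
qed

text \<open>Some \<open>a g\<close> is outside \<open>q\<close> by \<open>unit_span\<close>. Its
  factor \<open>g\<close> is used to move homogeneous elements of degree \<open>i e\<close> into the
  ring of sections, and so to pull \<open>q\<close> back to a homogeneous prime of \<open>R\<close>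
  not containing \<open>a\<close>.\<close>

lemma point_of_prime:
  assumes q: "additive_subgroup q L" and qU: "q \<subseteq> regular U" and one: "\<one>\<^bsub>L\<^esub> \<notin> q"
    and mult: "\<And>y z. y \<in> regular U \<Longrightarrow> z \<in> q \<Longrightarrow> y \<otimes>\<^bsub>L\<^esub> z \<in> q"
    and prime: "\<And>y z. y \<in> regular U \<Longrightarrow> z \<in> regular U \<Longrightarrow> y \<otimes>\<^bsub>L\<^esub> z \<in> q \<Longrightarrow> y \<in> q \<or> z \<in> q"
  shows "\<exists>p\<in>U. \<forall>z\<in>regular U. z \<in> q \<longleftrightarrow> \<not> Iv p z"
proof -
  interpret q: additive_subgroup q L by (rule q)
  obtain e a g where a: "a \<in> I" "a \<in> G e" "a \<noteq> \<zero>" "g \<in> Tw e" "\<iota> a \<otimes>\<^bsub>L\<^esub> g \<notin> q"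
    using unit_span[OF aff q] one by blast
  have gc: "g \<in> carrier L" by (rule Tw_carrier[OF a(4)])
  have gi: "g [^]\<^bsub>L\<^esub> i \<in> carrier L" for i :: nat using gc by simp
  define N where "N i = {y \<in> carrier R. \<iota> y \<otimes>\<^bsub>L\<^esub> g [^]\<^bsub>L\<^esub> i \<in> q}" for i :: nat
  \<comment> \<open>Elements whose degree need not be a multiple of \<open>e\<close> are tested
    through all their homogeneous multiples whose degree is. The core of \<open>Q\<close> is the
    required point.\<close>
  define Q where "Q = {x \<in> carrier R. \<forall>c\<in>Hom. \<forall>i. comp (x \<otimes> c) (i * e) \<in> N i}"
  have Nc: "y \<in> N i \<Longrightarrow> y \<in> carrier R" for y i unfolding N_def by blast
  have N0: "\<zero> \<in> N i" for i unfolding N_def using gi q.zero_closed by simp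
  have Nadd: "y \<oplus> y' \<in> N i" if "y \<in> N i" "y' \<in> N i" for y y' i
    using that q.a_closed[of "\<iota> y \<otimes>\<^bsub>L\<^esub> g [^]\<^bsub>L\<^esub> i" "\<iota> y' \<otimes>\<^bsub>L\<^esub> g [^]\<^bsub>L\<^esub> i"] gi unfolding N_def by (simp add: L.l_distr)
  have Nminus: "\<ominus> y \<in> N i" if "y \<in> N i" for y i
    using that q.a_inv_closed[of "\<iota> y \<otimes>\<^bsub>L\<^esub> g [^]\<^bsub>L\<^esub> i"] gi unfolding N_def by (simp add: L.l_minus)
  have Qc: "x \<in> Q \<Longrightarrow> x \<in> carrier R" for x unfolding Q_def by blast
  have Q: "additive_subgroup Q R"
  proof (intro additive_subgroup.intro subgroup.intro)
    show "Q \<subseteq> carrier (add_monoid R)" unfolding Q_def by auto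
    show "\<one>\<^bsub>add_monoid R\<^esub> \<in> Q" unfolding Q_def using N0 Hom_carrier by simp
    fix x assume x: "x \<in> Q"
    have "comp (\<ominus> x \<otimes> c) (i * e) \<in> N i" if c: "c \<in> Hom" for c i
    proof -
      have "\<ominus> comp (x \<otimes> c) (i * e) \<in> N i" using x c unfolding Q_def by (intro Nminus) blast
      then show ?thesis using comp_minus[of "x \<otimes> c"] l_minus[OF Qc[OF x] Hom_carrier[OF c]] Qc[OF x] Hom_carrier[OF c] by simp
    qed
    then have "\<ominus> x \<in> Q" unfolding Q_def using Qc[OF x] by simp
    then show "inv\<^bsub>add_monoid R\<^esub> x \<in> Q" unfolding a_inv_def .
    fix y assume y: "y \<in> Q"
    have "comp ((x \<oplus> y) \<otimes> c) (i * e) \<in> N i" if c: "c \<in> Hom" for c i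
    proof -
      have "comp (x \<otimes> c) (i * e) \<oplus> comp (y \<otimes> c) (i * e) \<in> N i" using x y c unfolding Q_def by (intro Nadd) blast+
      then show ?thesis using comp_add[of "x \<otimes> c" "y \<otimes> c"] l_distr[OF Qc[OF x] Qc[OF y] Hom_carrier[OF c]]
        Qc[OF x] Qc[OF y] Hom_carrier[OF c] by simp
    qed
    then show "x \<otimes>\<^bsub>add_monoid R\<^esub> y \<in> Q" unfolding Q_def using Qc[OF x] Qc[OF y] by simp
  qed
  define p where "p = comp_core Q"
  have mem: "b \<in> p \<longleftrightarrow> b \<in> Q" if "b \<in> Hom" for b unfolding p_def by (rule comp_core_Hom[OF Q that])
  have p_ideal: "ideal p R" unfolding p_def
  proof (rule comp_core_ideal[OF Q])
    fix x y assume y: "y \<in> Hom" and x: "x \<in> Q" "x \<in> Hom"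
    have "comp (x \<otimes> y \<otimes> c) (i * e) \<in> N i" if c: "c \<in> Hom" for c i
    proof -
      have "comp (x \<otimes> (y \<otimes> c)) (i * e) \<in> N i" using x(1) Hom_mult[OF y c] unfolding Q_def by blast
      then show ?thesis using m_assoc[OF Qc[OF x(1)] Hom_carrier[OF y] Hom_carrier[OF c]] by simp
    qed
    then show "x \<otimes> y \<in> Q" unfolding Q_def using Qc[OF x(1)] Hom_carrier[OF y] by simp
  qed
  have p_hom: "homogeneous_ideal R G p"
    using comp_core_homogeneous[OF p_ideal[unfolded p_def] Q] unfolding p_def .
  have NG: "\<iota> (b \<otimes> c) \<otimes>\<^bsub>L\<^esub> g [^]\<^bsub>L\<^esub> i \<in> regular U" if "b \<otimes> c \<in> G (i * e)" for b c i by (rule twist_regular[OF a(4) that])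
  \<comment> \<open>A homogeneous element outside \<open>Q\<close> has a homogeneous multiple of
    degree \<open>i e\<close> that gives a section outside \<open>q\<close>; primality of the core
    is checked on such multiples.\<close>
  have out: "\<exists>c\<in>Hom. \<exists>i. b \<otimes> c \<in> G (i * e) \<and> \<iota> (b \<otimes> c) \<otimes>\<^bsub>L\<^esub> g [^]\<^bsub>L\<^esub> i \<notin> q" if b: "b \<in> Hom" "b \<notin> Q" for b
  proof -
    obtain c i where c: "c \<in> Hom" "comp (b \<otimes> c) (i * e) \<notin> N i" using b Hom_carrier unfolding Q_def by blast
    obtain d where d: "b \<otimes> c \<in> G d" using Hom_mult[OF b(1) c(1)] unfolding Hom_def by blast
    have "d = i * e" using c(2) N0 comp_G[OF d, of "i * e"] by (auto split: if_splits)
    then have "b \<otimes> c \<in> G (i * e)" "b \<otimes> c \<notin> N i" using c(2) d comp_G[OF d, of "i * e"] by auto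
    then show ?thesis using c(1) G_carrier unfolding N_def by blast
  qed
  have inQ: "\<iota> (b \<otimes> c) \<otimes>\<^bsub>L\<^esub> g [^]\<^bsub>L\<^esub> i \<in> q" if b: "b \<in> Q" "c \<in> Hom" "b \<otimes> c \<in> G (i * e)" for b c i
  proof -
    have "comp (b \<otimes> c) (i * e) \<in> N i" using b(1,2) unfolding Q_def by blast
    then show ?thesis using comp_G[OF b(3), of "i * e"] unfolding N_def by simp
  qed
  have aQ: "b \<notin> Q" if "b \<otimes> c = a" "c \<in> Hom" for b c
    using inQ[of b c 1] that a(2,5) gc by auto
  have ac: "a \<in> carrier R" by (rule I_car[OF a(1)])
  have "primeideal p R"
  proof (rule homogeneous_prime[OF p_hom])
    show "\<one> \<notin> p" using mem[OF Hom_one] aQ[of \<one> a] ac G_Hom[OF a(2)] by simp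
    fix b b' assume b: "b \<in> Hom" "b' \<in> Hom" and bb: "b \<otimes> b' \<in> p"
    show "b \<in> p \<or> b' \<in> p"
    proof (rule ccontr)
      assume "\<not> (b \<in> p \<or> b' \<in> p)"
      then have n: "b \<notin> Q" "b' \<notin> Q" using mem b by blast+
      obtain c i where c: "c \<in> Hom" "b \<otimes> c \<in> G (i * e)" "\<iota> (b \<otimes> c) \<otimes>\<^bsub>L\<^esub> g [^]\<^bsub>L\<^esub> i \<notin> q" using out[OF b(1) n(1)] by blast
      obtain c' i' where c': "c' \<in> Hom" "b' \<otimes> c' \<in> G (i' * e)" "\<iota> (b' \<otimes> c') \<otimes>\<^bsub>L\<^esub> g [^]\<^bsub>L\<^esub> i' \<notin> q" using out[OF b(2) n(2)] by blast
      have k: "b \<in> carrier R" "b' \<in> carrier R" "c \<in> carrier R" "c' \<in> carrier R"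
        using b c(1) c'(1) Hom_carrier by blast+
      have eq: "(b \<otimes> b') \<otimes> (c \<otimes> c') = (b \<otimes> c) \<otimes> (b' \<otimes> c')" using k by (simp add: m_ac)
      have "(b \<otimes> b') \<otimes> (c \<otimes> c') \<in> G ((i + i') * e)"
        unfolding eq using component_mult[OF c(2) c'(2)] by (simp add: distrib_right)
      moreover have "b \<otimes> b' \<in> Q" using bb mem[OF Hom_mult[OF b]] by blast
      ultimately have "\<iota> ((b \<otimes> b') \<otimes> (c \<otimes> c')) \<otimes>\<^bsub>L\<^esub> g [^]\<^bsub>L\<^esub> (i + i') \<in> q"
        using inQ Hom_mult[OF c(1) c'(1)] by blast
      moreover have "\<iota> ((b \<otimes> b') \<otimes> (c \<otimes> c')) \<otimes>\<^bsub>L\<^esub> g [^]\<^bsub>L\<^esub> (i + i')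
          = (\<iota> (b \<otimes> c) \<otimes>\<^bsub>L\<^esub> g [^]\<^bsub>L\<^esub> i) \<otimes>\<^bsub>L\<^esub> (\<iota> (b' \<otimes> c') \<otimes>\<^bsub>L\<^esub> g [^]\<^bsub>L\<^esub> i')"
        unfolding eq using k gc by (simp add: L.nat_pow_mult[symmetric] L.m_ac)
      ultimately show False using prime[OF NG[OF c(2)] NG[OF c'(2)]] c(3) c'(3) by simp
    qed
  qed
  moreover have "a \<notin> p" using mem[OF G_Hom[OF a(2)]] aQ[of a \<one>] ac Hom_one by simp
  ultimately have pU: "p \<in> U" unfolding U_def using p_hom a(1) by blast
  have "z \<in> q \<longleftrightarrow> \<not> Iv p z" if z: "z \<in> regular U" for z
  proof -
    have "St p z" using z pU unfolding regular_iff by blast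
    then obtain d b t where rep: "b \<in> G d" "t \<in> G d" "t \<notin> p" "\<iota> t \<otimes>\<^bsub>L\<^esub> z = \<iota> b" "z \<in> carrier L" by (rule St_E)
    have c: "b \<in> carrier R" "t \<in> carrier R" using rep G_carrier by blast+
    have key: "z \<otimes>\<^bsub>L\<^esub> (\<iota> (t \<otimes> x) \<otimes>\<^bsub>L\<^esub> g [^]\<^bsub>L\<^esub> i) = \<iota> (b \<otimes> x) \<otimes>\<^bsub>L\<^esub> g [^]\<^bsub>L\<^esub> i" if x: "x \<in> carrier R" for x and i :: nat
    proof -
      have "z \<otimes>\<^bsub>L\<^esub> (\<iota> (t \<otimes> x) \<otimes>\<^bsub>L\<^esub> g [^]\<^bsub>L\<^esub> i) = (\<iota> t \<otimes>\<^bsub>L\<^esub> z) \<otimes>\<^bsub>L\<^esub> (\<iota> x \<otimes>\<^bsub>L\<^esub> g [^]\<^bsub>L\<^esub> i)"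
        using c x rep(5) gc by (simp add: L.m_ac)
      then show ?thesis unfolding rep(4) using c x gc by (simp add: L.m_assoc)
    qed
    have "z \<in> q \<longleftrightarrow> b \<in> Q"
    proof
      assume zq: "z \<in> q"
      show "b \<in> Q"
      proof (rule ccontr)
        assume "b \<notin> Q"
        then obtain x i where x: "x \<in> Hom" "b \<otimes> x \<in> G (i * e)" "\<iota> (b \<otimes> x) \<otimes>\<^bsub>L\<^esub> g [^]\<^bsub>L\<^esub> i \<notin> q"
          using out[OF G_Hom[OF rep(1)]] by blast
        obtain m where m: "x \<in> G m" using x(1) unfolding Hom_def by blast
        have b0: "b \<otimes> x \<noteq> \<zero>" using x(3) gi[of i] q.zero_closed by auto
        have "d + m = i * e"
          by (rule degree_unique[OF component_mult[OF rep(1) m] x(2) b0])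
        then have tx: "t \<otimes> x \<in> G (i * e)" using component_mult[OF rep(2) m] by simp
        have "z \<otimes>\<^bsub>L\<^esub> (\<iota> (t \<otimes> x) \<otimes>\<^bsub>L\<^esub> g [^]\<^bsub>L\<^esub> i) \<in> q"
          using mult[OF NG[OF tx] zq] L.m_comm[OF rep(5) regular_carrier[OF NG[OF tx]]] by simp
        then show False using x(3) key[OF Hom_carrier[OF x(1)]] by simp
      qed
    next
      assume bQ: "b \<in> Q"
      have "t \<notin> Q" using rep(3) mem[OF G_Hom[OF rep(2)]] by blast
      then obtain x i where x: "x \<in> Hom" "t \<otimes> x \<in> G (i * e)" "\<iota> (t \<otimes> x) \<otimes>\<^bsub>L\<^esub> g [^]\<^bsub>L\<^esub> i \<notin> q"
        using out[OF G_Hom[OF rep(2)]] by blast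
      obtain m where m: "x \<in> G m" using x(1) unfolding Hom_def by blast
      have t0: "t \<otimes> x \<noteq> \<zero>" using x(3) gi[of i] q.zero_closed by auto
      have "d + m = i * e"
        by (rule degree_unique[OF component_mult[OF rep(2) m] x(2) t0])
      then have bx: "b \<otimes> x \<in> G (i * e)" using component_mult[OF rep(1) m] by simp
      have "z \<otimes>\<^bsub>L\<^esub> (\<iota> (t \<otimes> x) \<otimes>\<^bsub>L\<^esub> g [^]\<^bsub>L\<^esub> i) \<in> q"
        unfolding key[OF Hom_carrier[OF x(1)]] by (rule inQ[OF bQ x(1) bx])
      then show "z \<in> q" using prime[OF z NG[OF x(2)]] x(3) by blast
    qed
    then show ?thesis
      unfolding Iv_iff_rep[OF U_sub[OF pU] rep] using mem[OF G_Hom[OF rep(1)]] by blast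
  qed
  then show ?thesis using pU by blast
qed

end

lemma (in domain) spec_fraction_model:
  assumes L: "field L" and \<psi>: "ring_hom_cring R L \<psi>" and inj: "inj_on \<psi> (carrier R)"
  shows "fraction_model R L \<psi> (points (Spec R)) (\<lambda>p. carrier R - p) (carrier R \<times> carrier R)"
proof (intro fraction_model.intro fraction_model_axioms.intro is_cring L \<psi> inj subset_refl)
  fix p assume "p \<in> topspace (points (Spec R))"
  then have p: "primeideal p R" unfolding topspace_Spec by simp
  show "mult_subset R (carrier R - p)" by (rule prime_mult_subset[OF p])
  show "\<zero> \<notin> carrier R - p" using additive_subgroup.zero_closed[OF ideal.axioms(1)[OF primeideal.axioms(1)[OF p]]] by blast
next
  fix a f assume f: "(a, f) \<in> carrier R \<times> carrier R"
  have "{q \<in> topspace (points (Spec R)). f \<in> carrier R - q} = {p. primeideal p R} - {p. primeideal p R \<and> {f} \<subseteq> p}"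
    unfolding topspace_Spec using f by blast
  then show "openin (points (Spec R)) {q \<in> topspace (points (Spec R)). f \<in> carrier R - q}"
    unfolding openin_Spec using f by (intro exI[of _ "{f}"]) simp
next
  have zero: "{\<zero>} \<in> U" if U: "openin (points (Spec R)) U" "U \<noteq> {}" for U
  proof -
    obtain E where E: "U = {p. primeideal p R} - {p. primeideal p R \<and> E \<subseteq> p}" using U(1) unfolding openin_Spec by blast
    obtain q where q: "primeideal q R" "\<not> E \<subseteq> q" using U(2) E by blast
    have "\<zero> \<in> q" using additive_subgroup.zero_closed[OF ideal.axioms(1)[OF primeideal.axioms(1)[OF q(1)]]] .
    then have "\<not> E \<subseteq> {\<zero>}" using q(2) by blast
    then show ?thesis using zeroprimeideal unfolding E by blast
  qed
  fix V W assume "openin (points (Spec R)) V" "openin (points (Spec R)) W" "V \<noteq> {}" "W \<noteq> {}"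
  then have "{\<zero>} \<in> V" "{\<zero>} \<in> W" using zero by blast+
  then show "V \<inter> W \<noteq> {}" by blast
qed

lemma fraction_sections_empty: "carrier (fraction_sections R X T F {}) = {\<lambda>_. undefined}"
  unfolding fraction_sections_def by auto

text \<open>Sheaf isomorphisms must be given on the empty open set too, where sections are not
  elements of the field.\<close>

lemma fraction_sections_empty_iso:
  "(\<lambda>_ _. undefined) \<in> ring_iso (fraction_sections R X T F {}) (fraction_sections R' X' T' F' {})"
proof (rule ring_iso_memI)
  show "bij_betw (\<lambda>_ _. undefined) (carrier (fraction_sections R X T F {})) (carrier (fraction_sections R' X' T' F' {}))"
    unfolding fraction_sections_empty by (simp add: bij_betw_def)
qed (auto simp: fraction_sections_def fun_eq_iff)

section \<open>The isomorphism with the spectrum of the ring of sections\<close>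

context affine_converse
begin

text \<open>Points correspond by \<open>twist_exists\<close> and \<open>point_of_prime\<close>, the
  topologies by \<open>basic_open\<close>. Both sheaves are modelled inside the same field
  \<open>L\<close>, so the comparison of sections is an equality of sets of regular elements, which
  \<open>stalk_iff\<close> supplies.\<close>

theorem affine: "is_affine OU"
proof -
  define \<Gamma> where "\<Gamma> = L\<lparr>carrier := regular U\<rparr>"
  \<comment> \<open>The isomorphic ring \<open>\<Gamma>\<close> has elements of another type;
    affineness asks for a ring on the type of sections.\<close>
  define B where "B = sections OU U"
  have sub: "subring (regular U) L" by (rule regular_subring_U[OF subset_refl U_ne])
  have G: "domain \<Gamma>" unfolding \<Gamma>_def by (rule L.subdomain_is_domain[OF L.subdomainI'[OF sub]])
  have sU: "sect U \<in> ring_iso \<Gamma> B"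
    unfolding \<Gamma>_def B_def sections_OU by (rule sect_iso[OF open_U U_ne])
  have "germ p \<zero>\<^bsub>L\<^esub> = \<zero>\<^bsub>localization R (Dens p)\<^esub>" if p: "p \<in> U" for p
  proof -
    have pt: "p \<in> topspace Top" using U_sub[OF p] unfolding topspace_Top .
    interpret T: mult_subset R "Dens p" by (rule T[OF pt])
    show ?thesis unfolding T.zero_eq by (rule germ_eq[OF pt]) (use T.T_one in auto)
  qed
  then have "sect U \<zero>\<^bsub>\<Gamma>\<^esub> = \<zero>\<^bsub>B\<^esub>"
    unfolding \<Gamma>_def B_def sections_OU by (simp add: sect_def fraction_sections_def restrict_def fun_eq_iff)
  then have "domain B" using domain.ring_iso_imp_img_domain[OF G sU] by simp
  then interpret B: domain B .
  define \<psi> where "\<psi> = inv_into (regular U) (sect U)"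
  have psi: "\<psi> \<in> ring_iso B \<Gamma>"
    using ring_iso_set_sym[OF _ sU] domain.axioms(1)[OF G] unfolding \<psi>_def \<Gamma>_def by (simp add: cring.axioms(1))
  have bij: "bij_betw \<psi> (carrier B) (regular U)" using psi unfolding ring_iso_def \<Gamma>_def by simp
  have psi_inj: "inj_on \<psi> (carrier B)" and psi_surj: "\<psi> ` carrier B = regular U"
    using bij unfolding bij_betw_def by auto
  have psi_reg: "\<psi> s \<in> regular U" if "s \<in> carrier B" for s using psi_surj that by blast
  have "\<psi> \<in> ring_hom B L"
  proof (rule ring_hom_memI)
    fix x y assume xy: "x \<in> carrier B" "y \<in> carrier B"
    show "\<psi> (x \<otimes>\<^bsub>B\<^esub> y) = \<psi> x \<otimes>\<^bsub>L\<^esub> \<psi> y" "\<psi> (x \<oplus>\<^bsub>B\<^esub> y) = \<psi> x \<oplus>\<^bsub>L\<^esub> \<psi> y"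
      using ring_iso_memE(2,3)[OF psi xy] unfolding \<Gamma>_def by simp_all
  next
    fix x assume "x \<in> carrier B" then show "\<psi> x \<in> carrier L" using psi_reg regular_carrier by blast
  next
    show "\<psi> \<one>\<^bsub>B\<^esub> = \<one>\<^bsub>L\<^esub>" using ring_iso_memE(4)[OF psi] unfolding \<Gamma>_def by simp
  qed
  then have hom: "ring_hom_cring B L \<psi>"
    by (intro ring_hom_cringI ring_hom_ringI2 B.ring_axioms B.is_cring L.is_cring L.ring_axioms)
  interpret psi: ring_hom_cring B L \<psi> by (rule hom)
  interpret SB: fraction_model B L \<psi> "points (Spec B)" "\<lambda>p. carrier B - p" "carrier B \<times> carrier B"
    by (rule B.spec_fraction_model[OF L.field_axioms hom psi_inj])
  define PB where "PB = {q. primeideal q B}"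
  \<comment> \<open>A point goes to the prime of the global sections that vanish there.\<close>
  define f where "f p = {s \<in> carrier B. \<not> Iv p (\<psi> s)}" for p
  define pre where "pre V = {p \<in> U. f p \<in> V}" for V
  have mem: "s \<in> f p \<longleftrightarrow> \<not> Iv p (\<psi> s)" if "s \<in> carrier B" for s p unfolding f_def using that by simp
  have S: "St p (\<psi> s)" if "s \<in> carrier B" "p \<in> U" for s p using psi_reg[OF that(1)] that(2) unfolding regular_iff by blast
  have fP: "f p \<in> PB" if p: "p \<in> U" for p
  proof -
    have mult: "s \<otimes>\<^bsub>B\<^esub> t \<in> f p \<longleftrightarrow> s \<in> f p \<or> t \<in> f p" if "s \<in> carrier B" "t \<in> carrier B" for s t
      using that Iv_mult[OF p S[OF that(1) p] S[OF that(2) p]] mem[of "s \<otimes>\<^bsub>B\<^esub> t"] mem[of s] mem[of t] by simp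
    have one: "\<one>\<^bsub>B\<^esub> \<notin> f p" using mem[of "\<one>\<^bsub>B\<^esub>" p] Iv_one[OF p] by simp
    have fB: "s \<in> carrier B" if "s \<in> f p" for s using that unfolding f_def by blast
    have "ideal (f p) B"
    proof (rule idealI[OF B.ring_axioms])
      show "subgroup (f p) (add_monoid B)"
      proof (rule subgroup.intro)
        show "f p \<subseteq> carrier (add_monoid B)" unfolding f_def by auto
        show "\<one>\<^bsub>add_monoid B\<^esub> \<in> f p" using mem[of "\<zero>\<^bsub>B\<^esub>" p] Iv_zero[OF p] by simp
        fix s assume s: "s \<in> f p"
        have "\<ominus>\<^bsub>B\<^esub> s = (\<ominus>\<^bsub>B\<^esub> \<one>\<^bsub>B\<^esub>) \<otimes>\<^bsub>B\<^esub> s" using fB[OF s] by (simp add: B.l_minus)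
        then have "\<ominus>\<^bsub>B\<^esub> s \<in> f p" using mult[of "\<ominus>\<^bsub>B\<^esub> \<one>\<^bsub>B\<^esub>" s] fB[OF s] s by simp
        then show "inv\<^bsub>add_monoid B\<^esub> s \<in> f p" unfolding a_inv_def .
        fix t assume t: "t \<in> f p"
        then show "s \<otimes>\<^bsub>add_monoid B\<^esub> t \<in> f p"
          using Iv_add[OF p S[OF fB[OF s] p] S[OF fB[OF t] p]] mem[of "s \<oplus>\<^bsub>B\<^esub> t" p] mem[of s p] mem[of t p] fB s by simp
      qed
      show "x \<otimes>\<^bsub>B\<^esub> s \<in> f p" "s \<otimes>\<^bsub>B\<^esub> x \<in> f p" if "s \<in> f p" "x \<in> carrier B" for s x
        using mult[of x s] mult[of s x] fB[OF that(1)] that by simp_all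
    qed
    then have "primeideal (f p) B"
      by (rule primeidealI[OF _ B.is_cring]) (use one mult in auto)
    then show ?thesis unfolding PB_def by simp
  qed
  have f_surj: "q \<in> f ` U" if q: "q \<in> PB" for q
  proof -
    interpret q: primeideal q B using q unfolding PB_def by simp
    let ?q = "\<psi> ` q"
    have qc: "s \<in> carrier B" if "s \<in> q" for s using q.a_subset that by blast
    have im: "s \<in> q" if "\<psi> s \<in> ?q" "s \<in> carrier B" for s
      using that qc psi_inj unfolding inj_on_def by blast
    have "additive_subgroup ?q L"
    proof (intro additive_subgroup.intro subgroup.intro)
      show "?q \<subseteq> carrier (add_monoid L)" using qc by auto
      have "\<psi> \<zero>\<^bsub>B\<^esub> \<in> ?q" by (rule imageI[OF q.zero_closed])
      then show "\<one>\<^bsub>add_monoid L\<^esub> \<in> ?q" unfolding psi.hom_zero by simp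
      fix x assume "x \<in> ?q"
      then obtain s where s: "s \<in> q" "x = \<psi> s" by blast
      have "\<psi> (\<ominus>\<^bsub>B\<^esub> s) = \<ominus>\<^bsub>L\<^esub> x" using s qc by simp
      then have "\<ominus>\<^bsub>L\<^esub> x \<in> ?q" by (rule subst[of _ _ "\<lambda>y. y \<in> ?q"]) (rule imageI[OF q.a_inv_closed[OF s(1)]])
      then show "inv\<^bsub>add_monoid L\<^esub> x \<in> ?q" unfolding a_inv_def .
      fix y assume "y \<in> ?q"
      then obtain t where t: "t \<in> q" "y = \<psi> t" by blast
      have "\<psi> (s \<oplus>\<^bsub>B\<^esub> t) = x \<oplus>\<^bsub>L\<^esub> y" using s t qc by simp
      then have "x \<oplus>\<^bsub>L\<^esub> y \<in> ?q" by (rule subst[of _ _ "\<lambda>y. y \<in> ?q"]) (rule imageI[OF q.a_closed[OF s(1) t(1)]])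
      then show "x \<otimes>\<^bsub>add_monoid L\<^esub> y \<in> ?q" by simp
    qed
    moreover have "?q \<subseteq> regular U" using qc psi_reg by blast
    moreover have "\<one>\<^bsub>L\<^esub> \<notin> ?q"
    proof
      assume "\<one>\<^bsub>L\<^esub> \<in> ?q"
      then have "\<one>\<^bsub>B\<^esub> \<in> q" using im[of "\<one>\<^bsub>B\<^esub>"] by simp
      then show False using B.prime_one[OF q.primeideal_axioms] by blast
    qed
    moreover have "y \<otimes>\<^bsub>L\<^esub> z \<in> ?q" if y: "y \<in> regular U" and z: "z \<in> ?q" for y z
    proof -
      obtain s where s: "s \<in> carrier B" "y = \<psi> s" using y psi_surj by blast
      obtain t where t: "t \<in> q" "z = \<psi> t" using z by blast
      have "\<psi> (s \<otimes>\<^bsub>B\<^esub> t) = y \<otimes>\<^bsub>L\<^esub> z" using s t qc by simp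
      then show ?thesis by (rule subst[of _ _ "\<lambda>y. y \<in> ?q"]) (rule imageI[OF q.I_l_closed[OF t(1) s(1)]])
    qed
    moreover have "y \<in> ?q \<or> z \<in> ?q" if y: "y \<in> regular U" and z: "z \<in> regular U" and yz: "y \<otimes>\<^bsub>L\<^esub> z \<in> ?q" for y z
    proof -
      obtain s where s: "s \<in> carrier B" "y = \<psi> s" using y psi_surj by blast
      obtain t where t: "t \<in> carrier B" "z = \<psi> t" using z psi_surj by blast
      have "s \<otimes>\<^bsub>B\<^esub> t \<in> q" using im[of "s \<otimes>\<^bsub>B\<^esub> t"] yz s t by simp
      then show ?thesis using q.I_prime[OF s(1) t(1)] s(2) t(2) by blast
    qed
    ultimately obtain p where p: "p \<in> U" "\<And>z. z \<in> regular U \<Longrightarrow> z \<in> ?q \<longleftrightarrow> \<not> Iv p z"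
      using point_of_prime by metis
    have "s \<in> q \<longleftrightarrow> s \<in> f p" if "s \<in> carrier B" for s
      using p(2)[OF psi_reg[OF that]] mem[OF that] im[OF _ that] by blast
    moreover have "s \<in> carrier B" if "s \<in> f p" for s using that unfolding f_def by blast
    ultimately have "q = f p" using qc by blast
    then show ?thesis using p(1) by blast
  qed
  have sep: "p = p'" if p: "p \<in> U" "p' \<in> U" and eq: "f p = f p'" for p p'
  proof -
    have iff: "Iv p z \<longleftrightarrow> Iv p' z" if "z \<in> regular U" for z
    proof -
      obtain s where "s \<in> carrier B" "z = \<psi> s" using \<open>z \<in> regular U\<close> psi_surj by blast
      then show ?thesis using mem[of s] eq by blast
    qed
    have le: "x \<subseteq> y" if x: "x \<in> U" "y \<in> U" and i: "\<And>z. z \<in> regular U \<Longrightarrow> Iv x z \<longleftrightarrow> Iv y z" for x y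
    proof -
      have "t \<in> y" if t: "t \<in> x" "t \<in> Hom" for t
      proof (rule ccontr)
        assume ty: "t \<notin> y"
        define W where "W = U \<inter> (Pts - {p \<in> Pts. {t} \<subseteq> p})"
        have "openin Top (Pts - {p \<in> Pts. {t} \<subseteq> p})" unfolding openin_Top using t(2) by blast
        then have "openin Top W" unfolding W_def using open_U by blast
        moreover have "W \<subseteq> U" "y \<in> W" unfolding W_def using ty x(2) U_sub by blast+
        ultimately obtain s where s: "s \<in> regular U" "Iv y s" "\<And>p'. p' \<in> U \<Longrightarrow> Iv p' s \<Longrightarrow> p' \<in> W"
          using basic_open by meson
        then have "x \<in> W" using i x(1) by blast
        then show False using t(1) unfolding W_def by blast
      qed
      then have "x \<inter> Hom \<subseteq> y" by blast
      then show ?thesis using homogeneous_subset_iff[OF PtsD(2) PtsD(5), OF U_sub[OF x(1)] U_sub[OF x(2)]] by simp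
    qed
    show ?thesis using le[OF p iff] le[OF p(2,1)] iff by blast
  qed
  have f_inj: "inj_on f U" using sep unfolding inj_on_def by blast
  have f_img: "f ` U = PB" using fP f_surj by blast
  have pre_sub: "pre V \<subseteq> U" for V unfolding pre_def by blast
  have pre_ne: "pre V \<noteq> {}" if "V \<subseteq> PB" "V \<noteq> {}" for V
    using that f_surj unfolding pre_def by blast
  have PB_sub: "V \<subseteq> PB" if "openin (points (Spec B)) V" for V
    using openin_subset[OF that] unfolding B.topspace_Spec PB_def .
  have open_pre: "openin Top (pre V)" if V: "openin (points (Spec B)) V" for V
  proof -
    obtain E where E: "E \<subseteq> carrier B" "V = PB - {q. primeideal q B \<and> E \<subseteq> q}"
      using V unfolding B.openin_Spec PB_def by blast
    have "pre V = (\<Union>s\<in>E. {p \<in> U. Iv p (\<psi> s)})"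
    proof
      show "pre V \<subseteq> (\<Union>s\<in>E. {p \<in> U. Iv p (\<psi> s)})"
      proof
        fix p assume "p \<in> pre V"
        then have p: "p \<in> U" "\<not> E \<subseteq> f p" using E(2) fP unfolding pre_def PB_def by blast+
        then obtain s where "s \<in> E" "s \<notin> f p" by blast
        then show "p \<in> (\<Union>s\<in>E. {p \<in> U. Iv p (\<psi> s)})" using mem E(1) p(1) by blast
      qed
      show "(\<Union>s\<in>E. {p \<in> U. Iv p (\<psi> s)}) \<subseteq> pre V"
      proof
        fix p assume "p \<in> (\<Union>s\<in>E. {p \<in> U. Iv p (\<psi> s)})"
        then obtain s where s: "s \<in> E" "p \<in> U" "Iv p (\<psi> s)" by blast
        then have "s \<notin> f p" unfolding f_def by blast
        then show "p \<in> pre V" using s(1,2) E(2) fP unfolding pre_def by blast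
      qed
    qed
    moreover have "openin Top (\<Union>s\<in>E. {p \<in> U. Iv p (\<psi> s)})" by (rule openin_Union) (use open_Iv in blast)
    ultimately show ?thesis by simp
  qed
  have homeo: "homeomorphic_map (points OU) (points (Spec B)) f"
  proof (rule bijective_open_imp_homeomorphic_map)
    show "f ` topspace (points OU) = topspace (points (Spec B))"
      unfolding topspace_OU B.topspace_Spec f_img PB_def ..
    then show "continuous_map (points OU) (points (Spec B)) f"
      unfolding continuous_map using open_pre pre_sub unfolding topspace_OU pre_def openin_OU by blast
    show "inj_on f (topspace (points OU))" unfolding topspace_OU by (rule f_inj)
    show "open_map (points OU) (points (Spec B)) f" unfolding open_map_def
    proof (intro allI impI)
      fix W assume "openin (points OU) W"
      then have W: "openin Top W" "W \<subseteq> U" unfolding openin_OU by auto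
      \<comment> \<open>The global sections invertible only inside \<open>W\<close>; by
        \<open>basic_open\<close> their open sets cover \<open>W\<close>, which shows that the image
        of \<open>W\<close> is open.\<close>
      define E where "E = {s \<in> carrier B. \<forall>p\<in>U. Iv p (\<psi> s) \<longrightarrow> p \<in> W}"
      have E: "E \<subseteq> carrier B" unfolding E_def by blast
      have 1: "\<not> E \<subseteq> f p" if p: "p \<in> W" for p
      proof -
        obtain z where z: "z \<in> regular U" "Iv p z" "\<And>p'. p' \<in> U \<Longrightarrow> Iv p' z \<Longrightarrow> p' \<in> W"
          using basic_open[OF W p] by blast
        obtain s where s: "s \<in> carrier B" "z = \<psi> s" using z(1) psi_surj by blast
        have "s \<in> E" unfolding E_def using s z(3) by blast
        moreover have "s \<notin> f p" using mem[OF s(1)] z(2) s(2) by blast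
        ultimately show ?thesis by blast
      qed
      have 2: "p \<in> W" if "p \<in> U" "\<not> E \<subseteq> f p" for p
        using that unfolding E_def f_def by blast
      have "f ` W = {q. primeideal q B} - {q. primeideal q B \<and> E \<subseteq> q}"
      proof
        show "f ` W \<subseteq> {q. primeideal q B} - {q. primeideal q B \<and> E \<subseteq> q}"
          using 1 fP W(2) unfolding PB_def by blast
        show "{q. primeideal q B} - {q. primeideal q B \<and> E \<subseteq> q} \<subseteq> f ` W"
        proof
          fix q assume q: "q \<in> {q. primeideal q B} - {q. primeideal q B \<and> E \<subseteq> q}"
          then obtain p where "p \<in> U" "q = f p" using f_surj unfolding PB_def by blast
          then show "q \<in> f ` W" using 2 q by blast
        qed
      qed
      then show "openin (points (Spec B)) (f ` W)" unfolding B.openin_Spec using E by blast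
    qed
  qed
  \<comment> \<open>Regularity is tested at points, and the stalk of the spectrum at
    \<open>f p\<close> is the stalk of \<open>OU\<close> at \<open>p\<close> as a subset of
    \<open>L\<close>.\<close>
  have reg: "SB.regular V = regular (pre V)" if V: "V \<subseteq> PB" for V
  proof -
    have stalk: "(\<exists>(a, s)\<in>carrier B \<times> carrier B. s \<in> carrier B - f p \<and> \<psi> s \<otimes>\<^bsub>L\<^esub> z = \<psi> a) \<longleftrightarrow> St p z"
      if "p \<in> U" "z \<in> carrier L" for p z
      unfolding stalk_iff[OF that] psi_surj[symmetric] using mem by auto
    show ?thesis
    proof (rule Set.set_eqI)
      fix z
      let ?X = "\<lambda>q. \<exists>(a, s)\<in>carrier B \<times> carrier B. s \<in> carrier B - q \<and> \<psi> s \<otimes>\<^bsub>L\<^esub> z = \<psi> a"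
      have "z \<in> SB.regular V \<longleftrightarrow> z \<in> carrier L \<and> (\<forall>q\<in>V. ?X q)" unfolding SB.regular_def by (rule mem_Collect_eq)
      also have "(\<forall>q\<in>V. ?X q) \<longleftrightarrow> (\<forall>p\<in>pre V. ?X (f p))"
      proof
        assume "\<forall>q\<in>V. ?X q" then show "\<forall>p\<in>pre V. ?X (f p)" unfolding pre_def by simp
      next
        assume r: "\<forall>p\<in>pre V. ?X (f p)"
        show "\<forall>q\<in>V. ?X q"
        proof
          fix q assume q: "q \<in> V"
          obtain p where p: "p \<in> U" "q = f p" using f_surj q V by blast
          then have "p \<in> pre V" unfolding pre_def using q by simp
          then show "?X q" unfolding p(2) by (rule bspec[OF r])
        qed
      qed
      also have "z \<in> carrier L \<and> (\<forall>p\<in>pre V. ?X (f p)) \<longleftrightarrow> z \<in> carrier L \<and> (\<forall>p\<in>pre V. St p z)"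
      proof (intro conj_cong refl ball_cong)
        fix p assume "z \<in> carrier L" "p \<in> pre V"
        then show "?X (f p) \<longleftrightarrow> St p z" using stalk pre_sub by blast
      qed
      finally show "z \<in> SB.regular V \<longleftrightarrow> z \<in> regular (pre V)" unfolding regular_iff .
    qed
  qed
  have B_sections: "sections (Spec B) = fraction_sections B (points (Spec B)) (\<lambda>p. carrier B - p) (carrier B \<times> carrier B)"
    by (rule B.sections_Spec)
  \<comment> \<open>A section over \<open>V\<close> is read as an element of \<open>L\<close> and
    then as a section over the preimage, so restriction changes nothing but the domain. The empty
    set is treated separately.\<close>
  define \<phi> where "\<phi> V s = (if V = {} then (\<lambda>_. undefined) else sect (pre V) (inv_into (SB.regular V) (SB.sect V) s))" for V s
  have phi_sect: "\<phi> V (SB.sect V z) = sect (pre V) z"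
    if V: "openin (points (Spec B)) V" "V \<noteq> {}" and z: "z \<in> SB.regular V" for V z
  proof -
    have "inj_on (SB.sect V) (SB.regular V)" using SB.sect_iso[OF V] unfolding ring_iso_def bij_betw_def by simp
    then show ?thesis unfolding \<phi>_def using V(2) inv_into_f_f z by simp
  qed
  have phi: "\<phi> V \<in> ring_iso (sections (Spec B) V) (sections OU (pre V))" if V: "openin (points (Spec B)) V" for V
  proof (cases "V = {}")
    case True
    then have "\<phi> V = (\<lambda>_ _. undefined)" "pre V = {}" unfolding \<phi>_def pre_def by auto
    then show ?thesis unfolding B_sections sections_OU True using fraction_sections_empty_iso by simp
  next
    case False
    have pV: "pre V \<noteq> {}" by (rule pre_ne[OF PB_sub[OF V] False])
    have r: "SB.regular V = regular (pre V)" by (rule reg[OF PB_sub[OF V]])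
    have "ring (L\<lparr>carrier := SB.regular V\<rparr>)" unfolding r by (rule regular_ring[OF pre_sub pV])
    then have "inv_into (SB.regular V) (SB.sect V) \<in> ring_iso (sections (Spec B) V) (L\<lparr>carrier := regular (pre V)\<rparr>)"
      using ring_iso_set_sym[OF _ SB.sect_iso[OF V False]] unfolding B_sections r[symmetric] by simp
    from ring_iso_set_trans[OF this sect_iso[OF open_pre[OF V] pV]]
    show ?thesis unfolding sections_OU \<phi>_def using False by (simp add: o_def)
  qed
  have restr: "\<phi> W (restrict s W) = restrict (\<phi> V s) (pre W)"
    if V: "openin (points (Spec B)) V" and W: "openin (points (Spec B)) W" "W \<subseteq> V"
      and s: "s \<in> carrier (sections (Spec B) V)" for V W s
  proof (cases "W = {}")
    case True
    then have "pre W = {}" unfolding pre_def by blast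
    then show ?thesis unfolding \<phi>_def True by (simp add: restrict_def)
  next
    case False
    then have V0: "V \<noteq> {}" using W(2) by blast
    obtain z where z: "z \<in> SB.regular V" "s = SB.sect V z"
      using SB.sect_surj[OF V V0] s unfolding B_sections by blast
    have zW: "z \<in> SB.regular W" using SB.regular_mono[OF W(2)] z(1) by blast
    have pW: "pre W \<subseteq> pre V" unfolding pre_def using W(2) by blast
    show ?thesis
      unfolding z(2) SB.sect_restrict[OF W(2)] phi_sect[OF W(1) False zW] phi_sect[OF V V0 z(1)] sect_restrict[OF pW] ..
  qed
  have "ringed_space_iso OU (Spec B) f \<phi>"
    unfolding ringed_space_iso_def Let_def topspace_OU B.restr_Spec restr_OU
    using homeo phi restr unfolding pre_def by blast
  then show ?thesis unfolding is_affine_def using B.is_cring unfolding B_def by blast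
qed

end

section \<open>Hypersurfaces and affine ideals\<close>

text \<open>For a prime of a domain, height exactly one. All primes compete, whereas
  \<open>codim_one\<close> sees only the points of a given spectrum.\<close>

definition height_one :: "('a, 'm) ring_scheme \<Rightarrow> 'a set \<Rightarrow> bool" where
  "height_one R p \<longleftrightarrow> p \<noteq> {\<zero>\<^bsub>R\<^esub>} \<and> (\<forall>q. primeideal q R \<and> q \<subset> p \<longrightarrow> q = {\<zero>\<^bsub>R\<^esub>})"

text \<open>\<open>Spec R\<close> is the homogeneous spectrum for the grading concentrated in degree zero.\<close>

definition trivial_grading :: "('a, 'm) ring_scheme \<Rightarrow> nat \<Rightarrow> 'a set" where
  "trivial_grading R d = (if d = 0 then carrier R else {\<zero>\<^bsub>R\<^esub>})"

lemma (in cring) trivial_grading: "graded_ring R (trivial_grading R)"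
proof (intro graded_ring.intro graded_ring_axioms.intro is_cring)
  show "additive_subgroup (trivial_grading R d) R" for d
    using zeroideal oneideal unfolding trivial_grading_def by (simp add: ideal.axioms(1))
  show "x \<otimes> y \<in> trivial_grading R (d + e)" if "x \<in> trivial_grading R d" "y \<in> trivial_grading R e" for x y d e
    using that unfolding trivial_grading_def by (auto split: if_splits)
  fix x assume x: "x \<in> carrier R"
  let ?c = "\<lambda>d::nat. if d = 0 then x else \<zero>"
  let ?P = "\<lambda>c. (\<forall>d. c d \<in> trivial_grading R d) \<and> finite {d. c d \<noteq> \<zero>} \<and> x = finsum R c {d. c d \<noteq> \<zero>}"
  have sum: "finsum R c {d. c d \<noteq> \<zero>} = c 0" if c: "\<forall>d. c d \<in> trivial_grading R d" for c
  proof -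
    have c0: "c 0 \<in> carrier R" using c[rule_format, of 0] unfolding trivial_grading_def by simp
    have d: "c d = \<zero>" if "d \<noteq> 0" for d using c[rule_format, of d] that unfolding trivial_grading_def by simp
    then have "{d. c d \<noteq> \<zero>} = (if c 0 = \<zero> then {} else {0})" by (auto, metis)
    then show ?thesis using c0 by simp
  qed
  show "\<exists>!c. ?P c"
  proof (rule ex1I[of _ ?c])
    have c: "\<forall>d. ?c d \<in> trivial_grading R d" unfolding trivial_grading_def using x by simp
    moreover have "finite {d. ?c d \<noteq> \<zero>}" by (rule finite_subset[of _ "{0}"]) auto
    ultimately show "?P ?c" using sum[OF c] by simp
    fix c assume P: "?P c"
    then have c: "\<forall>d. c d \<in> trivial_grading R d" by blast
    have "c 0 = x" using sum[OF c] P by simp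
    moreover have "c d = \<zero>" if "d \<noteq> 0" for d using c[rule_format, of d] that unfolding trivial_grading_def by simp
    ultimately show "c = ?c" by (auto simp: fun_eq_iff)
  qed
qed

section \<open>Spec as a homogeneous spectrum, and ideals with minimal primes of height one\<close>

context noeth_domain
begin

lemma trivial_graded_noeth: "graded_noeth_domain R (trivial_grading R)"
  by (intro graded_noeth_domain.intro trivial_grading noeth_domain_axioms)

lemma trivial_homogeneous: "homogeneous_ideal R (trivial_grading R) I \<longleftrightarrow> ideal I R"
proof
  show "ideal I R" if "homogeneous_ideal R (trivial_grading R) I" using that unfolding homogeneous_ideal_def by blast
  assume I: "ideal I R"
  have "I \<inter> (\<Union>d. trivial_grading R d) = I"
    using ideal.Icarr[OF I] unfolding trivial_grading_def by (auto intro!: exI[of _ 0])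
  then show "homogeneous_ideal R (trivial_grading R) I"
    unfolding homogeneous_ideal_def using I genideal_minimal[OF I subset_refl] genideal_self[of I] ideal.Icarr[OF I] by auto
qed

lemma trivial_spectrum: "hom_spectrum R (trivial_grading R)"
  by (intro hom_spectrum.intro trivial_grading domain_axioms)

lemma trivial_Union: "(\<Union>d. trivial_grading R d) = carrier R"
  "(\<Union>d. trivial_grading R d \<times> trivial_grading R d) = carrier R \<times> carrier R"
  unfolding trivial_grading_def by (auto split: if_splits)

lemma trivial_Pts: "hom_spectrum.Pts R (trivial_grading R) (carrier R) = {p. primeideal p R}"
proof -
  interpret T: hom_spectrum R "trivial_grading R" "carrier R" by (rule trivial_spectrum)
  show ?thesis
    unfolding T.Pts_def trivial_homogeneous using prime_one by (auto simp: primeideal_def)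
qed

lemma trivial_Space: "hom_spectrum.Space R (trivial_grading R) (carrier R) = Spec R"
proof -
  interpret T: hom_spectrum R "trivial_grading R" "carrier R" by (rule trivial_spectrum)
  have "T.Hom = carrier R" unfolding T.Hom_def by (rule trivial_Union(1))
  moreover have "T.Pairs = carrier R \<times> carrier R" unfolding T.Pairs_def by (rule trivial_Union(2))
  ultimately show ?thesis
    unfolding T.Space_def T.Top_def trivial_Pts Spec_def T.Dens_def[abs_def] by simp
qed

lemma trivial_Top: "hom_spectrum.Top R (trivial_grading R) (carrier R) = points (Spec R)"
proof -
  interpret T: hom_spectrum R "trivial_grading R" "carrier R" by (rule trivial_spectrum)
  show ?thesis unfolding trivial_Space[symmetric] T.Space_def fraction_space_def by simp
qed

lemma closedin_Spec_iff: "closedin (points (Spec R)) Z \<longleftrightarrow> (\<exists>E\<subseteq>carrier R. Z = {p. primeideal p R \<and> E \<subseteq> p})"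
proof -
  interpret T: hom_spectrum R "trivial_grading R" "carrier R" by (rule trivial_spectrum)
  have "T.Hom = carrier R" unfolding T.Hom_def by (rule trivial_Union(1))
  then show ?thesis using T.closedin_Top[of Z] unfolding trivial_Top trivial_Pts by simp
qed

lemma hypersurface_Spec_iff:
  "hypersurface (points (Spec R)) Z \<longleftrightarrow> closedin (points (Spec R)) Z \<and>
     (\<forall>p\<in>Z. (\<forall>q\<in>Z. q \<subseteq> p \<longrightarrow> q = p) \<longrightarrow> height_one R p)"
proof -
  interpret T: hom_spectrum R "trivial_grading R" "carrier R" by (rule trivial_spectrum)
  have "T.codim_one p \<longleftrightarrow> height_one R p" for p
    unfolding T.codim_one_def height_one_def trivial_Pts by blast
  then show ?thesis using T.hypersurface_iff[of Z] unfolding trivial_Top by simp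
qed

lemma affine_Spec_iff:
  assumes I: "ideal I R" and nz: "\<not> I \<subseteq> {\<zero>}"
  shows "is_affine (open_complement (Spec R) {p. primeideal p R \<and> I \<subseteq> p}) \<longleftrightarrow> affine_ideal R I"
proof -
  have crit: "affine_criterion R (trivial_grading R) (carrier R) I"
    using I nz ideal.Icarr[OF I]
    by (intro affine_criterion.intro affine_criterion_axioms.intro trivial_graded_noeth trivial_spectrum)
      (auto simp: trivial_homogeneous)
  interpret T: affine_criterion R "trivial_grading R" "carrier R" I by (rule crit)
  have eq: "T.OU = open_complement (Spec R) {p. primeideal p R \<and> I \<subseteq> p}"
    unfolding T.OU_def trivial_Space trivial_Pts by simp
  show ?thesis
  proof
    assume "is_affine (open_complement (Spec R) {p. primeideal p R \<and> I \<subseteq> p})"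
    then show "affine_ideal R I" using T.affine_imp_affine_ideal unfolding eq by blast
  next
    assume aff: "affine_ideal R I"
    \<comment> \<open>\<open>admissible\<close> holds because the trivial grading has no nonzero
      elements of positive degree.\<close>
    have "affine_converse R (trivial_grading R) (carrier R) I"
      by (intro affine_converse.intro affine_converse_axioms.intro crit aff)
        (simp add: trivial_grading_def split: if_splits)
    from affine_converse.affine[OF this]
    show "is_affine (open_complement (Spec R) {p. primeideal p R \<and> I \<subseteq> p})" unfolding eq .
  qed
qed

text \<open>Otherwise the product of elements outside \<open>P\<close>, one from each ideal, would
  lie in the intersection. Membership in the carrier covers the empty family.\<close>

lemma prime_finite_Inter:
  assumes P: "primeideal P R" and fin: "finite A" and K: "\<And>j. j \<in> A \<Longrightarrow> ideal (K j) R"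
    and sub: "{z \<in> carrier R. \<forall>j\<in>A. z \<in> K j} \<subseteq> P"
  shows "\<exists>j\<in>A. K j \<subseteq> P"
proof (rule ccontr)
  assume neg: "\<not> (\<exists>j\<in>A. K j \<subseteq> P)"
  have "\<exists>z\<in>carrier R. z \<notin> P \<and> (\<forall>j\<in>A. z \<in> K j)" using fin K neg
  proof (induction A rule: finite_induct)
    case empty
    then show ?case using prime_one[OF P] one_closed by blast
  next
    case (insert i A)
    then obtain z where z: "z \<in> carrier R" "z \<notin> P" "\<And>j. j \<in> A \<Longrightarrow> z \<in> K j" by blast
    obtain x where x: "x \<in> K i" "x \<notin> P" using insert.prems(2) by blast
    have i: "ideal (K i) R" using insert.prems(1) by blast
    have xc: "x \<in> carrier R" by (rule ideal.Icarr[OF i x(1)])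
    have "x \<otimes> z \<notin> P" using primeideal.I_prime[OF P xc z(1)] x(2) z(2) by blast
    moreover have "x \<otimes> z \<in> K i" by (rule ideal.I_r_closed[OF i x(1) z(1)])
    moreover have "x \<otimes> z \<in> K j" if "j \<in> A" for j
      using ideal.I_l_closed[OF _ z(3)[OF that] xc] insert.prems(1) that by blast
    ultimately show ?case using m_closed[OF xc z(1)] by blast
  qed
  then show False using sub by blast
qed

lemma colon_height_one:
  assumes closed: "power_bounded_closed R" and a: "a \<in> carrier R" "a \<noteq> \<zero>" and b: "b \<in> carrier R"
    and P: "minimal_prime R (colon R a b) P"
  shows "height_one R P"
proof -
  have "b \<otimes> a \<in> PIdl a" by (rule PIdl_mult_left[OF a(1) b])
  then have "a \<in> colon R a b" unfolding colon_def using a(1) m_comm[OF a(1) b] by simp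
  then have "P \<noteq> {\<zero>}" using P a(2) unfolding minimal_prime_def by blast
  then show ?thesis
    unfolding height_one_def using minimal_prime_colon_height_one[OF closed a b P] by blast
qed

lemma principal_height_one:
  assumes closed: "power_bounded_closed R" and a: "a \<in> carrier R" "a \<noteq> \<zero>" and P: "minimal_prime R (PIdl a) P"
  shows "height_one R P"
proof -
  have "colon R a \<one> = PIdl a" unfolding colon_def using PIdl_carrier[OF a(1)] by auto
  then show ?thesis using colon_height_one[OF closed a one_closed] P by simp
qed

text \<open>The ideal is the intersection of the finitely many \<open>(a : f j)\<close> with
  \<open>f j \<noteq> 0\<close>. So \<open>P\<close> contains one of them, and being minimal over
  the intersection it is minimal over that one, where \<open>colon_height_one\<close>
  applies.\<close>

lemma colon_family_height_one:
  assumes closed: "power_bounded_closed R" and a: "a \<in> carrier R" "a \<noteq> \<zero>"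
    and fin: "finite {j. f j \<noteq> \<zero>}" and f: "\<And>j. f j \<in> carrier R"
    and P: "minimal_prime R {z \<in> carrier R. \<forall>j. z \<otimes> f j \<in> PIdl a} P"
  shows "height_one R P"
proof -
  have prime: "primeideal P R" and sub: "{z \<in> carrier R. \<forall>j. z \<otimes> f j \<in> PIdl a} \<subseteq> P"
    and min: "\<And>Q. primeideal Q R \<Longrightarrow> {z \<in> carrier R. \<forall>j. z \<otimes> f j \<in> PIdl a} \<subseteq> Q \<Longrightarrow> Q \<subseteq> P \<Longrightarrow> Q = P"
    using P unfolding minimal_prime_def by blast+
  have z: "\<zero> \<in> PIdl a" using additive_subgroup.zero_closed[OF ideal.axioms(1)[OF cgenideal_ideal[OF a(1)]]] .
  have eq: "{z \<in> carrier R. \<forall>j\<in>{j. f j \<noteq> \<zero>}. z \<in> colon R a (f j)} = {z \<in> carrier R. \<forall>j. z \<otimes> f j \<in> PIdl a}"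
  proof -
    have "(\<forall>j\<in>{j. f j \<noteq> \<zero>}. x \<in> colon R a (f j)) \<longleftrightarrow> (\<forall>j. x \<otimes> f j \<in> PIdl a)" if x: "x \<in> carrier R" for x
    proof
      assume l: "\<forall>j\<in>{j. f j \<noteq> \<zero>}. x \<in> colon R a (f j)"
      show "\<forall>j. x \<otimes> f j \<in> PIdl a"
      proof
        fix j show "x \<otimes> f j \<in> PIdl a"
          using l z r_null[OF x] unfolding colon_def by (cases "f j = \<zero>") auto
      qed
    qed (use x in \<open>simp add: colon_def\<close>)
    then show ?thesis by blast
  qed
  obtain j where j: "colon R a (f j) \<subseteq> P"
    using prime_finite_Inter[OF prime fin, of "\<lambda>j. colon R a (f j)"] colon_is_ideal[OF a(1) f] sub unfolding eq by blast
  have "minimal_prime R (colon R a (f j)) P"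
    unfolding minimal_prime_def
  proof (intro conjI allI impI prime j)
    fix Q assume Q: "primeideal Q R \<and> colon R a (f j) \<subseteq> Q \<and> Q \<subseteq> P"
    have "{z \<in> carrier R. \<forall>j. z \<otimes> f j \<in> PIdl a} \<subseteq> colon R a (f j)" unfolding colon_def by blast
    then show "Q = P" using min[of Q] Q by blast
  qed
  then show ?thesis by (rule colon_height_one[OF closed a f])
qed

lemma affine_ideal_finite_Inter:
  assumes "finite \<P>" "\<And>P. P \<in> \<P> \<Longrightarrow> ideal P R" "\<And>P. P \<in> \<P> \<Longrightarrow> affine_ideal R P"
  shows "ideal {z \<in> carrier R. \<forall>P\<in>\<P>. z \<in> P} R \<and> affine_ideal R {z \<in> carrier R. \<forall>P\<in>\<P>. z \<in> P}"
  using assms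
proof (induction \<P> rule: finite_induct)
  case empty
  then show ?case using oneideal affine_ideal_carrier[OF one_not_zero] by simp
next
  case (insert P \<P>)
  have "{z \<in> carrier R. \<forall>Q\<in>insert P \<P>. z \<in> Q} = P \<inter> {z \<in> carrier R. \<forall>Q\<in>\<P>. z \<in> Q}"
    using ideal.Icarr[OF insert.prems(1)[OF insertI1]] by blast
  moreover have P: "ideal P R" "affine_ideal R P" using insert.prems by blast+
  moreover have IH: "ideal {z \<in> carrier R. \<forall>Q\<in>\<P>. z \<in> Q} R" "affine_ideal R {z \<in> carrier R. \<forall>Q\<in>\<P>. z \<in> Q}"
    using insert.IH insert.prems by blast+
  ultimately show ?case using i_intersect[OF P(1) IH(1)] affine_ideal_Int[OF P(1) IH(1) P(2) IH(2)] by simp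
qed

text \<open>A radical ideal is the intersection of its finitely many minimal primes, and the
  criterion is stable under finite intersections.\<close>

lemma affine_radical_ideal:
  assumes J: "ideal J R" and rad: "\<And>z. z \<in> carrier R \<Longrightarrow> (\<And>P. primeideal P R \<Longrightarrow> J \<subseteq> P \<Longrightarrow> z \<in> P) \<Longrightarrow> z \<in> J"
    and aff: "\<And>P. minimal_prime R J P \<Longrightarrow> affine_ideal R P"
  shows "affine_ideal R J"
proof -
  obtain \<P> where P: "finite \<P>" "\<And>P. P \<in> \<P> \<Longrightarrow> minimal_prime R J P"
    "\<And>Q. primeideal Q R \<Longrightarrow> J \<subseteq> Q \<Longrightarrow> \<exists>P\<in>\<P>. P \<subseteq> Q"
    using finitely_many_minimal_primes[OF J] by meson
  have "ideal P R" if "P \<in> \<P>" for P using P(2)[OF that] unfolding minimal_prime_def primeideal_def by blast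
  then have "affine_ideal R {z \<in> carrier R. \<forall>P\<in>\<P>. z \<in> P}"
    using affine_ideal_finite_Inter[OF P(1)] aff P(2) by blast
  moreover have "{z \<in> carrier R. \<forall>P\<in>\<P>. z \<in> P} = J"
  proof
    show "J \<subseteq> {z \<in> carrier R. \<forall>P\<in>\<P>. z \<in> P}"
      using P(2) ideal.Icarr[OF J] unfolding minimal_prime_def by blast
    show "{z \<in> carrier R. \<forall>P\<in>\<P>. z \<in> P} \<subseteq> J"
    proof
      fix z assume z: "z \<in> {z \<in> carrier R. \<forall>P\<in>\<P>. z \<in> P}"
      show "z \<in> J"
      proof (rule rad)
        show "z \<in> carrier R" using z by blast
        fix Q assume "primeideal Q R" "J \<subseteq> Q"
        then show "z \<in> Q" using P(3) z by blast
      qed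
    qed
  qed
  ultimately show ?thesis by simp
qed

end

locale normal_cone = graded_noeth_domain R G + hom_spectrum R G "irrelevant_ideal R G" for R (structure) and G +
  assumes closed: "power_bounded_closed R" and base_field: "subfield (G 0) R"
begin

lemma Proj_Space: "Proj R G = Space"
  unfolding Space_def Top_def Pts_def Proj_def Dens_def[abs_def] Pairs_def Hom_def ..

lemma points_Proj: "points (Proj R G) = Top"
  unfolding Proj_Space Space_def fraction_space_def by simp

text \<open>A nonzero component of degree zero would be a unit, because \<open>G 0\<close> is a
  field.\<close>

lemma proper_subset_irrelevant:
  assumes I: "homogeneous_ideal R G I" and one: "\<one> \<notin> I" shows "I \<subseteq> irrelevant_ideal R G"
proof
  fix x assume x: "x \<in> I"
  have id: "ideal I R" and comps: "comp x 0 \<in> I" using I x by (auto simp: homogeneous_ideal_iff)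
  have xc: "x \<in> carrier R" by (rule ideal.Icarr[OF id x])
  have "comp x 0 = \<zero>"
  proof (rule ccontr)
    assume "comp x 0 \<noteq> \<zero>"
    then have k: "comp x 0 \<in> G 0 - {\<zero>}" using comp_props(1)[OF xc] by blast
    have "inv (comp x 0) \<in> carrier R" "comp x 0 \<otimes> inv (comp x 0) = \<one>"
      using subfield_m_inv(1,2)[OF base_field k] G_carrier by blast+
    then show False using ideal.I_r_closed[OF id comps] one by metis
  qed
  then show "x \<in> irrelevant_ideal R G" unfolding irrelevant_ideal_eq using xc by simp
qed

lemma prime_subset_irrelevant: "primeideal p R \<Longrightarrow> homogeneous_ideal R G p \<Longrightarrow> p \<subseteq> irrelevant_ideal R G"
  using proper_subset_irrelevant prime_one by blast

lemma affine_Proj_iff: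
  assumes I: "homogeneous_ideal R G I" and one: "\<one> \<notin> I" and nz: "\<not> I \<subseteq> {\<zero>}"
  shows "is_affine (open_complement (Proj R G) {p \<in> Pts. I \<subseteq> p}) \<longleftrightarrow> affine_ideal R I"
proof -
  have sub: "I \<subseteq> irrelevant_ideal R G" by (rule proper_subset_irrelevant[OF I one])
  have crit: "affine_criterion R G (irrelevant_ideal R G) I"
    by (intro affine_criterion.intro affine_criterion_axioms.intro graded_noeth_domain_axioms hom_spectrum_axioms I sub nz)
  interpret C: affine_criterion R G "irrelevant_ideal R G" I by (rule crit)
  have eq: "C.OU = open_complement (Proj R G) {p \<in> Pts. I \<subseteq> p}" unfolding C.OU_def Proj_Space ..
  show ?thesis
  proof
    assume "is_affine (open_complement (Proj R G) {p \<in> Pts. I \<subseteq> p})"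
    then show "affine_ideal R I" using C.affine_imp_affine_ideal unfolding eq by blast
  next
    assume aff: "affine_ideal R I"
    have "affine_converse R G (irrelevant_ideal R G) I"
    proof (intro affine_converse.intro affine_converse_axioms.intro crit aff)
      \<comment> \<open>The case cannot arise: \<open>I\<close> lies in the irrelevant ideal, so its
        elements have no component of degree zero.\<close>
      fix a t d assume a: "a \<in> I" "a \<in> G 0" "a \<noteq> \<zero>"
      have "a \<in> irrelevant_ideal R G" using sub a(1) by blast
      then show "d = 0" using a(3) comp_G[OF a(2), of 0] unfolding irrelevant_ideal_eq by simp
    qed
    from affine_converse.affine[OF this]
    show "is_affine (open_complement (Proj R G) {p \<in> Pts. I \<subseteq> p})" unfolding eq .
  qed
qed

lemma minimal_prime_props:
  "minimal_prime R I P \<Longrightarrow> primeideal P R" "minimal_prime R I P \<Longrightarrow> I \<subseteq> P"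
  "minimal_prime R I P \<Longrightarrow> primeideal Q R \<Longrightarrow> I \<subseteq> Q \<Longrightarrow> Q \<subseteq> P \<Longrightarrow> Q = P"
  unfolding minimal_prime_def by blast+

lemma nonzero_homogeneous_element:
  assumes I: "homogeneous_ideal R G I" and x: "x \<in> I" "x \<noteq> \<zero>"
  shows "\<exists>d. \<exists>a\<in>G d. a \<in> I \<and> a \<noteq> \<zero>"
proof -
  have id: "ideal I R" and comps: "\<And>d. comp x d \<in> I" using I x by (auto simp: homogeneous_ideal_iff)
  have xc: "x \<in> carrier R" by (rule ideal.Icarr[OF id x(1)])
  have "\<exists>d. comp x d \<noteq> \<zero>" using comp_eqI[OF xc zero_closed] x(2) by auto
  then show ?thesis using comps comp_props(1)[OF xc] by blast
qed

text \<open>If \<open>V(I)\<close> is empty in \<open>Proj\<close> then the irrelevant ideal has height one and is the radical of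
  a principal ideal.\<close>

lemma irrelevant_affine:
  assumes I: "ideal I R" and ht: "height_one R (irrelevant_ideal R G)" and pr: "primeideal (irrelevant_ideal R G) R"
    and hom: "homogeneous_ideal R G (irrelevant_ideal R G)"
    and sub: "I \<subseteq> irrelevant_ideal R G"
    and rad: "\<And>P. primeideal P R \<Longrightarrow> I \<subseteq> P \<Longrightarrow> irrelevant_ideal R G \<subseteq> P"
  shows "affine_ideal R I"
proof -
  let ?M = "irrelevant_ideal R G"
  have "\<zero> \<in> ?M" using additive_subgroup.zero_closed[OF ideal.axioms(1)[OF primeideal.axioms(1)[OF pr]]] .
  then obtain y where "y \<in> ?M" "y \<noteq> \<zero>" using ht unfolding height_one_def by blast
  then obtain d x where x: "x \<in> G d" "x \<in> ?M" "x \<noteq> \<zero>" using nonzero_homogeneous_element[OF hom] by blast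
  have xc: "x \<in> carrier R" by (rule G_carrier[OF x(1)])
  \<comment> \<open>A minimal prime of \<open>(x)\<close> is homogeneous, hence contained in the
    irrelevant ideal, and it is nonzero; by height one it is the irrelevant ideal. So the principal
    ideal \<open>(x)\<close> has the same radical as \<open>I\<close>.\<close>
  have M: "?M \<subseteq> Q" if Q: "primeideal Q R" "PIdl x \<subseteq> Q" for Q
  proof -
    obtain P where P: "minimal_prime R (PIdl x) P" "P \<subseteq> Q"
      using minimal_prime_exists[OF cgenideal_ideal[OF xc] Q] by blast
    have "homogeneous_ideal R G P" by (rule minimal_prime_homogeneous[OF PIdl_homogeneous[OF x(1)] P(1)])
    then have "P \<subseteq> ?M" using prime_subset_irrelevant minimal_prime_props(1)[OF P(1)] by blast
    moreover have "P \<noteq> {\<zero>}" using minimal_prime_props(2)[OF P(1)] cgenideal_self[OF xc] x(3) by blast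
    ultimately have "P = ?M" using ht minimal_prime_props(1)[OF P(1)] unfolding height_one_def by blast
    then show ?thesis using P(2) by blast
  qed
  obtain m :: nat where m: "x [^] m \<in> I"
    using radical_prime[OF I xc] rad x(2) by blast
  let ?c = "x [^] m"
  have cc: "?c \<in> carrier R" "?c \<noteq> \<zero>" using xc pow_nonzero[OF xc x(3)] by auto
  have "\<exists>n::nat. z [^] n \<otimes> \<one> \<in> PIdl ?c" if z: "z \<in> I" for z
  proof -
    have zc: "z \<in> carrier R" by (rule ideal.Icarr[OF I z])
    have "\<exists>n::nat. z [^] n \<in> PIdl ?c"
    proof (rule radical_prime[OF cgenideal_ideal[OF cc(1)] zc])
      fix P assume P: "primeideal P R" "PIdl ?c \<subseteq> P"
      have "?c \<in> P" using P(2) cgenideal_self[OF cc(1)] by blast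
      then have "x \<in> P" using prime_pow_mem[OF P(1) xc] by blast
      then have "PIdl x \<subseteq> P" using cgenideal_minimal[OF primeideal.axioms(1)[OF P(1)]] by blast
      then show "z \<in> P" using M[OF P(1)] sub z by blast
    qed
    then show ?thesis using zc by simp
  qed
  \<comment> \<open>With \<open>c = x^m\<close> in \<open>I\<close>, every element of
    \<open>I\<close> has a power in \<open>(c)\<close>, so \<open>1 / c\<close> is a section over
    D(I) and \<open>c = c 1\<close> is the required expression.\<close>
  then have "\<one> \<in> transform R I ?c" unfolding transform_def by simp
  moreover have "?c = ?c \<otimes> \<one>" using cc(1) by simp
  ultimately have c: "?c \<in> {x \<otimes> y | x y. x \<in> I \<and> y \<in> transform R I ?c}" using m by blast
  have "{x \<otimes> y | x y. x \<in> I \<and> y \<in> transform R I ?c} \<subseteq> carrier R"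
    using ideal.Icarr[OF I] transform_carrier by auto
  then have "?c \<in> Idl {x \<otimes> y | x y. x \<in> I \<and> y \<in> transform R I ?c}" using genideal_self c by blast
  then show ?thesis unfolding affine_ideal_def using cc by blast
qed

text \<open>If \<open>V(I)\<close> is not empty in Proj, its minimal points are minimal primes of
  \<open>I\<close>, so it is a hypersurface and the hypothesis applies. The unit ideal and an empty
  \<open>V(I)\<close> are outside the reach of that hypothesis and are handled separately.\<close>

lemma homogeneous_affine:
  assumes proj: "\<And>Z. hypersurface (points (Proj R G)) Z \<Longrightarrow> Z \<noteq> {} \<Longrightarrow> is_affine (open_complement (Proj R G) Z)"
    and I: "homogeneous_ideal R G I" and ht: "\<And>P. minimal_prime R I P \<Longrightarrow> height_one R P"
  shows "affine_ideal R I"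
proof (cases "\<one> \<in> I")
  case True
  have "ideal I R" using I by (simp add: homogeneous_ideal_iff)
  then have "I = carrier R" using True ideal.one_imp_carrier by blast
  then show ?thesis using affine_ideal_carrier[OF one_not_zero] by simp
next
  case False
  have id: "ideal I R" using I by (simp add: homogeneous_ideal_iff)
  have hom: "homogeneous_ideal R G P" if "minimal_prime R I P" for P by (rule minimal_prime_homogeneous[OF I that])
  obtain P0 where P0: "minimal_prime R I P0"
    using proper_ideal_prime[OF id False] minimal_prime_exists[OF id] by blast
  have nz: "\<not> I \<subseteq> {\<zero>}"
  proof
    assume "I \<subseteq> {\<zero>}"
    then have "minimal_prime R I {\<zero>}"
      unfolding minimal_prime_def using zeroprimeideal additive_subgroup.zero_closed[OF ideal.axioms(1)[OF primeideal.axioms(1)]] by blast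
    then show False using ht unfolding height_one_def by blast
  qed
  let ?V = "{p \<in> Pts. I \<subseteq> p}"
  show ?thesis
  proof (cases "?V = {}")
    case True
    \<comment> \<open>A minimal prime is homogeneous; not being a point it contains the irrelevant
      ideal, and being proper it is contained in it.\<close>
    have eq: "P = irrelevant_ideal R G" if P: "minimal_prime R I P" for P
    proof -
      have p: "primeideal P R" "I \<subseteq> P" using minimal_prime_props[OF P] by blast+
      have "irrelevant_ideal R G \<subseteq> P" using True p hom[OF P] unfolding Pts_def by blast
      then show ?thesis using prime_subset_irrelevant[OF p(1) hom[OF P]] by blast
    qed
    show ?thesis
    proof (rule irrelevant_affine[OF id])
      show "height_one R (irrelevant_ideal R G)" "primeideal (irrelevant_ideal R G) R"
        "homogeneous_ideal R G (irrelevant_ideal R G)"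
        using ht[OF P0] minimal_prime_props(1)[OF P0] hom[OF P0] unfolding eq[OF P0] by blast+
      show "I \<subseteq> irrelevant_ideal R G" using minimal_prime_props(2)[OF P0] unfolding eq[OF P0] .
      fix Q assume "primeideal Q R" "I \<subseteq> Q"
      then obtain P where "minimal_prime R I P" "P \<subseteq> Q" using minimal_prime_exists[OF id] by blast
      then show "irrelevant_ideal R G \<subseteq> Q" using eq by blast
    qed
  next
    case nonempty: False
    have "codim_one p" if p: "p \<in> ?V" and min: "\<forall>q\<in>?V. q \<subseteq> p \<longrightarrow> q = p" for p
    proof -
      have pP: "p \<in> Pts" "I \<subseteq> p" using p by blast+
      obtain P where P: "minimal_prime R I P" "P \<subseteq> p"
        using minimal_prime_exists[OF id PtsD(1)[OF pP(1)] pP(2)] by blast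
      \<comment> \<open>A prime below the point \<open>p\<close> is itself relevant, so minimality
        of \<open>p\<close> among points makes \<open>p\<close> a minimal prime of
        \<open>I\<close>.\<close>
      have "\<not> irrelevant_ideal R G \<subseteq> P" using PtsD(3)[OF pP(1)] P(2) by blast
      then have "P \<in> ?V" unfolding Pts_def using minimal_prime_props(1,2)[OF P(1)] hom[OF P(1)] by blast
      then have "P = p" using min P(2) by blast
      then show ?thesis using ht[OF P(1)] unfolding height_one_def codim_one_def Pts_def by blast
    qed
    then have "hypersurface (points (Proj R G)) ?V"
      unfolding points_Proj hypersurface_iff using closedin_ideal[OF I] by blast
    then show ?thesis using proj nonempty affine_Proj_iff[OF I False nz] by blast
  qed
qed

lemma height_one_affine:
  assumes proj: "\<And>Z. hypersurface (points (Proj R G)) Z \<Longrightarrow> Z \<noteq> {} \<Longrightarrow> is_affine (open_complement (Proj R G) Z)"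
    and P: "primeideal P R" and ht: "height_one R P"
  shows "affine_ideal R P"
proof (cases "homogeneous_ideal R G P")
  case True
  show ?thesis
  proof (rule homogeneous_affine[OF proj True])
    fix Q assume Q: "minimal_prime R P Q"
    then have "P = Q" using minimal_prime_props(2)[OF Q] minimal_prime_props(3)[OF Q P subset_refl] by blast
    then show "height_one R Q" using ht by simp
  qed
next
  case False
  have add: "additive_subgroup P R" using P by (simp add: primeideal_def ideal_def)
  \<comment> \<open>The core is a prime strictly below \<open>P\<close>, hence zero by height one:
    \<open>P\<close> has no nonzero homogeneous elements.\<close>
  have "comp_core P \<noteq> P" using comp_core_prime(2)[OF P] False by metis
  then have "comp_core P = {\<zero>}"
    using comp_core_prime(1)[OF P] comp_core_subset[OF add] ht unfolding height_one_def by blast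
  then have PH: "P \<inter> Hom \<subseteq> {\<zero>}" using comp_core_Hom[OF add] by blast
  show ?thesis
  proof (rule nonhomogeneous_prime_affine[OF closed P _ PH])
    show "P \<noteq> {\<zero>}" using ht unfolding height_one_def by blast
    fix f i assume f: "f \<in> carrier R" "comp f i \<noteq> \<zero>"
    let ?I = "{z \<in> carrier R. \<forall>j. z \<otimes> comp f j \<in> PIdl (comp f i)}"
    have a: "comp f i \<in> carrier R" "comp f i \<in> G i" using comp_props(1)[OF f(1)] G_carrier by blast+
    have "ideal {z \<in> carrier R. \<forall>j\<in>UNIV. z \<otimes> comp f j \<in> PIdl (comp f i)} R"
      by (rule Inter_colon_ideal) (use cgenideal_ideal[OF a(1)] comp_carrier[OF f(1)] in auto)
    then have "ideal ?I R" by simp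
    moreover have "comp z d \<in> ?I" if z: "z \<in> ?I" for z d
    proof -
      have zc: "z \<in> carrier R" using z by blast
      have "comp z d \<otimes> comp f j \<in> PIdl (comp f i)" for j
      proof -
        have "comp (z \<otimes> comp f j) (d + j) \<in> PIdl (comp f i)"
          using PIdl_homogeneous[OF a(2)] z unfolding homogeneous_ideal_iff by blast
        then show ?thesis using comp_mult_hom[OF zc comp_props(1)[OF f(1), of j], of "d + j"] by simp
      qed
      then show ?thesis using comp_carrier[OF zc] by blast
    qed
    ultimately have hom: "homogeneous_ideal R G ?I" unfolding homogeneous_ideal_iff by blast
    show "affine_ideal R ?I"
    proof (rule homogeneous_affine[OF proj hom])
      fix Q assume "minimal_prime R ?I Q"
      then show "height_one R Q"
        by (rule colon_family_height_one[OF closed a(1) f(2) comp_props(2)[OF f(1)] comp_carrier[OF f(1)]])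
    qed
  qed
qed

text \<open>The intersection \<open>J\<close> of all points of \<open>Z\<close> is a radical ideal
  with zero set \<open>Z\<close>, whose minimal primes have height one. An empty \<open>Z\<close>
  gives the unit ideal.\<close>

lemma Spec_complement_affine:
  assumes proj: "\<And>Z. hypersurface (points (Proj R G)) Z \<Longrightarrow> Z \<noteq> {} \<Longrightarrow> is_affine (open_complement (Proj R G) Z)"
    and Z: "hypersurface (points (Spec R)) Z"
  shows "is_affine (open_complement (Spec R) Z)"
proof -
  obtain E where E: "E \<subseteq> carrier R" "Z = {p. primeideal p R \<and> E \<subseteq> p}"
    using Z unfolding hypersurface_Spec_iff closedin_Spec_iff by blast
  have ht: "height_one R p" if "p \<in> Z" "\<And>q. q \<in> Z \<Longrightarrow> q \<subseteq> p \<Longrightarrow> q = p" for p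
    using Z that unfolding hypersurface_Spec_iff by blast
  define J where "J = {z \<in> carrier R. \<forall>p\<in>Z. z \<in> p}"
  have Zid: "ideal p R" if "p \<in> Z" for p using that unfolding E(2) primeideal_def by blast
  have J: "ideal J R"
  proof (cases "Z = {}")
    case True then show ?thesis unfolding J_def using oneideal by simp
  next
    case False
    then have "J = \<Inter>Z" unfolding J_def using ideal.Icarr[OF Zid] by blast
    then show ?thesis using i_Intersect[of Z] Zid False by simp
  qed
  have "E \<subseteq> J" unfolding J_def using E by blast
  moreover have "J \<subseteq> p" if "p \<in> Z" for p unfolding J_def using that by blast
  ultimately have ZJ: "Z = {p. primeideal p R \<and> J \<subseteq> p}" using E(2) by blast
  have min: "height_one R P" if P: "minimal_prime R J P" for P
    using ht[of P] minimal_prime_props[OF P] unfolding ZJ by blast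
  \<comment> \<open>The whole space is not a hypersurface, as its generic point, the zero ideal, is
    not of height one.\<close>
  have nz: "\<not> J \<subseteq> {\<zero>}"
  proof
    assume "J \<subseteq> {\<zero>}"
    then have "minimal_prime R J {\<zero>}"
      unfolding minimal_prime_def using zeroprimeideal additive_subgroup.zero_closed[OF ideal.axioms(1)[OF primeideal.axioms(1)]] by blast
    then show False using min unfolding height_one_def by blast
  qed
  have "affine_ideal R J"
  proof (rule affine_radical_ideal[OF J])
    fix z assume "z \<in> carrier R" "\<And>P. primeideal P R \<Longrightarrow> J \<subseteq> P \<Longrightarrow> z \<in> P"
    then show "z \<in> J" unfolding J_def using ZJ by blast
  next
    fix P assume P: "minimal_prime R J P"
    show "affine_ideal R P" by (rule height_one_affine[OF proj minimal_prime_props(1)[OF P] min[OF P]])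
  qed
  then show ?thesis using affine_Spec_iff[OF J nz] unfolding ZJ by simp
qed

text \<open>\<open>J\<close> defines \<open>Z\<close> in Proj and the cone over it in Spec, and both
  complements are governed by the same condition on \<open>J\<close>. What has to be shown is that
  the cone is a hypersurface, where chains may pass through non-homogeneous primes.\<close>

lemma Proj_complement_affine:
  assumes spec: "\<And>Z. hypersurface (points (Spec R)) Z \<Longrightarrow> is_affine (open_complement (Spec R) Z)"
    and Z: "hypersurface (points (Proj R G)) Z" and ne: "Z \<noteq> {}"
  shows "is_affine (open_complement (Proj R G) Z)"
proof -
  let ?M = "irrelevant_ideal R G"
  obtain E where E: "E \<subseteq> Hom" "Z = {p \<in> Pts. E \<subseteq> p}"
    using Z unfolding points_Proj hypersurface_iff closedin_Top by blast
  have cod: "codim_one p" if "p \<in> Z" "\<And>q. q \<in> Z \<Longrightarrow> q \<subseteq> p \<Longrightarrow> q = p" for p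
    using Z that unfolding points_Proj hypersurface_iff by blast
  define J where "J = \<Inter>Z"
  have ZP: "Z \<subseteq> Pts" unfolding E(2) by blast
  have hom: "homogeneous_ideal R G J" unfolding J_def by (rule Inter_homogeneous[OF ZP ne])
  have J: "ideal J R" using hom by (simp add: homogeneous_ideal_iff)
  have "E \<subseteq> J" unfolding J_def E(2) by blast
  moreover have JZ: "J \<subseteq> p" if "p \<in> Z" for p unfolding J_def using that by blast
  ultimately have ZJ: "Z = {p \<in> Pts. J \<subseteq> p}" using E(2) by blast
  obtain p0 where p0: "p0 \<in> Z" using ne by blast
  have one: "\<one> \<notin> J" using PtsD(6)[of p0] p0 ZP JZ by blast
  have nz: "\<not> J \<subseteq> {\<zero>}"
  proof
    assume J0: "J \<subseteq> {\<zero>}"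
    have zP: "{\<zero>} \<in> Pts" using zero_Pts p0 ZP by blast
    have "{\<zero>} \<in> Z" unfolding ZJ using zP J0 by blast
    moreover have "q = {\<zero>}" if "q \<in> Z" "q \<subseteq> {\<zero>}" for q using that PtsD(7)[of q] ZP by blast
    ultimately have "codim_one {\<zero>}" by (rule cod)
    then show False unfolding codim_one_def by blast
  qed
  \<comment> \<open>No minimal prime of \<open>J\<close> contains the irrelevant ideal:
    \<open>J\<close> is the intersection of points, and each point contains a relevant minimal
    prime. So \<open>P\<close> contains the intersection of the relevant minimal primes, hence one
    of them, and equals it.\<close>
  have minZ: "P \<in> Z" if P: "minimal_prime R J P" for P
  proof -
    obtain \<P> where PP: "finite \<P>" "\<And>P. P \<in> \<P> \<Longrightarrow> minimal_prime R J P"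
      "\<And>Q. primeideal Q R \<Longrightarrow> J \<subseteq> Q \<Longrightarrow> \<exists>P\<in>\<P>. P \<subseteq> Q"
      using finitely_many_minimal_primes[OF J] by meson
    let ?A = "{Q \<in> \<P>. \<not> ?M \<subseteq> Q}"
    have "{z \<in> carrier R. \<forall>Q\<in>?A. z \<in> Q} \<subseteq> P"
    proof
      fix z assume z: "z \<in> {z \<in> carrier R. \<forall>Q\<in>?A. z \<in> Q}"
      have "z \<in> q" if q: "q \<in> Z" for q
      proof -
        have qP: "q \<in> Pts" using q ZP by blast
        obtain Q where Q: "Q \<in> \<P>" "Q \<subseteq> q" using PP(3)[OF PtsD(1)[OF qP] JZ[OF q]] by blast
        then have "Q \<in> ?A" using PtsD(3)[OF qP] by blast
        then show ?thesis using z Q(2) by blast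
      qed
      then have "z \<in> J" unfolding J_def by blast
      then show "z \<in> P" using minimal_prime_props(2)[OF P] by blast
    qed
    then have "\<exists>Q\<in>?A. Q \<subseteq> P"
      using prime_finite_Inter[OF minimal_prime_props(1)[OF P], of ?A "\<lambda>Q. Q"] PP(1)
        minimal_prime_props(1)[OF PP(2)] by (simp add: primeideal.axioms(1))
    then obtain Q where Q: "Q \<in> \<P>" "\<not> ?M \<subseteq> Q" "Q \<subseteq> P" by blast
    have "Q = P" using minimal_prime_props(3)[OF P _ _ Q(3)] minimal_prime_props(1,2)[OF PP(2)[OF Q(1)]] by blast
    then show ?thesis
      unfolding ZJ Pts_def using Q(2) minimal_prime_props(1,2)[OF P] minimal_prime_homogeneous[OF hom P] by blast
  qed
  \<comment> \<open>Codimension one is known among homogeneous primes only. A minimal prime of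
    \<open>(a)\<close> inside \<open>P\<close>, for a nonzero homogeneous \<open>a\<close> in
    \<open>P\<close>, is homogeneous and so must be \<open>P\<close>; as a minimal prime of a
    principal ideal it has height one among all primes.\<close>
  have min: "height_one R P" if P: "minimal_prime R J P" for P
  proof -
    have PZ: "P \<in> Z" by (rule minZ[OF P])
    have PP: "P \<in> Pts" using PZ ZP by blast
    have c: "codim_one P"
    proof (rule cod[OF PZ])
      fix q assume q: "q \<in> Z" "q \<subseteq> P"
      then show "q = P" using minimal_prime_props(3)[OF P PtsD(1) JZ[OF q(1)] q(2)] ZP by blast
    qed
    then obtain x where "x \<in> P" "x \<noteq> \<zero>" unfolding codim_one_def using PtsD(7)[OF PP] by blast
    then obtain d a where a: "a \<in> G d" "a \<in> P" "a \<noteq> \<zero>" using nonzero_homogeneous_element[OF PtsD(2)[OF PP]] by blast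
    have ac: "a \<in> carrier R" by (rule G_carrier[OF a(1)])
    have "PIdl a \<subseteq> P" by (rule cgenideal_minimal[OF PtsD(4)[OF PP] a(2)])
    then obtain Q where Q: "minimal_prime R (PIdl a) Q" "Q \<subseteq> P"
      using minimal_prime_exists[OF cgenideal_ideal[OF ac] PtsD(1)[OF PP]] by blast
    have "\<not> ?M \<subseteq> Q" using PtsD(3)[OF PP] Q(2) by blast
    then have QP: "Q \<in> Pts"
      unfolding Pts_def using minimal_prime_props(1)[OF Q(1)] minimal_prime_homogeneous[OF PIdl_homogeneous[OF a(1)] Q(1)] by blast
    have "Q \<noteq> {\<zero>}" using minimal_prime_props(2)[OF Q(1)] cgenideal_self[OF ac] a(3) by blast
    then have "Q = P" using c QP Q(2) unfolding codim_one_def by blast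
    then show ?thesis using principal_height_one[OF closed ac a(3) Q(1)] by simp
  qed
  let ?Z = "{p. primeideal p R \<and> J \<subseteq> p}"
  have "hypersurface (points (Spec R)) ?Z"
    unfolding hypersurface_Spec_iff closedin_Spec_iff
  proof (intro conjI exI[of _ J] ballI impI refl)
    show "J \<subseteq> carrier R" using ideal.Icarr[OF J] by blast
    fix p assume p: "p \<in> ?Z" "\<forall>q\<in>?Z. q \<subseteq> p \<longrightarrow> q = p"
    then have "minimal_prime R J p" unfolding minimal_prime_def by blast
    then show "height_one R p" by (rule min)
  qed
  then have "affine_ideal R J" using spec affine_Spec_iff[OF J nz] by blast
  then show ?thesis using affine_Proj_iff[OF hom one nz] unfolding ZJ by blast
qed

end

theorem mainTheorem15:
  fixes S :: "('a, 'm) ring_scheme" and K :: "'a set" and G :: "nat \<Rightarrow> 'a set"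
  assumes "subfield K S"
    and "graded_ring S G"
    and "G 0 = K"
    and "integrally_closed_domain S"
    and "\<exists>B. finite B \<and> B \<subseteq> G 1 \<and> generate_ring S (K \<union> B) = carrier S"
  shows "(\<forall>Z. hypersurface (points (Proj S G)) Z \<and> Z \<noteq> {} \<longrightarrow> is_affine (open_complement (Proj S G) Z))
     \<longleftrightarrow> (\<forall>Z. hypersurface (points (Spec S)) Z \<longrightarrow> is_affine (open_complement (Spec S) Z))"
proof -
  have dom: "domain S" using assms(4) unfolding integrally_closed_domain_def by blast
  obtain B where B: "finite B" "B \<subseteq> G 1" "generate_ring S (K \<union> B) = carrier S" using assms(5) by blast
  have "B \<subseteq> carrier S" using B(2) graded_ring.G_carrier[OF assms(2)] by blast
  then have noeth: "noeth_domain S"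
    using domain.finitely_generated_algebra_noetherian[OF dom assms(1) B(1) _ B(3)] by blast
  interpret normal_cone S G
  proof (intro normal_cone.intro normal_cone_axioms.intro graded_noeth_domain.intro hom_spectrum.intro assms(2) noeth dom)
    show "power_bounded_closed S" by (rule domain.integrally_closed_imp_power_bounded_closed[OF dom noeth assms(4)])
    show "subfield (G 0) S" unfolding assms(3) by (rule assms(1))
  qed
  show ?thesis using Spec_complement_affine Proj_complement_affine by blast
qed

end
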